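(* Let $\Omega\subset\mathbb{R}^n$ be a bounded open set and let $p:\Omega\to[1,\infty)$ be a log-Hölder continuous exponent with $p^+=\operatorname{ess\,sup}_\Omega p<\infty$. Then $\widetilde{\mathrm{BV}}^{p(\cdot)}(\Omega)=\mathrm{BV}^{p(\cdot)}(\Omega)$ (equality as sets of functions).
   Context: Log-Hölder continuity: since $\Omega$ is bounded, $p$ is called log-Hölder continuous in $\Omega$ if there is $c>0$ with $|p(x)-p(y)|\le \dfrac{c}{\log(e+1/|x-y|)}$ for all $x,y\in\Omega$, $x\ne y$. $L^{p(\cdot)}(\Omega)$ is the variable exponent Lebesgue space of measurable $u:\Omega\to\mathbb{R}$ (identified when equal a.e.) with $\int_\Omega |u/\lambda|^{p(x)}dx<\infty$ for some $\lambda>0$, with Luxemburg norm $\|u\|_{L^{p(\cdot)}(\Omega)}=\inf\{\lambda>0:\int_\Omega|u/\lambda|^{p(x)}dx\le 1\}$. $\mathrm{Lip}_{\mathrm{loc}}(\Omega)$ denotes the locally Lipschitz functions on $\Omega$. The space $\widetilde{\mathrm{BV}}^{p(\cdot)}(\Omega)$: for $u\in L^{p(\cdot)}(\Omega)$ let $$\varrho_{\widetilde{\mathrm{BV}}^{p(\cdot)}}(u)=\inf\Big\{\liminf_{i\to\infty}\int_\Omega|\nabla u_i(x)|^{p(x)}dx\Big\},$$ the infimum being over all sequences $(u_i)$ in $\mathrm{Lip}_{\mathrm{loc}}(\Omega)\cap L^{p(\cdot)}(\Omega)$ with $u_i\to u$ in $L^{p(\cdot)}(\Omega)$; then $\widetilde{\mathrm{BV}}^{p(\cdot)}(\Omega)=\{u\in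 L^{p(\cdot)}(\Omega):\varrho_{\widetilde{\mathrm{BV}}^{p(\cdot)}}(u)<\infty\}$. The space $\mathrm{BV}^{p(\cdot)}(\Omega)$: let $Y=\{x\in\Omega: p(x)=1\}$. For open $U\subset\Omega$, $\|Du\|(U)=\sup\{\int_U u\,\mathrm{div}\,\varphi\,dx:\varphi\in C_0^1(U;\mathbb{R}^n),|\varphi|\le 1\}$, and for a Borel set $A\subset\Omega$, $\|Du\|(A)=\inf\{\|Du\|(U): U\text{ open},\ A\subset U\subset\Omega\}$. Let $$\varrho_{\mathrm{BV}^{p(\cdot)}(\Omega)}(u)=\|Du\|(Y)+\int_{\Omega\setminus Y}|\nabla u|^{p(x)}\,dx,$$ where $\nabla u$ is the weak gradient on the open set $\Omega\setminus Y$ (the value is $\infty$ if the weak gradient does not exist there). Then $\mathrm{BV}^{p(\cdot)}(\Omega)$ consists of all measurable $u:\Omega\to\mathbb{R}$ for which $\|u\|_{\mathrm{BV}^{p(\cdot)}(\Omega)}=\|u\|_{L^{p(\cdot)}(\Omega)}+\inf\{\lambda>0:\varrho_{\mathrm{BV}^{p(\cdot)}(\Omega)}(u/\lambda)\le1\}<\infty$. *)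

theory Defs
  imports "HOL-Analysis.Analysis" "HOL-Probability.Essential_Supremum"
begin

text \<open>
  Functions on \<open>\<Omega>\<close> are total functions on the ambient Euclidean space; every notion below depends
  only on their values on \<open>\<Omega>\<close>. Spaces of functions modulo equality almost everywhere are rendered
  by the sets of all their representatives.
\<close>

subsection \<open>Variable exponents and variable exponent Lebesgue spaces\<close>

definition log_Holder :: "'a::euclidean_space set \<Rightarrow> ('a \<Rightarrow> real) \<Rightarrow> bool" where
  "log_Holder \<Omega> p \<longleftrightarrow>
    (\<exists>c>0. \<forall>x\<in>\<Omega>. \<forall>y\<in>\<Omega>. x \<noteq> y \<longrightarrow> \<bar>p x - p y\<bar> \<le> c / ln (exp 1 + 1 / norm (x - y)))"

definition modular_Lp ::
  "'a::euclidean_space set \<Rightarrow> ('a \<Rightarrow> real) \<Rightarrow> ('a \<Rightarrow> real) \<Rightarrow> ennreal" where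
  "modular_Lp \<Omega> p u = (\<integral>\<^sup>+x. ennreal (\<bar>u x\<bar> powr p x) \<partial>lebesgue_on \<Omega>)"

text \<open>The value is \<open>\<infinity>\<close> if no \<open>l\<close> is admissible.\<close>

definition luxemburg :: "(('a \<Rightarrow> real) \<Rightarrow> ennreal) \<Rightarrow> ('a \<Rightarrow> real) \<Rightarrow> ennreal" where
  "luxemburg \<rho> u = Inf {ennreal l |l. 0 < l \<and> \<rho> (\<lambda>x. u x / l) \<le> 1}"

definition space_Lp ::
  "'a::euclidean_space set \<Rightarrow> ('a \<Rightarrow> real) \<Rightarrow> ('a \<Rightarrow> real) set" where
  "space_Lp \<Omega> p =
    {u \<in> borel_measurable (lebesgue_on \<Omega>). \<exists>l>0. modular_Lp \<Omega> p (\<lambda>x. u x / l) < \<infinity>}"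

definition norm_Lp ::
  "'a::euclidean_space set \<Rightarrow> ('a \<Rightarrow> real) \<Rightarrow> ('a \<Rightarrow> real) \<Rightarrow> ennreal" where
  "norm_Lp \<Omega> p = luxemburg (modular_Lp \<Omega> p)"

subsection \<open>Gradient, divergence and test functions\<close>

definition partial_deriv ::
  "'a::euclidean_space \<Rightarrow> ('a \<Rightarrow> real) \<Rightarrow> 'a \<Rightarrow> real" where
  "partial_deriv b f x = deriv (\<lambda>t. f (x + t *\<^sub>R b)) 0"

text \<open>
  The pointwise gradient. For a locally Lipschitz function the partial derivatives exist almost
  everywhere, so the unspecified value of \<^const>\<open>deriv\<close> elsewhere is irrelevant under the integral.
\<close>

definition grad :: "('a::euclidean_space \<Rightarrow> real) \<Rightarrow> 'a \<Rightarrow> 'a" where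
  "grad f x = (\<Sum>b\<in>Basis. partial_deriv b f x *\<^sub>R b)"

definition divergence :: "('a::euclidean_space \<Rightarrow> 'a) \<Rightarrow> 'a \<Rightarrow> real" where
  "divergence \<phi> x = (\<Sum>b\<in>Basis. partial_deriv b (\<lambda>y. \<phi> y \<bullet> b) x)"

text \<open>
  The space \<open>C\<^sub>0\<^sup>1(U)\<close>: functions of class \<open>C\<^sup>1\<close> whose support is a compact subset of \<open>U\<close>, identified
  with their extensions by zero to the whole space.
\<close>

definition C1_compact ::
  "'a::euclidean_space set \<Rightarrow> ('a \<Rightarrow> 'b::real_normed_vector) set" where
  "C1_compact U = {\<phi>.
    (\<exists>\<phi>'. (\<forall>x. (\<phi> has_derivative blinfun_apply (\<phi>' x)) (at x)) \<and> continuous_on UNIV \<phi>') \<and>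
    compact (closure {x. \<phi> x \<noteq> 0}) \<and> closure {x. \<phi> x \<noteq> 0} \<subseteq> U}"

definition locally_integrable ::
  "'a::euclidean_space set \<Rightarrow> ('a \<Rightarrow> 'b::euclidean_space) \<Rightarrow> bool" where
  "locally_integrable V f \<longleftrightarrow> (\<forall>K. compact K \<and> K \<subseteq> V \<longrightarrow> f absolutely_integrable_on K)"

definition has_weak_gradient ::
  "'a::euclidean_space set \<Rightarrow> ('a \<Rightarrow> real) \<Rightarrow> ('a \<Rightarrow> 'a) \<Rightarrow> bool" where
  "has_weak_gradient V u g \<longleftrightarrow>
    locally_integrable V u \<and> locally_integrable V g \<and>
    (\<forall>\<phi> \<in> C1_compact V. \<forall>b\<in>Basis.
      (LINT x|lebesgue_on V. u x * partial_deriv b \<phi> x) = - (LINT x|lebesgue_on V. (g x \<bullet> b) * \<phi> x))"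

text \<open>Weak gradients are unique up to equality almost everywhere; we select one.\<close>

definition weak_gradient ::
  "'a::euclidean_space set \<Rightarrow> ('a \<Rightarrow> real) \<Rightarrow> 'a \<Rightarrow> 'a" where
  "weak_gradient V u = (SOME g. has_weak_gradient V u g)"

subsection \<open>The space defined by relaxation\<close>

definition Lip_loc :: "'a::euclidean_space set \<Rightarrow> ('a \<Rightarrow> real) set" where
  "Lip_loc \<Omega> = {u. local_lipschitz (UNIV :: real set) \<Omega> (\<lambda>_. u)}"

definition modular_BV_tilde ::
  "'a::euclidean_space set \<Rightarrow> ('a \<Rightarrow> real) \<Rightarrow> ('a \<Rightarrow> real) \<Rightarrow> ennreal" where
  "modular_BV_tilde \<Omega> p u =
    Inf {liminf (\<lambda>i. \<integral>\<^sup>+x. ennreal (norm (grad (v i) x) powr p x) \<partial>lebesgue_on \<Omega>) |v :: nat \<Rightarrow> 'a \<Rightarrow> real.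
      (\<forall>i. v i \<in> Lip_loc \<Omega> \<inter> space_Lp \<Omega> p) \<and>
      (\<lambda>i. norm_Lp \<Omega> p (\<lambda>x. v i x - u x)) \<longlonglongrightarrow> 0}"

definition BV_tilde ::
  "'a::euclidean_space set \<Rightarrow> ('a \<Rightarrow> real) \<Rightarrow> ('a \<Rightarrow> real) set" where
  "BV_tilde \<Omega> p = {u \<in> space_Lp \<Omega> p. modular_BV_tilde \<Omega> p u < \<infinity>}"

subsection \<open>The space of mixed bounded variation and Sobolev type\<close>

text \<open>
  The total variation on an open set. The truncation of negative numbers by \<^const>\<open>ennreal\<close> does not
  change the supremum, since \<open>\<phi> = 0\<close> is admissible. The integrals are meaningful for locally integrable
  \<open>u\<close>, in particular for all \<open>u\<close> with \<open>norm_Lp \<Omega> p u < \<infinity>\<close> if \<open>p \<ge> 1\<close> and \<open>\<Omega>\<close> is bounded.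
\<close>

definition variation_open ::
  "('a::euclidean_space \<Rightarrow> real) \<Rightarrow> 'a set \<Rightarrow> ennreal" where
  "variation_open u U =
    (SUP \<phi> \<in> {\<phi> \<in> C1_compact U. \<forall>x\<in>U. norm (\<phi> x) \<le> 1}.
      ennreal (LINT x|lebesgue_on U. u x * divergence \<phi> x))"

definition variation ::
  "'a::euclidean_space set \<Rightarrow> ('a \<Rightarrow> real) \<Rightarrow> 'a set \<Rightarrow> ennreal" where
  "variation \<Omega> u A = (INF U \<in> {U. open U \<and> A \<subseteq> U \<and> U \<subseteq> \<Omega>}. variation_open u U)"

definition weak_gradient_energy ::
  "'a::euclidean_space set \<Rightarrow> ('a \<Rightarrow> real) \<Rightarrow> ('a \<Rightarrow> real) \<Rightarrow> ennreal" where
  "weak_gradient_energy V p u =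
    (if \<exists>g. has_weak_gradient V u g
     then \<integral>\<^sup>+x. ennreal (norm (weak_gradient V u x) powr p x) \<partial>lebesgue_on V
     else \<infinity>)"

definition modular_BV ::
  "'a::euclidean_space set \<Rightarrow> ('a \<Rightarrow> real) \<Rightarrow> ('a \<Rightarrow> real) \<Rightarrow> ennreal" where
  "modular_BV \<Omega> p u =
    (let Y = {x \<in> \<Omega>. p x = 1}
     in variation \<Omega> u Y + weak_gradient_energy (\<Omega> - Y) p u)"

definition norm_BV ::
  "'a::euclidean_space set \<Rightarrow> ('a \<Rightarrow> real) \<Rightarrow> ('a \<Rightarrow> real) \<Rightarrow> ennreal" where
  "norm_BV \<Omega> p u = norm_Lp \<Omega> p u + luxemburg (modular_BV \<Omega> p) u"

definition BV ::
  "'a::euclidean_space set \<Rightarrow> ('a \<Rightarrow> real) \<Rightarrow> ('a \<Rightarrow> real) set" where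
  "BV \<Omega> p = {u \<in> borel_measurable (lebesgue_on \<Omega>). norm_BV \<Omega> p u < \<infinity>}"

end

theory Submission
  imports Defs
begin

text \<open>
  Let \<open>Y\<close> be the set where \<open>p = 1\<close>, and \<open>V\<close> its complement in \<open>\<Omega>\<close>.

  From the relaxed space to BV: a sequence of bounded energy bounds the variation by duality.
  Weak compactness of the gradients on \<open>V\<close> is replaced by an elementary argument: among the
  approximants in ever smaller \<open>L\<^sup>1\<close> neighbourhoods of \<open>u\<close>, choose near-minimisers of the area
  functional. Midpoints are admissible, so uniform convexity of the area integrand makes the
  gradients converge almost everywhere along a subsequence. On compact subsets of \<open>V\<close> the
  exponent exceeds 1, the gradients are equiintegrable, and the limit is the weak gradient.

  From BV to the relaxed space: mollify with radius \<open>\<epsilon>\<close> times the larger of the distances to the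
  complements of \<open>U\<close> and \<open>V\<close>, where \<open>U\<close> is an open neighbourhood of \<open>Y\<close> on which \<open>Du\<close> has
  finite mass. Each ball then lies in \<open>U\<close> or in \<open>V\<close>. In the latter case Jensen's inequality and
  log-Hoelder continuity bound the energy. In the former, a ball meeting \<open>Y\<close> has \<open>p - 1\<close> so small
  that the power \<open>p - 1\<close> of the gradient of the mollification, which is at most a negative power
  of the radius, is bounded, and the energy reduces to the mass of \<open>Du\<close> by duality.
\<close>

subsection \<open>Differentiability of Lipschitz functions along lines\<close>

text \<open>Two difficulties shape the details. First, p need not stay away from 1 near Y, so
  reflexivity and maximal-function bounds are out of reach there and gradients are controlled only
  through their L1 mass. Second, the radius \<delta> of the mollification is merely Lipschitz, and
  differentiating the mollification differentiates \<delta> as well. Its partial derivatives exist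
  almost everywhere, by the same result on lines that serves integration by parts for the
  competitors of the relaxed space. The derivative of a moving kernel is not a mollified gradient,
  but conservation of mass makes it minus the divergence of a compactly supported field: the kernel
  times the velocity that carries it (\<open>kern_field\<close>). Tested inside V this field sees
  the weak gradient, tested inside U it sees the variation. Exponents are exchanged by one estimate,
  \<open>powr_log_Holder\<close>: averages over a ball of radius d are at most a multiple of a fixed
  negative power of d, and raising such a number to the power c / ln (e + 1/d) costs a bounded
  factor. It is used both near Y and away from it.\<close>

lemma interval_measure_cball:
  fixes g :: "real \<Rightarrow> real"
  assumes "mono g" "continuous_on UNIV g" "h \<noteq> 0"
  shows "emeasure (interval_measure g) (cball (x + h/2) (\<bar>h\<bar>/2)) = ennreal \<bar>g (x + h) - g x\<bar>"
proof (cases "h > 0")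
  case True
  then have "cball (x + h/2) (\<bar>h\<bar>/2) = {x..x+h}"
    by (auto simp: cball_eq_atLeastAtMost)
  moreover have "g x \<le> g (x+h)"
    using assms(1) True by (auto simp: mono_def)
  ultimately show ?thesis
    using True assms by (auto simp: emeasure_interval_measure_Icc mono_def)
next
  case False
  then have "cball (x + h/2) (\<bar>h\<bar>/2) = {x+h..x}"
    by (auto simp: cball_eq_atLeastAtMost)
  moreover have "g (x+h) \<le> g x"
    using assms(1) False by (auto simp: mono_def)
  ultimately show ?thesis
    using False assms by (auto simp: emeasure_interval_measure_Icc mono_def)
qed

lemma small_interval_in_open:
  fixes x :: real
  assumes "open G" "x \<in> G" "0 < d"
  obtains e where "e > 0" "e \<le> d" "\<And>h. h \<noteq> 0 \<Longrightarrow> \<bar>h\<bar> < e \<Longrightarrow> cball (x + h/2) (\<bar>h\<bar>/2) \<subseteq> G"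
proof -
  obtain e where e: "e > 0" "ball x e \<subseteq> G"
    using assms openE by blast
  show thesis
  proof (rule that[of "min e d"])
    fix h :: real assume h: "h \<noteq> 0" "\<bar>h\<bar> < min e d"
    have "cball (x + h/2) (\<bar>h\<bar>/2) \<subseteq> ball x e"
    proof
      fix y assume "y \<in> cball (x + h/2) (\<bar>h\<bar>/2)"
      then have "\<bar>x + h/2 - y\<bar> \<le> \<bar>h\<bar>/2" by (simp add: dist_real_def)
      then have "\<bar>x - y\<bar> \<le> \<bar>h\<bar>" by (auto simp: abs_if split: if_splits)
      then show "y \<in> ball x e" using h by (simp add: dist_real_def)
    qed
    with e show "cball (x + h/2) (\<bar>h\<bar>/2) \<subseteq> G" by blast
  qed (use e assms in auto)
qed

text \<open>The intervals in \<open>G\<close> on which \<open>g\<close> grows by at most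
  \<open>r\<close> times their length form a fine cover of \<open>S\<close>. By Vitali's theorem a
  disjoint subfamily covers almost all of \<open>S\<close>, and its total growth is at most
  \<open>r\<close> times the measure of \<open>G\<close>. Open intervals are kept so that
  \<open>W\<close> is open; only countably many endpoints are lost.\<close>

lemma lower_quotient_cover:
  fixes g :: "real \<Rightarrow> real"
  assumes g: "mono g" "continuous_on UNIV g"
    and low: "\<And>x d. x \<in> S \<Longrightarrow> 0 < d \<Longrightarrow> \<exists>h. h \<noteq> 0 \<and> \<bar>h\<bar> < d \<and> (g (x + h) - g x) / h < r"
    and G: "open G" "S \<subseteq> G" and r: "r \<ge> 0"
  obtains W where "open W" "negligible (S - W)"
    "emeasure (interval_measure g) W \<le> ennreal r * emeasure lborel G"
proof -
  \<comment> \<open>The index (x, h) stands for the interval with endpoints x and x + h. Written as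
    a ball it does not depend on the sign of h and suits Vitali's theorem.\<close>
  define c where "c = (\<lambda>i::real\<times>real. fst i + snd i / 2)"
  define \<rho> where "\<rho> = (\<lambda>i::real\<times>real. \<bar>snd i\<bar> / 2)"
  define K where "K = {i. snd i \<noteq> 0 \<and> cball (c i) (\<rho> i) \<subseteq> G \<and>
    \<bar>g (fst i + snd i) - g (fst i)\<bar> \<le> r * \<bar>snd i\<bar>}"
  have Kpos: "\<And>i. i \<in> K \<Longrightarrow> 0 < \<rho> i" by (auto simp: K_def \<rho>_def)
  have Kcov: "\<exists>i. i \<in> K \<and> x \<in> cball (c i) (\<rho> i) \<and> \<rho> i < d" if x: "x \<in> S" and d: "0 < d" for x d
  proof -
    obtain e where e: "e > 0" "e \<le> d" "\<And>h. h \<noteq> 0 \<Longrightarrow> \<bar>h\<bar> < e \<Longrightarrow> cball (x + h/2) (\<bar>h\<bar>/2) \<subseteq> G"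
      using small_interval_in_open[OF G(1) _ d] G(2) x by blast
    obtain h where h: "h \<noteq> 0" "\<bar>h\<bar> < e" "(g (x + h) - g x) / h < r"
      using low[OF x e(1)] by blast
    have "(g (x + h) - g x) / h \<ge> 0"
      using g(1) h(1) by (cases "h > 0") (auto simp: mono_def intro: divide_nonpos_neg)
    then have "\<bar>g (x + h) - g x\<bar> / \<bar>h\<bar> \<le> r"
      using h(3) by (simp flip: abs_divide)
    then have "\<bar>g (x + h) - g x\<bar> \<le> r * \<bar>h\<bar>"
      using h by (simp add: pos_divide_le_eq)
    then have "(x,h) \<in> K" using h e by (auto simp: K_def c_def \<rho>_def)
    moreover have "x \<in> cball (c (x,h)) (\<rho> (x,h))" by (auto simp: c_def \<rho>_def dist_real_def)
    moreover have "\<rho> (x,h) < d" using h e by (auto simp: \<rho>_def)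
    ultimately show ?thesis by blast
  qed
  obtain C where C: "countable C" "C \<subseteq> K"
     "pairwise (\<lambda>i j. disjnt (cball (c i) (\<rho> i)) (cball (c j) (\<rho> j))) C"
     "negligible(S - (\<Union>i \<in> C. cball (c i) (\<rho> i)))"
    using Vitali_covering_theorem_cballs[of K \<rho> S c] Kpos Kcov by blast
  define W where "W = (\<Union>i\<in>C. ball (c i) (\<rho> i))"
  have disj: "disjoint_family_on (\<lambda>i. ball (c i) (\<rho> i)) C"
    unfolding disjoint_family_on_def
  proof (intro ballI impI)
    fix i j assume "i \<in> C" "j \<in> C" "i \<noteq> j"
    then have "cball (c i) (\<rho> i) \<inter> cball (c j) (\<rho> j) = {}"
      using C(3) by (simp add: pairwise_def disjnt_def)
    moreover have "ball (c i) (\<rho> i) \<subseteq> cball (c i) (\<rho> i)" "ball (c j) (\<rho> j) \<subseteq> cball (c j) (\<rho> j)"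
      by (rule ball_subset_cball)+
    ultimately show "ball (c i) (\<rho> i) \<inter> ball (c j) (\<rho> j) = {}" by blast
  qed
  show thesis
  proof (rule that[of W])
    show "open W" by (auto simp: W_def)
    have "S - W \<subseteq> (S - (\<Union>i \<in> C. cball (c i) (\<rho> i))) \<union> (\<Union>i\<in>C. sphere (c i) (\<rho> i))"
      by (auto simp: W_def sphere_def cball_def ball_def) (metis order_le_less)
    moreover have "negligible (\<Union>i\<in>C. sphere (c i) (\<rho> i))"
      using C(1) by (intro negligible_countable_Union) (auto simp: negligible_sphere)
    ultimately show "negligible (S - W)"
      using C(4) negligible_Un negligible_subset by blast
    have "emeasure (interval_measure g) W
        = (\<integral>\<^sup>+i. emeasure (interval_measure g) (ball (c i) (\<rho> i)) \<partial>count_space C)"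
      unfolding W_def by (intro emeasure_UN_countable C(1) disj) auto
    also have "\<dots> \<le> (\<integral>\<^sup>+i. ennreal r * emeasure lborel (ball (c i) (\<rho> i)) \<partial>count_space C)"
    proof (rule nn_integral_mono)
      fix i assume "i \<in> space (count_space C)"
      then have i: "i \<in> K" using C by auto
      have "emeasure (interval_measure g) (ball (c i) (\<rho> i)) \<le> emeasure (interval_measure g) (cball (c i) (\<rho> i))"
        by (intro emeasure_mono) auto
      also have "\<dots> = ennreal \<bar>g (fst i + snd i) - g (fst i)\<bar>"
        using i unfolding c_def \<rho>_def by (intro interval_measure_cball g) (auto simp: K_def)
      also have "\<dots> \<le> ennreal (r * \<bar>snd i\<bar>)"
        using i by (intro ennreal_leI) (auto simp: K_def)
      also have "\<dots> = ennreal r * emeasure lborel (ball (c i) (\<rho> i))"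
        using r by (simp add: ball_eq_greaterThanLessThan \<rho>_def ennreal_mult)
      finally show "emeasure (interval_measure g) (ball (c i) (\<rho> i)) \<le> ennreal r * emeasure lborel (ball (c i) (\<rho> i))" .
    qed
    also have "\<dots> = ennreal r * (\<integral>\<^sup>+i. emeasure lborel (ball (c i) (\<rho> i)) \<partial>count_space C)"
      by (simp add: nn_integral_cmult)
    also have "(\<integral>\<^sup>+i. emeasure lborel (ball (c i) (\<rho> i)) \<partial>count_space C) = emeasure lborel W"
      unfolding W_def by (intro emeasure_UN_countable[symmetric] C(1) disj) auto
    also have "emeasure lborel W \<le> emeasure lborel G"
    proof (rule emeasure_mono)
      show "W \<subseteq> G" using C(2) by (fastforce simp: W_def K_def)
    qed (use G in auto)
    finally show "emeasure (interval_measure g) W \<le> ennreal r * emeasure lborel G"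
      by (simp add: mult_left_mono)
  qed
qed

text \<open>The mirror image of \<open>lower_quotient_cover\<close>, with growth at least
  \<open>s\<close> times the length. Closed intervals are kept because they must exhaust
  \<open>S\<close> up to a null set; being disjoint subsets of \<open>W\<close>, they grow in total
  by at most the Stieltjes measure of \<open>W\<close>.\<close>

lemma upper_quotient_cover:
  fixes g :: "real \<Rightarrow> real"
  assumes g: "mono g" "continuous_on UNIV g"
    and up: "\<And>x d. x \<in> S \<Longrightarrow> 0 < d \<Longrightarrow> \<exists>h. h \<noteq> 0 \<and> \<bar>h\<bar> < d \<and> (g (x + h) - g x) / h > s"
    and W: "open W" "S \<subseteq> W" and s: "s \<ge> 0" and S: "S \<in> sets borel"
  shows "ennreal s * emeasure lborel S \<le> emeasure (interval_measure g) W"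
proof -
  define c where "c = (\<lambda>i::real\<times>real. fst i + snd i / 2)"
  define \<rho> where "\<rho> = (\<lambda>i::real\<times>real. \<bar>snd i\<bar> / 2)"
  define K where "K = {i. snd i \<noteq> 0 \<and> cball (c i) (\<rho> i) \<subseteq> W \<and>
    \<bar>g (fst i + snd i) - g (fst i)\<bar> \<ge> s * \<bar>snd i\<bar>}"
  have Kpos: "\<And>i. i \<in> K \<Longrightarrow> 0 < \<rho> i" by (auto simp: K_def \<rho>_def)
  have Kcov: "\<exists>i. i \<in> K \<and> x \<in> cball (c i) (\<rho> i) \<and> \<rho> i < d" if x: "x \<in> S" and d: "0 < d" for x d
  proof -
    obtain e where e: "e > 0" "e \<le> d" "\<And>h. h \<noteq> 0 \<Longrightarrow> \<bar>h\<bar> < e \<Longrightarrow> cball (x + h/2) (\<bar>h\<bar>/2) \<subseteq> W"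
      using small_interval_in_open[OF W(1) _ d] W(2) x by blast
    obtain h where h: "h \<noteq> 0" "\<bar>h\<bar> < e" "(g (x + h) - g x) / h > s"
      using up[OF x e(1)] by blast
    have "\<bar>(g (x + h) - g x) / h\<bar> \<ge> s" using h by linarith
    then have "\<bar>g (x + h) - g x\<bar> \<ge> s * \<bar>h\<bar>"
      using h by (simp add: abs_divide pos_le_divide_eq)
    then have "(x,h) \<in> K" using h e by (auto simp: K_def c_def \<rho>_def)
    moreover have "x \<in> cball (c (x,h)) (\<rho> (x,h))" by (auto simp: c_def \<rho>_def dist_real_def)
    moreover have "\<rho> (x,h) < d" using h e by (auto simp: \<rho>_def)
    ultimately show ?thesis by blast
  qed
  obtain C where C: "countable C" "C \<subseteq> K"
     "pairwise (\<lambda>i j. disjnt (cball (c i) (\<rho> i)) (cball (c j) (\<rho> j))) C"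
     "negligible(S - (\<Union>i \<in> C. cball (c i) (\<rho> i)))"
    using Vitali_covering_theorem_cballs[of K \<rho> S c] Kpos Kcov by blast
  define V where "V = (\<Union>i\<in>C. cball (c i) (\<rho> i))"
  have disj: "disjoint_family_on (\<lambda>i. cball (c i) (\<rho> i)) C"
    using C(3) unfolding disjoint_family_on_def pairwise_def disjnt_def by blast
  have V: "V \<in> sets borel" unfolding V_def using C(1) by (intro sets.countable_UN') auto
  have "emeasure lborel (S - V) = 0"
    using C(4) S V
    by (simp add: V_def[symmetric] negligible_iff_emeasure0 emeasure_completion)
  then have "emeasure lborel S \<le> emeasure lborel V"
    using emeasure_mono[of S "V \<union> (S - V)" lborel] emeasure_subadditive[of V lborel "S - V"] S V
    by (auto intro: order_trans)
  then have "ennreal s * emeasure lborel S \<le> ennreal s * emeasure lborel V"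
    by (rule mult_left_mono) simp
  also have "emeasure lborel V = (\<integral>\<^sup>+i. emeasure lborel (cball (c i) (\<rho> i)) \<partial>count_space C)"
    unfolding V_def by (intro emeasure_UN_countable C(1) disj) auto
  also have "ennreal s * \<dots> = (\<integral>\<^sup>+i. ennreal s * emeasure lborel (cball (c i) (\<rho> i)) \<partial>count_space C)"
    by (simp add: nn_integral_cmult)
  also have "\<dots> \<le> (\<integral>\<^sup>+i. emeasure (interval_measure g) (cball (c i) (\<rho> i)) \<partial>count_space C)"
  proof (rule nn_integral_mono)
    fix i assume "i \<in> space (count_space C)"
    then have i: "i \<in> K" using C by auto
    have "ennreal s * emeasure lborel (cball (c i) (\<rho> i)) = ennreal (s * \<bar>snd i\<bar>)"
      using s by (simp add: cball_eq_atLeastAtMost \<rho>_def ennreal_mult)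
    also have "\<dots> \<le> ennreal \<bar>g (fst i + snd i) - g (fst i)\<bar>"
      using i by (intro ennreal_leI) (auto simp: K_def)
    also have "\<dots> = emeasure (interval_measure g) (cball (c i) (\<rho> i))"
      using i unfolding c_def \<rho>_def by (intro interval_measure_cball[symmetric] g) (auto simp: K_def)
    finally show "ennreal s * emeasure lborel (cball (c i) (\<rho> i)) \<le> emeasure (interval_measure g) (cball (c i) (\<rho> i))" .
  qed
  also have "\<dots> = emeasure (interval_measure g) V"
    unfolding V_def by (intro emeasure_UN_countable[symmetric] C(1) disj) auto
  also have "\<dots> \<le> emeasure (interval_measure g) W"
  proof (rule emeasure_mono)
    show "V \<subseteq> W" using C(2) by (fastforce simp: V_def K_def)
  qed (use W in auto)
  finally show ?thesis .
qed

text \<open>For a bounded piece \<open>B\<close> of \<open>S\<close>, choose an open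
  \<open>G\<close> around it with excess measure below e. The lower quotients give \<open>W\<close>
  of Stieltjes measure at most r (|B| + e), and the upper quotients on \<open>B \<inter> W\<close>
  bound that measure below by s |B|. Letting e tend to 0 forces |B| = 0, because r < s.\<close>

lemma oscillating_quotient_null_mono:
  fixes g :: "real \<Rightarrow> real"
  assumes g: "mono g" "continuous_on UNIV g"
    and S: "S \<in> sets borel" and rs: "r < s"
    and low: "\<And>x d. x \<in> S \<Longrightarrow> 0 < d \<Longrightarrow> \<exists>h. h \<noteq> 0 \<and> \<bar>h\<bar> < d \<and> (g (x + h) - g x) / h < r"
    and up: "\<And>x d. x \<in> S \<Longrightarrow> 0 < d \<Longrightarrow> \<exists>h. h \<noteq> 0 \<and> \<bar>h\<bar> < d \<and> (g (x + h) - g x) / h > s"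
  shows "emeasure lborel S = 0"
proof (cases "S = {}")
  case False
  \<comment> \<open>Quotients of a monotone function are nonnegative, so a single point of
    \<open>S\<close> already shows that \<open>r\<close> is positive.\<close>
  then obtain x0 where "x0 \<in> S" by blast
  then obtain h0 where "h0 \<noteq> 0" "(g (x0 + h0) - g x0) / h0 < r"
    using low[of x0 1] by auto
  moreover have "(g (x0 + h0) - g x0) / h0 \<ge> 0"
    using g(1) \<open>h0 \<noteq> 0\<close> by (cases "h0 > 0") (auto simp: mono_def intro: divide_nonpos_neg)
  ultimately have r: "r > 0" by linarith
  have bdd: "emeasure lborel (S \<inter> {-real N..real N}) = 0" for N
  proof -
    define B where "B = S \<inter> {-real N..real N}"
    have B: "B \<in> sets borel" using S by (auto simp: B_def)
    have Bf: "emeasure lborel B < \<infinity>"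
      using emeasure_mono[of B "{-real N..real N}" lborel] by (auto simp: B_def intro: le_less_trans)
    have le: "s * measure lborel B \<le> r * (measure lborel B + e)" if "e > 0" for e
    proof -
      have "B \<in> sets lebesgue" using B by simp
      then obtain G where G: "open G" "B \<subseteq> G" "(G - B) \<in> lmeasurable" "emeasure lebesgue (G - B) < ennreal e"
        by (rule sets_lebesgue_outer_open[OF _ \<open>e > 0\<close>])
      have "emeasure lborel G \<le> emeasure lborel B + emeasure lborel (G - B)"
        using emeasure_subadditive[of B lborel "G - B"] G(1,2) B
        by (auto simp: Un_absorb1)
      also have "emeasure lborel (G - B) \<le> ennreal e"
        using G B by (simp add: emeasure_completion)
      also have "emeasure lborel B = ennreal (measure lborel B)"
        using Bf by (simp add: emeasure_eq_ennreal_measure)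
      finally have Ge: "emeasure lborel G \<le> ennreal (measure lborel B + e)"
        using \<open>e > 0\<close> by (simp add: ennreal_plus add_left_mono)
      obtain W where W: "open W" "negligible (B - W)"
        "emeasure (interval_measure g) W \<le> ennreal r * emeasure lborel G"
        by (rule lower_quotient_cover[OF g low G(1,2) less_imp_le[OF r], rotated 2]) (auto simp: B_def)
      have BW: "B \<inter> W \<in> sets borel" using B W by auto
      have "ennreal s * emeasure lborel (B \<inter> W) \<le> emeasure (interval_measure g) W"
        by (rule upper_quotient_cover[OF g up W(1) _ _ BW]) (use r rs in \<open>auto simp: B_def\<close>)
      moreover have "emeasure lborel (B - W) = 0"
        using W(1,2) B by (simp add: negligible_iff_emeasure0 emeasure_completion)
      then have "emeasure lborel (B \<inter> W) = emeasure lborel B"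
        using emeasure_Diff_null_set[of "B - W" lborel B] B W(1)
        by (simp add: null_sets_def Diff_Diff_Int)
      ultimately have "ennreal s * emeasure lborel B \<le> emeasure (interval_measure g) W"
        by (simp only:)
      also note W(3)
      also have "ennreal r * emeasure lborel G \<le> ennreal r * ennreal (measure lborel B + e)"
        by (intro mult_left_mono Ge) simp
      finally have "ennreal s * ennreal (measure lborel B) \<le> ennreal r * ennreal (measure lborel B + e)"
        using Bf by (simp add: emeasure_eq_ennreal_measure)
      then show ?thesis
        using r rs \<open>e > 0\<close> by (simp add: ennreal_mult[symmetric] del: ennreal_plus)
    qed
    have "s * measure lborel B \<le> r * measure lborel B"
    proof (rule field_le_epsilon)
      fix e :: real assume "e > 0"
      show "s * measure lborel B \<le> r * measure lborel B + e"
        using le[of "e / r"] r \<open>e > 0\<close> by (simp add: distrib_left)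
    qed
    then have "measure lborel B = 0"
      using rs measure_nonneg[of lborel B] by (simp add: mult_le_cancel_right)
    then show ?thesis using Bf by (simp add: emeasure_eq_ennreal_measure B_def[symmetric])
  qed
  have "S = (\<Union>N. S \<inter> {-real N..real N})"
  proof -
    have "\<exists>N. x \<in> {-real N..real N}" for x
    proof -
      obtain N where "\<bar>x\<bar> \<le> real N" using real_arch_simple by blast
      then have "x \<in> {-real N..real N}" by auto
      then show ?thesis ..
    qed
    then show ?thesis by blast
  qed
  moreover have "(\<Union>N. S \<inter> {-real N..real N}) \<in> null_sets lborel"
    using bdd S by (intro null_sets_UN) (auto simp: null_sets_def)
  ultimately show ?thesis by (metis null_setsD1)
qed simp

section \<open>From monotone functions on the line to Lipschitz functions on Euclidean space\<close>

lemma mcshane_extension: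
  fixes f :: "'a::metric_space \<Rightarrow> real"
  assumes f: "L-lipschitz_on S f"
  obtains g where "L-lipschitz_on UNIV g" "\<And>x. x \<in> S \<Longrightarrow> g x = f x"
proof (cases "S = {}")
  case True
  show thesis
    by (rule that[of "\<lambda>_. 0"]) (use True lipschitz_on_nonneg[OF f] in \<open>auto simp: lipschitz_on_def\<close>)
next
  case False
  then obtain s where s: "s \<in> S" by blast
  have L: "L \<ge> 0" using lipschitz_on_nonneg[OF f] .
  have fl: "\<bar>f y - f z\<bar> \<le> L * dist y z" if "y \<in> S" "z \<in> S" for y z
    using lipschitz_onD[OF f that] by (simp add: dist_real_def)
  \<comment> \<open>McShane's formula: the lower envelope of the cones of slope L whose apexes lie
    on the graph of \<open>f\<close> over \<open>S\<close>.\<close>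
  define g where "g x = (INF y\<in>S. f y + L * dist x y)" for x
  have bdd: "bdd_below ((\<lambda>y. f y + L * dist x y) ` S)" for x
  proof (rule bdd_belowI2)
    fix y assume "y \<in> S"
    have "f s - f y \<le> L * dist s y" using fl[OF s \<open>y \<in> S\<close>] by linarith
    also have "\<dots> \<le> L * (dist x s + dist x y)"
      using dist_triangle3[of s y x] L by (simp add: mult_left_mono)
    finally show "f s - L * dist x s \<le> f y + L * dist x y" by (simp add: algebra_simps)
  qed
  have le: "g x \<le> g x' + L * dist x x'" for x x'
  proof -
    have "g x - L * dist x x' \<le> g x'"
      unfolding g_def[of x']
    proof (rule cINF_greatest)
      fix y assume y: "y \<in> S"
      have "g x \<le> f y + L * dist x y" unfolding g_def by (rule cINF_lower[OF bdd y])
      also have "\<dots> \<le> f y + L * (dist x x' + dist x' y)"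
        using dist_triangle[of x y x'] L by (simp add: mult_left_mono)
      finally show "g x - L * dist x x' \<le> f y + L * dist x' y" by (simp add: algebra_simps)
    qed (use False in auto)
    then show ?thesis by simp
  qed
  show thesis
  proof (rule that[of g])
    show "L-lipschitz_on UNIV g"
    proof (rule lipschitz_onI)
      fix x y show "dist (g x) (g y) \<le> L * dist x y"
        using le[of x y] le[of y x] by (simp add: dist_real_def dist_commute abs_le_iff)
    qed (fact L)
    fix x assume x: "x \<in> S"
    have "g x \<le> f x + L * dist x x" unfolding g_def by (rule cINF_lower[OF bdd x])
    moreover have "f x \<le> g x" unfolding g_def
    proof (rule cINF_greatest)
      fix y assume "y \<in> S"
      then show "f x \<le> f y + L * dist x y" using fl[OF x] by (smt (verit))
    qed (use False in auto)
    ultimately show "g x = f x" by simp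
  qed
qed

text \<open>On this set the lower limit of the difference quotients along \<open>b\<close> is at
  most \<open>r\<close> and the upper limit at least \<open>s\<close>. Restricting the increments to
  rationals makes the set Borel for continuous \<open>f\<close>, and continuity recovers the real
  increments.\<close>

definition oscillation_set :: "('a::euclidean_space \<Rightarrow> real) \<Rightarrow> 'a \<Rightarrow> real \<Rightarrow> real \<Rightarrow> 'a set" where
  "oscillation_set f b r s = {x. \<forall>n::nat.
     (\<exists>h\<in>\<rat>. h \<noteq> 0 \<and> \<bar>h\<bar> < 1 / (Suc n) \<and> (f (x + h *\<^sub>R b) - f x) / h < r) \<and>
     (\<exists>h\<in>\<rat>. h \<noteq> 0 \<and> \<bar>h\<bar> < 1 / (Suc n) \<and> (f (x + h *\<^sub>R b) - f x) / h > s)}"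

lemma oscillation_set_borel:
  assumes "continuous_on UNIV f"
  shows "oscillation_set f b r s \<in> sets borel"
proof -
  have [measurable]: "f \<in> borel_measurable borel" using assms by (rule borel_measurable_continuous_onI)
  have "Measurable.pred borel (\<lambda>x. \<forall>n::nat.
     (\<exists>q. of_rat q \<noteq> (0::real) \<and> \<bar>of_rat q\<bar> < 1 / real (Suc n) \<and> (f (x + of_rat q *\<^sub>R b) - f x) / of_rat q < r) \<and>
     (\<exists>q. of_rat q \<noteq> (0::real) \<and> \<bar>of_rat q\<bar> < 1 / real (Suc n) \<and> (f (x + of_rat q *\<^sub>R b) - f x) / of_rat q > s))"
    by measurable
  then show ?thesis
    unfolding oscillation_set_def pred_def by (simp add: Rats_def)
qed

text \<open>Adding L x makes \<open>g\<close> monotone and shifts every difference quotient by L,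
  which reduces the claim to the monotone case with both thresholds shifted.\<close>

lemma oscillation_set_null_real:
  fixes g :: "real \<Rightarrow> real"
  assumes g: "L-lipschitz_on UNIV g" and rs: "r < s"
  shows "emeasure lborel (oscillation_set g 1 r s) = 0"
proof -
  have L: "L \<ge> 0" using lipschitz_on_nonneg[OF g] .
  have cg: "continuous_on UNIV g" by (rule lipschitz_on_continuous_on[OF g])
  define G where "G x = g x + L * x" for x
  have G: "mono G"
  proof (rule monoI)
    fix x y :: real assume "x \<le> y"
    then show "G x \<le> G y"
      using lipschitz_onD[OF g, of x y] by (simp add: G_def dist_real_def algebra_simps abs_le_iff)
  qed
  have q: "(G (x + h) - G x) / h = (g (x + h) - g x) / h + L" if "h \<noteq> 0" for x h
    using that by (simp add: G_def field_simps)
  have *: "\<exists>n. 1 / real (Suc n) < d" if "d > 0" for d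
    using reals_Archimedean[OF that] by (auto simp: inverse_eq_divide)
  show ?thesis
  proof (rule oscillating_quotient_null_mono[OF G, where r = "r + L" and s = "s + L"])
    show "continuous_on UNIV G" unfolding G_def by (intro continuous_intros cg)
    show "oscillation_set g 1 r s \<in> sets borel" by (rule oscillation_set_borel[OF cg])
    show "r + L < s + L" using rs by simp
    fix x d :: real assume x: "x \<in> oscillation_set g 1 r s" and d: "0 < d"
    obtain n where n: "1 / real (Suc n) < d" using *[OF d] by blast
    obtain h where "h \<noteq> 0" "\<bar>h\<bar> < 1 / real (Suc n)" "(g (x + h) - g x) / h < r"
      using x by (auto simp: oscillation_set_def simp del: of_nat_Suc)
    then show "\<exists>h. h \<noteq> 0 \<and> \<bar>h\<bar> < d \<and> (G (x + h) - G x) / h < r + L"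
      using n q[of h x] by (intro exI[of _ h]) auto
    obtain h where "h \<noteq> 0" "\<bar>h\<bar> < 1 / real (Suc n)" "(g (x + h) - g x) / h > s"
      using x by (auto simp: oscillation_set_def simp del: of_nat_Suc)
    then show "\<exists>h. h \<noteq> 0 \<and> \<bar>h\<bar> < d \<and> s + L < (G (x + h) - G x) / h"
      using n q[of h x] by (intro exI[of _ h]) auto
  qed
qed

text \<open>Translating \<open>E\<close> along \<open>b\<close> by t in [0, 1] and averaging does
  not change its measure; Fubini then turns the average into an integral of line measures. This
  needs no splitting of the space into \<open>b\<close> and its orthogonal complement.\<close>

lemma null_set_by_lines:
  fixes b :: "'a::euclidean_space"
  assumes E: "E \<in> sets borel"
    and null: "\<And>x. emeasure lborel {t::real. x + t *\<^sub>R b \<in> E} = 0"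
  shows "emeasure lborel E = 0"
proof -
  note E[measurable]
  have "emeasure lborel E = (\<integral>\<^sup>+x. indicator E x \<partial>lborel)" using E by simp
  also have "\<dots> = (\<integral>\<^sup>+x. indicator E (x + t *\<^sub>R b) \<partial>lborel)" for t :: real
    by (subst lborel_distr_plus[of "t *\<^sub>R b", symmetric])
       (subst nn_integral_distr, auto simp: add.commute)
  finally have shift: "emeasure lborel E = (\<integral>\<^sup>+x. indicator E (x + t *\<^sub>R b) \<partial>lborel)" for t :: real .
  have "emeasure lborel E = (\<integral>\<^sup>+t. emeasure lborel E * indicator {0..1} t \<partial>(lborel::real measure))"
    by (simp add: nn_integral_cmult_indicator)
  also have "\<dots> = (\<integral>\<^sup>+t. (\<integral>\<^sup>+x. indicator E (x + t *\<^sub>R b) * indicator {0..1::real} t \<partial>lborel) \<partial>lborel)"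
    by (intro nn_integral_cong) (simp add: nn_integral_multc flip: shift)
  also have "\<dots> = (\<integral>\<^sup>+x. (\<integral>\<^sup>+t. indicator E (x + t *\<^sub>R b) * indicator {0..1::real} t \<partial>lborel) \<partial>lborel)"
    by (rule lborel_pair.Fubini') measurable
  also have "\<dots> \<le> (\<integral>\<^sup>+x. (\<integral>\<^sup>+t. indicator {t. x + t *\<^sub>R b \<in> E} t \<partial>(lborel::real measure)) \<partial>(lborel::'a measure))"
    by (intro nn_integral_mono) (auto simp: indicator_def)
  also have "\<dots> = (\<integral>\<^sup>+x. emeasure lborel {t. x + t *\<^sub>R b \<in> E} \<partial>(lborel::'a measure))"
    by (intro nn_integral_cong nn_integral_indicator) simp
  also have "\<dots> = 0" using null by simp
  finally show ?thesis by simp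
qed

lemma oscillation_set_null:
  fixes f :: "'a::euclidean_space \<Rightarrow> real"
  assumes f: "L-lipschitz_on UNIV f" and rs: "r < s"
  shows "emeasure lborel (oscillation_set f b r s) = 0"
proof (rule null_set_by_lines)
  show "oscillation_set f b r s \<in> sets borel"
    by (rule oscillation_set_borel[OF lipschitz_on_continuous_on[OF f]])
  fix x
  have eq: "{t. x + t *\<^sub>R b \<in> oscillation_set f b r s} = oscillation_set (\<lambda>t. f (x + t *\<^sub>R b)) 1 r s"
    by (simp add: oscillation_set_def algebra_simps)
  have "(L * norm b)-lipschitz_on UNIV (\<lambda>t::real. f (x + t *\<^sub>R b))"
  proof (rule lipschitz_onI)
    fix t u :: real
    have "dist (f (x + t *\<^sub>R b)) (f (x + u *\<^sub>R b)) \<le> L * dist (x + t *\<^sub>R b) (x + u *\<^sub>R b)"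
      using lipschitz_onD[OF f] by blast
    also have "dist (x + t *\<^sub>R b) (x + u *\<^sub>R b) = norm b * dist t u"
      by (simp add: dist_norm flip: scaleR_diff_left)
    finally show "dist (f (x + t *\<^sub>R b)) (f (x + u *\<^sub>R b)) \<le> L * norm b * dist t u" by simp
  qed (use lipschitz_on_nonneg[OF f] in auto)
  then show "emeasure lborel {t. x + t *\<^sub>R b \<in> oscillation_set f b r s} = 0"
    unfolding eq by (rule oscillation_set_null_real) (fact rs)
qed

lemma eventually_nhds_Rats:
  fixes h :: real
  assumes "eventually P (nhds h)"
  shows "\<exists>k\<in>\<rat>. P k"
proof -
  obtain d where "d > 0" "\<And>k. dist k h < d \<Longrightarrow> P k"
    using assms by (auto simp: eventually_nhds_metric)
  moreover obtain k where "k \<in> \<rat>" "h < k" "k < h + d"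
    using Rats_dense_in_real[of h "h + d"] \<open>d > 0\<close> by auto
  ultimately show ?thesis by (intro bexI[of _ k]) (auto simp: dist_real_def)
qed

text \<open>If the lower and the upper limit of the quotients differed, two rationals would fit
  between them and the point would lie in an oscillation set. The Lipschitz bound makes the common
  value finite.\<close>

lemma has_derivative_if_not_oscillating:
  fixes f :: "'a::euclidean_space \<Rightarrow> real"
  assumes f: "L-lipschitz_on UNIV f"
    and no: "\<And>r s. r \<in> \<rat> \<Longrightarrow> s \<in> \<rat> \<Longrightarrow> r < s \<Longrightarrow> x \<notin> oscillation_set f b r s"
  shows "\<exists>D. ((\<lambda>t. f (x + t *\<^sub>R b)) has_real_derivative D) (at 0)"
proof -
  define q where "q h = (f (x + h *\<^sub>R b) - f x) / h" for h
  have L: "L \<ge> 0" using lipschitz_on_nonneg[OF f] .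
  have cf: "continuous_on UNIV f" by (rule lipschitz_on_continuous_on[OF f])
  have qb: "\<bar>q h\<bar> \<le> L * norm b" for h
  proof (cases "h = 0")
    case False
    have "\<bar>f (x + h *\<^sub>R b) - f x\<bar> \<le> L * norm b * \<bar>h\<bar>"
      using lipschitz_onD[OF f, of "x + h *\<^sub>R b" x] by (simp add: dist_real_def dist_norm mult_ac)
    with False show ?thesis by (simp add: q_def abs_divide pos_divide_le_eq)
  qed (use L in \<open>auto simp: q_def\<close>)
  have qc: "isCont q h" if "h \<noteq> 0" for h
  proof -
    have icf: "isCont f y" for y using cf by (simp add: continuous_on_eq_continuous_at)
    have "isCont (\<lambda>h. x + h *\<^sub>R b) h" by (intro continuous_intros)
    from isCont_o2[OF this icf] have "isCont (\<lambda>h. f (x + h *\<^sub>R b)) h" .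
    then show ?thesis unfolding q_def using that by (intro continuous_intros) auto
  qed
  \<comment> \<open>The quotient is continuous at nonzero increments, so an open condition that it
    satisfies at arbitrarily small increments is satisfied at rational ones too.\<close>
  have rat: "\<exists>h\<in>\<rat>. h \<noteq> 0 \<and> \<bar>h\<bar> < 1 / real (Suc n) \<and> P (q h)"
    if fr: "\<exists>\<^sub>F h in at 0. P (q h)" and P: "open (Collect P)" for P n
  proof -
    have "eventually (\<lambda>h::real. h \<noteq> 0 \<and> \<bar>h\<bar> < 1 / real (Suc n)) (at 0)"
      unfolding eventually_at by (intro exI[of _ "1 / real (Suc n)"]) auto
    from frequently_ex[OF frequently_eventually_frequently[OF fr this]]
    obtain h where h: "h \<noteq> 0" "\<bar>h\<bar> < 1 / real (Suc n)" "P (q h)" by blast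
    have "(q \<longlongrightarrow> q h) (nhds h)" using qc[OF h(1)] by (simp add: isCont_def tendsto_at_iff_tendsto_nhds)
    from topological_tendstoD[OF this P] have "eventually (\<lambda>k. P (q k)) (nhds h)" using h by simp
    moreover have "eventually (\<lambda>k. k \<noteq> 0) (nhds h)" using h(1) by (rule t1_space_nhds)
    moreover have "open {k::real. \<bar>k\<bar> < 1 / real (Suc n)}" by (intro open_Collect_less continuous_intros)
    from eventually_nhds_in_open[OF this] have "eventually (\<lambda>k. \<bar>k\<bar> < 1 / real (Suc n)) (nhds h)"
      using h(2) by simp
    ultimately have "eventually (\<lambda>k. k \<noteq> 0 \<and> \<bar>k\<bar> < 1 / real (Suc n) \<and> P (q k)) (nhds h)"
      by eventually_elim auto
    then show ?thesis by (rule eventually_nhds_Rats)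
  qed
  define a where "a = Liminf (at 0) (\<lambda>h. ereal (q h))"
  define c where "c = Limsup (at 0) (\<lambda>h. ereal (q h))"
  have ac: "a \<le> c" unfolding a_def c_def by (rule Liminf_le_Limsup) simp
  have ca: "c \<le> a"
  proof (rule ccontr)
    assume "\<not> c \<le> a"
    then have "a < c" by simp
    then obtain s0 where s0: "a < ereal (of_rat s0)" "ereal (of_rat s0) < c"
      using ereal_dense3 by blast
    obtain r0 where r0: "a < ereal (of_rat r0)" "ereal (of_rat r0) < ereal (of_rat s0)"
      using ereal_dense3[OF s0(1)] by blast
    have "x \<in> oscillation_set f b (of_rat r0) (of_rat s0)"
    proof -
      have "\<exists>\<^sub>F h in at 0. q h < of_rat r0"
      proof (rule ccontr)
        assume "\<not> ?thesis"
        then have "\<forall>\<^sub>F h in at 0. ereal (of_rat r0) \<le> ereal (q h)"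
          by (simp add: not_frequently not_less)
        from Liminf_bounded[OF this] r0 show False by (simp add: a_def)
      qed
      moreover have "\<exists>\<^sub>F h in at 0. q h > of_rat s0"
      proof (rule ccontr)
        assume "\<not> ?thesis"
        then have "\<forall>\<^sub>F h in at 0. ereal (q h) \<le> ereal (of_rat s0)"
          by (simp add: not_frequently not_less)
        from Limsup_bounded[OF this] s0 show False by (simp add: c_def)
      qed
      ultimately show ?thesis
        using rat[of "\<lambda>y. y < of_rat r0"] rat[of "\<lambda>y. y > of_rat s0"]
        by (simp add: oscillation_set_def q_def open_Collect_less continuous_intros del: of_nat_Suc)
    qed
    moreover have "of_rat r0 < (of_rat s0 :: real)" using r0 by simp
    ultimately show False using no[of "of_rat r0" "of_rat s0"] by simp
  qed
  have eq: "a = c" using ac ca by (rule antisym)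
  have "- ereal (L * norm b) \<le> a" unfolding a_def
    by (rule Liminf_bounded, rule always_eventually) (use qb in \<open>auto simp: abs_le_iff minus_le_iff\<close>)
  moreover have "c \<le> ereal (L * norm b)" unfolding c_def
    by (rule Limsup_bounded, rule always_eventually) (use qb in \<open>auto simp: abs_le_iff\<close>)
  ultimately obtain D where D: "a = ereal D" using eq by (cases a) auto
  have "((\<lambda>h. ereal (q h)) \<longlongrightarrow> ereal D) (at 0)"
    by (rule Liminf_eq_Limsup) (use D eq in \<open>auto simp: a_def c_def\<close>)
  then have "(q \<longlongrightarrow> D) (at 0)" by simp
  then show ?thesis by (intro exI[of _ D]) (simp add: DERIV_def q_def[abs_def])
qed

lemma lipschitz_partial_AE:
  fixes f :: "'a::euclidean_space \<Rightarrow> real"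
  assumes f: "L-lipschitz_on UNIV f"
  shows "AE x in lborel. \<exists>D. ((\<lambda>t. f (x + t *\<^sub>R b)) has_real_derivative D) (at 0)"
proof -
  have "AE x in lborel. x \<notin> oscillation_set f b (of_rat r) (of_rat s)" if "r < s" for r s
  proof (rule AE_not_in)
    show "oscillation_set f b (of_rat r) (of_rat s) \<in> null_sets lborel"
      using oscillation_set_null[OF f] oscillation_set_borel[OF lipschitz_on_continuous_on[OF f]] that
      by (auto simp: null_sets_def of_rat_less)
  qed
  then have "AE x in lborel. \<forall>r s. r < s \<longrightarrow> x \<notin> oscillation_set f b (of_rat r) (of_rat s)"
    by (simp add: AE_all_countable)
  then show ?thesis
  proof eventually_elim
    case (elim x)
    show ?case
      by (rule has_derivative_if_not_oscillating[OF f]) (use elim in \<open>auto simp: Rats_def of_rat_less\<close>)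
  qed
qed

text \<open>Lindelof's theorem leaves countably many open sets on which \<open>u\<close> is
  Lipschitz. On each, \<open>u\<close> is replaced by a global McShane extension, which has the same
  derivatives at the points of the open set.\<close>

lemma Lip_loc_partial_AE:
  fixes u :: "'a::euclidean_space \<Rightarrow> real"
  assumes \<Omega>: "open \<Omega>" and u: "u \<in> Lip_loc \<Omega>"
  shows "AE x in lborel. x \<in> \<Omega> \<longrightarrow> (\<exists>D. ((\<lambda>t. u (x + t *\<^sub>R b)) has_real_derivative D) (at 0))"
proof -
  define F where "F = {B. open B \<and> B \<subseteq> \<Omega> \<and> (\<exists>L. L-lipschitz_on B u)}"
  have "\<exists>B\<in>F. x \<in> B" if x: "x \<in> \<Omega>" for x
  proof -
    have "\<exists>e>0. \<exists>L. \<forall>t\<in>cball (0::real) e \<inter> UNIV. L-lipschitz_on (cball x e \<inter> \<Omega>) u"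
      using u x unfolding Lip_loc_def local_lipschitz_def by blast
    then obtain e L where "e > 0" and eL: "\<forall>t\<in>cball (0::real) e \<inter> UNIV. L-lipschitz_on (cball x e \<inter> \<Omega>) u"
      by blast
    then have e: "e > 0" "L-lipschitz_on (cball x e \<inter> \<Omega>) u"
      using bspec[OF eL, of 0] by auto
    have "L-lipschitz_on (ball x e \<inter> \<Omega>) u" by (rule lipschitz_on_subset[OF e(2)]) auto
    then show ?thesis using \<Omega> x e(1) by (intro bexI[of _ "ball x e \<inter> \<Omega>"]) (auto simp: F_def)
  qed
  then have UF: "\<Union>F = \<Omega>" by (auto simp: F_def)
  obtain F' where F': "F' \<subseteq> F" "countable F'" "\<Union>F' = \<Union>F"
    by (rule Lindelof[of F]) (auto simp: F_def)
  have "AE x in lborel. x \<in> B \<longrightarrow> (\<exists>D. ((\<lambda>t. u (x + t *\<^sub>R b)) has_real_derivative D) (at 0))" if BF: "B \<in> F'" for B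
  proof -
    obtain L where B: "open B" "L-lipschitz_on B u" using BF F'(1) by (auto simp: F_def)
    obtain g where g: "L-lipschitz_on UNIV g" "\<And>x. x \<in> B \<Longrightarrow> g x = u x"
      using mcshane_extension[OF B(2)] by blast
    from lipschitz_partial_AE[OF g(1), of b] show ?thesis
    proof eventually_elim
      case (elim x)
      show ?case
      proof
        assume x: "x \<in> B"
        obtain D where D: "((\<lambda>t. g (x + t *\<^sub>R b)) has_real_derivative D) (at 0)" using elim by blast
        have "open ((\<lambda>t::real. x + t *\<^sub>R b) -` B)"
          by (intro open_vimage B continuous_intros)
        then have "((\<lambda>t. u (x + t *\<^sub>R b)) has_real_derivative D) (at 0)"
          by (rule has_field_derivative_transform_within_open[OF D]) (use x g in auto)
        then show "\<exists>D. ((\<lambda>t. u (x + t *\<^sub>R b)) has_real_derivative D) (at 0)" ..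
      qed
    qed
  qed
  then have "AE x in lborel. \<forall>B\<in>F'. x \<in> B \<longrightarrow> (\<exists>D. ((\<lambda>t. u (x + t *\<^sub>R b)) has_real_derivative D) (at 0))"
    using F'(2) by (subst AE_ball_countable) auto
  then show ?thesis
  proof eventually_elim
    case (elim x)
    have "x \<in> \<Omega> \<longleftrightarrow> (\<exists>B\<in>F'. x \<in> B)" using F'(3) UF by blast
    with elim show ?case by blast
  qed
qed

subsection \<open>Test functions and integration by parts\<close>

lemma integrable_lborel_bounded_on:
  fixes f :: "'a::euclidean_space \<Rightarrow> 'b::{banach,second_countable_topology}"
  assumes [measurable]: "f \<in> borel_measurable borel" and K: "bounded K"
    and le: "\<And>x. norm (f x) \<le> C" and z: "\<And>x. x \<notin> K \<Longrightarrow> f x = 0"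
  shows "integrable lborel f"
proof -
  obtain r where r: "K \<subseteq> cball 0 r"
    using bounded_subset_ballD[OF K, of 0] ball_subset_cball[of 0] by (meson order_trans)
  have "integrable lborel (\<lambda>x. indicator (cball 0 r) x *\<^sub>R f x)"
    by (rule integrableI_bounded_set_indicator[where B = C])
       (use le emeasure_lborel_cball_finite in \<open>auto\<close>)
  also have "(\<lambda>x. indicator (cball 0 r) x *\<^sub>R f x) = f"
    using r z by (force simp: indicator_def)
  finally show ?thesis .
qed

lemma C1_compactE:
  fixes \<phi> :: "'a::euclidean_space \<Rightarrow> 'b::euclidean_space"
  assumes "\<phi> \<in> C1_compact U"
  obtains \<phi>' B where "\<And>x. (\<phi> has_derivative blinfun_apply (\<phi>' x)) (at x)" "continuous_on UNIV \<phi>'"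
    "\<And>x. norm (\<phi> x) \<le> B" "\<And>x. norm (\<phi>' x) \<le> B" "B-lipschitz_on UNIV \<phi>"
    "\<And>x. x \<notin> closure {x. \<phi> x \<noteq> 0} \<Longrightarrow> \<phi> x = 0" "\<And>x. x \<notin> closure {x. \<phi> x \<noteq> 0} \<Longrightarrow> \<phi>' x = 0"
    "compact (closure {x. \<phi> x \<noteq> 0})" "closure {x. \<phi> x \<noteq> 0} \<subseteq> U"
proof -
  define K where "K = closure {x. \<phi> x \<noteq> 0}"
  obtain \<phi>' where \<phi>': "\<And>x. (\<phi> has_derivative blinfun_apply (\<phi>' x)) (at x)" "continuous_on UNIV \<phi>'"
    and K: "compact K" "K \<subseteq> U"
    using assms unfolding C1_compact_def K_def by blast
  have z: "\<phi> x = 0" if "x \<notin> K" for x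
    using that closure_subset[of "{x. \<phi> x \<noteq> 0}"] unfolding K_def by blast
  have z': "\<phi>' x = 0" if "x \<notin> K" for x
  proof -
    have "open (- K)" using K(1) by (simp add: compact_imp_closed open_Compl)
    then have "((\<lambda>_. 0) has_derivative blinfun_apply (\<phi>' x)) (at x)"
      by (rule has_derivative_transform_within_open[OF \<phi>'(1)]) (use that z in auto)
    then have "blinfun_apply (\<phi>' x) = (\<lambda>_. 0)"
      using has_derivative_const has_derivative_unique by blast
    then show ?thesis by (intro blinfun_eqI) simp
  qed
  have c: "continuous_on UNIV \<phi>"
    using \<phi>'(1) by (meson continuous_at_imp_continuous_on has_derivative_continuous)
  have bd: "bounded (\<phi> ` K)" "bounded (\<phi>' ` K)"
    using K(1) c \<phi>'(2) by (meson compact_continuous_image compact_imp_bounded continuous_on_subset subset_UNIV)+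
  obtain B1 where B1: "B1 > 0" "\<And>x. x \<in> K \<Longrightarrow> norm (\<phi> x) \<le> B1"
    using bd(1) unfolding bounded_pos by blast
  obtain B2 where B2: "B2 > 0" "\<And>x. x \<in> K \<Longrightarrow> norm (\<phi>' x) \<le> B2"
    using bd(2) unfolding bounded_pos by blast
  note B = B1(1) B2(1) B1(2) B2(2)
  define B where "B = max B1 B2"
  have b1: "norm (\<phi> x) \<le> B" for x 
  proof (cases "x \<in> K")
    case True then show ?thesis using B(3)[of x] by (simp add: B_def)
  qed (use z B in \<open>simp add: B_def\<close>)
  have b2: "norm (\<phi>' x) \<le> B" for x 
  proof (cases "x \<in> K")
    case True then show ?thesis using B(4)[of x] by (simp add: B_def)
  qed (use z' B in \<open>simp add: B_def\<close>)
  have lip: "B-lipschitz_on UNIV \<phi>"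
  proof (rule bounded_derivative_imp_lipschitz)
    show "\<And>x. x \<in> UNIV \<Longrightarrow> (\<phi> has_derivative blinfun_apply (\<phi>' x)) (at x within UNIV)" using \<phi>' by simp
    show "\<And>x. x \<in> UNIV \<Longrightarrow> onorm (blinfun_apply (\<phi>' x)) \<le> B" using b2 by (simp add: norm_blinfun.rep_eq)
  qed (use B in \<open>auto simp: B_def\<close>)
  show thesis
    by (rule that[OF \<phi>' b1 b2 lip z[unfolded K_def] z'[unfolded K_def] K[unfolded K_def]])
qed

lemma partial_deriv_eqI:
  "((\<lambda>t. f (x + t *\<^sub>R b)) has_real_derivative D) (at 0) \<Longrightarrow> partial_deriv b f x = D"
  unfolding partial_deriv_def by (rule DERIV_imp_deriv)

lemma has_derivative_partial:
  fixes \<phi> :: "'a::euclidean_space \<Rightarrow> real"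
  assumes "(\<phi> has_derivative D) (at x)"
  shows "((\<lambda>t. \<phi> (x + t *\<^sub>R b)) has_real_derivative D b) (at 0)"
proof -
  interpret bounded_linear D using assms by (rule has_derivative_bounded_linear)
  have "((\<lambda>t::real. x + t *\<^sub>R b) has_derivative (\<lambda>t. t *\<^sub>R b)) (at 0)"
    by (auto intro!: derivative_eq_intros)
  from has_derivative_compose[OF this, of \<phi> D] assms
  have "((\<lambda>t. \<phi> (x + t *\<^sub>R b)) has_derivative (\<lambda>t. D (t *\<^sub>R b))) (at 0)" by simp
  then show ?thesis by (simp add: has_field_derivative_def scaleR mult_commute_abs)
qed

lemma C1_compact_partial:
  fixes \<phi> :: "'a::euclidean_space \<Rightarrow> real"
  assumes "\<phi> \<in> C1_compact U" and b: "norm b \<le> 1"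
  obtains B where "B \<ge> 0" "\<And>x. \<bar>\<phi> x\<bar> \<le> B" "\<And>x. \<bar>partial_deriv b \<phi> x\<bar> \<le> B" "B-lipschitz_on UNIV \<phi>"
    "\<And>x. ((\<lambda>t. \<phi> (x + t *\<^sub>R b)) has_real_derivative partial_deriv b \<phi> x) (at 0)"
    "continuous_on UNIV \<phi>" "continuous_on UNIV (partial_deriv b \<phi>)"
    "\<And>x. x \<notin> closure {x. \<phi> x \<noteq> 0} \<Longrightarrow> \<phi> x = 0" "\<And>x. x \<notin> closure {x. \<phi> x \<noteq> 0} \<Longrightarrow> partial_deriv b \<phi> x = 0"
    "compact (closure {x. \<phi> x \<noteq> 0})" "closure {x. \<phi> x \<noteq> 0} \<subseteq> U"
proof (rule C1_compactE[OF assms(1)])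
  fix \<phi>' B assume 1: "\<And>x. (\<phi> has_derivative blinfun_apply (\<phi>' x)) (at x)" "continuous_on UNIV \<phi>'"
    "\<And>x. norm (\<phi> x) \<le> B" "\<And>x. norm (\<phi>' x) \<le> B" "B-lipschitz_on UNIV \<phi>"
    "\<And>x. x \<notin> closure {x. \<phi> x \<noteq> 0} \<Longrightarrow> \<phi> x = 0" "\<And>x. x \<notin> closure {x. \<phi> x \<noteq> 0} \<Longrightarrow> \<phi>' x = 0"
    "compact (closure {x. \<phi> x \<noteq> 0})" "closure {x. \<phi> x \<noteq> 0} \<subseteq> U"
  have eq: "partial_deriv b \<phi> x = \<phi>' x b" for x
    by (rule partial_deriv_eqI[OF has_derivative_partial[OF 1(1)]])
  have B: "B \<ge> 0" using order_trans[OF norm_ge_zero 1(3)] .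
  have bd: "\<bar>partial_deriv b \<phi> x\<bar> \<le> B" for x
  proof -
    have "\<bar>\<phi>' x b\<bar> \<le> norm (\<phi>' x) * norm b" using norm_blinfun[of "\<phi>' x" b] by simp
    also have "\<dots> \<le> B * 1" using 1(4) b B by (intro mult_mono) auto
    finally show ?thesis by (simp add: eq)
  qed
  have der: "((\<lambda>t. \<phi> (x + t *\<^sub>R b)) has_real_derivative partial_deriv b \<phi> x) (at 0)" for x
    unfolding eq by (rule has_derivative_partial[OF 1(1)])
  have cont: "continuous_on UNIV (partial_deriv b \<phi>)"
    unfolding eq by (intro continuous_intros 1)
  have c: "continuous_on UNIV \<phi>" using 1(5) by (rule lipschitz_on_continuous_on)
  have z: "\<And>x. x \<notin> closure {x. \<phi> x \<noteq> 0} \<Longrightarrow> partial_deriv b \<phi> x = 0" by (simp add: eq 1(7))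
  have b0: "\<And>x. \<bar>\<phi> x\<bar> \<le> B" using 1(3) by simp
  show thesis by (rule that[OF B b0 bd 1(5) der c cont 1(6) z 1(8,9)])
qed

lemma component_in_C1_compact:
  fixes \<phi> :: "'a::euclidean_space \<Rightarrow> 'b::euclidean_space"
  assumes "\<phi> \<in> C1_compact U"
  shows "(\<lambda>x. \<phi> x \<bullet> c) \<in> C1_compact U"
proof -
  obtain \<phi>' where 1: "\<And>x. (\<phi> has_derivative blinfun_apply (\<phi>' x)) (at x)" "continuous_on UNIV \<phi>'"
    and K: "compact (closure {x. \<phi> x \<noteq> 0})" "closure {x. \<phi> x \<noteq> 0} \<subseteq> U"
    using assms unfolding C1_compact_def by blast
  have sub: "closure {x. \<phi> x \<bullet> c \<noteq> 0} \<subseteq> closure {x. \<phi> x \<noteq> 0}"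
    by (rule closure_mono) auto
  then have "compact (closure {x. \<phi> x \<bullet> c \<noteq> 0})"
    using K(1) by (metis closed_closure compact_Int_closed inf.absorb_iff2)
  moreover have "\<forall>x. ((\<lambda>x. \<phi> x \<bullet> c) has_derivative blinfun_apply (blinfun_inner_left c o\<^sub>L \<phi>' x)) (at x)"
    using 1(1) by (auto intro!: derivative_eq_intros simp: inner_commute)
  moreover have "continuous_on UNIV (\<lambda>x. blinfun_inner_left c o\<^sub>L \<phi>' x)"
    by (intro continuous_intros 1)
  ultimately show ?thesis unfolding C1_compact_def using sub K
    by (intro CollectI conjI exI[of _ "\<lambda>x. blinfun_inner_left c o\<^sub>L \<phi>' x"]) auto
qed

lemma integrable_C1_compact_mult:
  fixes u :: "'a::euclidean_space \<Rightarrow> real"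
  assumes u: "locally_integrable \<Omega> u" and f: "continuous_on UNIV f"
    and K: "compact K" "K \<subseteq> \<Omega>" "\<And>x. x \<notin> K \<Longrightarrow> f x = 0" and \<Omega>: "\<Omega> \<in> sets lebesgue"
  shows "integrable (lebesgue_on \<Omega>) (\<lambda>x. u x * f x)"
proof -
  have "set_integrable lebesgue K u" using u K(1,2) unfolding locally_integrable_def by blast
  then have ui: "integrable lebesgue (\<lambda>x. indicator K x *\<^sub>R u x)" by (simp add: set_integrable_def)
  have "bounded (f ` K)"
    by (intro compact_imp_bounded compact_continuous_image continuous_on_subset[OF f subset_UNIV] K)
  then obtain B where B0: "\<forall>y\<in>f ` K. norm y \<le> B" by (auto simp: bounded_iff)
  then have B: "\<And>x. x \<in> K \<Longrightarrow> norm (f x) \<le> B" by blast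
  have fm: "f \<in> borel_measurable lebesgue"
    by (rule measurable_completion) (simp add: borel_measurable_continuous_onI[OF f])
  have "integrable lebesgue (\<lambda>x. (indicator K x *\<^sub>R u x) * f x)"
  proof (rule Bochner_Integration.integrable_bound[OF integrable_mult_left[OF ui, of B]])
    show "(\<lambda>x. (indicator K x *\<^sub>R u x) * f x) \<in> borel_measurable lebesgue"
      using ui fm by (intro borel_measurable_times) auto
    have "norm (indicator K x *\<^sub>R u x * f x) \<le> norm (indicator K x *\<^sub>R u x * B)" for x
      using B[of x] by (auto simp: indicator_def abs_mult intro!: mult_left_mono)
    then show "AE x in lebesgue. norm (indicator K x *\<^sub>R u x * f x) \<le> norm (indicator K x *\<^sub>R u x * B)" by simp
  qed
  also have "(\<lambda>x. (indicator K x *\<^sub>R u x) * f x) = (\<lambda>x. indicator \<Omega> x *\<^sub>R (u x * f x))"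
  proof
    fix x show "(indicator K x *\<^sub>R u x) * f x = indicator \<Omega> x *\<^sub>R (u x * f x)"
      using K(2) K(3)[of x] by (cases "x \<in> K") (auto simp: indicator_def)
  qed
  finally show ?thesis using \<Omega> by (simp add: integrable_restrict_space)
qed

text \<open>The bridge between two settings: the definitions integrate over
  \<open>lebesgue_on \<Omega>\<close>, while translation and Fubini are applied to Borel functions
  on \<open>lborel\<close>. The Borel representative has to vanish off \<Omega>.\<close>

lemma lebesgue_on_integral_eq:
  fixes f :: "'a::euclidean_space \<Rightarrow> 'b::euclidean_space"
  assumes \<Omega>: "\<Omega> \<in> sets borel" and g[measurable]: "g \<in> borel_measurable borel"
    and eq: "AE x in lborel. x \<in> \<Omega> \<longrightarrow> f x = g x" and z: "\<And>x. x \<notin> \<Omega> \<Longrightarrow> g x = 0"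
  shows "(LINT x|lebesgue_on \<Omega>. f x) = (LINT x|lborel. g x)"
    and "f \<in> borel_measurable (lebesgue_on \<Omega>)"
    and "integrable (lebesgue_on \<Omega>) f \<longleftrightarrow> integrable lborel g"
proof -
  have gm: "g \<in> borel_measurable lebesgue" by (rule measurable_completion) simp
  have \<Omega>l: "\<Omega> \<inter> space lebesgue \<in> sets lebesgue" using \<Omega> by auto
  have ae: "AE x in lebesgue. g x = indicator \<Omega> x *\<^sub>R f x"
    using AE_completion[OF eq] by eventually_elim (use z in \<open>auto simp: indicator_def\<close>)
  have fm: "(\<lambda>x. indicator \<Omega> x *\<^sub>R f x) \<in> borel_measurable lebesgue"
    by (rule borel_measurable_AE[OF gm ae])
  show "f \<in> borel_measurable (lebesgue_on \<Omega>)"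
    using fm \<Omega>l by (simp add: borel_measurable_restrict_space_iff)
  have "(LINT x|lebesgue_on \<Omega>. f x) = (LINT x|lebesgue. indicator \<Omega> x *\<^sub>R f x)"
    by (rule integral_restrict_space[OF \<Omega>l])
  also have "\<dots> = (LINT x|lebesgue. g x)"
    by (rule integral_cong_AE[OF fm gm]) (use ae in \<open>auto elim: eventually_mono\<close>)
  also have "\<dots> = (LINT x|lborel. g x)" by (rule integral_completion) simp
  finally show "(LINT x|lebesgue_on \<Omega>. f x) = (LINT x|lborel. g x)" .
  have "integrable (lebesgue_on \<Omega>) f \<longleftrightarrow> integrable lebesgue (\<lambda>x. indicator \<Omega> x *\<^sub>R f x)"
    by (rule integrable_restrict_space[OF \<Omega>l])
  also have "\<dots> \<longleftrightarrow> integrable lebesgue g"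
    by (rule integrable_cong_AE[OF fm gm]) (use ae in \<open>auto elim: eventually_mono\<close>)
  also have "\<dots> \<longleftrightarrow> integrable lborel g" by (rule integrable_completion) simp
  finally show "integrable (lebesgue_on \<Omega>) f \<longleftrightarrow> integrable lborel g" .
qed

section \<open>Integration by parts for locally Lipschitz functions\<close>

lemma Lip_loc_continuous_on:
  assumes "u \<in> Lip_loc \<Omega>"
  shows "continuous_on \<Omega> u"
  using local_lipschitz_continuous_on[of "UNIV :: real set" \<Omega> "\<lambda>_. u" 0] assms
  by (simp add: Lip_loc_def)

lemma Lip_loc_compact_lipschitz:
  fixes u :: "'a::euclidean_space \<Rightarrow> real"
  assumes "u \<in> Lip_loc \<Omega>" "compact K" "K \<subseteq> \<Omega>"
  obtains L where "L-lipschitz_on K u"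
proof -
  have "local_lipschitz (UNIV::real set) K (\<lambda>_. u)"
    by (rule local_lipschitz_subset[OF _ subset_UNIV assms(3)]) (use assms(1) in \<open>simp add: Lip_loc_def\<close>)
  then obtain L where "\<And>t::real. t \<in> {0} \<Longrightarrow> L-lipschitz_on K u"
    by (rule local_lipschitz_compact_implies_lipschitz[where T = "{0}", OF local_lipschitz_subset[OF _ subset_UNIV order_refl] assms(2)]) auto
  then show thesis using that by blast
qed

lemma difference_quotient_sequence:
  fixes u :: "'a::euclidean_space \<Rightarrow> real"
  assumes \<Omega>: "open \<Omega>" "x \<in> \<Omega>" and D: "((\<lambda>t. u (x + t *\<^sub>R b)) has_real_derivative D) (at 0)"
    and k: "k \<longlonglongrightarrow> 0" "\<And>i. k i \<noteq> (0::real)"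
  shows "(\<lambda>i. (indicator \<Omega> (x + k i *\<^sub>R b) *\<^sub>R u (x + k i *\<^sub>R b) - indicator \<Omega> x *\<^sub>R u x) / k i) \<longlonglongrightarrow> D"
proof -
  have "((\<lambda>h. (u (x + h *\<^sub>R b) - u x) / h) \<longlongrightarrow> D) (at 0)" using D by (simp add: DERIV_def)
  moreover have "filterlim k (at 0) sequentially" using k by (simp add: filterlim_at)
  ultimately have "(\<lambda>i. (u (x + k i *\<^sub>R b) - u x) / k i) \<longlonglongrightarrow> D"
    by (rule filterlim_compose)
  moreover have "\<forall>\<^sub>F i in sequentially. x + k i *\<^sub>R b \<in> \<Omega>"
  proof -
    have "(\<lambda>i. x + k i *\<^sub>R b) \<longlonglongrightarrow> x + 0 *\<^sub>R b" by (intro tendsto_intros k)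
    then show ?thesis using \<Omega> by (auto dest: topological_tendstoD)
  qed
  then have "\<forall>\<^sub>F i in sequentially. (u (x + k i *\<^sub>R b) - u x) / k i =
     (indicator \<Omega> (x + k i *\<^sub>R b) *\<^sub>R u (x + k i *\<^sub>R b) - indicator \<Omega> x *\<^sub>R u x) / k i"
    by eventually_elim (use \<Omega> in auto)
  ultimately show ?thesis by (rule Lim_transform_eventually)
qed

text \<open>Where no derivative exists, \<open>partial_deriv\<close> has an unspecified value, so
  its measurability is not immediate. The limit of difference quotients of the extension of
  \<open>u\<close> by zero is Borel and agrees with it almost everywhere on \<Omega>; near a point
  of the open set \<Omega> the extension is \<open>u\<close> itself.\<close>

lemma Lip_loc_partial_borel_version:
  fixes u :: "'a::euclidean_space \<Rightarrow> real"
  assumes \<Omega>: "open \<Omega>" and u: "u \<in> Lip_loc \<Omega>"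
  obtains g where "g \<in> borel_measurable borel" "\<And>x. x \<notin> \<Omega> \<Longrightarrow> g x = 0"
    "AE x in lborel. x \<in> \<Omega> \<longrightarrow> partial_deriv b u x = g x \<and> ((\<lambda>t. u (x + t *\<^sub>R b)) has_real_derivative g x) (at 0)"
proof -
  define v where "v x = indicator \<Omega> x *\<^sub>R u x" for x
  have [measurable]: "v \<in> borel_measurable borel"
    unfolding v_def[abs_def]
    by (rule borel_measurable_continuous_on_indicator) (use \<Omega> Lip_loc_continuous_on[OF u] in auto)
  have [measurable]: "\<Omega> \<in> sets borel" using \<Omega> by simp
  define g where "g x = indicator \<Omega> x *\<^sub>R lim (\<lambda>i. (v (x + (1 / real (Suc i)) *\<^sub>R b) - v x) / (1 / real (Suc i)))" for x
  show thesis
  proof (rule that[of g])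
    show "g \<in> borel_measurable borel"
      unfolding g_def[abs_def] by (intro borel_measurable_scaleR borel_measurable_lim_metric) measurable
    show "g x = 0" if "x \<notin> \<Omega>" for x using that by (simp add: g_def)
    show "AE x in lborel. x \<in> \<Omega> \<longrightarrow> partial_deriv b u x = g x \<and> ((\<lambda>t. u (x + t *\<^sub>R b)) has_real_derivative g x) (at 0)"
      using Lip_loc_partial_AE[OF \<Omega> u, of b]
    proof eventually_elim
      case (elim x)
      show ?case
      proof
        assume x: "x \<in> \<Omega>"
        with elim obtain D where D: "((\<lambda>t. u (x + t *\<^sub>R b)) has_real_derivative D) (at 0)" by blast
        have "(\<lambda>i. (v (x + (1 / real (Suc i)) *\<^sub>R b) - v x) / (1 / real (Suc i))) \<longlonglongrightarrow> D"
          unfolding v_def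
          by (rule difference_quotient_sequence[OF \<Omega> x D]) (use LIMSEQ_inverse_real_of_nat in \<open>auto simp: inverse_eq_divide\<close>)
        then have "g x = D" using x unfolding g_def by (simp add: limI)
        then show "partial_deriv b u x = g x \<and> ((\<lambda>t. u (x + t *\<^sub>R b)) has_real_derivative g x) (at 0)"
          using D partial_deriv_eqI by blast
      qed
    qed
  qed
qed

lemma lborel_shift:
  fixes f :: "'a::euclidean_space \<Rightarrow> 'b::{banach,second_countable_topology}"
  assumes [measurable]: "f \<in> borel_measurable borel"
  shows "(LINT x|lborel. f (x + c)) = (LINT x|lborel. f x)"
    and "integrable lborel (\<lambda>x. f (x + c)) \<longleftrightarrow> integrable lborel f"
proof -
  have "(LINT x|distr lborel borel ((+) c). f x) = (LINT x|lborel. f (c + x))"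
    by (rule integral_distr) measurable
  then show "(LINT x|lborel. f (x + c)) = (LINT x|lborel. f x)"
    by (simp add: lborel_distr_plus add.commute)
  have "integrable (distr lborel borel ((+) c)) f \<longleftrightarrow> integrable lborel (\<lambda>x. f (c + x))"
    by (rule integrable_distr_eq) measurable
  then show "integrable lborel (\<lambda>x. f (x + c)) \<longleftrightarrow> integrable lborel f"
    by (simp add: lborel_distr_plus add.commute)
qed

text \<open>Translation invariance moves a difference quotient from \<phi> to \<open>u\<close>, with
  the opposite increment. Both sides then converge by dominated convergence, since \<phi> is
  Lipschitz and \<open>u\<close> is Lipschitz near the support of \<phi>.\<close>

lemma Lip_loc_integration_by_parts:
  fixes u :: "'a::euclidean_space \<Rightarrow> real"
  assumes \<Omega>: "open \<Omega>" and u: "u \<in> Lip_loc \<Omega>" and \<phi>: "\<phi> \<in> C1_compact \<Omega>" and b: "norm b \<le> 1"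
  shows "(LINT x|lebesgue_on \<Omega>. u x * partial_deriv b \<phi> x) = - (LINT x|lebesgue_on \<Omega>. partial_deriv b u x * \<phi> x)"
proof (rule C1_compact_partial[OF \<phi> b])
  fix B
  define K where "K = closure {x. \<phi> x \<noteq> 0}"
  assume B: "B \<ge> 0" "\<And>x. \<bar>\<phi> x\<bar> \<le> B" "\<And>x. \<bar>partial_deriv b \<phi> x\<bar> \<le> B" and lip: "B-lipschitz_on UNIV \<phi>"
    and der: "\<And>x. ((\<lambda>t. \<phi> (x + t *\<^sub>R b)) has_real_derivative partial_deriv b \<phi> x) (at 0)"
    and cont: "continuous_on UNIV \<phi>" "continuous_on UNIV (partial_deriv b \<phi>)"
    and z: "\<And>x. x \<notin> closure {x. \<phi> x \<noteq> 0} \<Longrightarrow> \<phi> x = 0" "\<And>x. x \<notin> closure {x. \<phi> x \<noteq> 0} \<Longrightarrow> partial_deriv b \<phi> x = 0"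
    and K: "compact (closure {x. \<phi> x \<noteq> 0})" "closure {x. \<phi> x \<noteq> 0} \<subseteq> \<Omega>"
  note z = z[folded K_def] and K = K[folded K_def]
  have [measurable]: "\<phi> \<in> borel_measurable borel" "partial_deriv b \<phi> \<in> borel_measurable borel"
    using cont by (auto intro: borel_measurable_continuous_onI)
  have \<Omega>b: "\<Omega> \<in> sets borel" using \<Omega> by simp
  obtain e where e: "e > 0" "(\<Union>x\<in>K. cball x e) \<subseteq> \<Omega>"
    using compact_subset_open_imp_cball_epsilon_subset[OF K(1) \<Omega> K(2)] by blast
  define Ke where "Ke = (\<Union>x\<in>K. cball x e)"
  \<comment> \<open>Sum of two compact sets, hence compact. Every translate of the support by at
    most e stays in \<open>Ke\<close>, where \<open>u\<close> has a single Lipschitz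
    constant.\<close>
  have "Ke = {x + y |x y. x \<in> K \<and> y \<in> cball 0 e}"
    by (force simp: Ke_def dist_norm norm_minus_commute intro: exI[of _ "_ - _"])
  then have Kec: "compact Ke" using compact_sums[OF K(1) compact_cball[of 0 e]] by (simp only:)
  have KeO: "Ke \<subseteq> \<Omega>" using e by (simp add: Ke_def)
  obtain L where L: "L-lipschitz_on Ke u"
    by (rule Lip_loc_compact_lipschitz[OF u Kec]) (use e in \<open>auto simp: Ke_def\<close>)
  have L0: "L \<ge> 0" using lipschitz_on_nonneg[OF L] .
  define v where "v x = indicator \<Omega> x *\<^sub>R u x" for x
  have vm[measurable]: "v \<in> borel_measurable borel"
    unfolding v_def[abs_def]
    by (rule borel_measurable_continuous_on_indicator) (use \<Omega> Lip_loc_continuous_on[OF u] in auto)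
  have "bounded (u ` Ke)"
    by (intro compact_imp_bounded compact_continuous_image lipschitz_on_continuous_on[OF L] Kec)
  then obtain C where C: "\<forall>y\<in>u ` Ke. norm y \<le> C" by (auto simp: bounded_iff)
  have vC: "\<bar>v x\<bar> \<le> \<bar>C\<bar>" if "x \<in> Ke" for x using C that by (force simp: v_def indicator_def)
  have vu: "v x = u x" if "x \<in> Ke" for x using that KeO by (auto simp: v_def)
  obtain g where g[measurable]: "g \<in> borel_measurable borel" and gz: "\<And>x. x \<notin> \<Omega> \<Longrightarrow> g x = 0"
    and gd: "AE x in lborel. x \<in> \<Omega> \<longrightarrow> partial_deriv b u x = g x \<and> ((\<lambda>t. u (x + t *\<^sub>R b)) has_real_derivative g x) (at 0)"
    using Lip_loc_partial_borel_version[OF \<Omega> u] by blast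
  define k where "k i = e / real (Suc i)" for i
  have k: "k \<longlonglongrightarrow> 0" "\<And>i. k i > 0" "\<And>i. k i \<le> e"
    using e(1) LIMSEQ_Suc[OF lim_const_over_n[of e]] by (auto simp: k_def[abs_def] field_simps)
  have near: "x \<in> Ke" if "y \<in> K" "norm (x - y) \<le> k i" for x y i
    using that k(3)[of i] by (auto simp: Ke_def dist_norm norm_minus_commute intro!: bexI[of _ y])
  have kb: "norm (k i *\<^sub>R b) \<le> k i" for i
    using b k(2)[of i] by (simp add: mult_left_le)
  have KKe: "x \<in> Ke" if "x \<in> K" for x using near[of x x 0] that k(2)[of 0] by auto
  have bK: "bounded Ke" using Kec by (rule compact_imp_bounded)
  have i1: "integrable lborel (\<lambda>x. v x * \<phi> (x + c))" if c: "norm c \<le> k i" for c i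
  proof (rule integrable_lborel_bounded_on[OF _ bK, where C = "\<bar>C\<bar> * B"])
    show z1: "v x * \<phi> (x + c) = 0" if "x \<notin> Ke" for x
      using near[of "x + c" x i] z(1)[of "x + c"] c that by (auto simp: norm_minus_commute)
    show "norm (v x * \<phi> (x + c)) \<le> \<bar>C\<bar> * B" for x
    proof (cases "x \<in> Ke")
      case True then show ?thesis using vC B by (simp add: abs_mult mult_mono)
    next
      case False
      from z1[OF this] show ?thesis using B(1) by (simp only: norm_zero) simp
    qed
  qed measurable
  have i2: "integrable lborel (\<lambda>x. v (x + c) * \<phi> x)" if c: "norm c \<le> k i" for c i
  proof -
    have "integrable lborel (\<lambda>x. v x * \<phi> (x + (- c)))" by (rule i1[of "-c" i]) (use c in simp)
    then have "integrable lborel (\<lambda>x. v (x + c) * \<phi> (x + c + (- c)))"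
      by (subst lborel_shift(2)[of "\<lambda>x. v x * \<phi> (x + (- c))" c]) measurable
    then show ?thesis by simp
  qed
  have sh: "(LINT x|lborel. v x * \<phi> (x + c)) = (LINT x|lborel. v (x + (- c)) * \<phi> x)" for c
    using lborel_shift(1)[of "\<lambda>x. v x * \<phi> (x + c)" "-c"] by simp
  define A where "A i = (LINT x|lborel. v x * ((\<phi> (x + k i *\<^sub>R b) - \<phi> x) / k i))" for i
  define w where "w i = (\<lambda>x. \<phi> x * ((v (x + (- k i) *\<^sub>R b) - v x) / (- k i)))" for i
  have A2: "A i = - (LINT x|lborel. w i x)" for i
  proof -
    have "A i = (LINT x|lborel. (v x * \<phi> (x + k i *\<^sub>R b) - v x * \<phi> (x + 0)) / k i)"
      by (simp add: A_def algebra_simps)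
    also have "\<dots> = ((LINT x|lborel. v x * \<phi> (x + k i *\<^sub>R b)) - (LINT x|lborel. v x * \<phi> (x + 0))) / k i"
      by (subst integral_divide_zero, subst Bochner_Integration.integral_diff)
         (use i1[OF kb] i1[of 0 0] k(2)[of 0] in auto)
    also have "\<dots> = ((LINT x|lborel. v (x + (- k i) *\<^sub>R b) * \<phi> x) - (LINT x|lborel. v (x + 0) * \<phi> x)) / k i"
      using sh[of "k i *\<^sub>R b"] sh[of 0] by simp
    also have "\<dots> = (LINT x|lborel. (v (x + (- k i) *\<^sub>R b) * \<phi> x - v (x + 0) * \<phi> x) / k i)"
      by (subst integral_divide_zero, subst Bochner_Integration.integral_diff)
         (use i2[of "(- k i) *\<^sub>R b" i] kb[of i] i2[of 0 0] k(2)[of 0] in auto)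
    also have "\<dots> = (LINT x|lborel. - w i x)"
      by (simp add: w_def algebra_simps divide_simps)
    finally show ?thesis by simp
  qed
  have lim1: "A \<longlonglongrightarrow> (LINT x|lborel. v x * partial_deriv b \<phi> x)"
    unfolding A_def[abs_def]
  proof (rule integral_dominated_convergence[where w = "\<lambda>x. indicator Ke x * (\<bar>C\<bar> * B)"])
    show "integrable lborel (\<lambda>x. indicator Ke x * (\<bar>C\<bar> * B))"
      using Kec emeasure_compact_finite[OF Kec] by (intro integrable_mult_left) (auto simp: compact_imp_closed)
    have "(\<lambda>i. (\<phi> (x + k i *\<^sub>R b) - \<phi> x) / k i) \<longlonglongrightarrow> partial_deriv b \<phi> x" for x
      using difference_quotient_sequence[OF open_UNIV UNIV_I der k(1)] k(2) by (simp add: less_imp_neq[symmetric] order_less_imp_not_eq2)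
    then show "AE x in lborel. (\<lambda>i. v x * ((\<phi> (x + k i *\<^sub>R b) - \<phi> x) / k i)) \<longlonglongrightarrow> v x * partial_deriv b \<phi> x"
      by (intro always_eventually allI tendsto_intros)
    have "norm (v x * ((\<phi> (x + k i *\<^sub>R b) - \<phi> x) / k i)) \<le> indicator Ke x * (\<bar>C\<bar> * B)" for i x
    proof (cases "x \<in> Ke")
      case True
      have "\<bar>\<phi> (x + k i *\<^sub>R b) - \<phi> x\<bar> \<le> B * norm (k i *\<^sub>R b)"
        using lipschitz_onD[OF lip, of "x + k i *\<^sub>R b" x] by (simp add: dist_real_def dist_norm)
      also have "\<dots> \<le> B * k i" using kb B by (intro mult_left_mono) auto
      finally have "\<bar>(\<phi> (x + k i *\<^sub>R b) - \<phi> x) / k i\<bar> \<le> B"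
        using k(2)[of i] by (simp add: abs_divide pos_divide_le_eq)
      then show ?thesis using True vC[OF True] by (simp add: abs_mult mult_mono del: times_divide_eq_right)
    next
      case False
      then have "\<phi> x = 0" "\<phi> (x + k i *\<^sub>R b) = 0"
        using z(1) KKe near[of "x + k i *\<^sub>R b" x i] kb[of i] by (auto simp: norm_minus_commute)
      then show ?thesis using B(1) by simp
    qed
    then show "\<And>i. AE x in lborel. norm (v x * ((\<phi> (x + k i *\<^sub>R b) - \<phi> x) / k i)) \<le> indicator Ke x * (\<bar>C\<bar> * B)"
      by simp
  qed measurable
  have lim2: "(\<lambda>i. LINT x|lborel. w i x) \<longlonglongrightarrow> (LINT x|lborel. g x * \<phi> x)"
  proof (rule integral_dominated_convergence[where w = "\<lambda>x. indicator Ke x * (B * L)"])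
    show "integrable lborel (\<lambda>x. indicator Ke x * (B * L))"
      using Kec emeasure_compact_finite[OF Kec] by (intro integrable_mult_left) (auto simp: compact_imp_closed)
    show "AE x in lborel. (\<lambda>i. w i x) \<longlonglongrightarrow> g x * \<phi> x"
      using gd
    proof eventually_elim
      case (elim x)
      show ?case
      proof (cases "x \<in> \<Omega>")
        case True
        then have D: "((\<lambda>t. u (x + t *\<^sub>R b)) has_real_derivative g x) (at 0)" using elim by blast
        have "(\<lambda>i. (v (x + (- k i) *\<^sub>R b) - v x) / (- k i)) \<longlonglongrightarrow> g x"
          unfolding v_def
          by (rule difference_quotient_sequence[OF \<Omega> True D])
             (use k(1,2) tendsto_minus[OF k(1)] in \<open>auto simp: less_imp_neq[symmetric] order_less_imp_not_eq2\<close>)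
        then show ?thesis unfolding w_def by (subst mult.commute) (intro tendsto_intros)
      next
        case False
        then have "\<phi> x = 0" using z K by blast
        then show ?thesis by (simp add: w_def)
      qed
    qed
    have "norm (w i x) \<le> indicator Ke x * (B * L)" for i x
    proof (cases "x \<in> K")
      case True
      have m: "x + (- k i) *\<^sub>R b \<in> Ke" using near[of x "x + (- k i) *\<^sub>R b" i] True kb[of i] by simp
      have "\<bar>v (x + (- k i) *\<^sub>R b) - v x\<bar> \<le> L * norm (k i *\<^sub>R b)"
        unfolding vu[OF m] vu[OF KKe[OF True]]
        using lipschitz_onD[OF L m KKe[OF True]] by (simp add: dist_real_def dist_norm)
      also have "\<dots> \<le> L * k i" using kb L0 by (intro mult_left_mono) auto
      finally have "\<bar>(v (x + (- k i) *\<^sub>R b) - v x) / (- k i)\<bar> \<le> L"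
        using k(2)[of i] by (simp add: abs_divide pos_divide_le_eq)
      then show ?thesis using KKe[OF True] B L0 by (simp add: w_def abs_mult mult_mono del: times_divide_eq_right)
    qed (use z B L0 in \<open>simp add: w_def\<close>)
    then show "\<And>i. AE x in lborel. norm (w i x) \<le> indicator Ke x * (B * L)" by simp
  qed (auto simp: w_def)
  have "(LINT x|lborel. v x * partial_deriv b \<phi> x) = - (LINT x|lborel. g x * \<phi> x)"
  proof (rule LIMSEQ_unique[OF lim1])
    have "A = (\<lambda>i. - (LINT x|lborel. w i x))" using A2 by blast
    then show "A \<longlonglongrightarrow> - (LINT x|lborel. g x * \<phi> x)" using tendsto_minus[OF lim2] by simp
  qed
  moreover have "(LINT x|lebesgue_on \<Omega>. u x * partial_deriv b \<phi> x) = (LINT x|lborel. v x * partial_deriv b \<phi> x)"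
    by (rule lebesgue_on_integral_eq(1)[OF \<Omega>b]) (measurable, auto simp: v_def)
  moreover have "(LINT x|lebesgue_on \<Omega>. partial_deriv b u x * \<phi> x) = (LINT x|lborel. g x * \<phi> x)"
    by (rule lebesgue_on_integral_eq(1)[OF \<Omega>b]) (measurable, use gd gz in \<open>auto elim: eventually_mono\<close>)
  ultimately show ?thesis by simp
qed

lemma grad_borel_measurable:
  fixes u :: "'a::euclidean_space \<Rightarrow> real"
  assumes "open \<Omega>" "u \<in> Lip_loc \<Omega>"
  shows "grad u \<in> borel_measurable (lebesgue_on \<Omega>)"
proof -
  have "partial_deriv b u \<in> borel_measurable (lebesgue_on \<Omega>)" for b
  proof -
    obtain g where g: "g \<in> borel_measurable borel" "\<And>x. x \<notin> \<Omega> \<Longrightarrow> g x = 0"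
      "AE x in lborel. x \<in> \<Omega> \<longrightarrow> partial_deriv b u x = g x \<and> ((\<lambda>t. u (x + t *\<^sub>R b)) has_real_derivative g x) (at 0)"
      using Lip_loc_partial_borel_version[OF assms] by blast
    show ?thesis
      by (rule lebesgue_on_integral_eq(2)[OF _ g(1) _ g(2)]) (use g(3) assms(1) in \<open>auto elim: eventually_mono\<close>)
  qed
  then show ?thesis unfolding grad_def[abs_def] by measurable
qed

subsection \<open>Mollification at a variable scale\<close>

lemma L1_lipschitz_dense:
  fixes f :: "'a::euclidean_space \<Rightarrow> real"
  assumes "integrable lborel f" "\<eta> > 0"
  shows "\<exists>g L. L-lipschitz_on UNIV g \<and> integrable lborel g \<and> (LINT x|lborel. \<bar>f x - g x\<bar>) < \<eta>"
  using assms
proof (induction f arbitrary: \<eta> rule: integrable_induct)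
  case (base A c)
  show ?case
  proof -
    have A: "A \<in> sets borel" "emeasure lborel A < \<infinity>" using base by auto
    \<comment> \<open>The error \<bar>c\<bar> \<epsilon> is paid twice, once for replacing
      \<open>A\<close> by \<open>U\<close> and once for the cutoff, so it has to be below \<eta> /
      2.\<close>
    define \<epsilon> where "\<epsilon> = \<eta> / (2 * (\<bar>c\<bar> + 1))"
    have \<epsilon>: "\<epsilon> > 0" "\<bar>c\<bar> * \<epsilon> < \<eta> / 2" using base by (auto simp: \<epsilon>_def field_simps add_pos_nonneg)
    have "A \<in> sets lebesgue" using A by simp
    then obtain U where U: "open U" "A \<subseteq> U" "(U - A) \<in> lmeasurable" "emeasure lebesgue (U - A) < ennreal \<epsilon>"
      by (rule sets_lebesgue_outer_open[OF _ \<epsilon>(1)])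
    have UA: "emeasure lborel (U - A) < ennreal \<epsilon>" using U A by (simp add: emeasure_completion)
    have "emeasure lborel U \<le> emeasure lborel A + emeasure lborel (U - A)"
      using emeasure_subadditive[of A lborel "U - A"] U(1,2) A by (auto simp: Un_absorb1)
    also have "\<dots> < \<infinity>" using A(2) order.strict_trans[OF UA ennreal_less_top] by simp
    finally have Uf: "emeasure lborel U < \<infinity>" .
    \<comment> \<open>The distance to an empty set is 0 by convention, which would make the cutoff
      vanish.\<close>
    have Une: "- U \<noteq> {}"
    proof
      assume "- U = {}" then have "U = UNIV" by auto
      with Uf show False by (simp add: emeasure_lborel_UNIV)
    qed
    \<comment> \<open>Lipschitz cutoffs that increase pointwise to the indicator of the open set
      \<open>U\<close>.\<close>
    define g where "g k x = min 1 (real k * infdist x (- U))" for k x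
    have glip: "(real k)-lipschitz_on UNIV (g k)" for k
    proof (rule lipschitz_onI)
      fix x y :: 'a
      have "\<bar>infdist x (-U) - infdist y (-U)\<bar> \<le> dist x y" by (rule infdist_triangle_abs)
      then have "\<bar>real k * infdist x (-U) - real k * infdist y (-U)\<bar> \<le> real k * dist x y"
        by (metis abs_mult abs_of_nat mult_left_mono of_nat_0_le_iff right_diff_distrib)
      then show "dist (g k x) (g k y) \<le> real k * dist x y"
        by (simp add: g_def dist_real_def min_def abs_if split: if_splits)
    qed simp
    have gm[measurable]: "g k \<in> borel_measurable borel" for k
      by (intro borel_measurable_continuous_onI lipschitz_on_continuous_on[OF glip])
    have [measurable]: "U \<in> sets borel" "A \<in> sets borel" using U A by auto
    have gU: "\<bar>g k x\<bar> \<le> indicator U x" for k x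
      by (cases "x \<in> U") (auto simp: g_def infdist_nonneg)
    have iU: "integrable lborel (indicator U :: 'a \<Rightarrow> real)"
      using Uf by (simp add: integrable_indicator_iff)
    have ig: "integrable lborel (g k)" for k
      by (rule Bochner_Integration.integrable_bound[OF iU]) (use gU in auto)
    have "(\<lambda>k. LINT x|lborel. \<bar>indicator U x - g k x\<bar>) \<longlonglongrightarrow> (LINT x::'a|lborel. (0::real))"
    proof (rule integral_dominated_convergence[where w = "\<lambda>x. 2 * indicator U x"])
      show "integrable lborel (\<lambda>x::'a. 2 * indicator U x :: real)" using iU by simp
      have "(\<lambda>k. \<bar>indicator U x - g k x\<bar>) \<longlonglongrightarrow> 0" for x
      proof (cases "x \<in> U")
        case True
        have "infdist x (-U) > 0"
          using True U(1) Une by (intro infdist_pos_not_in_closed) auto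
        then obtain N where N: "real N * infdist x (-U) > 1" using reals_Archimedean3 by blast
        have "\<forall>\<^sub>F k in sequentially. 0 = \<bar>indicator U x - g k x\<bar>"
          using eventually_ge_at_top[of N]
        proof eventually_elim
          case (elim k)
          have "real N * infdist x (-U) \<le> real k * infdist x (-U)"
            using elim by (intro mult_right_mono) (auto simp: infdist_nonneg)
          then show ?case using N True by (simp add: g_def)
        qed
        then show ?thesis by (rule Lim_transform_eventually[OF tendsto_const])
      next
        case False
        then have "g k x = 0" for k using gU[of k x] by simp
        then show ?thesis using False by simp
      qed
      then show "AE x in lborel. (\<lambda>k. \<bar>indicator U x - g k x\<bar>) \<longlonglongrightarrow> 0" by simp
      have "norm \<bar>indicator U x - g k x\<bar> \<le> 2 * indicator U x" for k x
        using gU[of k x] by (auto simp: indicator_def split: if_splits)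
      then show "\<And>k. AE x in lborel. norm \<bar>indicator U x - g k x\<bar> \<le> 2 * indicator U x" by simp
    qed measurable
    then have "(\<lambda>k. LINT x|lborel. \<bar>indicator U x - g k x\<bar>) \<longlonglongrightarrow> 0" by simp
    then have "\<forall>\<^sub>F k in sequentially. (LINT x|lborel. \<bar>indicator U x - g k x\<bar>) < \<epsilon>"
      using \<epsilon>(1) by (rule order_tendstoD(2))
    then obtain k where k: "(LINT x|lborel. \<bar>indicator U x - g k x\<bar>) < \<epsilon>"
      using eventually_happens by force
    have iA: "integrable lborel (indicator A :: 'a \<Rightarrow> real)"
      using A by (simp add: integrable_indicator_iff)
    have fUA: "emeasure lborel (U - A) < \<infinity>" using order.strict_trans[OF UA ennreal_less_top] by simp
    have mUA: "measure lborel (U - A) < \<epsilon>"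
      using UA fUA \<epsilon>(1) by (simp add: emeasure_eq_ennreal_measure ennreal_less_iff)
    have "(LINT x|lborel. \<bar>indicator A x *\<^sub>R c - c * g k x\<bar>)
        \<le> (LINT x|lborel. \<bar>c\<bar> * indicator (U - A) x + \<bar>c\<bar> * \<bar>indicator U x - g k x\<bar>)"
    proof (rule integral_mono)
      show "integrable lborel (\<lambda>x. \<bar>indicator A x *\<^sub>R c - c * g k x\<bar>)" using iA ig by simp
      show "integrable lborel (\<lambda>x. \<bar>c\<bar> * indicator (U - A) x + \<bar>c\<bar> * \<bar>indicator U x - g k x\<bar>)"
        using fUA iU ig by (intro Bochner_Integration.integrable_add integrable_mult_right integrable_abs
            Bochner_Integration.integrable_diff) (simp_all add: integrable_indicator_iff)
      fix x
      have "\<bar>indicator A x - g k x\<bar> \<le> indicator (U - A) x + \<bar>indicator U x - g k x\<bar>"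
        using U(2) by (auto simp: indicator_def)
      then have "\<bar>c\<bar> * \<bar>indicator A x - g k x\<bar> \<le> \<bar>c\<bar> * (indicator (U - A) x + \<bar>indicator U x - g k x\<bar>)"
        by (rule mult_left_mono) simp
      then show "\<bar>indicator A x *\<^sub>R c - c * g k x\<bar> \<le> \<bar>c\<bar> * indicator (U - A) x + \<bar>c\<bar> * \<bar>indicator U x - g k x\<bar>"
        by (simp add: abs_mult[symmetric] algebra_simps)
    qed
    also have "\<dots> = \<bar>c\<bar> * measure lborel (U - A) + \<bar>c\<bar> * (LINT x|lborel. \<bar>indicator U x - g k x\<bar>)"
      using fUA iU ig by (subst Bochner_Integration.integral_add)
        (auto simp: integrable_indicator_iff intro!: integrable_mult_right)
    also have "\<dots> \<le> \<bar>c\<bar> * \<epsilon> + \<bar>c\<bar> * \<epsilon>"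
      using k mUA by (intro add_mono mult_left_mono) auto
    also have "\<dots> < \<eta>" using \<epsilon> by linarith
    finally have lt: "(LINT x|lborel. \<bar>indicator A x *\<^sub>R c - c * g k x\<bar>) < \<eta>" .
    have "(\<bar>c\<bar> * real k)-lipschitz_on UNIV (\<lambda>x. c * g k x)"
      using lipschitz_on_cmult[OF glip] by (simp add: lipschitz_on_cmult_real)
    with lt ig show ?thesis
      by (intro exI[of _ "\<lambda>x. c * g k x"] exI[of _ "\<bar>c\<bar> * real k"]) auto
  qed
next
  case (add f1 f2)
  obtain g1 L1 where 1: "L1-lipschitz_on UNIV g1" "integrable lborel g1" "(LINT x|lborel. \<bar>f1 x - g1 x\<bar>) < \<eta>/2"
    using add.IH(1)[of "\<eta>/2"] add.prems by auto
  obtain g2 L2 where 2: "L2-lipschitz_on UNIV g2" "integrable lborel g2" "(LINT x|lborel. \<bar>f2 x - g2 x\<bar>) < \<eta>/2"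
    using add.IH(2)[of "\<eta>/2"] add.prems by auto
  have "(LINT x|lborel. \<bar>f1 x + f2 x - (g1 x + g2 x)\<bar>) \<le> (LINT x|lborel. \<bar>f1 x - g1 x\<bar> + \<bar>f2 x - g2 x\<bar>)"
  proof (rule integral_mono)
    show "\<bar>f1 x + f2 x - (g1 x + g2 x)\<bar> \<le> \<bar>f1 x - g1 x\<bar> + \<bar>f2 x - g2 x\<bar>" for x by linarith
  qed (use add.hyps 1(2) 2(2) in auto)
  also have "\<dots> = (LINT x|lborel. \<bar>f1 x - g1 x\<bar>) + (LINT x|lborel. \<bar>f2 x - g2 x\<bar>)"
    using add.hyps 1(2) 2(2) by (intro Bochner_Integration.integral_add) auto
  also have "\<dots> < \<eta>" using 1(3) 2(3) by simp
  finally have "(LINT x|lborel. \<bar>f1 x + f2 x - (g1 x + g2 x)\<bar>) < \<eta>" .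
  then show ?case
    using lipschitz_on_add[OF 1(1) 2(1)] 1(2) 2(2)
    by (intro exI[of _ "\<lambda>x. g1 x + g2 x"] exI[of _ "L1 + L2"]) auto
next
  case (lim f s)
  have "(\<lambda>i. LINT x|lborel. \<bar>f x - s i x\<bar>) \<longlonglongrightarrow> (LINT x::'a|lborel. (0::real))"
  \<comment> \<open>The approximants of the induction satisfy \<bar>s i x\<bar> \<le> 2 \<bar>f
    x\<bar>, hence the factor 3.\<close>
  proof (rule integral_dominated_convergence[where w = "\<lambda>x. 3 * \<bar>f x\<bar>"])
    show "AE x in lborel. (\<lambda>i. \<bar>f x - s i x\<bar>) \<longlonglongrightarrow> 0"
    proof (intro always_eventually allI)
      fix x have "(\<lambda>i. \<bar>f x - s i x\<bar>) \<longlonglongrightarrow> \<bar>f x - f x\<bar>"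
        using lim.hyps(2)[of x] by (intro tendsto_intros) simp
      then show "(\<lambda>i. \<bar>f x - s i x\<bar>) \<longlonglongrightarrow> 0" by simp
    qed
    have "norm \<bar>f x - s i x\<bar> \<le> 3 * \<bar>f x\<bar>" for i x using lim.hyps(3)[of x i] by simp
    then show "\<And>i. AE x in lborel. norm \<bar>f x - s i x\<bar> \<le> 3 * \<bar>f x\<bar>" by simp
  qed (use lim.hyps in auto)
  then have "(\<lambda>i. LINT x|lborel. \<bar>f x - s i x\<bar>) \<longlonglongrightarrow> 0" by simp
  then have "\<forall>\<^sub>F i in sequentially. (LINT x|lborel. \<bar>f x - s i x\<bar>) < \<eta>/2"
    using lim.prems by (intro order_tendstoD(2)[of _ 0]) auto
  then obtain i where i: "(LINT x|lborel. \<bar>f x - s i x\<bar>) < \<eta>/2" using eventually_happens by force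
  obtain g L where g: "L-lipschitz_on UNIV g" "integrable lborel g" "(LINT x|lborel. \<bar>s i x - g x\<bar>) < \<eta>/2"
    using lim.IH[of "\<eta>/2" i] lim.prems by auto
  have "(LINT x|lborel. \<bar>f x - g x\<bar>) \<le> (LINT x|lborel. \<bar>f x - s i x\<bar> + \<bar>s i x - g x\<bar>)"
    using lim.hyps g(2) by (intro integral_mono) auto
  also have "\<dots> = (LINT x|lborel. \<bar>f x - s i x\<bar>) + (LINT x|lborel. \<bar>s i x - g x\<bar>)"
    using lim.hyps g(2) by (intro Bochner_Integration.integral_add) auto
  also have "\<dots> < \<eta>" using i g(3) by simp
  finally show ?case using g by blast
qed

section \<open>The kernel and its derivatives in scale and position\<close>

definition bump :: "real \<Rightarrow> real" where "bump s = (max 0 (1 - s))\<^sup>2"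
definition bump' :: "real \<Rightarrow> real" where "bump' s = - 2 * max 0 (1 - s)"

lemma bump_zero: "s \<ge> 1 \<Longrightarrow> bump s = 0" "s \<ge> 1 \<Longrightarrow> bump' s = 0"
  by (auto simp: bump_def bump'_def)

lemma bump_bounds: "0 \<le> bump s" "s \<ge> 0 \<Longrightarrow> bump s \<le> 1" "s \<ge> 0 \<Longrightarrow> \<bar>bump' s\<bar> \<le> 2"
  by (auto simp: bump_def bump'_def max_def power_le_one)

text \<open>Squaring the positive part makes the profile continuously differentiable across s = 1,
  which is all that test functions of class C1 require. Inserting the squared norm avoids a
  singularity at the centre.\<close>

lemma bump_deriv: "(bump has_real_derivative bump' s) (at s)"
proof -
  consider "s < 1" | "s > 1" | "s = 1" by linarith
  then show ?thesis
  proof cases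
    case 1
    have "((\<lambda>s. (1 - s)\<^sup>2) has_real_derivative bump' s) (at s)"
      using 1 by (auto intro!: derivative_eq_intros simp: bump'_def)
    then show ?thesis
      by (rule has_field_derivative_transform_within_open[where S = "{..<1}"]) (use 1 in \<open>auto simp: bump_def\<close>)
  next
    case 2
    have "((\<lambda>s. 0) has_real_derivative bump' s) (at s)" using 2 by (simp add: bump'_def)
    then show ?thesis
      by (rule has_field_derivative_transform_within_open[where S = "{1<..}"]) (use 2 in \<open>auto simp: bump_def\<close>)
  next
    case 3
    have "((\<lambda>h. (bump (1 + h) - bump 1) / h) \<longlongrightarrow> 0) (at 0)"
    proof (rule Lim_null_comparison)
      have "norm ((bump (1 + h) - bump 1) / h) \<le> \<bar>h\<bar>" for h
        by (cases "h = 0") (auto simp: bump_def max_def power2_eq_square abs_mult)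
      then show "\<forall>\<^sub>F h in at 0. norm ((bump (1 + h) - bump 1) / h) \<le> \<bar>h\<bar>" by simp
      show "((\<lambda>h::real. \<bar>h\<bar>) \<longlongrightarrow> 0) (at 0)" by (rule tendsto_eq_intros) (auto intro!: tendsto_eq_intros)
    qed
    then show ?thesis using 3 by (simp add: DERIV_def bump'_def)
  qed
qed

lemma continuous_on_bump [continuous_intros]:
  "continuous_on S f \<Longrightarrow> continuous_on S (\<lambda>x. bump (f x))"
  "continuous_on S f \<Longrightarrow> continuous_on S (\<lambda>x. bump' (f x))"
  unfolding bump_def bump'_def by (auto intro!: continuous_intros)

lemma borel_measurable_bump [measurable]: "bump \<in> borel_measurable borel" "bump' \<in> borel_measurable borel"
  by (auto intro!: borel_measurable_continuous_onI continuous_intros)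

definition bump_mass :: "'a::euclidean_space itself \<Rightarrow> real" where
  "bump_mass _ = (LINT z::'a|lborel. bump ((norm z)\<^sup>2))"

lemma integrable_bump: "integrable lborel (\<lambda>z::'a::euclidean_space. bump ((norm z)\<^sup>2))"
proof (rule integrable_lborel_bounded_on[where K = "cball 0 1" and C = 1])
  show "bump ((norm x)\<^sup>2) = 0" if "x \<notin> cball 0 1" for x :: 'a
    using that by (intro bump_zero) (simp add: power_le_one_iff)
qed (auto simp: bump_bounds)

lemma bump_mass_pos: "bump_mass TYPE('a::euclidean_space) > 0"
proof -
  \<comment> \<open>On the ball of radius 1/2 one has 1 - \<bar>z\<bar>^2 \<ge> 3/4, so the bump is
    at least (3/4)^2 = 9/16 there.\<close>
  have "0 < (9/16) * measure lborel (cball (0::'a) (1/2))"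
    by (simp add: content_cball_pos)
  also have "\<dots> = (LINT z::'a|lborel. indicator (cball 0 (1/2)) z * (9/16))" by simp
  also have "\<dots> \<le> bump_mass TYPE('a)"
    unfolding bump_mass_def
  proof (rule integral_mono[OF _ integrable_bump])
    show "integrable lborel (\<lambda>z::'a. indicator (cball 0 (1/2)) z * (9/16) :: real)"
      using emeasure_lborel_cball_finite[of "0::'a" "1/2"]
      by (intro integrable_mult_left) (simp add: integrable_indicator_iff)
    fix z :: 'a
    show "indicator (cball 0 (1/2)) z * (9/16) \<le> bump ((norm z)\<^sup>2)"
    proof (cases "norm z \<le> 1/2")
      case True
      then have "(norm z)\<^sup>2 \<le> (1/2)\<^sup>2" by (intro power_mono) auto
      then have "3/4 \<le> 1 - (norm z)\<^sup>2" by (simp add: power2_eq_square)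
      then have "(3/4)\<^sup>2 \<le> bump ((norm z)\<^sup>2)" unfolding bump_def by (intro power_mono) auto
      then show ?thesis using True by (simp add: power2_eq_square)
    qed (simp add: bump_bounds)
  qed
  finally show ?thesis .
qed

definition kern :: "real \<Rightarrow> 'a::euclidean_space \<Rightarrow> real" where
  "kern t z = bump ((norm z)\<^sup>2 / t\<^sup>2) / (bump_mass TYPE('a) * t ^ DIM('a))"

text \<open>The derivative of \<open>kern\<close> at (t, z) in the direction (s, h). Scale and
  position are differentiated jointly because the scale will depend on the centre.\<close>

definition kern_deriv :: "real \<Rightarrow> 'a::euclidean_space \<Rightarrow> real \<Rightarrow> 'a \<Rightarrow> real" where
  "kern_deriv t z s h = (bump' ((norm z)\<^sup>2 / t\<^sup>2) * (2 * (z \<bullet> h) / t\<^sup>2 - 2 * (norm z)\<^sup>2 * s / t ^ 3)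
      - real DIM('a) * s / t * bump ((norm z)\<^sup>2 / t\<^sup>2)) / (bump_mass TYPE('a) * t ^ DIM('a))"

lemma kern_measurable [measurable (raw)]:
  assumes [measurable]: "f \<in> borel_measurable M" "g \<in> borel_measurable M"
  shows "(\<lambda>x. kern (f x) (g x)) \<in> borel_measurable M"
  unfolding kern_def by measurable

lemma kern_deriv_measurable [measurable (raw)]:
  assumes [measurable]: "f \<in> borel_measurable M" "g \<in> borel_measurable M" "s \<in> borel_measurable M" "h \<in> borel_measurable M"
  shows "(\<lambda>x. kern_deriv (f x) (g x) (s x) (h x)) \<in> borel_measurable M"
  unfolding kern_deriv_def by measurable

lemma kern_nonneg: "t \<ge> 0 \<Longrightarrow> kern t z \<ge> 0"
  unfolding kern_def by (intro divide_nonneg_nonneg bump_bounds mult_nonneg_nonneg less_imp_le[OF bump_mass_pos]) auto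

lemma kern_outside:
  assumes "t > 0" "norm z \<ge> t" shows "kern t z = 0" "kern_deriv t z s h = 0"
proof -
  have "(norm z)\<^sup>2 / t\<^sup>2 \<ge> 1" using assms by (simp add: power_mono)
  then show "kern t z = 0" "kern_deriv t z s h = 0" by (simp_all add: kern_def kern_deriv_def bump_zero)
qed

lemma kern_le:
  fixes z :: "'a::euclidean_space"
  assumes "t > 0"
  shows "kern t z \<le> 1 / (bump_mass TYPE('a) * t ^ DIM('a))"
  unfolding kern_def using assms bump_mass_pos[where 'a='a]
  by (intro divide_right_mono bump_bounds) auto

text \<open>Only \<bar>z\<bar> < t matters. There \<open>bump'\<close> is at most 2 in absolute
  value and its inner derivative at most 2 (\<bar>h\<bar> + \<bar>s\<bar>) / t, which gives the 4;
  the dimension comes from differentiating the normalising power of t.\<close>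

lemma kern_deriv_le:
  fixes z :: "'a::euclidean_space"
  assumes t: "t > 0"
  shows "\<bar>kern_deriv t z s h\<bar> \<le> (4 + DIM('a)) * (norm h + \<bar>s\<bar>) / (bump_mass TYPE('a) * t ^ Suc DIM('a))"
proof (cases "norm z \<ge> t")
  case True
  show ?thesis unfolding kern_outside(2)[OF t True]
    using t bump_mass_pos[where 'a='a] by (auto intro!: divide_nonneg_nonneg mult_nonneg_nonneg)
next
  case False
  let ?r = "(norm z)\<^sup>2 / t\<^sup>2"
  have 1: "\<bar>2 * (z \<bullet> h) / t\<^sup>2\<bar> \<le> 2 * norm h / t"
  proof -
    have "\<bar>z \<bullet> h\<bar> \<le> t * norm h"
      using Cauchy_Schwarz_ineq2[of z h] False by (meson less_imp_le mult_right_mono norm_ge_zero not_le order_trans)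
    then have "2 * \<bar>z \<bullet> h\<bar> / t\<^sup>2 \<le> 2 * (t * norm h) / t\<^sup>2" using t by (intro divide_right_mono) auto
    then show ?thesis using t by (simp add: abs_mult power2_eq_square)
  qed
  have 2: "\<bar>2 * (norm z)\<^sup>2 * s / t ^ 3\<bar> \<le> 2 * \<bar>s\<bar> / t"
  proof -
    have "(norm z)\<^sup>2 \<le> t\<^sup>2" using False by (intro power_mono) auto
    then have "2 * (norm z)\<^sup>2 * \<bar>s\<bar> / t ^ 3 \<le> 2 * t\<^sup>2 * \<bar>s\<bar> / t ^ 3"
      using t by (intro divide_right_mono mult_right_mono) auto
    then show ?thesis using t by (simp add: abs_mult power2_eq_square power3_eq_cube)
  qed
  have "\<bar>bump' ?r * (2 * (z \<bullet> h) / t\<^sup>2 - 2 * (norm z)\<^sup>2 * s / t ^ 3)\<bar> \<le> 2 * (2 * norm h / t + 2 * \<bar>s\<bar> / t)"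
  proof -
    have "\<bar>2 * (z \<bullet> h) / t\<^sup>2 - 2 * (norm z)\<^sup>2 * s / t ^ 3\<bar> \<le> 2 * norm h / t + 2 * \<bar>s\<bar> / t"
      using 1 2 abs_triangle_ineq4[of "2 * (z \<bullet> h) / t\<^sup>2" "2 * (norm z)\<^sup>2 * s / t ^ 3"] by linarith
    then show ?thesis unfolding abs_mult by (intro mult_mono bump_bounds) auto
  qed
  moreover have "\<bar>real DIM('a) * s / t * bump ?r\<bar> \<le> real DIM('a) * \<bar>s\<bar> / t * 1"
    unfolding abs_mult using t bump_bounds(1,2)[of ?r] by (intro mult_mono) (auto simp: abs_mult)
  ultimately have "\<bar>bump' ?r * (2 * (z \<bullet> h) / t\<^sup>2 - 2 * (norm z)\<^sup>2 * s / t ^ 3) - real DIM('a) * s / t * bump ?r\<bar>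
      \<le> 2 * (2 * norm h / t + 2 * \<bar>s\<bar> / t) + real DIM('a) * \<bar>s\<bar> / t" by linarith
  also have "\<dots> = (4 * norm h + 4 * \<bar>s\<bar> + DIM('a) * \<bar>s\<bar>) / t" using t by (simp add: field_simps)
  also have "\<dots> \<le> (4 + DIM('a)) * (norm h + \<bar>s\<bar>) / t"
    using t by (intro divide_right_mono) (auto simp: algebra_simps)
  finally have "\<bar>bump' ?r * (2 * (z \<bullet> h) / t\<^sup>2 - 2 * (norm z)\<^sup>2 * s / t ^ 3) - real DIM('a) * s / t * bump ?r\<bar>
     / (bump_mass TYPE('a) * t ^ DIM('a)) \<le> (4 + DIM('a)) * (norm h + \<bar>s\<bar>) / t / (bump_mass TYPE('a) * t ^ DIM('a))"
    using t bump_mass_pos[where 'a='a] by (intro divide_right_mono) auto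
  then show ?thesis
    using t bump_mass_pos[where 'a='a] by (simp add: kern_deriv_def abs_divide abs_mult mult_ac)
qed

lemma kern_has_derivative:
  fixes z :: "'a::euclidean_space"
  assumes t: "t > 0"
  shows "((\<lambda>p. kern (fst p) (snd p)) has_derivative (\<lambda>p. kern_deriv t z (fst p) (snd p))) (at (t, z))"
proof -
  have nz: "norm z * norm z = z \<bullet> z" by (simp add: dot_square_norm power2_eq_square)
  have 1: "((\<lambda>p::real \<times> 'a. (snd p \<bullet> snd p) / (fst p)\<^sup>2) has_derivative
      (\<lambda>p. 2 * (z \<bullet> snd p) / t\<^sup>2 - 2 * (norm z)\<^sup>2 * fst p / t ^ 3)) (at (t, z))"
    using t nz by (auto intro!: derivative_eq_intros
      simp: fun_eq_iff power2_norm_eq_inner inner_commute field_simps power2_eq_square power3_eq_cube eval_nat_numeral)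
  have 2: "((\<lambda>p::real \<times> 'a. bump ((snd p \<bullet> snd p) / (fst p)\<^sup>2)) has_derivative
      (\<lambda>p. (2 * (z \<bullet> snd p) / t\<^sup>2 - 2 * (norm z)\<^sup>2 * fst p / t ^ 3) * bump' ((norm z)\<^sup>2 / t\<^sup>2))) (at (t, z))"
    using DERIV_compose_FDERIV[OF bump_deriv 1] by (simp add: power2_norm_eq_inner)
  have 3: "((\<lambda>p::real \<times> 'a. 1 / (bump_mass TYPE('a) * fst p ^ DIM('a))) has_derivative
      (\<lambda>p. - real DIM('a) * fst p / t / (bump_mass TYPE('a) * t ^ DIM('a)))) (at (t, z))"
  proof -
    have tn: "t * t ^ (DIM('a) - Suc 0) = t ^ DIM('a)"
      using power_Suc[of t "DIM('a) - Suc 0"] by simp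
    have d: "((\<lambda>r. 1 / (bump_mass TYPE('a) * r ^ DIM('a))) has_real_derivative
        - real DIM('a) / t / (bump_mass TYPE('a) * t ^ DIM('a))) (at (fst (t, z)))"
      using t bump_mass_pos[where 'a='a] tn by (auto intro!: derivative_eq_intros simp: field_simps)
    have "(fst has_derivative fst) (at (t, z))" by (auto intro!: derivative_eq_intros)
    from DERIV_compose_FDERIV[where g = fst, OF d this]
    show ?thesis by (simp add: mult_ac)
  qed
  have "((\<lambda>p::real \<times> 'a. bump ((snd p \<bullet> snd p) / (fst p)\<^sup>2) * (1 / (bump_mass TYPE('a) * fst p ^ DIM('a)))) has_derivative
     (\<lambda>p. kern_deriv t z (fst p) (snd p))) (at (t, z))"
    by (rule has_derivative_eq_rhs[OF has_derivative_mult[OF 2 3]])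
      (use t bump_mass_pos[where 'a='a] in \<open>simp add: fun_eq_iff kern_deriv_def power2_norm_eq_inner field_simps\<close>)
  then show ?thesis by (simp add: kern_def power2_norm_eq_inner)
qed

lemma kern_integral:
  fixes x :: "'a::euclidean_space"
  assumes t: "t > 0"
  shows "integrable lborel (\<lambda>y. kern t (y - x))" "(LINT y|lborel. kern t (y - x)) = 1"
proof -
  have m: "kern t \<in> borel_measurable (borel :: 'a measure)" by measurable
  have i0: "integrable lborel (kern t :: 'a \<Rightarrow> real)"
  proof (rule integrable_lborel_bounded_on[where K = "cball 0 t" and C = "1 / (bump_mass TYPE('a) * t ^ DIM('a))"])
    show "norm (kern t x) \<le> 1 / (bump_mass TYPE('a) * t ^ DIM('a))" for x :: 'a
      using kern_le[OF t, of x] kern_nonneg[of t x] t by simp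
    show "kern t x = 0" if "x \<notin> cball 0 t" for x :: 'a using that kern_outside[OF t, of x] by simp
  qed (use m in auto)
  have "(LINT y|lborel. kern t (y :: 'a)) = (LINT y|density (distr lborel borel (\<lambda>x. 0 + t *\<^sub>R x)) (\<lambda>_. \<bar>t\<bar>^DIM('a)). kern t (y :: 'a))"
    using lborel_affine[of t "0::'a"] t by simp
  also have "\<dots> = (LINT y|lborel. t ^ DIM('a) * kern t (t *\<^sub>R y :: 'a))"
    using t m by (subst integral_density) (auto simp: integral_distr)
  also have "(\<lambda>y::'a. t ^ DIM('a) * kern t (t *\<^sub>R y)) = (\<lambda>y. bump ((norm y)\<^sup>2) / bump_mass TYPE('a))"
    using t bump_mass_pos[where 'a='a] by (auto simp: kern_def fun_eq_iff power_mult_distrib)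
  also have "(LINT y|lborel. bump ((norm (y::'a))\<^sup>2) / bump_mass TYPE('a)) = 1"
    using bump_mass_pos[where 'a='a] by (simp add: bump_mass_def)
  finally have one: "(LINT y|lborel. kern t (y :: 'a)) = 1" .
  show "integrable lborel (\<lambda>y. kern t (y - x))" "(LINT y|lborel. kern t (y - x)) = 1"
    using lborel_shift[OF m, of "-x"] i0 one by simp_all
qed

text \<open>The mean value inequality on the convex set of scales at least \<open>t0\<close>. The
  factor 2 comes from \<bar>h\<bar> + \<bar>s\<bar> \<le> 2 \<bar>(s, h)\<bar>.\<close>

lemma kern_lipschitz:
  fixes z z' :: "'a::euclidean_space"
  assumes t0: "t0 > 0" "t \<ge> t0" "t' \<ge> t0"
  shows "\<bar>kern t z - kern t' z'\<bar> \<le> 2 * (4 + DIM('a)) / (bump_mass TYPE('a) * t0 ^ Suc DIM('a)) * norm ((t, z) - (t', z'))"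
proof -
  let ?S = "{t0..} \<times> (UNIV :: 'a set)"
  have "norm ((\<lambda>p. kern (fst p) (snd p)) (t, z) - (\<lambda>p. kern (fst p) (snd p)) (t', z'))
     \<le> 2 * (4 + DIM('a)) / (bump_mass TYPE('a) * t0 ^ Suc DIM('a)) * norm ((t, z) - (t', z'))"
  proof (rule differentiable_bound[where S = ?S])
    show "convex ?S" by (intro convex_Times) (auto simp: convex_real_interval)
    fix p assume p: "p \<in> ?S"
    then have tp: "fst p \<ge> t0" "fst p > 0" using t0 by auto
    show "((\<lambda>p. kern (fst p) (snd p)) has_derivative (\<lambda>q. kern_deriv (fst p) (snd p) (fst q) (snd q))) (at p within ?S)"
      using kern_has_derivative[OF tp(2), of "snd p"] by (simp add: has_derivative_at_withinI)
    show "onorm (\<lambda>q. kern_deriv (fst p) (snd p) (fst q) (snd q)) \<le> 2 * (4 + DIM('a)) / (bump_mass TYPE('a) * t0 ^ Suc DIM('a))"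
    proof (rule onorm_le)
      fix q :: "real \<times> 'a"
      have "\<bar>kern_deriv (fst p) (snd p) (fst q) (snd q)\<bar>
          \<le> (4 + DIM('a)) * (norm (snd q) + \<bar>fst q\<bar>) / (bump_mass TYPE('a) * fst p ^ Suc DIM('a))"
        by (rule kern_deriv_le) (use tp in auto)
      also have "\<dots> \<le> (4 + DIM('a)) * (norm q + norm q) / (bump_mass TYPE('a) * t0 ^ Suc DIM('a))"
        using tp t0 bump_mass_pos[where 'a='a] norm_snd_le[of "snd q" "fst q"] norm_fst_le[of "fst q" "snd q"]
        by (intro frac_le mult_left_mono add_mono power_mono) auto
      finally show "norm (kern_deriv (fst p) (snd p) (fst q) (snd q))
         \<le> 2 * (4 + DIM('a)) / (bump_mass TYPE('a) * t0 ^ Suc DIM('a)) * norm q"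
        by (simp add: algebra_simps)
    qed
  qed (use t0 in auto)
  then show ?thesis by simp
qed

section \<open>The mollification operator for a scale that depends on the point\<close>

definition mollify :: "('a::euclidean_space \<Rightarrow> real) \<Rightarrow> ('a \<Rightarrow> real) \<Rightarrow> 'a \<Rightarrow> real" where
  "mollify \<delta> f x = (LINT y|lborel. kern (\<delta> x) (y - x) * f y)"

text \<open>Bounds the kernel integrated over its centre, where the mass need not be 1: the height
  is at most (3/2)^n / (\<open>bump_mass\<close> times \<delta>(y)^n) on a ball of radius 2
  \<delta>(y), and (3/2)^n 2^n = 3^n.\<close>

definition kern_mass :: "'a::euclidean_space itself \<Rightarrow> real" where
  "kern_mass _ = 3 ^ DIM('a) * unit_ball_vol DIM('a) / bump_mass TYPE('a)"

lemma kern_mass_nonneg: "kern_mass TYPE('a::euclidean_space) \<ge> 0"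
  using bump_mass_pos[where 'a='a] by (simp add: kern_mass_def)

lemma integrable_kern_mult:
  fixes f :: "'a::euclidean_space \<Rightarrow> real"
  assumes f: "integrable lborel f" and t: "t > 0"
  shows "integrable lborel (\<lambda>y. kern t (y - x) * f y)"
proof (rule Bochner_Integration.integrable_bound[OF integrable_mult_right[OF f, of "1 / (bump_mass TYPE('a) * t ^ DIM('a))"]])
  have "norm (kern t (y - x) * f y) \<le> norm (1 / (bump_mass TYPE('a) * t ^ DIM('a)) * f y)" for y
  proof -
    have "\<bar>kern t (y - x)\<bar> * \<bar>f y\<bar> \<le> 1 / (bump_mass TYPE('a) * t ^ DIM('a)) * \<bar>f y\<bar>"
      using kern_le[OF t, of "y - x"] kern_nonneg[of t "y - x"] t by (intro mult_right_mono) auto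
    also have "\<dots> \<le> \<bar>1 / (bump_mass TYPE('a) * t ^ DIM('a))\<bar> * \<bar>f y\<bar>" by (intro mult_right_mono abs_ge_self) auto
    finally show ?thesis by (simp add: abs_mult del: times_divide_eq_left times_divide_eq_right)
  qed
  then show "AE y in lborel. norm (kern t (y - x) * f y) \<le> norm (1 / (bump_mass TYPE('a) * t ^ DIM('a)) * f y)" by simp
qed (use f in measurable)

text \<open>A Lipschitz constant below 1 keeps scales comparable within one kernel radius: if
  \<bar>y - x\<bar> < \<delta>(x), then \<delta>(y) lies between \<delta>(x)/2 and 3
  \<delta>(x)/2.\<close>

locale variable_scale =
  fixes \<Omega> :: "'a::euclidean_space set" and \<delta> :: "'a \<Rightarrow> real"
  assumes open_\<Omega>: "open \<Omega>" and bounded_\<Omega>: "bounded \<Omega>"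
    and \<delta>_lip: "(1/2)-lipschitz_on UNIV \<delta>"
    and \<delta>_pos: "x \<in> \<Omega> \<Longrightarrow> 0 < \<delta> x"
begin

lemma \<delta>_dist: "\<bar>\<delta> x - \<delta> y\<bar> \<le> norm (x - y) / 2"
  using lipschitz_onD[OF \<delta>_lip, of x y] by (simp add: dist_real_def dist_norm)

lemma \<delta>_le: "\<delta> x \<le> \<delta> y + norm (x - y) / 2"
  using \<delta>_dist[of x y] abs_ge_self[of "\<delta> x - \<delta> y"] by linarith

lemma \<delta>_borel [measurable]: "\<delta> \<in> borel_measurable borel"
  by (intro borel_measurable_continuous_onI lipschitz_on_continuous_on[OF \<delta>_lip])

lemma \<Omega>_borel [measurable]: "\<Omega> \<in> sets borel"
  using open_\<Omega> by simp

lemma mollify_borel: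
  assumes [measurable]: "f \<in> borel_measurable borel"
  shows "mollify \<delta> f \<in> borel_measurable borel"
  unfolding mollify_def[abs_def] by measurable

lemma kern_mass_le:
  "(\<integral>\<^sup>+x. ennreal (kern (\<delta> x) (y - x)) * indicator \<Omega> x \<partial>lborel) \<le> ennreal (kern_mass TYPE('a))"
proof (cases "\<delta> y > 0")
  case True
  have I: "bump_mass TYPE('a) > 0" by (rule bump_mass_pos)
  have "(\<integral>\<^sup>+x. ennreal (kern (\<delta> x) (y - x)) * indicator \<Omega> x \<partial>lborel)
      \<le> (\<integral>\<^sup>+x. ennreal ((3/2) ^ DIM('a) / (bump_mass TYPE('a) * \<delta> y ^ DIM('a))) * indicator (cball y (2 * \<delta> y)) x \<partial>lborel)"
  proof (rule nn_integral_mono)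
    fix x
    show "ennreal (kern (\<delta> x) (y - x)) * indicator \<Omega> x
      \<le> ennreal ((3/2) ^ DIM('a) / (bump_mass TYPE('a) * \<delta> y ^ DIM('a))) * indicator (cball y (2 * \<delta> y)) x"
    proof (cases "x \<in> \<Omega> \<and> norm (y - x) < \<delta> x")
      case True
      then have x: "x \<in> \<Omega>" "norm (y - x) < \<delta> x" by auto
      have p: "\<delta> x > 0" using \<delta>_pos x by simp
      have d: "\<delta> x \<le> \<delta> y + norm (y - x) / 2" "\<delta> y \<le> \<delta> x + norm (y - x) / 2"
        using \<delta>_le[of x y] \<delta>_le[of y x] by (simp_all add: norm_minus_commute)
      \<comment> \<open>From \<bar>y - x\<bar> < \<delta>(x) \<le> \<delta>(y) + \<bar>y -
        x\<bar>/2; so the centres whose kernels reach y lie in a ball of radius 2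
        \<delta>(y).\<close>
      have "norm (y - x) \<le> 2 * \<delta> y" using d x by linarith
      then have "x \<in> cball y (2 * \<delta> y)" by (simp add: dist_norm)
      moreover have "kern (\<delta> x) (y - x) \<le> (3/2) ^ DIM('a) / (bump_mass TYPE('a) * \<delta> y ^ DIM('a))"
      proof -
        have "\<delta> y \<le> 3/2 * \<delta> x" using d x by linarith
        then have "\<delta> y ^ DIM('a) \<le> (3/2 * \<delta> x) ^ DIM('a)" using \<open>\<delta> y > 0\<close> by (intro power_mono) auto
        then have "\<delta> y ^ DIM('a) \<le> (3/2) ^ DIM('a) * \<delta> x ^ DIM('a)" by (simp only: power_mult_distrib)
        then have "1 / (bump_mass TYPE('a) * \<delta> x ^ DIM('a)) \<le> (3/2) ^ DIM('a) / (bump_mass TYPE('a) * \<delta> y ^ DIM('a))"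
          using I p \<open>\<delta> y > 0\<close> by (simp add: divide_simps mult.commute)
        with kern_le[OF p, of "y - x"] show ?thesis by linarith
      qed
      ultimately show ?thesis using x by (simp add: ennreal_leI)
    next
      case False
      then show ?thesis using kern_outside(1)[OF \<delta>_pos, of x "y - x"] by (cases "x \<in> \<Omega>") auto
    qed
  qed
  also have "\<dots> = ennreal ((3/2) ^ DIM('a) / (bump_mass TYPE('a) * \<delta> y ^ DIM('a))) * ennreal (unit_ball_vol DIM('a) * (2 * \<delta> y) ^ DIM('a))"
    using True by (simp add: nn_integral_cmult_indicator emeasure_cball)
  also have "\<dots> = ennreal ((3/2) ^ DIM('a) / (bump_mass TYPE('a) * \<delta> y ^ DIM('a)) * (unit_ball_vol DIM('a) * (2 * \<delta> y) ^ DIM('a)))"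
    using True I by (intro ennreal_mult[symmetric] divide_nonneg_nonneg) auto
  also have "(3/2) ^ DIM('a) / (bump_mass TYPE('a) * \<delta> y ^ DIM('a)) * (unit_ball_vol DIM('a) * (2 * \<delta> y) ^ DIM('a)) = kern_mass TYPE('a)"
    using True I by (simp add: kern_mass_def power_mult_distrib power_divide field_simps)
  finally show ?thesis .
next
  case False
  \<comment> \<open>If \<delta>(y) \<le> 0, the Lipschitz bound gives \<delta>(x) \<le> \<bar>y -
    x\<bar> for every centre x, so no kernel reaches y.\<close>
  have z: "ennreal (kern (\<delta> x) (y - x)) * indicator \<Omega> x = 0" for x
  proof (cases "x \<in> \<Omega>")
    case True
    have "\<delta> x \<le> norm (y - x)"
      using \<delta>_le[of x y] False norm_ge_zero[of "x - y"] norm_minus_commute[of x y] by linarith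
    then show ?thesis using kern_outside(1)[OF \<delta>_pos[OF True], of "y - x"] by simp
  qed simp
  show ?thesis unfolding z by simp
qed

text \<open>The substitute for Young's convolution inequality: after Fubini the kernel is integrated
  over its centre, where \<open>kern_mass_le\<close> applies.\<close>

lemma mollify_L1:
  assumes f: "integrable lborel f"
  shows "(\<integral>\<^sup>+x. ennreal \<bar>mollify \<delta> f x\<bar> * indicator \<Omega> x \<partial>lborel)
    \<le> ennreal (kern_mass TYPE('a)) * ennreal (LINT x|lborel. \<bar>f x\<bar>)"
proof -
  have [measurable]: "f \<in> borel_measurable borel" using f by auto
  have "(\<integral>\<^sup>+x. ennreal \<bar>mollify \<delta> f x\<bar> * indicator \<Omega> x \<partial>lborel)
     \<le> (\<integral>\<^sup>+x. (\<integral>\<^sup>+y. ennreal (kern (\<delta> x) (y - x)) * indicator \<Omega> x * ennreal \<bar>f y\<bar> \<partial>lborel) \<partial>lborel)"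
  proof (rule nn_integral_mono)
    fix x
    show "ennreal \<bar>mollify \<delta> f x\<bar> * indicator \<Omega> x
      \<le> (\<integral>\<^sup>+y. ennreal (kern (\<delta> x) (y - x)) * indicator \<Omega> x * ennreal \<bar>f y\<bar> \<partial>lborel)"
    proof (cases "x \<in> \<Omega>")
      case True
      have "ennreal \<bar>mollify \<delta> f x\<bar> \<le> (\<integral>\<^sup>+y. ennreal (norm (kern (\<delta> x) (y - x) * f y)) \<partial>lborel)"
        using integral_norm_bound_ennreal[OF integrable_kern_mult[OF f \<delta>_pos[OF True], of x]]
        by (simp add: mollify_def)
      also have "\<dots> = (\<integral>\<^sup>+y. ennreal (kern (\<delta> x) (y - x)) * ennreal \<bar>f y\<bar> \<partial>lborel)"
        unfolding real_norm_def abs_mult abs_of_nonneg[OF kern_nonneg[OF less_imp_le[OF \<delta>_pos[OF True]]]]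
        by (intro nn_integral_cong ennreal_mult kern_nonneg less_imp_le[OF \<delta>_pos[OF True]] abs_ge_zero)
      finally show ?thesis using True by simp
    qed simp
  qed
  also have "\<dots> = (\<integral>\<^sup>+y. (\<integral>\<^sup>+x. ennreal (kern (\<delta> x) (y - x)) * indicator \<Omega> x * ennreal \<bar>f y\<bar> \<partial>lborel) \<partial>lborel)"
    by (rule lborel_pair.Fubini') measurable
  also have "\<dots> \<le> (\<integral>\<^sup>+y. ennreal (kern_mass TYPE('a)) * ennreal \<bar>f y\<bar> \<partial>lborel)"
  proof (rule nn_integral_mono)
    fix y
    show "(\<integral>\<^sup>+x. ennreal (kern (\<delta> x) (y - x)) * indicator \<Omega> x * ennreal \<bar>f y\<bar> \<partial>lborel) \<le> ennreal (kern_mass TYPE('a)) * ennreal \<bar>f y\<bar>"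
      by (subst nn_integral_multc) (auto intro!: mult_right_mono kern_mass_le)
  qed
  also have "\<dots> = ennreal (kern_mass TYPE('a)) * (\<integral>\<^sup>+y. ennreal \<bar>f y\<bar> \<partial>lborel)"
    by (rule nn_integral_cmult) measurable
  also have "(\<integral>\<^sup>+y. ennreal \<bar>f y\<bar> \<partial>lborel) = ennreal (LINT x|lborel. \<bar>f x\<bar>)"
    using f by (intro nn_integral_eq_integral) auto
  finally show ?thesis .
qed

lemma mollify_lipschitz_close:
  assumes g: "L-lipschitz_on UNIV g" "integrable lborel g" and x: "x \<in> \<Omega>"
  shows "\<bar>mollify \<delta> g x - g x\<bar> \<le> L * \<delta> x"
proof -
  note p = \<delta>_pos[OF x]
  note k = kern_integral[OF p, of x]
  have "mollify \<delta> g x - g x = (LINT y|lborel. kern (\<delta> x) (y - x) * g y) - (LINT y|lborel. kern (\<delta> x) (y - x) * g x)"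
    using k(2) by (simp add: mollify_def)
  also have "\<dots> = (LINT y|lborel. kern (\<delta> x) (y - x) * (g y - g x))"
    using integrable_kern_mult[OF g(2) p, of x] k(1)
    by (subst Bochner_Integration.integral_diff[symmetric]) (auto simp: algebra_simps)
  finally have "\<bar>mollify \<delta> g x - g x\<bar> \<le> (LINT y|lborel. \<bar>kern (\<delta> x) (y - x) * (g y - g x)\<bar>)"
    by (simp add: integral_abs_bound)
  also have "\<dots> \<le> (LINT y|lborel. kern (\<delta> x) (y - x) * (L * \<delta> x))"
  proof (rule integral_mono)
    have "integrable lborel (\<lambda>y. kern (\<delta> x) (y - x) * g y - kern (\<delta> x) (y - x) * g x)"
      using integrable_kern_mult[OF g(2) p, of x] k(1) by auto
    then show "integrable lborel (\<lambda>y. \<bar>kern (\<delta> x) (y - x) * (g y - g x)\<bar>)"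
      by (simp add: right_diff_distrib)
    show "integrable lborel (\<lambda>y. kern (\<delta> x) (y - x) * (L * \<delta> x))" using k(1) by auto
    fix y
    show "\<bar>kern (\<delta> x) (y - x) * (g y - g x)\<bar> \<le> kern (\<delta> x) (y - x) * (L * \<delta> x)"
    proof (cases "norm (y - x) < \<delta> x")
      case True
      have "\<bar>g y - g x\<bar> \<le> L * norm (y - x)"
        using lipschitz_onD[OF g(1), of y x] by (simp add: dist_real_def dist_norm)
      also have "\<dots> \<le> L * \<delta> x" using True lipschitz_on_nonneg[OF g(1)] by (intro mult_left_mono) auto
      finally show ?thesis using kern_nonneg[of "\<delta> x" "y - x"] p by (simp add: abs_mult mult_left_mono)
    next
      case False
      then show ?thesis using kern_outside(1)[OF p, of "y - x"] by simp
    qed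
  qed
  also have "\<dots> = L * \<delta> x" using k by simp
  finally show ?thesis .
qed

lemma kern_quotient_le:
  assumes t0: "t0 > 0" "\<delta> x \<ge> t0" "\<delta> x' \<ge> t0"
  shows "\<bar>kern (\<delta> x) (y - x) - kern (\<delta> x') (y - x')\<bar>
    \<le> 4 * (4 + DIM('a)) / (bump_mass TYPE('a) * t0 ^ Suc DIM('a)) * norm (x - x')"
proof -
  define B where "B = 2 * (4 + DIM('a)) / (bump_mass TYPE('a) * t0 ^ Suc DIM('a))"
  have B: "B \<ge> 0" unfolding B_def using t0 bump_mass_pos[where 'a='a]
    by (intro divide_nonneg_nonneg mult_nonneg_nonneg) auto
  have "\<bar>kern (\<delta> x) (y - x) - kern (\<delta> x') (y - x')\<bar> \<le> B * norm ((\<delta> x, y - x) - (\<delta> x', y - x'))"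
    unfolding B_def by (rule kern_lipschitz[OF t0])
  also have "\<dots> \<le> B * (2 * norm (x - x'))"
  proof (rule mult_left_mono[OF _ B])
    have "norm ((\<delta> x, y - x) - (\<delta> x', y - x')) \<le> \<bar>\<delta> x - \<delta> x'\<bar> + norm (x - x')"
    using norm_Pair_le[of "\<delta> x - \<delta> x'" "x' - x"] by (simp add: norm_minus_commute)
  also have "\<dots> \<le> 2 * norm (x - x')" using \<delta>_dist[of x x'] norm_ge_zero[of "x - x'"] by linarith
    finally show "norm ((\<delta> x, y - x) - (\<delta> x', y - x')) \<le> 2 * norm (x - x')" .
  qed
  finally have "\<bar>kern (\<delta> x) (y - x) - kern (\<delta> x') (y - x')\<bar> \<le> B * (2 * norm (x - x'))" .
  moreover have "2 * a / q * (2 * n) = 4 * a / q * n" for a q n :: real by simp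
  ultimately show ?thesis unfolding B_def by (simp only:)
qed

lemma mollify_Lip_loc:
  assumes f: "integrable lborel f"
  shows "mollify \<delta> f \<in> Lip_loc \<Omega>"
proof -
  have "\<exists>u>0. \<exists>L. \<forall>t\<in>cball (t::real) u \<inter> UNIV. L-lipschitz_on (cball x u \<inter> \<Omega>) (mollify \<delta> f)" if x: "x \<in> \<Omega>" for t x
  proof (intro exI conjI ballI)
    note p = \<delta>_pos[OF x]
    define B where "B = 4 * (4 + DIM('a)) / (bump_mass TYPE('a) * (\<delta> x / 2) ^ Suc DIM('a))"
    have B: "B \<ge> 0" unfolding B_def using p bump_mass_pos[where 'a='a]
      by (intro divide_nonneg_nonneg mult_nonneg_nonneg) auto
    show "0 < \<delta> x" by (rule p)
    show "(B * (LINT y|lborel. \<bar>f y\<bar>))-lipschitz_on (cball x (\<delta> x) \<inter> \<Omega>) (mollify \<delta> f)"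
    proof (rule lipschitz_onI)
      fix x1 x2 assume 1: "x1 \<in> cball x (\<delta> x) \<inter> \<Omega>" and 2: "x2 \<in> cball x (\<delta> x) \<inter> \<Omega>"
      \<comment> \<open>Within distance \<delta>(x) of x the scale loses at most half of
        \<delta>(x), so one Lipschitz bound of the kernel serves the whole neighbourhood.\<close>
      have d1: "\<delta> x1 \<ge> \<delta> x / 2" using 1 \<delta>_le[of x x1] by (simp add: dist_norm)
      have d2: "\<delta> x2 \<ge> \<delta> x / 2" using 2 \<delta>_le[of x x2] by (simp add: dist_norm)
      have "mollify \<delta> f x1 - mollify \<delta> f x2 = (LINT y|lborel. (kern (\<delta> x1) (y - x1) - kern (\<delta> x2) (y - x2)) * f y)"
        using integrable_kern_mult[OF f, of "\<delta> x1" x1] integrable_kern_mult[OF f, of "\<delta> x2" x2] d1 d2 p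
        by (simp add: mollify_def left_diff_distrib)
      also have "\<bar>\<dots>\<bar> \<le> (LINT y|lborel. \<bar>(kern (\<delta> x1) (y - x1) - kern (\<delta> x2) (y - x2)) * f y\<bar>)"
        by (rule integral_abs_bound)
      also have "\<dots> \<le> (LINT y|lborel. B * norm (x1 - x2) * \<bar>f y\<bar>)"
      proof (rule integral_mono)
        show "integrable lborel (\<lambda>y. \<bar>(kern (\<delta> x1) (y - x1) - kern (\<delta> x2) (y - x2)) * f y\<bar>)"
          using integrable_kern_mult[OF f, of "\<delta> x1" x1] integrable_kern_mult[OF f, of "\<delta> x2" x2] d1 d2 p
          by (simp add: left_diff_distrib)
        show "integrable lborel (\<lambda>y. B * norm (x1 - x2) * \<bar>f y\<bar>)" using f by auto
        show "\<bar>(kern (\<delta> x1) (y - x1) - kern (\<delta> x2) (y - x2)) * f y\<bar> \<le> B * norm (x1 - x2) * \<bar>f y\<bar>" for y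
          unfolding abs_mult B_def by (intro mult_right_mono kern_quotient_le) (use d1 d2 p in auto)
      qed
      finally show "dist (mollify \<delta> f x1) (mollify \<delta> f x2) \<le> B * (LINT y|lborel. \<bar>f y\<bar>) * dist x1 x2"
        by (simp add: dist_real_def dist_norm mult_ac)
    qed (use B in simp)
  qed
  then show ?thesis unfolding Lip_loc_def by (auto intro!: local_lipschitzI)
qed

text \<open>The chain rule under the integral sign: along \<open>b\<close> the scale changes at rate
  \<open>m\<close> and the argument y - x moves with velocity -b. Only differentiability of \<delta>
  at the given point and in the given direction enters, so this covers almost every point.\<close>

lemma mollify_has_partial:
  assumes f: "integrable lborel f" and x: "x \<in> \<Omega>" and b: "norm b = 1"
    and m: "((\<lambda>s. \<delta> (x + s *\<^sub>R b)) has_real_derivative m) (at 0)"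
  shows "((\<lambda>s. mollify \<delta> f (x + s *\<^sub>R b)) has_real_derivative
    (LINT y|lborel. kern_deriv (\<delta> x) (y - x) m (- b) * f y)) (at 0)"
  unfolding DERIV_def
proof (subst tendsto_at_iff_sequentially, intro allI impI)
  note p = \<delta>_pos[OF x]
  have [measurable]: "f \<in> borel_measurable borel" using f by auto
  fix h :: "nat \<Rightarrow> real" assume h: "\<forall>i. h i \<in> UNIV - {0}" "h \<longlonglongrightarrow> 0"
  define B where "B = 4 * (4 + DIM('a)) / (bump_mass TYPE('a) * (\<delta> x / 2) ^ Suc DIM('a))"
  have B: "B \<ge> 0" unfolding B_def using p bump_mass_pos[where 'a='a]
    by (intro divide_nonneg_nonneg mult_nonneg_nonneg) auto
  have "\<forall>\<^sub>F i in sequentially. \<bar>h i\<bar> < \<delta> x"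
    using tendsto_rabs[OF h(2)] p by (intro order_tendstoD(2)[of _ 0]) auto
  \<comment> \<open>Dropping the first N increments keeps the moving points within \<delta>(x) of x,
    where the scales stay above \<delta>(x)/2 and the quotients have the common bound B.\<close>
  then obtain N where N: "\<And>i. i \<ge> N \<Longrightarrow> \<bar>h i\<bar> < \<delta> x" by (auto simp: eventually_sequentially)
  define q where "q i y = (kern (\<delta> (x + h (i + N) *\<^sub>R b)) (y - (x + h (i + N) *\<^sub>R b)) - kern (\<delta> x) (y - x)) / h (i + N)" for i y
  have dx: "\<delta> (x + h (i + N) *\<^sub>R b) \<ge> \<delta> x / 2" for i
    using N[of "i + N"] \<delta>_le[of x "x + h (i + N) *\<^sub>R b"] b by simp
  have qi: "integrable lborel (\<lambda>y. q i y * f y)"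
    and qe: "(LINT y|lborel. q i y * f y) = (mollify \<delta> f (x + h (i + N) *\<^sub>R b) - mollify \<delta> f x) / h (i + N)" for i
  proof -
    have i: "integrable lborel (\<lambda>y. kern (\<delta> (x + h (i + N) *\<^sub>R b)) (y - (x + h (i + N) *\<^sub>R b)) * f y)"
      "integrable lborel (\<lambda>y. kern (\<delta> x) (y - x) * f y)"
      using dx[of i] p by (intro integrable_kern_mult f; linarith)+
    have e: "q i y * f y = (kern (\<delta> (x + h (i + N) *\<^sub>R b)) (y - (x + h (i + N) *\<^sub>R b)) * f y - kern (\<delta> x) (y - x) * f y) / h (i + N)" for y
      by (simp add: q_def left_diff_distrib)
    show "integrable lborel (\<lambda>y. q i y * f y)" unfolding e using i by auto
    show "(LINT y|lborel. q i y * f y) = (mollify \<delta> f (x + h (i + N) *\<^sub>R b) - mollify \<delta> f x) / h (i + N)"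
      unfolding e mollify_def using i by simp
  qed
  have qb: "\<bar>q i y\<bar> \<le> B" for i y
  proof -
    have "\<bar>kern (\<delta> (x + h (i + N) *\<^sub>R b)) (y - (x + h (i + N) *\<^sub>R b)) - kern (\<delta> x) (y - x)\<bar> \<le> B * norm (x + h (i + N) *\<^sub>R b - x)"
      unfolding B_def by (rule kern_quotient_le) (use dx[of i] p in auto)
    then show ?thesis using b h(1) by (simp add: q_def abs_divide divide_le_eq)
  qed
  have ql: "(\<lambda>i. q i y) \<longlonglongrightarrow> kern_deriv (\<delta> x) (y - x) m (- b)" for y
  proof -
    have d1: "((\<lambda>s. (\<delta> (x + s *\<^sub>R b), y - (x + s *\<^sub>R b))) has_derivative (\<lambda>s. (m * s, - (s *\<^sub>R b)))) (at 0)"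
      using m by (auto intro!: derivative_eq_intros simp: has_field_derivative_def)
    have d2: "((\<lambda>p. kern (fst p) (snd p)) has_derivative (\<lambda>p. kern_deriv (\<delta> x) (y - x) (fst p) (snd p)))
        (at (\<delta> (x + 0 *\<^sub>R b), y - (x + 0 *\<^sub>R b)))"
      using kern_has_derivative[OF p, of "y - x"] by simp
    from has_derivative_compose[OF d1 d2]
    have D: "((\<lambda>s. kern (\<delta> (x + s *\<^sub>R b)) (y - (x + s *\<^sub>R b))) has_derivative
        (\<lambda>s. kern_deriv (\<delta> x) (y - x) (m * s) (- (s *\<^sub>R b)))) (at 0)"
      by (simp only: fst_conv snd_conv)
    have lin: "kern_deriv (\<delta> x) (y - x) (m * s) (- (s *\<^sub>R b)) = kern_deriv (\<delta> x) (y - x) m (- b) * s" for s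
      by (simp add: kern_deriv_def algebra_simps diff_divide_distrib add_divide_distrib)
    have "((\<lambda>s. kern (\<delta> (x + s *\<^sub>R b)) (y - (x + s *\<^sub>R b))) has_real_derivative kern_deriv (\<delta> x) (y - x) m (- b)) (at 0)"
      using D unfolding lin has_field_derivative_def by simp
    then have "((\<lambda>s. (kern (\<delta> (x + s *\<^sub>R b)) (y - (x + s *\<^sub>R b)) - kern (\<delta> x) (y - x)) / s) \<longlongrightarrow> kern_deriv (\<delta> x) (y - x) m (- b)) (at 0)"
      by (simp add: DERIV_def)
    moreover have "filterlim (\<lambda>i. h (i + N)) (at 0) sequentially"
      using h LIMSEQ_ignore_initial_segment[OF h(2), of N] by (auto simp: filterlim_at)
    ultimately show ?thesis unfolding q_def by (rule filterlim_compose)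
  qed
  have "(\<lambda>i. LINT y|lborel. q i y * f y) \<longlonglongrightarrow> (LINT y|lborel. kern_deriv (\<delta> x) (y - x) m (- b) * f y)"
  proof (rule integral_dominated_convergence[where w = "\<lambda>y. B * \<bar>f y\<bar>"])
    show "AE y in lborel. (\<lambda>i. q i y * f y) \<longlonglongrightarrow> kern_deriv (\<delta> x) (y - x) m (- b) * f y"
      by (intro always_eventually allI tendsto_intros ql)
    show "AE y in lborel. norm (q i y * f y) \<le> B * \<bar>f y\<bar>" for i
      using qb by (intro always_eventually allI) (simp add: abs_mult mult_right_mono)
  qed (use f qi in \<open>auto simp: q_def\<close>)
  then have "(\<lambda>i. (mollify \<delta> f (x + h (i + N) *\<^sub>R b) - mollify \<delta> f x) / h (i + N))
     \<longlonglongrightarrow> (LINT y|lborel. kern_deriv (\<delta> x) (y - x) m (- b) * f y)" unfolding qe .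
  then have "(\<lambda>i. (mollify \<delta> f (x + h i *\<^sub>R b) - mollify \<delta> f x) / h i)
     \<longlonglongrightarrow> (LINT y|lborel. kern_deriv (\<delta> x) (y - x) m (- b) * f y)" by (rule LIMSEQ_offset)
  then show "((\<lambda>s. (mollify \<delta> f (x + (0 + s) *\<^sub>R b) - mollify \<delta> f (x + 0 *\<^sub>R b)) / s) \<circ> h)
     \<longlonglongrightarrow> (LINT y|lborel. kern_deriv (\<delta> x) (y - x) m (- b) * f y)"
    by (simp add: comp_def)
qed

end

text \<open>Approximate \<open>f\<close> by a Lipschitz function \<open>g\<close>: mollification
  moves \<open>g\<close> by at most L times the radius, and \<open>mollify_L1\<close> controls the
  remainder f - g. The threshold e depends only on a bound for the radius, hence the quantification
  over all scale functions.\<close>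

lemma mollify_L1_convergence:
  fixes f :: "'a::euclidean_space \<Rightarrow> real"
  assumes f: "integrable lborel f" and \<eta>: "\<eta> > 0" and \<Omega>: "open \<Omega>" "bounded \<Omega>"
  obtains e where "e > 0" "\<And>\<delta>. variable_scale \<Omega> \<delta> \<Longrightarrow> (\<And>x. x \<in> \<Omega> \<Longrightarrow> \<delta> x \<le> e) \<Longrightarrow>
    (\<integral>\<^sup>+x. ennreal \<bar>mollify \<delta> f x - f x\<bar> * indicator \<Omega> x \<partial>lborel) \<le> ennreal \<eta>"
proof -
  define C where "C = kern_mass TYPE('a)"
  have C: "C \<ge> 0" unfolding C_def by (rule kern_mass_nonneg)
  \<comment> \<open>The remainder f - g is counted C times for its mollification and once for
    itself.\<close>
  obtain g L where g: "L-lipschitz_on UNIV g" "integrable lborel g" "(LINT x|lborel. \<bar>f x - g x\<bar>) < \<eta> / (2 * (C + 1))"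
    using L1_lipschitz_dense[OF f, of "\<eta> / (2 * (C + 1))"] \<eta> C by auto
  have L: "L \<ge> 0" using lipschitz_on_nonneg[OF g(1)] .
  define V where "V = measure lborel \<Omega>"
  have V: "emeasure lborel \<Omega> = ennreal V" "V \<ge> 0"
    using emeasure_bounded_finite[OF \<Omega>(2)] by (simp_all add: V_def emeasure_eq_ennreal_measure)
  \<comment> \<open>With radii below e, mollifying \<open>g\<close> costs at most \<eta> / 2 over
    all of \<Omega>. The added ones keep the denominator positive.\<close>
  define e where "e = \<eta> / (2 * (L + 1) * (V + 1))"
  have e: "e > 0" using \<eta> L V by (simp add: e_def)
  define N where "N = (LINT x|lborel. \<bar>f x - g x\<bar>)"
  have N: "N \<ge> 0" by (simp add: N_def)
  have fm[measurable]: "f \<in> borel_measurable borel" "g \<in> borel_measurable borel" using f g by auto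
  have \<Omega>m[measurable]: "\<Omega> \<in> sets borel" using \<Omega> by simp
  show thesis
  proof (rule that[OF e])
    fix \<delta> assume "variable_scale \<Omega> \<delta>" and le: "\<And>x. x \<in> \<Omega> \<Longrightarrow> \<delta> x \<le> e"
    then interpret variable_scale \<Omega> \<delta> by simp
    have [measurable]: "mollify \<delta> (\<lambda>x. f x - g x) \<in> borel_measurable borel" by (rule mollify_borel) measurable
    have "(\<integral>\<^sup>+x. ennreal \<bar>mollify \<delta> f x - f x\<bar> * indicator \<Omega> x \<partial>lborel)
      \<le> (\<integral>\<^sup>+x. (ennreal \<bar>mollify \<delta> (\<lambda>x. f x - g x) x\<bar> * indicator \<Omega> x + ennreal (L * e) * indicator \<Omega> x) + ennreal \<bar>f x - g x\<bar> \<partial>lborel)"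
    proof (rule nn_integral_mono)
      fix x
      show "ennreal \<bar>mollify \<delta> f x - f x\<bar> * indicator \<Omega> x
        \<le> (ennreal \<bar>mollify \<delta> (\<lambda>x. f x - g x) x\<bar> * indicator \<Omega> x + ennreal (L * e) * indicator \<Omega> x) + ennreal \<bar>f x - g x\<bar>"
      proof (cases "x \<in> \<Omega>")
        case True
        have 1: "mollify \<delta> (\<lambda>x. f x - g x) x = mollify \<delta> f x - mollify \<delta> g x"
          using integrable_kern_mult[OF f \<delta>_pos[OF True], of x] integrable_kern_mult[OF g(2) \<delta>_pos[OF True], of x]
          by (simp add: mollify_def right_diff_distrib)
        have 2: "\<bar>mollify \<delta> g x - g x\<bar> \<le> L * e"
          using mollify_lipschitz_close[OF g(1,2) True] le[OF True] L mult_left_mono order_trans by blast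
        have "\<bar>mollify \<delta> f x - f x\<bar> \<le> \<bar>mollify \<delta> (\<lambda>x. f x - g x) x\<bar> + L * e + \<bar>f x - g x\<bar>"
          using 1 2 by linarith
        then have "ennreal \<bar>mollify \<delta> f x - f x\<bar> \<le> ennreal (\<bar>mollify \<delta> (\<lambda>x. f x - g x) x\<bar> + L * e + \<bar>f x - g x\<bar>)"
          by (rule ennreal_leI)
        also have "\<dots> = ennreal \<bar>mollify \<delta> (\<lambda>x. f x - g x) x\<bar> + ennreal (L * e) + ennreal \<bar>f x - g x\<bar>"
          using L e by (simp add: ennreal_plus)
        finally show ?thesis using True by simp
      qed simp
    qed
    also have "\<dots> = (\<integral>\<^sup>+x. ennreal \<bar>mollify \<delta> (\<lambda>x. f x - g x) x\<bar> * indicator \<Omega> x \<partial>lborel)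
       + ennreal (L * e) * emeasure lborel \<Omega> + (\<integral>\<^sup>+x. ennreal \<bar>f x - g x\<bar> \<partial>lborel)"
      by (simp add: nn_integral_add nn_integral_cmult_indicator)
    also have "(\<integral>\<^sup>+x. ennreal \<bar>f x - g x\<bar> \<partial>lborel) = ennreal N"
      unfolding N_def using f g by (intro nn_integral_eq_integral) auto
    also have "(\<integral>\<^sup>+x. ennreal \<bar>mollify \<delta> (\<lambda>x. f x - g x) x\<bar> * indicator \<Omega> x \<partial>lborel) \<le> ennreal C * ennreal N"
      unfolding C_def N_def using f g by (intro mollify_L1) auto
    also have "ennreal C * ennreal N + ennreal (L * e) * emeasure lborel \<Omega> + ennreal N = ennreal (C * N + L * e * V + N)"
      using C N L e V by (simp add: ennreal_plus ennreal_mult)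
    also have "\<dots> \<le> ennreal \<eta>"
    proof (rule ennreal_leI)
      have "(C + 1) * N \<le> \<eta> / 2"
        using g(3) C by (simp add: N_def[symmetric] field_simps)
      moreover have "L * e * V \<le> (L + 1) * e * (V + 1)"
        using L e V by (intro mult_mono) auto
      moreover have "(L + 1) * e * (V + 1) = \<eta> / 2"
        using L V by (simp add: e_def divide_simps)
      ultimately show "C * N + L * e * V + N \<le> \<eta>" by (simp add: algebra_simps)
    qed
    finally show "(\<integral>\<^sup>+x. ennreal \<bar>mollify \<delta> f x - f x\<bar> * indicator \<Omega> x \<partial>lborel) \<le> ennreal \<eta>"
      by (simp add: add_right_mono)
  qed
qed

subsection \<open>Uniqueness of weak gradients\<close>

lemma C1_compactI:
  fixes \<phi> :: "'a::euclidean_space \<Rightarrow> real"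
  assumes "\<And>x. (\<phi> has_derivative (\<lambda>h. G x \<bullet> h)) (at x)" "continuous_on UNIV G"
    and K: "compact K" "K \<subseteq> U" "\<And>x. x \<notin> K \<Longrightarrow> \<phi> x = 0"
  shows "\<phi> \<in> C1_compact U"
proof -
  have "closure {x. \<phi> x \<noteq> 0} \<subseteq> K"
    using K by (intro closure_minimal) (auto simp: compact_imp_closed)
  moreover from this have "compact (closure {x. \<phi> x \<noteq> 0})"
    using K(1) by (metis closed_closure compact_Int_closed inf.absorb_iff2)
  moreover have "\<forall>x. (\<phi> has_derivative blinfun_apply (blinfun_inner_right (G x))) (at x)"
    using assms(1) by simp
  moreover have "continuous_on UNIV (\<lambda>x. blinfun_inner_right (G x))"
    by (intro continuous_intros assms(2) bounded_linear.continuous_on[OF bounded_linear_blinfun_inner_right])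
  ultimately show ?thesis
    unfolding C1_compact_def using K(2)
    by (intro CollectI conjI exI[of _ "\<lambda>x. blinfun_inner_right (G x)"]) auto
qed

definition kern_grad :: "real \<Rightarrow> 'a::euclidean_space \<Rightarrow> 'a" where
  "kern_grad t z = (2 * bump' ((norm z)\<^sup>2 / t\<^sup>2) / (t\<^sup>2 * (bump_mass TYPE('a) * t ^ DIM('a)))) *\<^sub>R z"

lemma kern_deriv_grad: "kern_deriv t z 0 h = kern_grad t z \<bullet> h"
  by (simp add: kern_deriv_def kern_grad_def field_simps)

lemma kern_has_grad:
  assumes "t > 0"
  shows "((\<lambda>y. kern t (y - x)) has_derivative (\<lambda>h. kern_grad t (y - x) \<bullet> h)) (at y)"
proof -
  have d1: "((\<lambda>y. (t, y - x)) has_derivative (\<lambda>h. (0, h))) (at y)"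
    by (auto intro!: derivative_eq_intros)
  have d2: "((\<lambda>p. kern (fst p) (snd p)) has_derivative (\<lambda>p. kern_deriv t (y - x) (fst p) (snd p))) (at (t, y - x))"
    by (rule kern_has_derivative[OF assms])
  from has_derivative_compose[OF d1 d2] show ?thesis
    by (simp add: kern_deriv_grad)
qed

lemma continuous_on_kern_grad: "t > 0 \<Longrightarrow> continuous_on UNIV (\<lambda>y. kern_grad t (y - x))"
  unfolding kern_grad_def using bump_mass_pos[where 'a='a] by (auto intro!: continuous_intros)

lemma kern_C1_compact:
  assumes "t > 0" "cball x t \<subseteq> U"
  shows "(\<lambda>y. kern t (y - x)) \<in> C1_compact U"
  by (rule C1_compactI[OF kern_has_grad continuous_on_kern_grad, where K = "cball x t"])
     (use assms in \<open>auto simp: dist_norm norm_minus_commute not_le intro!: kern_outside(1) less_imp_le\<close>)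

lemma ex_borel_version:
  fixes h :: "'a::euclidean_space \<Rightarrow> real"
  assumes h: "integrable lebesgue h"
  obtains f where "f \<in> borel_measurable borel" "AE x in lborel. f x = h x" "integrable lborel f"
proof -
  have hm: "h \<in> borel_measurable (completion lborel)" using h by auto
  obtain f where f: "f \<in> borel_measurable lborel" "AE x in lborel. h x = f x"
    using completion_ex_borel_measurable_real[OF hm] by blast
  have fl: "f \<in> borel_measurable lebesgue" by (rule measurable_completion) (use f in simp)
  have "integrable lebesgue f"
    using h integrable_cong_AE[OF hm fl AE_completion[OF f(2)]] by simp
  then have "integrable lborel f" using f(1) by (simp add: integrable_completion)
  moreover have "AE x in lborel. f x = h x" using f(2) by eventually_elim simp
  ultimately show thesis using that[of f] f(1) by simp
qed

text \<open>Kernels are admissible test functions, so all mollifications of \<open>h\<close> at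
  small constant scales vanish on a ball. They also converge to \<open>h\<close> in L1
  there.\<close>

lemma fundamental_lemma_variations:
  fixes h :: "'a::euclidean_space \<Rightarrow> real"
  assumes V: "open V" and h: "locally_integrable V h"
    and z: "\<And>\<phi>. \<phi> \<in> C1_compact V \<Longrightarrow> (LINT x|lebesgue_on V. h x * \<phi> x) = 0"
  shows "AE x in lebesgue. x \<in> V \<longrightarrow> h x = 0"
proof -
  \<comment> \<open>The doubled ball leaves room for kernels of radius up to r centred in the ball
    itself.\<close>
  define F where "F = {ball c r |c r. 0 < r \<and> cball c (2 * r) \<subseteq> V}"
  have UF: "\<Union>F = V"
  proof (intro subset_antisym subsetI)
    fix x assume "x \<in> V"
    then obtain e where "e > 0" "cball x e \<subseteq> V" using V open_contains_cball by blast
    then have "ball x (e/2) \<in> F" "x \<in> ball x (e/2)" unfolding F_def by (auto intro!: exI[of _ x] exI[of _ "e/2"])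
    then show "x \<in> \<Union>F" by blast
  next
    fix x assume "x \<in> \<Union>F"
    then obtain c r where "0 < r" "cball c (2 * r) \<subseteq> V" "x \<in> ball c r" by (auto simp: F_def)
    then show "x \<in> V" by (auto simp: subset_iff)
  qed
  obtain F' where F': "F' \<subseteq> F" "countable F'" "\<Union>F' = \<Union>F"
    by (rule Lindelof[of F]) (auto simp: F_def)
  have "AE x in lborel. x \<in> B \<longrightarrow> h x = 0" if BF: "B \<in> F'" for B
  proof -
    obtain c r where cr: "B = ball c r" "0 < r" "cball c (2 * r) \<subseteq> V" using BF F'(1) by (auto simp: F_def)
    define K where "K = cball c (2 * r)"
    have "integrable lebesgue (\<lambda>x. indicator K x *\<^sub>R h x)"
      using h cr(3) unfolding locally_integrable_def set_integrable_def K_def by auto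
    then obtain f where f[measurable]: "f \<in> borel_measurable borel" and fe: "AE x in lborel. f x = indicator K x *\<^sub>R h x"
      and fi: "integrable lborel f" by (rule ex_borel_version)
    have m0: "mollify (\<lambda>_. t) f x = 0" if t: "0 < t" "t \<le> r" and x: "x \<in> B" for t x
    proof -
      have sub: "cball x t \<subseteq> K"
      proof
        fix y assume "y \<in> cball x t"
        then show "y \<in> K" using x t dist_triangle[of c y x] by (simp add: K_def cr(1))
      qed
      have k: "(\<lambda>y. kern t (y - x)) \<in> C1_compact V"
        using sub cr(3) t(1) by (intro kern_C1_compact) (auto simp: K_def)
      have [measurable]: "V \<in> sets borel" using V by simp
      have "mollify (\<lambda>_. t) f x = (LINT y|lborel. indicator V y * (kern t (y - x) * f y))"
        unfolding mollify_def
      proof (rule Bochner_Integration.integral_cong[OF refl])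
        fix y show "kern t (y - x) * f y = indicator V y * (kern t (y - x) * f y)"
        proof (cases "y \<in> V")
          case False
          then have "y \<notin> cball x t" using sub cr(3) unfolding K_def by blast
          then have "norm (y - x) \<ge> t" by (simp add: dist_norm norm_minus_commute)
          from kern_outside(1)[OF t(1) this] show ?thesis by simp
        qed simp
      qed
      also have "\<dots> = (LINT y|lebesgue_on V. h y * kern t (y - x))"
      proof (rule lebesgue_on_integral_eq(1)[symmetric])
        show "AE y in lborel. y \<in> V \<longrightarrow> h y * kern t (y - x) = indicator V y * (kern t (y - x) * f y)"
          using fe
        proof eventually_elim
          case (elim y)
          show ?case
          proof (cases "norm (y - x) < t")
            case True
            then have "y \<in> K" using sub by (auto simp: dist_norm norm_minus_commute subset_iff)
            then show ?thesis using elim by simp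
          next
            case False
            then show ?thesis using kern_outside(1)[OF t(1), of "y - x"] by simp
          qed
        qed
      qed (auto intro!: borel_measurable_times)
      also have "\<dots> = 0" by (rule z[OF k])
      finally show ?thesis .
    qed
    have le: "(\<integral>\<^sup>+x. ennreal \<bar>f x\<bar> * indicator B x \<partial>lborel) \<le> ennreal \<eta>" if \<eta>: "\<eta> > 0" for \<eta>
    proof (rule mollify_L1_convergence[OF fi \<eta>, of B])
      fix e :: real assume e: "e > 0" and conv: "\<And>\<delta>. variable_scale B \<delta> \<Longrightarrow> (\<And>x. x \<in> B \<Longrightarrow> \<delta> x \<le> e) \<Longrightarrow>
          (\<integral>\<^sup>+x. ennreal \<bar>mollify \<delta> f x - f x\<bar> * indicator B x \<partial>lborel) \<le> ennreal \<eta>"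
      have vs: "variable_scale B (\<lambda>_. min e r)"
        using e cr by unfold_locales (auto simp: lipschitz_on_def)
      have "(\<integral>\<^sup>+x. ennreal \<bar>f x\<bar> * indicator B x \<partial>lborel)
          = (\<integral>\<^sup>+x. ennreal \<bar>mollify (\<lambda>_. min e r) f x - f x\<bar> * indicator B x \<partial>lborel)"
      proof (rule nn_integral_cong)
        fix x show "ennreal \<bar>f x\<bar> * indicator B x = ennreal \<bar>mollify (\<lambda>_. min e r) f x - f x\<bar> * indicator B x"
          using m0[of "min e r" x] e cr(2) by (cases "x \<in> B") auto
      qed
      also have "\<dots> \<le> ennreal \<eta>" by (rule conv[OF vs]) simp
      finally show ?thesis .
    qed (auto simp: cr)
    have "(\<integral>\<^sup>+x. ennreal \<bar>f x\<bar> * indicator B x \<partial>lborel) \<le> 0"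
      by (rule ennreal_le_epsilon) (use le in auto)
    then have "(\<integral>\<^sup>+x. ennreal \<bar>f x\<bar> * indicator B x \<partial>lborel) = 0" by simp
    moreover have "(\<lambda>x. ennreal \<bar>f x\<bar> * indicator B x) \<in> borel_measurable lborel"
    proof -
      have [measurable]: "B \<in> sets borel" using cr(1) by simp
      show ?thesis by measurable
    qed
    ultimately have "AE x in lborel. ennreal \<bar>f x\<bar> * indicator B x = 0"
      by (simp add: nn_integral_0_iff_AE)
    with fe show ?thesis
    proof eventually_elim
      case (elim x)
      show ?case
      proof
        assume x: "x \<in> B"
        then have "x \<in> K" using cr by (auto simp: K_def)
        with elim x show "h x = 0" by simp
      qed
    qed
  qed
  then have "AE x in lborel. \<forall>B\<in>F'. x \<in> B \<longrightarrow> h x = 0"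
    using F'(2) by (subst AE_ball_countable) auto
  then have "AE x in lborel. x \<in> V \<longrightarrow> h x = 0"
  proof eventually_elim
    case (elim x)
    have "x \<in> V \<longleftrightarrow> (\<exists>B\<in>F'. x \<in> B)" using F'(3) UF by blast
    with elim show ?case by blast
  qed
  then show ?thesis by (rule AE_completion)
qed

lemma integrable_test_mult:
  fixes f :: "'a::euclidean_space \<Rightarrow> real"
  assumes f: "locally_integrable V f" and \<phi>: "\<phi> \<in> C1_compact V" and V: "open V"
  shows "integrable (lebesgue_on V) (\<lambda>x. f x * \<phi> x)"
    and "b \<in> Basis \<Longrightarrow> integrable (lebesgue_on V) (\<lambda>x. f x * partial_deriv b \<phi> x)"
proof -
  have V': "V \<in> sets lebesgue" using V by simp
  have "integrable (lebesgue_on V) (\<lambda>x. f x * \<phi> x) \<and> integrable (lebesgue_on V) (\<lambda>x. f x * partial_deriv b \<phi> x)"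
    if b: "norm b \<le> 1" for b
  proof (rule C1_compact_partial[OF \<phi> b])
    assume c: "continuous_on UNIV \<phi>" "continuous_on UNIV (partial_deriv b \<phi>)"
      and k: "compact (closure {x. \<phi> x \<noteq> 0})" "closure {x. \<phi> x \<noteq> 0} \<subseteq> V"
      and z: "\<And>x. x \<notin> closure {x. \<phi> x \<noteq> 0} \<Longrightarrow> \<phi> x = 0" "\<And>x. x \<notin> closure {x. \<phi> x \<noteq> 0} \<Longrightarrow> partial_deriv b \<phi> x = 0"
    show ?thesis
      using integrable_C1_compact_mult[OF f c(1) k z(1) V'] integrable_C1_compact_mult[OF f c(2) k z(2) V'] ..
  qed
  \<comment> \<open>The vector 0 also has norm at most 1, so the first claim follows without a basis
    vector.\<close>
  from this[of 0] this[of b]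
  show "integrable (lebesgue_on V) (\<lambda>x. f x * \<phi> x)"
    and "b \<in> Basis \<Longrightarrow> integrable (lebesgue_on V) (\<lambda>x. f x * partial_deriv b \<phi> x)"
    by simp_all
qed

text \<open>Since \<open>weak_gradient\<close> is an arbitrary choice, this is what allows its
  energy to be computed from a gradient constructed by other means.\<close>

lemma weak_gradient_unique:
  fixes g g' :: "'a::euclidean_space \<Rightarrow> 'a"
  assumes V: "open V" and g: "has_weak_gradient V u g" and g': "has_weak_gradient V u g'"
  shows "AE x in lebesgue. x \<in> V \<longrightarrow> g x = g' x"
proof -
  have gl: "locally_integrable V g" "locally_integrable V g'" using g g' unfolding has_weak_gradient_def by auto
  have comp: "locally_integrable V (\<lambda>x. f x \<bullet> b)" if "locally_integrable V f" for f :: "'a \<Rightarrow> 'a" and b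
    unfolding locally_integrable_def set_integrable_def
  proof (intro allI impI)
    fix K assume "compact K \<and> K \<subseteq> V"
    then have "integrable lebesgue (\<lambda>x. indicator K x *\<^sub>R f x)"
      using that unfolding locally_integrable_def set_integrable_def by blast
    then have "integrable lebesgue (\<lambda>x. (indicator K x *\<^sub>R f x) \<bullet> b)" by (rule integrable_inner_left)
    then show "integrable lebesgue (\<lambda>x. indicator K x *\<^sub>R (f x \<bullet> b))" by simp
  qed
  have "AE x in lebesgue. x \<in> V \<longrightarrow> g x \<bullet> b - g' x \<bullet> b = 0" if b: "b \<in> Basis" for b
  proof (rule fundamental_lemma_variations[OF V])
    show "locally_integrable V (\<lambda>x. g x \<bullet> b - g' x \<bullet> b)"
      using comp[OF gl(1), of b] comp[OF gl(2), of b]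
      unfolding locally_integrable_def by (intro allI impI set_integral_diff(1)) blast+
    fix \<phi> :: "'a \<Rightarrow> real" assume \<phi>: "\<phi> \<in> C1_compact V"
    note i = integrable_test_mult(1)[OF comp[OF gl(1), of b] \<phi> V] integrable_test_mult(1)[OF comp[OF gl(2), of b] \<phi> V]
    have "(LINT x|lebesgue_on V. (g x \<bullet> b) * \<phi> x) = (LINT x|lebesgue_on V. (g' x \<bullet> b) * \<phi> x)"
    proof -
      have "(LINT x|lebesgue_on V. u x * partial_deriv b \<phi> x) = - (LINT x|lebesgue_on V. (g x \<bullet> b) * \<phi> x)"
        using g \<phi> b unfolding has_weak_gradient_def by blast
      moreover have "(LINT x|lebesgue_on V. u x * partial_deriv b \<phi> x) = - (LINT x|lebesgue_on V. (g' x \<bullet> b) * \<phi> x)"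
        using g' \<phi> b unfolding has_weak_gradient_def by blast
      ultimately show ?thesis by linarith
    qed
    then show "(LINT x|lebesgue_on V. (g x \<bullet> b - g' x \<bullet> b) * \<phi> x) = 0"
      using i by (simp add: left_diff_distrib)
  qed
  then have "AE x in lebesgue. \<forall>b\<in>Basis. x \<in> V \<longrightarrow> g x \<bullet> b - g' x \<bullet> b = 0"
    by (rule AE_finite_allI[OF finite_Basis])
  then show ?thesis
  proof eventually_elim
    case (elim x)
    show ?case
    proof (rule impI, rule euclidean_eqI)
      fix b :: 'a assume "x \<in> V" "b \<in> Basis"
      with elim have "g x \<bullet> b - g' x \<bullet> b = 0" by blast
      then show "g x \<bullet> b = g' x \<bullet> b" by simp
    qed
  qed
qed

subsection \<open>Variable exponents\<close>

lemma powr_ge_tangent: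
  fixes s a q :: real
  assumes s: "s \<ge> 0" and a: "a > 0" and q: "q \<ge> 1"
  shows "a powr q + q * a powr (q - 1) * (s - a) \<le> s powr q"
proof -
  \<comment> \<open>Bernoulli's inequality for real exponents, from the tangents of exp at \<theta>
    x, evaluated at x and at 0. Weighted with \<theta> and 1 - \<theta> their linear terms cancel;
    then \<theta> = 1/q and x = q ln t.\<close>
  have bern: "1 + q * (t - 1) \<le> t powr q" if t: "t > 0" for t :: real
  proof -
    define x where "x = q * ln t"
    define \<theta> where "\<theta> = 1 / q"
    have th: "0 \<le> \<theta>" "\<theta> \<le> 1" using q by (auto simp: \<theta>_def)
    have 1: "exp (\<theta> * x) * (1 + (1 - \<theta>) * x) \<le> exp x"
    proof -
      have "exp (\<theta> * x) * (1 + (1 - \<theta>) * x) \<le> exp (\<theta> * x) * exp ((1 - \<theta>) * x)"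
        by (intro mult_left_mono) (use exp_ge_add_one_self[of "(1 - \<theta>) * x"] in auto)
      then show ?thesis by (simp add: exp_add[symmetric] algebra_simps)
    qed
    have 2: "exp (\<theta> * x) * (1 - \<theta> * x) \<le> 1"
    proof -
      have "exp (\<theta> * x) * (1 - \<theta> * x) \<le> exp (\<theta> * x) * exp (- (\<theta> * x))"
        by (intro mult_left_mono) (use exp_ge_add_one_self[of "- (\<theta> * x)"] in auto)
      then show ?thesis by (simp add: exp_add[symmetric])
    qed
    have "exp (\<theta> * x) = \<theta> * (exp (\<theta> * x) * (1 + (1 - \<theta>) * x)) + (1 - \<theta>) * (exp (\<theta> * x) * (1 - \<theta> * x))"
      by (simp add: algebra_simps)
    also have "\<dots> \<le> \<theta> * exp x + (1 - \<theta>) * 1"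
      using th by (intro add_mono mult_left_mono 1 2) auto
    finally have "t \<le> \<theta> * t powr q + (1 - \<theta>)"
      using t q by (simp add: x_def \<theta>_def powr_def)
    then have "q * t \<le> q * (\<theta> * t powr q + (1 - \<theta>))" using q by (intro mult_left_mono) auto
    then show ?thesis using q by (simp add: \<theta>_def algebra_simps)
  qed
  show ?thesis
  proof (cases "s = 0")
    case True
    have "a powr q = a powr (q - 1) * a" using a by (simp add: powr_diff)
    then have "a powr q + q * a powr (q - 1) * (s - a) = (1 - q) * a powr q"
      using True by (simp add: algebra_simps)
    also have "\<dots> \<le> 0" using q by (intro mult_nonpos_nonneg) auto
    finally show ?thesis using True by simp
  next
    case False
    have "a powr q * (1 + q * (s / a - 1)) \<le> a powr q * (s / a) powr q"
      using s a False by (intro mult_left_mono bern) auto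
    also have "\<dots> = s powr q" using s a by (simp add: powr_divide)
    also have "a powr q * (1 + q * (s / a - 1)) = a powr q + q * a powr (q - 1) * (s - a)"
      using a by (simp add: powr_diff field_simps)
    finally show ?thesis .
  qed
qed

lemma powr_midpoint:
  fixes x y q :: real
  assumes "x \<ge> 0" "y \<ge> 0" "q \<ge> 1"
  shows "((x + y) / 2) powr q \<le> (x powr q + y powr q) / 2"
proof (cases "x + y = 0")
  case False
  then have a: "(x + y) / 2 > 0" using assms by simp
  have s: "q * ((x + y) / 2) powr (q - 1) * (x - (x + y) / 2) + q * ((x + y) / 2) powr (q - 1) * (y - (x + y) / 2) = 0"
    by (simp add: algebra_simps)
  show ?thesis
    using powr_ge_tangent[OF assms(1) a assms(3)] powr_ge_tangent[OF assms(2) a assms(3)] s by argo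
qed (use assms in auto)

lemma powr_add_le:
  fixes x y q P :: real
  assumes "x \<ge> 0" "y \<ge> 0" "q \<ge> 1" "q \<le> P"
  shows "(x + y) powr q \<le> 2 powr P * (x powr q + y powr q)"
proof -
  have "(x + y) powr q = 2 powr q * ((x + y) / 2) powr q"
    using assms by (simp add: powr_divide)
  also have "\<dots> \<le> 2 powr P * ((x powr q + y powr q) / 2)"
    using assms by (intro mult_mono powr_midpoint powr_mono) auto
  also have "\<dots> \<le> 2 powr P * (x powr q + y powr q)"
    by (intro mult_left_mono) auto
  finally show ?thesis .
qed

lemma le_one_plus_powr:
  fixes x q :: real
  assumes "x \<ge> 0" "q \<ge> 1"
  shows "x \<le> 1 + x powr q"
proof (cases "x \<le> 1")
  case False
  then have "x powr 1 \<le> x powr q" using assms by (intro powr_mono) auto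
  then show ?thesis using assms by simp
qed (simp add: add_increasing2)

lemma powr_divide_le:
  fixes x q l :: real
  assumes "x \<ge> 0" "q \<ge> 1" "l \<ge> 1"
  shows "(x / l) powr q \<le> (1 / l) * x powr q"
proof -
  have "l powr 1 \<le> l powr q" using assms by (intro powr_mono) auto
  then have "x powr q / l powr q \<le> x powr q / l" using assms by (intro divide_left_mono) auto
  then show ?thesis using assms by (simp add: powr_divide)
qed

lemma luxemburg_finite_iff: "luxemburg \<rho> u < \<infinity> \<longleftrightarrow> (\<exists>l>0. \<rho> (\<lambda>x. u x / l) \<le> 1)"
proof
  assume "luxemburg \<rho> u < \<infinity>"
  then show "\<exists>l>0. \<rho> (\<lambda>x. u x / l) \<le> 1"
    unfolding luxemburg_def by (auto simp: Inf_less_iff)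
next
  assume "\<exists>l>0. \<rho> (\<lambda>x. u x / l) \<le> 1"
  then obtain l where "0 < l" "\<rho> (\<lambda>x. u x / l) \<le> 1" by blast
  then have "luxemburg \<rho> u \<le> ennreal l" unfolding luxemburg_def by (intro Inf_lower) blast
  then show "luxemburg \<rho> u < \<infinity>" by (simp add: le_less_trans)
qed

lemma luxemburg_less_imp:
  assumes "luxemburg \<rho> u < ennreal \<eta>"
  obtains l where "0 < l" "l < \<eta>" "\<rho> (\<lambda>x. u x / l) \<le> 1"
proof -
  obtain l where "0 < l" "\<rho> (\<lambda>x. u x / l) \<le> 1" "ennreal l < ennreal \<eta>"
    using assms unfolding luxemburg_def by (auto simp: Inf_less_iff)
  then show thesis using that[of l] by (simp add: ennreal_less_iff)
qed

lemma luxemburg_le: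
  "0 < l \<Longrightarrow> \<rho> (\<lambda>x. u x / l) \<le> 1 \<Longrightarrow> luxemburg \<rho> u \<le> ennreal l"
  unfolding luxemburg_def by (intro Inf_lower) blast

text \<open>The log-Hoelder constant is a parameter, so that the later constants may be defined in
  terms of it.\<close>

locale variable_exponent =
  fixes \<Omega> :: "'a::euclidean_space set" and p :: "'a \<Rightarrow> real" and c :: real
  assumes open_dom: "open \<Omega>" and bounded_dom: "bounded \<Omega>"
    and p_ge: "x \<in> \<Omega> \<Longrightarrow> 1 \<le> p x"
    and c_pos: "c > 0"
    and p_log_Holder: "x \<in> \<Omega> \<Longrightarrow> y \<in> \<Omega> \<Longrightarrow> x \<noteq> y \<Longrightarrow> \<bar>p x - p y\<bar> \<le> c / ln (exp 1 + 1 / norm (x - y))"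
begin

abbreviation "M \<equiv> lebesgue_on \<Omega>"

lemma dom_borel [measurable]: "\<Omega> \<in> sets borel" using open_dom by simp

lemma dom_finite: "emeasure lborel \<Omega> < \<infinity>" using bounded_dom by (rule emeasure_bounded_finite)

definition vol where "vol = measure lborel \<Omega>"

lemma vol: "emeasure lborel \<Omega> = ennreal vol" "vol \<ge> 0"
  using dom_finite by (simp_all add: vol_def emeasure_eq_ennreal_measure)

lemma emeasure_M: "emeasure M \<Omega> = ennreal vol"
  using vol by (simp add: emeasure_restrict_space)

lemma nn_integral_M: "(\<integral>\<^sup>+x. f x \<partial>M) = (\<integral>\<^sup>+x. f x * indicator \<Omega> x \<partial>lborel)"
  by (simp add: nn_integral_restrict_space nn_integral_completion)

lemma finite_M: "finite_measure M"
  by (rule finite_measureI) (simp add: emeasure_M)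

lemma ln_ge_1: "r > 0 \<Longrightarrow> 1 \<le> ln (exp 1 + 1 / r)" for r :: real
  by (subst ln_exp[of 1, symmetric], subst ln_le_cancel_iff) (auto intro: add_pos_pos)

definition P where "P = (SUP x\<in>\<Omega>. p x) + 1"

text \<open>Since ln (e + 1/r) \<ge> 1 for every r > 0, the log-Hoelder condition bounds the
  oscillation of p over \<Omega> by c.\<close>

lemma p_le: assumes x: "x \<in> \<Omega>" shows "p x \<le> P"
proof -
  have "p y \<le> p x + c" if y: "y \<in> \<Omega>" for y
  proof (cases "y = x")
    case False
    have "p y - p x \<le> c / ln (exp 1 + 1 / norm (y - x))"
      using p_log_Holder[OF y x False] by linarith
    also have "\<dots> \<le> c / 1" using c_pos ln_ge_1[of "norm (y - x)"] False by (intro divide_left_mono) auto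
    finally show ?thesis by simp
  qed (use c_pos in simp)
  then have "bdd_above (p ` \<Omega>)" by (auto intro!: bdd_aboveI2)
  then have "p x \<le> (SUP x\<in>\<Omega>. p x)" using x by (rule cSUP_upper2) simp
  then show ?thesis by (simp add: P_def)
qed

lemma p_continuous: "continuous_on \<Omega> p"
  unfolding continuous_on_iff
proof (intro ballI allI impI)
  fix x and e :: real assume x: "x \<in> \<Omega>" and e: "e > 0"
  \<comment> \<open>Then 1/d = exp (c/e), so a distance below d makes the logarithm exceed c/e, and
    the log-Hoelder bound falls below e.\<close>
  define d where "d = exp (- (c / e))"
  have "dist (p y) (p x) < e" if y: "y \<in> \<Omega>" "dist y x < d" for y
  proof (cases "y = x")
    case False
    have n: "norm (y - x) > 0" "norm (y - x) < d" using False y by (auto simp: dist_norm)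
    have "exp (c / e) = 1 / d" by (simp add: d_def exp_minus inverse_eq_divide)
    also have "\<dots> < exp 1 + 1 / norm (y - x)"
      using n by (intro add_strict_increasing2) (auto intro!: divide_strict_left_mono simp: d_def less_imp_le)
    finally have "ln (exp (c / e)) < ln (exp 1 + 1 / norm (y - x))"
      by (subst ln_less_cancel_iff) (use n in \<open>auto intro: add_pos_pos\<close>)
    then have "c / e < ln (exp 1 + 1 / norm (y - x))" by simp
    then have "c / ln (exp 1 + 1 / norm (y - x)) < e"
      using e c_pos ln_ge_1[OF n(1)] by (simp add: field_simps)
    then show ?thesis using p_log_Holder[OF y(1) x False] by (simp add: dist_real_def)
  qed (use e in simp)
  then show "\<exists>d>0. \<forall>x'\<in>\<Omega>. dist x' x < d \<longrightarrow> dist (p x') (p x) < e"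
    by (intro exI[of _ d]) (auto simp: d_def)
qed

lemma p_measurable [measurable]: "p \<in> borel_measurable M"
proof -
  have "(\<lambda>x. indicator \<Omega> x *\<^sub>R p x) \<in> borel_measurable borel"
    by (rule borel_measurable_continuous_on_indicator) (use p_continuous in auto)
  then have "(\<lambda>x. indicator \<Omega> x *\<^sub>R p x) \<in> borel_measurable lebesgue"
    by (intro measurable_completion) simp
  then show ?thesis by (simp add: borel_measurable_restrict_space_iff)
qed

lemma modular_scale:
  assumes "l \<ge> 1" and [measurable]: "u \<in> borel_measurable M"
  shows "modular_Lp \<Omega> p (\<lambda>x. u x / l) \<le> ennreal (1 / l) * modular_Lp \<Omega> p u"
proof -
  have "modular_Lp \<Omega> p (\<lambda>x. u x / l) \<le> (\<integral>\<^sup>+x. ennreal (1 / l) * ennreal (\<bar>u x\<bar> powr p x) \<partial>M)"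
    unfolding modular_Lp_def
  proof (rule nn_integral_mono)
    fix x assume "x \<in> space M"
    then have "(\<bar>u x\<bar> / l) powr p x \<le> (1 / l) * \<bar>u x\<bar> powr p x"
      using assms(1) by (intro powr_divide_le p_ge) auto
    then show "ennreal (\<bar>u x / l\<bar> powr p x) \<le> ennreal (1 / l) * ennreal (\<bar>u x\<bar> powr p x)"
      using assms(1) by (simp add: ennreal_mult[symmetric] ennreal_leI abs_divide)
  qed
  also have "\<dots> = ennreal (1 / l) * modular_Lp \<Omega> p u"
    unfolding modular_Lp_def by (rule nn_integral_cmult) measurable
  finally show ?thesis .
qed

end

subsection \<open>Almost everywhere convergence of near-minimisers\<close>

abbreviation area :: "'a::real_inner \<Rightarrow> real" where "area z \<equiv> sqrt (1 + (norm z)\<^sup>2)"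

lemma area_ge_1: "area z \<ge> 1" and area_le: "area z \<le> 1 + norm z"
proof -
  show "area z \<ge> 1" by simp
  have "1 + (norm z)\<^sup>2 \<le> (1 + norm z)\<^sup>2" by (simp add: power2_sum)
  then show "area z \<le> 1 + norm z" by (rule real_le_lsqrt[rotated 1]) simp
qed

text \<open>Strict convexity of the area integrand, made quantitative: with D the midpoint deficit
  and s the sum of the two areas, \<bar>a - b\<bar>^2 \<le> 2 D s^3. The convexity degenerates at
  infinity, hence the factor s^3 and the square root on the left. The free parameter K trades the
  deficit against s so that both enter linearly and can be integrated.\<close>

lemma area_deficit:
  fixes a b :: "'a::real_inner"
  assumes K: "K > 0"
  shows "sqrt (norm (a - b)) \<le> 2 * K ^ 3 * (area a + area b - 2 * area ((1/2) *\<^sub>R (a + b))) + (area a + area b) / K"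
proof -
  \<comment> \<open>A and B are the norms of the vectors (1, a) and (1, b), Q is the norm of their
    sum and Y their inner product. Thus (A B)^2 - Y^2 is a Gram determinant, and s^2 - Q^2 is twice
    A B - Y.\<close>
  define A where "A = area a"
  define B where "B = area b"
  define Q where "Q = 2 * area ((1/2) *\<^sub>R (a + b))"
  define s where "s = A + B"
  define Y where "Y = 1 + a \<bullet> b"
  have A2: "A\<^sup>2 = 1 + a \<bullet> a" and B2: "B\<^sup>2 = 1 + b \<bullet> b" by (simp_all add: A_def B_def power2_norm_eq_inner)
  have AB: "A \<ge> 1" "B \<ge> 1" unfolding A_def B_def by (rule area_ge_1)+
  have Q0: "Q \<ge> 0" by (simp add: Q_def)
  have "Q\<^sup>2 = 4 * (1 + (norm ((1/2) *\<^sub>R (a + b)))\<^sup>2)" by (simp add: Q_def power_mult_distrib)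
  also have "\<dots> = 4 + (a + b) \<bullet> (a + b)" by (simp add: power_divide power2_norm_eq_inner)
  finally have Q2: "Q\<^sup>2 = 4 + a \<bullet> a + 2 * (a \<bullet> b) + b \<bullet> b"
    by (simp add: inner_add_left inner_add_right inner_commute)
  have sQ: "s\<^sup>2 - Q\<^sup>2 = 2 * (A * B - Y)"
    unfolding Q2 by (simp add: s_def power2_sum A2 B2 Y_def)
  have "(norm (a - b))\<^sup>2 = a \<bullet> a - 2 * (a \<bullet> b) + b \<bullet> b"
    by (simp add: power2_norm_eq_inner inner_diff_left inner_diff_right inner_commute)
  moreover have "(A * B)\<^sup>2 = (1 + a \<bullet> a) * (1 + b \<bullet> b)" by (simp add: power_mult_distrib A2 B2)
  moreover have "(a \<bullet> b)\<^sup>2 \<le> (a \<bullet> a) * (b \<bullet> b)" by (rule Cauchy_Schwarz_ineq)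
  ultimately have N: "(norm (a - b))\<^sup>2 \<le> (A * B)\<^sup>2 - Y\<^sup>2"
    by (simp add: Y_def power2_eq_square algebra_simps)
  have "Y\<^sup>2 \<le> (A * B)\<^sup>2" using N zero_le_power2[of "norm (a - b)"] by linarith
  then have "\<bar>Y\<bar> \<le> \<bar>A * B\<bar>" by (simp only: abs_le_square_iff)
  then have Y: "\<bar>Y\<bar> \<le> A * B" using AB by (simp add: abs_mult)
  have N2: "(norm (a - b))\<^sup>2 \<le> (A * B - Y) * (2 * (A * B))"
  proof -
    have "(A * B)\<^sup>2 - Y\<^sup>2 = (A * B - Y) * (A * B + Y)" by (simp add: power2_eq_square algebra_simps)
    also have "\<dots> \<le> (A * B - Y) * (2 * (A * B))"
      using Y by (intro mult_left_mono) auto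
    finally show ?thesis using N by linarith
  qed
  have "0 \<le> s\<^sup>2 - Q\<^sup>2" unfolding sQ using Y by (simp add: abs_le_iff)
  then have "Q\<^sup>2 \<le> s\<^sup>2" by simp
  then have Qs: "Q \<le> s" by (rule power2_le_imp_le) (use AB in \<open>simp add: s_def\<close>)
  define D where "D = s - Q"
  have D: "D \<ge> 0" using Qs by (simp add: D_def)
  have "A * B - Y \<le> s * D"
  proof -
    have "2 * (A * B - Y) = D * (s + Q)" unfolding sQ[symmetric] by (simp add: D_def power2_eq_square algebra_simps)
    also have "\<dots> \<le> D * (2 * s)" using D Qs by (intro mult_left_mono) auto
    finally show ?thesis by (simp add: mult_ac)
  qed
  then have "(A * B - Y) * (2 * (A * B)) \<le> (s * D) * (2 * s\<^sup>2)"
  proof (rule mult_mono)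
    have "A * B \<le> s * s" using AB by (intro mult_mono) (auto simp: s_def)
    then show "2 * (A * B) \<le> 2 * s\<^sup>2" by (simp add: power2_eq_square)
  qed (use AB D in \<open>auto simp: s_def\<close>)
  \<comment> \<open>The powers of K cancel. The right side has the form X Z^3 \<le> (X + Z)^4, and
    taking fourth roots gives the claim.\<close>
  with N2 have N3: "(norm (a - b))\<^sup>2 \<le> (2 * K ^ 3 * D) * (s / K) ^ 3"
    using K by (simp add: power_divide power2_eq_square power3_eq_cube field_simps)
  define X where "X = 2 * K ^ 3 * D"
  define Z where "Z = s / K"
  have XZ: "X \<ge> 0" "Z \<ge> 0" using D K AB by (auto simp: X_def Z_def s_def)
  have "x ^ 4 = (x\<^sup>2)\<^sup>2" for x :: real by (simp add: eval_nat_numeral)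
  then have "(sqrt (norm (a - b))) ^ 4 = ((sqrt (norm (a - b)))\<^sup>2)\<^sup>2" .
  also have "\<dots> = (norm (a - b))\<^sup>2" by simp
  also have "\<dots> \<le> X * Z ^ 3" using N3 by (simp add: X_def Z_def)
  also have "\<dots> \<le> (X + Z) * (X + Z) ^ 3" using XZ by (intro mult_mono power_mono) auto
  also have "\<dots> = (X + Z) ^ 4" by (simp add: eval_nat_numeral)
  finally have "sqrt (norm (a - b)) \<le> X + Z" using XZ by (subst (asm) power_mono_iff) auto
  then show ?thesis by (simp add: X_def Z_def D_def s_def Q_def A_def B_def)
qed

text \<open>The infima of the area over the decreasing sets \<open>W n\<close> increase to a finite
  limit L. The midpoint of two consecutive near-minimisers lies in the larger set, so its area is
  almost L as well and the deficit is small. With K = 2^k in \<open>area_deficit\<close>, the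
  integrals of the square roots of consecutive distances become summable.\<close>

lemma AE_convergent_near_minimisers:
  fixes W :: "nat \<Rightarrow> ('b \<Rightarrow> 'a::euclidean_space) set"
  assumes M: "finite_measure M"
    and ne: "\<And>n. W n \<noteq> {}" and dec: "\<And>m n. m \<le> n \<Longrightarrow> W n \<subseteq> W m"
    and mid: "\<And>n G H. G \<in> W n \<Longrightarrow> H \<in> W n \<Longrightarrow> (\<lambda>x. (1/2) *\<^sub>R (G x + H x)) \<in> W n"
    and int: "\<And>n G. G \<in> W n \<Longrightarrow> integrable M G"
    and bd: "\<And>n G. G \<in> W n \<Longrightarrow> (LINT x|M. norm (G x)) \<le> C"
  obtains G where "\<And>k. G k \<in> W k" "AE x in M. convergent (\<lambda>k. G k x)"
proof -
  interpret finite_measure M by (rule M)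
  define J where "J G = (LINT x|M. area (G x))" for G :: "'b \<Rightarrow> 'a"
  define C' where "C' = measure M (space M) + C"
  have ai: "integrable M (\<lambda>x. area (G x))" if "G \<in> W n" for G n
  proof (rule Bochner_Integration.integrable_bound[where f = "\<lambda>x. 1 + norm (G x)"])
    have [measurable]: "G \<in> borel_measurable M" using int[OF that] by auto
    show "(\<lambda>x. area (G x)) \<in> borel_measurable M" by measurable
    show "AE x in M. norm (area (G x)) \<le> norm (1 + norm (G x))"
      using area_le by (intro always_eventually allI) auto
    show "integrable M (\<lambda>x. 1 + norm (G x))" using int[OF that] by auto
  qed
  have J0: "J G \<ge> 0" for G unfolding J_def by (rule Bochner_Integration.integral_nonneg) simp
  have JC: "J G \<le> C'" if "G \<in> W n" for G n
  proof -
    have "J G \<le> (LINT x|M. 1 + norm (G x))"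
      unfolding J_def using ai[OF that] int[OF that] area_le by (intro integral_mono) auto
    also have "\<dots> \<le> C'" using int[OF that] bd[OF that] by (simp add: C'_def)
    finally show ?thesis .
  qed
  define I where "I n = (INF G\<in>W n. J G)" for n
  have bb: "bdd_below (J ` W n)" for n using J0 by (intro bdd_belowI2[of _ 0]) auto
  have IJ: "I n \<le> J G" if "G \<in> W n" for G n
    unfolding I_def using bb that by (rule cINF_lower)
  have Imono: "I m \<le> I n" if "m \<le> n" for m n
    unfolding I_def using ne dec[OF that] bb by (intro cINF_superset_mono) auto
  have IC: "I n \<le> C'" for n
  proof -
    obtain G where "G \<in> W n" using ne by blast
    then show ?thesis using IJ JC order_trans by blast
  qed
  have ba: "bdd_above (range I)" using IC by (intro bdd_aboveI2) auto
  define L where "L = (SUP n. I n)"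
  have IL: "I n \<le> L" for n unfolding L_def using ba by (intro cSUP_upper) auto
  \<comment> \<open>The tolerance 16^-k has to beat the factor K^3 = 8^k; what remains is
    2^-k.\<close>
  define \<tau> where "\<tau> k = (1/16 :: real) ^ k" for k :: nat
  have \<tau>: "\<tau> k > 0" "\<tau> (Suc k) \<le> \<tau> k" for k by (auto simp: \<tau>_def)
  have "\<exists>n. L - \<tau> k < I n" for k
  proof -
    have "L - \<tau> k < L" using \<tau> by simp
    then show ?thesis unfolding L_def using less_cSUP_iff[OF _ ba] by auto
  qed
  then have "\<forall>k. \<exists>n. L - \<tau> k < I n" ..
  from choice[OF this] obtain N0 where "\<forall>k. L - \<tau> k < I (N0 k)" ..
  then have N0: "\<And>k. L - \<tau> k < I (N0 k)" ..
  \<comment> \<open>The partial sums make N increasing and at least N0 k; the summand k makes it at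
    least k, so that \<open>G k\<close> lies in \<open>W k\<close>.\<close>
  define N where "N k = (\<Sum>i\<le>k. N0 i) + k" for k
  have Nk: "k \<le> N k" "N k \<le> N (Suc k)" "N0 k \<le> N k" for k
    by (auto simp: N_def intro!: trans_le_add1 member_le_sum)
  have NI: "L - \<tau> k < I (N k)" for k using N0[of k] Imono[OF Nk(3)[of k]] by linarith
  have "\<forall>k. \<exists>G. G \<in> W (N k) \<and> J G < I (N k) + \<tau> k"
  proof
    fix k
    have "(INF G\<in>W (N k). J G) < I (N k) + \<tau> k" using \<tau> by (simp add: I_def)
    then show "\<exists>G. G \<in> W (N k) \<and> J G < I (N k) + \<tau> k" using cINF_less_iff[OF ne bb] by auto
  qed
  from choice[OF this] obtain G where "\<forall>k. G k \<in> W (N k) \<and> J (G k) < I (N k) + \<tau> k" ..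
  then have G: "\<And>k. G k \<in> W (N k)" "\<And>k. J (G k) < I (N k) + \<tau> k" by simp_all
  have GL: "J (G k) < L + \<tau> k" for k using G(2)[of k] IL[of "N k"] by linarith
  define H where "H k = (\<lambda>x. (1/2) *\<^sub>R (G k x + G (Suc k) x))" for k
  have G': "G (Suc k) \<in> W (N k)" for k using G(1)[of "Suc k"] dec[OF Nk(2)[of k]] by blast
  have H: "H k \<in> W (N k)" for k unfolding H_def by (rule mid[OF G(1) G'])
  have Gm[measurable]: "G k \<in> borel_measurable M" for k using int[OF G(1)[of k]] by auto
  define S where "S k x = sqrt (norm (G k x - G (Suc k) x))" for k x
  define R where "R k x = 2 * (2 ^ k) ^ 3 * (area (G k x) + area (G (Suc k) x) - 2 * area (H k x))
     + (area (G k x) + area (G (Suc k) x)) / 2 ^ k" for k x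
  have SR: "S k x \<le> R k x" for k x
    unfolding S_def R_def H_def by (rule area_deficit) simp
  have Ri: "integrable M (R k)" for k
    unfolding R_def using ai[OF G(1)] ai[OF G'] ai[OF H] by auto
  have RI: "(LINT x|M. R k x) \<le> (8 + 2 * C') * (1/2) ^ k" for k
  proof -
    have "(LINT x|M. R k x) = 2 * (2 ^ k) ^ 3 * (J (G k) + J (G (Suc k)) - 2 * J (H k)) + (J (G k) + J (G (Suc k))) / 2 ^ k"
      unfolding R_def J_def using ai[OF G(1)] ai[OF G'] ai[OF H] by simp
    also have "\<dots> \<le> 2 * (2 ^ k) ^ 3 * (4 * \<tau> k) + (C' + C') / 2 ^ k"
    proof (intro add_mono mult_left_mono divide_right_mono)
      \<comment> \<open>Each of the two areas is below L + \<tau> k, and the midpoint has area at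
        least I (N k) > L - \<tau> k.\<close>
      show "J (G k) + J (G (Suc k)) - 2 * J (H k) \<le> 4 * \<tau> k"
        using GL[of k] GL[of "Suc k"] \<tau>(2)[of k] NI[of k] IJ[OF H[of k]] by linarith
    qed (use JC[OF G(1)] in auto)
    also have "2 * (2 ^ k) ^ 3 * (4 * \<tau> k) = 8 * (1/2) ^ k"
    proof -
      have "((2::real) ^ k) ^ 3 * (1/16) ^ k = (2 ^ 3 * (1/16)) ^ k"
        by (simp only: power_mult_distrib power_mult[symmetric] mult.commute[of k 3])
      then show ?thesis by (simp add: \<tau>_def)
    qed
    finally show ?thesis by (simp add: algebra_simps power_divide)
  qed
  have C'0: "C' \<ge> 0" using JC[OF G(1)[of 0]] J0[of "G 0"] by linarith
  have "(\<integral>\<^sup>+x. (\<Sum>k. ennreal (S k x)) \<partial>M) = (\<Sum>k. \<integral>\<^sup>+x. ennreal (S k x) \<partial>M)"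
    by (rule nn_integral_suminf) (simp add: S_def)
  also have "\<dots> \<le> (\<Sum>k. ennreal ((8 + 2 * C') * (1/2) ^ k))"
  proof (rule suminf_le)
    fix k
    have "(\<integral>\<^sup>+x. ennreal (S k x) \<partial>M) \<le> (\<integral>\<^sup>+x. ennreal (R k x) \<partial>M)"
      by (intro nn_integral_mono ennreal_leI SR)
    also have "\<dots> = ennreal (LINT x|M. R k x)"
    proof (rule nn_integral_eq_integral[OF Ri])
      have "0 \<le> R k x" for x
      proof -
        have "0 \<le> S k x" by (simp add: S_def)
        then show ?thesis using SR[of k x] by linarith
      qed
      then show "AE x in M. 0 \<le> R k x" by simp
    qed
    also have "\<dots> \<le> ennreal ((8 + 2 * C') * (1/2) ^ k)" by (intro ennreal_leI RI)
    finally show "(\<integral>\<^sup>+x. ennreal (S k x) \<partial>M) \<le> ennreal ((8 + 2 * C') * (1/2) ^ k)" .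
  qed (rule summableI)+
  also have "\<dots> < \<infinity>"
  proof -
    have "summable (\<lambda>k. (8 + 2 * C') * (1/2::real) ^ k)" by (intro summable_mult summable_geometric) simp
    then show ?thesis using C'0 by (subst suminf_ennreal2) auto
  qed
  finally have fin: "(\<integral>\<^sup>+x. (\<Sum>k. ennreal (S k x)) \<partial>M) \<noteq> \<infinity>" by simp
  have "AE x in M. (\<Sum>k. ennreal (S k x)) \<noteq> \<infinity>"
    by (rule nn_integral_PInf_AE[OF _ fin]) (simp add: S_def)
  then have conv: "AE x in M. convergent (\<lambda>k. G k x)"
  proof eventually_elim
    case (elim x)
    have sS: "summable (\<lambda>k. S k x)"
      by (rule summable_suminf_not_top) (use elim in \<open>auto simp: S_def\<close>)
    have "\<forall>\<^sub>F k in sequentially. S k x < 1"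
      using summable_LIMSEQ_zero[OF sS] by (rule order_tendstoD(2)) simp
    \<comment> \<open>The square roots tend to 0, and a number below 1 is at most its square root;
      hence the distances themselves are summable.\<close>
    then have ev: "\<forall>\<^sub>F k in sequentially. norm (G (Suc k) x - G k x) \<le> S k x"
    proof eventually_elim
      case (elim k)
      define r where "r = norm (G k x - G (Suc k) x)"
      have "sqrt r < 1" "r \<ge> 0" using elim by (auto simp: S_def r_def)
      then have "sqrt r * sqrt r \<le> sqrt r * 1" by (intro mult_left_mono) auto
      then have "r \<le> sqrt r" using \<open>r \<ge> 0\<close> by simp
      then show ?case by (simp add: S_def r_def norm_minus_commute)
    qed
    have "summable (\<lambda>k. G (Suc k) x - G k x)"
      by (rule summable_comparison_test_ev[OF ev sS])
    then have "(\<lambda>n. \<Sum>k<n. G (Suc k) x - G k x) \<longlonglongrightarrow> (\<Sum>k. G (Suc k) x - G k x)"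
      by (rule summable_LIMSEQ)
    then have "(\<lambda>n. (G n x - G 0 x) + G 0 x) \<longlonglongrightarrow> (\<Sum>k. G (Suc k) x - G k x) + G 0 x"
      by (intro tendsto_add tendsto_const) (simp add: sum_lessThan_telescope[of "\<lambda>k. G k x"])
    then show ?case by (auto simp: convergent_def)
  qed
  show thesis
  proof (rule that[of G])
    show "G k \<in> W k" for k using G(1)[of k] dec[OF Nk(1)[of k]] by blast
  qed (rule conv)
qed

subsection \<open>Relaxed functions have bounded variation\<close>

lemma less_liminf_imp_frequently:
  fixes f :: "nat \<Rightarrow> ennreal"
  assumes "liminf f < C"
  shows "\<exists>\<^sub>F i in sequentially. f i < C"
proof (rule ccontr)
  assume "\<not> ?thesis"
  then have "\<forall>\<^sub>F i in sequentially. C \<le> f i" by (simp add: not_frequently not_less)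
  from Liminf_bounded[OF this] assms show False by simp
qed

context variable_exponent
begin

text \<open>Membership asks for a finite modular at some scale, finiteness of the norm for a modular
  of at most 1. Enlarging the scale by the factor max 1 m brings a modular m below 1, because p
  \<ge> 1.\<close>

lemma space_Lp_iff: "u \<in> space_Lp \<Omega> p \<longleftrightarrow> u \<in> borel_measurable M \<and> norm_Lp \<Omega> p u < \<infinity>"
proof
  assume u: "u \<in> space_Lp \<Omega> p"
  then have um: "u \<in> borel_measurable M" by (simp add: space_Lp_def)
  obtain l where l: "l > 0" "modular_Lp \<Omega> p (\<lambda>x. u x / l) < \<infinity>" using u by (auto simp: space_Lp_def)
  obtain m where m: "m \<ge> 0" "modular_Lp \<Omega> p (\<lambda>x. u x / l) = ennreal m"
    using l(2) by (cases "modular_Lp \<Omega> p (\<lambda>x. u x / l)") auto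
  define k where "k = max 1 m"
  have "modular_Lp \<Omega> p (\<lambda>x. u x / l / k) \<le> ennreal (1 / k) * ennreal m"
    using modular_scale[of k "\<lambda>x. u x / l"] um unfolding m(2) by (simp add: k_def)
  also have "\<dots> = ennreal (m / k)" using m by (simp add: ennreal_mult[symmetric] k_def)
  also have "\<dots> \<le> ennreal 1" using m by (intro ennreal_leI) (simp add: k_def divide_le_eq)
  finally have "modular_Lp \<Omega> p (\<lambda>x. u x / (l * k)) \<le> 1" by simp
  moreover have "l * k > 0" using l(1) by (simp add: k_def)
  ultimately show "u \<in> borel_measurable M \<and> norm_Lp \<Omega> p u < \<infinity>"
    using um unfolding norm_Lp_def luxemburg_finite_iff by blast
next
  assume u: "u \<in> borel_measurable M \<and> norm_Lp \<Omega> p u < \<infinity>"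
  then obtain l where "l > 0" "modular_Lp \<Omega> p (\<lambda>x. u x / l) \<le> 1"
    unfolding norm_Lp_def luxemburg_finite_iff by blast
  moreover from this(2) have "modular_Lp \<Omega> p (\<lambda>x. u x / l) < \<infinity>" by (rule le_less_trans) simp
  ultimately show "u \<in> space_Lp \<Omega> p" using u by (auto simp: space_Lp_def)
qed

text \<open>On a set of finite measure the energy controls the L1 norm through s \<le> 1 + s^q,
  whatever the exponent q \<ge> 1.\<close>

lemma L1_le_powr:
  fixes f :: "'a \<Rightarrow> 'b::euclidean_space"
  assumes [measurable]: "f \<in> borel_measurable M" and E: "(\<integral>\<^sup>+x. ennreal (norm (f x) powr p x) \<partial>M) \<le> ennreal E" "E \<ge> 0"
  shows "integrable M f" "(LINT x|M. norm (f x)) \<le> vol + E"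
proof -
  have "(\<integral>\<^sup>+x. ennreal (norm (f x)) \<partial>M) \<le> (\<integral>\<^sup>+x. 1 + ennreal (norm (f x) powr p x) \<partial>M)"
  proof (rule nn_integral_mono)
    fix x assume "x \<in> space M"
    then have "norm (f x) \<le> 1 + norm (f x) powr p x" by (intro le_one_plus_powr p_ge) auto
    then have "ennreal (norm (f x)) \<le> ennreal (1 + norm (f x) powr p x)" by (rule ennreal_leI)
    then show "ennreal (norm (f x)) \<le> 1 + ennreal (norm (f x) powr p x)" by (simp add: ennreal_plus)
  qed
  also have "\<dots> = ennreal vol + (\<integral>\<^sup>+x. ennreal (norm (f x) powr p x) \<partial>M)"
    using emeasure_M by (subst nn_integral_add) auto
  also have "\<dots> \<le> ennreal vol + ennreal E" using E by (intro add_left_mono)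
  also have "\<dots> = ennreal (vol + E)" using E vol by (simp add: ennreal_plus)
  finally have le: "(\<integral>\<^sup>+x. ennreal (norm (f x)) \<partial>M) \<le> ennreal (vol + E)" .
  then show i: "integrable M f" by (intro integrableI_bounded) (auto intro: le_less_trans)
  have "ennreal (LINT x|M. norm (f x)) \<le> ennreal (vol + E)"
    using le i by (subst nn_integral_eq_integral[symmetric]) auto
  then show "(LINT x|M. norm (f x)) \<le> vol + E" using E vol by (subst (asm) ennreal_le_iff) auto
qed

lemma L1_le_Lp:
  assumes [measurable]: "u \<in> borel_measurable M" and l: "l > 0" "modular_Lp \<Omega> p (\<lambda>x. u x / l) \<le> 1"
  shows "integrable M u" "(LINT x|M. \<bar>u x\<bar>) \<le> l * (vol + 1)"
proof -
  have "(\<integral>\<^sup>+x. ennreal (norm (u x / l) powr p x) \<partial>M) \<le> ennreal 1"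
    using l(2) by (simp add: modular_Lp_def)
  from L1_le_powr[OF _ this] have 1: "integrable M (\<lambda>x. u x / l)" "(LINT x|M. norm (u x / l)) \<le> vol + 1" by auto
  have "integrable M (\<lambda>x. l * (u x / l))" by (rule integrable_mult_right) (use 1 in auto)
  then show "integrable M u" using l(1) by simp
  have "(LINT x|M. norm (u x / l)) = (LINT x|M. \<bar>u x\<bar>) / l" using l(1) by (simp add: abs_divide)
  then show "(LINT x|M. \<bar>u x\<bar>) \<le> l * (vol + 1)" using 1(2) l(1) by (simp add: divide_le_eq mult.commute)
qed

lemma space_Lp_integrable: "u \<in> space_Lp \<Omega> p \<Longrightarrow> integrable M u"
  unfolding space_Lp_iff norm_Lp_def luxemburg_finite_iff using L1_le_Lp(1) by blast

lemma locally_integrable_M: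
  fixes f :: "'a \<Rightarrow> 'b::euclidean_space"
  assumes f: "integrable M f" and V: "V \<subseteq> \<Omega>"
  shows "locally_integrable V f"
  unfolding locally_integrable_def
proof (intro allI impI)
  fix K assume K: "compact K \<and> K \<subseteq> V"
  have "set_integrable lebesgue \<Omega> f"
    using f unfolding set_integrable_def by (simp add: integrable_restrict_space)
  then show "set_integrable lebesgue K f"
    by (rule set_integrable_subset) (use K V in \<open>auto intro: lmeasurable_compact fmeasurableD\<close>)
qed

section \<open>Competing gradients for the relaxation, and their limit\<close>

definition weak_identity :: "('a \<Rightarrow> real) \<Rightarrow> ('a \<Rightarrow> 'a) \<Rightarrow> bool" where
  "weak_identity v G \<longleftrightarrow> (\<forall>\<phi>\<in>C1_compact \<Omega>. \<forall>b\<in>Basis.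
     (LINT x|M. v x * partial_deriv b \<phi> x) = - (LINT x|M. (G x \<bullet> b) * \<phi> x))"

lemma integrable_test:
  fixes v :: "'a \<Rightarrow> real" and G :: "'a \<Rightarrow> 'a"
  assumes "\<phi> \<in> C1_compact \<Omega>" "b \<in> Basis"
  shows "integrable M v \<Longrightarrow> integrable M (\<lambda>x. v x * partial_deriv b \<phi> x)"
    "integrable M G \<Longrightarrow> integrable M (\<lambda>x. (G x \<bullet> b) * \<phi> x)"
proof -
  show "integrable M (\<lambda>x. v x * partial_deriv b \<phi> x)" if "integrable M v"
    by (rule integrable_test_mult(2)[OF locally_integrable_M[OF that order_refl] assms(1) open_dom assms(2)])
  show "integrable M (\<lambda>x. (G x \<bullet> b) * \<phi> x)" if "integrable M G"
    by (rule integrable_test_mult(1)[OF locally_integrable_M[OF integrable_inner_left order_refl] assms(1) open_dom])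
      (use that in auto)
qed

text \<open>The sets to which the near-minimiser lemma is applied. Of the Lipschitz approximants
  only the linear relation \<open>weak_identity\<close> is retained. With convexity of the energy
  and of the L1 distance this yields closure under midpoints, as that lemma requires.\<close>

definition relaxed :: "('a \<Rightarrow> real) \<Rightarrow> real \<Rightarrow> nat \<Rightarrow> ('a \<Rightarrow> 'a) set" where
  "relaxed u E n = {G. integrable M G \<and> (\<integral>\<^sup>+x. ennreal (norm (G x) powr p x) \<partial>M) \<le> ennreal E \<and>
     (\<exists>v. integrable M v \<and> (LINT x|M. \<bar>v x - u x\<bar>) \<le> 1 / real (Suc n) \<and> weak_identity v G)}"

lemma energy_midpoint:
  fixes G H :: "'a \<Rightarrow> 'a"
  assumes [measurable]: "G \<in> borel_measurable M" "H \<in> borel_measurable M"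
    and "(\<integral>\<^sup>+x. ennreal (norm (G x) powr p x) \<partial>M) \<le> ennreal E" "(\<integral>\<^sup>+x. ennreal (norm (H x) powr p x) \<partial>M) \<le> ennreal E"
    and E: "E \<ge> 0"
  shows "(\<integral>\<^sup>+x. ennreal (norm ((1/2) *\<^sub>R (G x + H x)) powr p x) \<partial>M) \<le> ennreal E"
proof -
  have "(\<integral>\<^sup>+x. ennreal (norm ((1/2) *\<^sub>R (G x + H x)) powr p x) \<partial>M)
     \<le> (\<integral>\<^sup>+x. ennreal (1/2) * (ennreal (norm (G x) powr p x) + ennreal (norm (H x) powr p x)) \<partial>M)"
  proof (rule nn_integral_mono)
    fix x assume "x \<in> space M"
    then have x: "x \<in> \<Omega>" by simp
    have "norm ((1/2) *\<^sub>R (G x + H x)) powr p x \<le> ((norm (G x) + norm (H x)) / 2) powr p x"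
      using norm_triangle_ineq[of "G x" "H x"] p_ge[OF x] by (intro powr_mono2) auto
    also have "\<dots> \<le> (norm (G x) powr p x + norm (H x) powr p x) / 2"
      using p_ge[OF x] by (intro powr_midpoint) auto
    finally have "ennreal (norm ((1/2) *\<^sub>R (G x + H x)) powr p x) \<le> ennreal ((1/2) * (norm (G x) powr p x + norm (H x) powr p x))"
      by (intro ennreal_leI) simp
    also have "\<dots> = ennreal (1/2) * (ennreal (norm (G x) powr p x) + ennreal (norm (H x) powr p x))"
      by (subst ennreal_mult) (auto simp: ennreal_plus)
    finally show "ennreal (norm ((1/2) *\<^sub>R (G x + H x)) powr p x) \<le> ennreal (1/2) * (ennreal (norm (G x) powr p x) + ennreal (norm (H x) powr p x))" .
  qed
  also have "\<dots> = ennreal (1/2) * ((\<integral>\<^sup>+x. ennreal (norm (G x) powr p x) \<partial>M) + (\<integral>\<^sup>+x. ennreal (norm (H x) powr p x) \<partial>M))"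
    by (subst nn_integral_cmult, measurable, subst nn_integral_add, measurable)
  also have "\<dots> \<le> ennreal (1/2) * (ennreal E + ennreal E)"
    by (intro mult_left_mono add_mono assms) simp
  also have "ennreal E + ennreal E = ennreal (E + E)" using E E by (rule ennreal_plus[symmetric])
  also have "ennreal (1/2) * ennreal (E + E) = ennreal ((1/2) * (E + E))"
    by (rule ennreal_mult[symmetric]) (use E in auto)
  also have "(1/2) * (E + E) = E" by simp
  finally show ?thesis .
qed

lemma relaxed_midpoint:
  assumes u: "integrable M u" and E: "E \<ge> 0" and G: "G \<in> relaxed u E n" and H: "H \<in> relaxed u E n"
  shows "(\<lambda>x. (1/2) *\<^sub>R (G x + H x)) \<in> relaxed u E n"
proof -
  obtain v where v: "integrable M v" "(LINT x|M. \<bar>v x - u x\<bar>) \<le> 1 / real (Suc n)" "weak_identity v G"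
    using G unfolding relaxed_def by blast
  obtain w where w: "integrable M w" "(LINT x|M. \<bar>w x - u x\<bar>) \<le> 1 / real (Suc n)" "weak_identity w H"
    using H unfolding relaxed_def by blast
  have Gi: "integrable M G" "integrable M H" using G H by (auto simp: relaxed_def)
  have "(LINT x|M. \<bar>(1/2) * (v x + w x) - u x\<bar>) \<le> (LINT x|M. (1/2) * \<bar>v x - u x\<bar> + (1/2) * \<bar>w x - u x\<bar>)"
  proof (rule integral_mono)
    fix x
    have "\<bar>(a + b) / 2\<bar> \<le> (1/2) * \<bar>a\<bar> + (1/2) * \<bar>b\<bar>" for a b :: real
      using abs_triangle_ineq[of a b] by (simp add: abs_divide)
    from this[of "v x - u x" "w x - u x"]
    have "\<bar>((v x - u x) + (w x - u x)) / 2\<bar> \<le> (1/2) * \<bar>v x - u x\<bar> + (1/2) * \<bar>w x - u x\<bar>" .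
    moreover have "(1/2) * (v x + w x) - u x = ((v x - u x) + (w x - u x)) / 2" by (simp add: field_simps)
    ultimately show "\<bar>(1/2) * (v x + w x) - u x\<bar> \<le> (1/2) * \<bar>v x - u x\<bar> + (1/2) * \<bar>w x - u x\<bar>"
      by (simp only:)
  qed (use v(1) w(1) u in auto)
  also have "\<dots> = (1/2) * (LINT x|M. \<bar>v x - u x\<bar>) + (1/2) * (LINT x|M. \<bar>w x - u x\<bar>)"
    using v(1) w(1) u by simp
  also have "\<dots> \<le> 1 / real (Suc n)" using v(2) w(2) by linarith
  finally have 1: "(LINT x|M. \<bar>(1/2) * (v x + w x) - u x\<bar>) \<le> 1 / real (Suc n)" .
  have 2: "weak_identity (\<lambda>x. (1/2) * (v x + w x)) (\<lambda>x. (1/2) *\<^sub>R (G x + H x))"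
    unfolding weak_identity_def
  proof (intro ballI)
    fix \<phi> :: "'a \<Rightarrow> real" and b :: 'a assume \<phi>: "\<phi> \<in> C1_compact \<Omega>" and b: "b \<in> Basis"
    note t = integrable_test[OF \<phi> b]
    have "(LINT x|M. (1/2) * (v x + w x) * partial_deriv b \<phi> x)
      = (LINT x|M. (1/2) * (v x * partial_deriv b \<phi> x) + (1/2) * (w x * partial_deriv b \<phi> x))"
      by (intro Bochner_Integration.integral_cong) (auto simp: algebra_simps)
    also have "\<dots> = (1/2) * (LINT x|M. v x * partial_deriv b \<phi> x) + (1/2) * (LINT x|M. w x * partial_deriv b \<phi> x)"
      using t(1)[OF v(1)] t(1)[OF w(1)] by simp
    also have "\<dots> = - ((1/2) * (LINT x|M. (G x \<bullet> b) * \<phi> x) + (1/2) * (LINT x|M. (H x \<bullet> b) * \<phi> x))"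
      using v(3) w(3) \<phi> b by (simp add: weak_identity_def)
    also have "\<dots> = - (LINT x|M. (1/2) * ((G x \<bullet> b) * \<phi> x) + (1/2) * ((H x \<bullet> b) * \<phi> x))"
      using t(2)[OF Gi(1)] t(2)[OF Gi(2)] by simp
    finally show "(LINT x|M. (1/2) * (v x + w x) * partial_deriv b \<phi> x) = - (LINT x|M. ((1/2) *\<^sub>R (G x + H x) \<bullet> b) * \<phi> x)"
      by (simp add: algebra_simps)
  qed
  have 3: "(\<integral>\<^sup>+x. ennreal (norm ((1/2) *\<^sub>R (G x + H x)) powr p x) \<partial>M) \<le> ennreal E"
    by (rule energy_midpoint) (use G H Gi E in \<open>auto simp: relaxed_def\<close>)
  have 4: "integrable M (\<lambda>x. (1/2) *\<^sub>R (G x + H x))" using Gi by auto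
  have 5: "integrable M (\<lambda>x. (1/2) * (v x + w x))" using v(1) w(1) by auto
  show ?thesis unfolding relaxed_def using 1 2 3 4 5 by blast
qed

lemma relaxed_decreasing: "m \<le> n \<Longrightarrow> relaxed u E n \<subseteq> relaxed u E m"
proof
  fix G assume mn: "m \<le> n" and G: "G \<in> relaxed u E n"
  have "1 / real (Suc n) \<le> 1 / real (Suc m)" using mn by (intro divide_left_mono) auto
  moreover obtain v where "integrable M v" "(LINT x|M. \<bar>v x - u x\<bar>) \<le> 1 / real (Suc n)" "weak_identity v G"
    using G unfolding relaxed_def by blast
  ultimately show "G \<in> relaxed u E m" using G unfolding relaxed_def by (intro CollectI conjI exI[of _ v]) auto
qed

lemma BV_tilde_relaxed:
  assumes u: "u \<in> BV_tilde \<Omega> p"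
  obtains E where "E \<ge> 0" "\<And>n. relaxed u E n \<noteq> {}"
proof -
  have uL: "u \<in> space_Lp \<Omega> p" and fin: "modular_BV_tilde \<Omega> p u < \<infinity>" using u by (auto simp: BV_tilde_def)
  obtain v where v: "\<And>i. v i \<in> Lip_loc \<Omega> \<inter> space_Lp \<Omega> p" "(\<lambda>i. norm_Lp \<Omega> p (\<lambda>x. v i x - u x)) \<longlonglongrightarrow> 0"
    and lim: "liminf (\<lambda>i. \<integral>\<^sup>+x. ennreal (norm (grad (v i) x) powr p x) \<partial>M) < \<infinity>"
    using fin unfolding modular_BV_tilde_def Inf_less_iff by auto
  obtain E where E: "liminf (\<lambda>i. \<integral>\<^sup>+x. ennreal (norm (grad (v i) x) powr p x) \<partial>M) < ennreal E" "E \<ge> 0"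
  proof -
    obtain r where "r \<ge> 0" "liminf (\<lambda>i. \<integral>\<^sup>+x. ennreal (norm (grad (v i) x) powr p x) \<partial>M) = ennreal r"
      using lim by (cases "liminf (\<lambda>i. \<integral>\<^sup>+x. ennreal (norm (grad (v i) x) powr p x) \<partial>M)") auto
    \<comment> \<open>Raising the bound by 1 makes the inequality strict, so that infinitely many
      members of the sequence have energy below it.\<close>
    then show thesis using that[of "r + 1"] by (simp add: ennreal_less_iff)
  qed
  have fr: "\<exists>\<^sub>F i in sequentially. (\<integral>\<^sup>+x. ennreal (norm (grad (v i) x) powr p x) \<partial>M) < ennreal E"
    using E(1) by (rule less_liminf_imp_frequently)
  have ne: "relaxed u E n \<noteq> {}" for n
  proof -
    \<comment> \<open>A Luxemburg norm below \<eta> gives an L1 norm of at most \<eta> (vol + 1),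
      which is 1/(n+1).\<close>
    define \<eta> where "\<eta> = 1 / (real (Suc n) * (vol + 1))"
    have \<eta>: "\<eta> > 0" using vol by (simp add: \<eta>_def)
    have "\<forall>\<^sub>F i in sequentially. norm_Lp \<Omega> p (\<lambda>x. v i x - u x) < ennreal \<eta>"
      using v(2) by (rule order_tendstoD(2)) (use \<eta> in simp)
    from frequently_ex[OF frequently_eventually_frequently[OF fr this]]
    obtain i where i: "(\<integral>\<^sup>+x. ennreal (norm (grad (v i) x) powr p x) \<partial>M) < ennreal E"
      "norm_Lp \<Omega> p (\<lambda>x. v i x - u x) < ennreal \<eta>" by blast
    obtain l where l: "0 < l" "l < \<eta>" "modular_Lp \<Omega> p (\<lambda>x. (v i x - u x) / l) \<le> 1"
      using i(2) unfolding norm_Lp_def by (rule luxemburg_less_imp)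
    have vm: "v i \<in> borel_measurable M" "u \<in> borel_measurable M" using v(1) uL by (auto simp: space_Lp_def)
    have "(LINT x|M. \<bar>v i x - u x\<bar>) \<le> l * (vol + 1)" using vm l by (intro L1_le_Lp(2)) auto
    also have "\<dots> \<le> \<eta> * (vol + 1)" using l vol by (intro mult_right_mono) auto
    also have "\<dots> = 1 / real (Suc n)" using vol by (simp add: \<eta>_def)
    finally have 1: "(LINT x|M. \<bar>v i x - u x\<bar>) \<le> 1 / real (Suc n)" .
    have vi: "integrable M (v i)" using v(1)[of i] space_Lp_integrable by blast
    have vl: "v i \<in> Lip_loc \<Omega>" using v(1) by blast
    have gm: "grad (v i) \<in> borel_measurable M" by (rule grad_borel_measurable[OF open_dom vl])
    have gi: "integrable M (grad (v i))" using gm i(1) E(2) by (intro L1_le_powr(1)[where E = E]) auto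
    have "weak_identity (v i) (grad (v i))"
      unfolding weak_identity_def
    proof (intro ballI)
      fix \<phi> :: "'a \<Rightarrow> real" and b :: 'a assume \<phi>: "\<phi> \<in> C1_compact \<Omega>" and b: "b \<in> Basis"
      have "grad (v i) x \<bullet> b = partial_deriv b (v i) x" for x
        using b by (simp add: grad_def)
      then show "(LINT x|M. v i x * partial_deriv b \<phi> x) = - (LINT x|M. (grad (v i) x \<bullet> b) * \<phi> x)"
        using Lip_loc_integration_by_parts[OF open_dom vl \<phi>, of b] b by simp
    qed
    then have "grad (v i) \<in> relaxed u E n"
      unfolding relaxed_def using gi i(1) vi 1 by (intro CollectI conjI exI[of _ "v i"]) auto
    then show ?thesis by blast
  qed
  show thesis by (rule that[OF E(2) ne])
qed

text \<open>Fatou's lemma carries the energy bound over to the pointwise limit. The limit of the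
  gradients is not yet tied to \<open>u\<close>: near Y part of their mass may concentrate, so only
  compact subsets of V will allow the weak identity to pass to the limit.\<close>

lemma BV_tilde_limit:
  assumes u: "u \<in> BV_tilde \<Omega> p"
  obtains E Gs G v where "E \<ge> 0" "\<And>k. integrable M (Gs k)" "\<And>k. integrable M (v k)"
    "\<And>k. (\<integral>\<^sup>+x. ennreal (norm (Gs k x) powr p x) \<partial>M) \<le> ennreal E" "\<And>k. weak_identity (v k) (Gs k)"
    "(\<lambda>k. LINT x|M. \<bar>v k x - u x\<bar>) \<longlonglongrightarrow> 0" "AE x in M. (\<lambda>k. Gs k x) \<longlonglongrightarrow> G x" "G \<in> borel_measurable M"
    "(\<integral>\<^sup>+x. ennreal (norm (G x) powr p x) \<partial>M) \<le> ennreal E"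
proof -
  have ui: "integrable M u" using u by (intro space_Lp_integrable) (simp add: BV_tilde_def)
  obtain E where E: "E \<ge> 0" "\<And>n. relaxed u E n \<noteq> {}" using BV_tilde_relaxed[OF u] by blast
  obtain Gs where Gs: "\<And>k. Gs k \<in> relaxed u E k" "AE x in M. convergent (\<lambda>k. Gs k x)"
  proof (rule AE_convergent_near_minimisers[OF finite_M, of "relaxed u E" "vol + E"])
    show "(LINT x|M. norm (G x)) \<le> vol + E" if "G \<in> relaxed u E n" for n G
      using that E(1) by (intro L1_le_powr(2)) (auto simp: relaxed_def)
    show "integrable M G" if "G \<in> relaxed u E n" for n G using that by (simp add: relaxed_def)
  qed (use E(2) relaxed_decreasing relaxed_midpoint[OF ui E(1)] in auto)
  have "\<forall>k. \<exists>v. integrable M v \<and> (LINT x|M. \<bar>v x - u x\<bar>) \<le> 1 / real (Suc k) \<and> weak_identity v (Gs k)"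
    using Gs(1) by (simp add: relaxed_def del: of_nat_Suc)
  from choice[OF this] obtain v where v: "\<forall>k. integrable M (v k) \<and> (LINT x|M. \<bar>v k x - u x\<bar>) \<le> 1 / real (Suc k) \<and> weak_identity (v k) (Gs k)" ..
  have Gi: "\<And>k. integrable M (Gs k)" and Ge: "\<And>k. (\<integral>\<^sup>+x. ennreal (norm (Gs k x) powr p x) \<partial>M) \<le> ennreal E"
    using Gs(1) by (simp_all add: relaxed_def)
  have Gm[measurable]: "\<And>k. Gs k \<in> borel_measurable M" using Gi by auto
  have v1: "\<And>k. integrable M (v k)" and v2: "\<And>k. (LINT x|M. \<bar>v k x - u x\<bar>) \<le> 1 / real (Suc k)" and v3: "\<And>k. weak_identity (v k) (Gs k)"
    using v by auto
  have v4: "(\<lambda>k. LINT x|M. \<bar>v k x - u x\<bar>) \<longlonglongrightarrow> 0"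
  proof (rule tendsto_sandwich[OF _ _ tendsto_const LIMSEQ_inverse_real_of_nat])
    show "\<forall>\<^sub>F k in sequentially. (LINT x|M. \<bar>v k x - u x\<bar>) \<le> inverse (real (Suc k))"
      using v2 by (intro always_eventually allI) (simp add: inverse_eq_divide)
    show "\<forall>\<^sub>F k in sequentially. 0 \<le> (LINT x|M. \<bar>v k x - u x\<bar>)" by simp
  qed
  define G where "G x = lim (\<lambda>k. Gs k x)" for x
  have G: "G \<in> borel_measurable M" unfolding G_def[abs_def] by measurable
  have lim: "AE x in M. (\<lambda>k. Gs k x) \<longlonglongrightarrow> G x"
    using Gs(2) by eventually_elim (simp add: G_def convergent_LIMSEQ_iff)
  have "(\<integral>\<^sup>+x. ennreal (norm (G x) powr p x) \<partial>M) \<le> (\<integral>\<^sup>+x. liminf (\<lambda>k. ennreal (norm (Gs k x) powr p x)) \<partial>M)"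
  proof (rule nn_integral_mono_AE)
    have "AE x in M. x \<in> space M" by (rule AE_space)
    with lim show "AE x in M. ennreal (norm (G x) powr p x) \<le> liminf (\<lambda>k. ennreal (norm (Gs k x) powr p x))"
    proof eventually_elim
      case (elim x)
      have "p x > 0" using p_ge[of x] elim(2) by simp
      then have "(\<lambda>k. norm (Gs k x) powr p x) \<longlonglongrightarrow> norm (G x) powr p x"
        by (intro tendsto_powr2 tendsto_norm elim(1) tendsto_const) auto
      then have "(\<lambda>k. ennreal (norm (Gs k x) powr p x)) \<longlonglongrightarrow> ennreal (norm (G x) powr p x)"
        by (rule tendsto_ennrealI)
      then show ?case using lim_imp_Liminf[OF sequentially_bot] by fastforce
    qed
  qed
  also have "\<dots> \<le> liminf (\<lambda>k. \<integral>\<^sup>+x. ennreal (norm (Gs k x) powr p x) \<partial>M)"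
    by (rule nn_integral_liminf) measurable
  also have "\<dots> \<le> ennreal E"
    by (rule Liminf_le) (use Ge in auto)
  finally have en: "(\<integral>\<^sup>+x. ennreal (norm (G x) powr p x) \<partial>M) \<le> ennreal E" .
  show thesis by (rule that[OF E(1) Gi v1 Ge v3 v4 lim G en])
qed

end

lemma C1_compact_mono: "U \<subseteq> V \<Longrightarrow> C1_compact U \<subseteq> C1_compact V"
  unfolding C1_compact_def by blast

lemma lebesgue_on_integral_subset:
  fixes f :: "'a::euclidean_space \<Rightarrow> real"
  assumes "V \<subseteq> \<Omega>" "V \<in> sets borel" "\<Omega> \<in> sets borel" "\<And>x. x \<notin> V \<Longrightarrow> f x = 0"
  shows "(LINT x|lebesgue_on V. f x) = (LINT x|lebesgue_on \<Omega>. f x)"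
proof -
  have "(\<lambda>x. indicator V x *\<^sub>R f x) = (\<lambda>x. indicator \<Omega> x *\<^sub>R f x)"
    using assms(1,4) by (auto simp: indicator_def fun_eq_iff)
  then show ?thesis using assms(2,3) by (simp add: integral_restrict_space)
qed

lemma integral_mult_tendsto_L1:
  fixes v :: "nat \<Rightarrow> 'b \<Rightarrow> real"
  assumes v: "\<And>k. integrable M (v k)" and u: "integrable M u" and h[measurable]: "h \<in> borel_measurable M"
    and B: "\<And>x. \<bar>h x\<bar> \<le> B" and lim: "(\<lambda>k. LINT x|M. \<bar>v k x - u x\<bar>) \<longlonglongrightarrow> 0"
  shows "(\<lambda>k. LINT x|M. v k x * h x) \<longlonglongrightarrow> (LINT x|M. u x * h x)"
proof -
  have i: "integrable M (\<lambda>x. f x * h x)" if f: "integrable M f" for f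
  proof (rule Bochner_Integration.integrable_bound[OF integrable_mult_right[OF f, of B]])
    have "norm (f x * h x) \<le> norm (B * f x)" for x
      using mult_left_mono[OF B[of x], of "\<bar>f x\<bar>"] mult_right_mono[OF abs_ge_self[of B], of "\<bar>f x\<bar>"]
      by (simp add: abs_mult mult.commute)
    then show "AE x in M. norm (f x * h x) \<le> norm (B * f x)" by simp
    show "(\<lambda>x. f x * h x) \<in> borel_measurable M" using f by measurable
  qed
  have "(\<lambda>k. (LINT x|M. v k x * h x) - (LINT x|M. u x * h x)) \<longlonglongrightarrow> 0"
  proof (rule Lim_null_comparison)
    show "(\<lambda>k. B * (LINT x|M. \<bar>v k x - u x\<bar>)) \<longlonglongrightarrow> 0" using tendsto_mult_right_zero[OF lim] by simp
    have "norm ((LINT x|M. v k x * h x) - (LINT x|M. u x * h x)) \<le> B * (LINT x|M. \<bar>v k x - u x\<bar>)" for k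
    proof -
      have "(LINT x|M. v k x * h x) - (LINT x|M. u x * h x) = (LINT x|M. (v k x - u x) * h x)"
        using i[OF v] i[OF u] by (simp add: left_diff_distrib)
      also have "norm \<dots> \<le> (LINT x|M. norm ((v k x - u x) * h x))" by (rule integral_norm_bound)
      also have "\<dots> \<le> (LINT x|M. B * \<bar>v k x - u x\<bar>)"
      proof (rule integral_mono)
        show "integrable M (\<lambda>x. norm ((v k x - u x) * h x))"
          using i[of "\<lambda>x. v k x - u x"] v u by auto
        show "integrable M (\<lambda>x. B * \<bar>v k x - u x\<bar>)" using v u by auto
        show "norm ((v k x - u x) * h x) \<le> B * \<bar>v k x - u x\<bar>" for x
          using mult_left_mono[OF B[of x], of "\<bar>v k x - u x\<bar>"] by (simp add: abs_mult mult.commute)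
      qed
      finally show ?thesis by simp
    qed
    then show "\<forall>\<^sub>F k in sequentially. norm ((LINT x|M. v k x * h x) - (LINT x|M. u x * h x)) \<le> B * (LINT x|M. \<bar>v k x - u x\<bar>)"
      by simp
  qed
  then show ?thesis by (simp add: LIM_zero_iff)
qed

section \<open>Passing to the limit off Y and in the total variation\<close>

context variable_exponent
begin

definition Y where "Y = {x \<in> \<Omega>. p x = 1}"
definition V where "V = \<Omega> - Y"

lemma V_open: "open V"
proof -
  have "V = \<Omega> \<inter> p -` (- {1})" by (auto simp: V_def Y_def)
  also have "open \<dots>" by (rule continuous_open_preimage[OF p_continuous open_dom]) auto
  finally show ?thesis .
qed

lemma V_sub: "V \<subseteq> \<Omega>" by (auto simp: V_def)

text \<open>On the compact set p is at least some q > 1, so the part of the integrand above a height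
  R is at most R^(1-q) times an integrand with bounded integral. The part below R tends to 0 by
  dominated convergence.\<close>

lemma equiintegrable_L1_limit:
  fixes Gs :: "nat \<Rightarrow> 'a \<Rightarrow> 'a"
  assumes Gi: "\<And>k. integrable M (Gs k)" and Ge: "\<And>k. (\<integral>\<^sup>+x. ennreal (norm (Gs k x) powr p x) \<partial>M) \<le> ennreal E"
    and lim: "AE x in M. (\<lambda>k. Gs k x) \<longlonglongrightarrow> G x" and G[measurable]: "G \<in> borel_measurable M"
    and en: "(\<integral>\<^sup>+x. ennreal (norm (G x) powr p x) \<partial>M) \<le> ennreal E" and E: "E \<ge> 0"
    and K: "compact K" "K \<subseteq> V"
  shows "(\<lambda>k. LINT x|M. indicator K x * norm (Gs k x - G x)) \<longlonglongrightarrow> 0"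
proof -
  interpret finite_measure M by (rule finite_M)
  have [measurable]: "\<And>k. Gs k \<in> borel_measurable M" using Gi by auto
  have Gint: "integrable M G" using G en E by (rule L1_le_powr(1))
  have Km[measurable]: "(indicator K :: 'a \<Rightarrow> real) \<in> borel_measurable M"
    by (rule measurable_restrict_space1)
      (use fmeasurableD[OF lmeasurable_compact[OF K(1)]] in simp)
  \<comment> \<open>The minimum of the continuous exponent over K exceeds 1 because K avoids
    Y.\<close>
  obtain q where q: "q > 1" "\<And>x. x \<in> K \<Longrightarrow> q \<le> p x"
  proof (cases "K = {}")
    case False
    have "continuous_on K p" using p_continuous K V_sub by (meson continuous_on_subset order_trans)
    then obtain x0 where x0: "x0 \<in> K" "\<forall>x\<in>K. p x0 \<le> p x" using continuous_attains_inf[OF K(1) False] by blast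
    have "x0 \<in> \<Omega>" "p x0 \<noteq> 1" using x0(1) K(2) by (auto simp: V_def Y_def)
    then have "p x0 > 1" using p_ge[of x0] by simp
    then show thesis using that x0(2) by blast
  qed (use that[of 2] in auto)
  define f where "f k x = norm (Gs k x - G x)" for k x
  have fm[measurable]: "\<And>k. f k \<in> borel_measurable M" unfolding f_def by measurable
  have fi: "integrable M (f k)" for k unfolding f_def using Gi Gint by auto
  define E' where "E' = 2 powr P * (E + E)"
  have E': "E' \<ge> 0" using E by (simp add: E'_def)
  have fe: "(\<integral>\<^sup>+x. ennreal (f k x powr p x) \<partial>M) \<le> ennreal E'" for k
  proof -
    have "(\<integral>\<^sup>+x. ennreal (f k x powr p x) \<partial>M)
       \<le> (\<integral>\<^sup>+x. ennreal (2 powr P) * (ennreal (norm (Gs k x) powr p x) + ennreal (norm (G x) powr p x)) \<partial>M)"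
    proof (rule nn_integral_mono)
      fix x assume "x \<in> space M"
      then have x: "x \<in> \<Omega>" by simp
      have "f k x powr p x \<le> (norm (Gs k x) + norm (G x)) powr p x"
        unfolding f_def using norm_triangle_ineq4[of "Gs k x" "G x"] p_ge[OF x] by (intro powr_mono2) auto
      also have "\<dots> \<le> 2 powr P * (norm (Gs k x) powr p x + norm (G x) powr p x)"
        using p_ge[OF x] p_le[OF x] by (intro powr_add_le) auto
      finally have "ennreal (f k x powr p x) \<le> ennreal (2 powr P * (norm (Gs k x) powr p x + norm (G x) powr p x))"
        by (rule ennreal_leI)
      also have "\<dots> = ennreal (2 powr P) * (ennreal (norm (Gs k x) powr p x) + ennreal (norm (G x) powr p x))"
        by (subst ennreal_mult) (auto simp: ennreal_plus)
      finally show "ennreal (f k x powr p x) \<le> ennreal (2 powr P) * (ennreal (norm (Gs k x) powr p x) + ennreal (norm (G x) powr p x))" .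
    qed
    also have "\<dots> = ennreal (2 powr P) * ((\<integral>\<^sup>+x. ennreal (norm (Gs k x) powr p x) \<partial>M) + (\<integral>\<^sup>+x. ennreal (norm (G x) powr p x) \<partial>M))"
      by (subst nn_integral_cmult, measurable, subst nn_integral_add, measurable)
    also have "\<dots> \<le> ennreal (2 powr P) * (ennreal E + ennreal E)"
      by (intro mult_left_mono add_mono Ge en) simp
    also have "ennreal E + ennreal E = ennreal (E + E)" using E E by (rule ennreal_plus[symmetric])
    also have "ennreal (2 powr P) * ennreal (E + E) = ennreal E'"
      unfolding E'_def by (rule ennreal_mult[symmetric]) (use E in auto)
    finally show ?thesis .
  qed
  have fpi: "integrable M (\<lambda>x. f k x powr p x)" for k
    by (rule integrableI_bounded) (use fe[of k] in \<open>auto intro: le_less_trans\<close>)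
  have fpe: "(LINT x|M. f k x powr p x) \<le> E'" for k
  proof -
    have "ennreal (LINT x|M. f k x powr p x) \<le> ennreal E'"
      using fe[of k] by (subst nn_integral_eq_integral[symmetric, OF fpi]) auto
    then show ?thesis using E' by (subst (asm) ennreal_le_iff) auto
  qed
  \<comment> \<open>Where f > R \<ge> 1, write f as f^(1-p) f^p; the first factor is at most
    R^(1-q).\<close>
  have ptw: "indicator K x * f k x \<le> min (f k x) R + R powr (1 - q) * f k x powr p x" if R: "R \<ge> 1" for R k x
  proof (cases "x \<in> K \<and> f k x > R")
    case True
    then have x: "x \<in> K" "f k x > R" by auto
    have f0: "f k x > 0" using x R by simp
    have "f k x = f k x powr (1 - p x) * f k x powr p x" using f0 by (simp flip: powr_add)
    also have "\<dots> \<le> R powr (1 - q) * f k x powr p x"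
    proof (rule mult_right_mono)
      have "f k x powr (1 - p x) \<le> R powr (1 - p x)" using x R q(2)[OF x(1)] q(1) by (intro powr_mono2') auto
      also have "\<dots> \<le> R powr (1 - q)" using R q(2)[OF x(1)] by (intro powr_mono) auto
      finally show "f k x powr (1 - p x) \<le> R powr (1 - q)" .
    qed simp
    finally show ?thesis using x R by simp
  next
    case False
    then have "indicator K x * f k x \<le> min (f k x) R" using R by (auto simp: indicator_def f_def)
    then show ?thesis by (simp add: add_increasing2)
  qed
  have dct: "(\<lambda>k. LINT x|M. min (f k x) R) \<longlonglongrightarrow> (LINT x|M. 0)" if R: "R \<ge> 1" for R
  proof (rule integral_dominated_convergence[where w = "\<lambda>_. R"])
    show "AE x in M. (\<lambda>k. min (f k x) R) \<longlonglongrightarrow> 0"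
      using lim
    proof eventually_elim
      case (elim x)
      have "(\<lambda>k. min (norm (Gs k x - G x)) R) \<longlonglongrightarrow> min (norm (G x - G x)) R"
        by (intro tendsto_intros elim)
      then show ?case using R by (simp add: f_def)
    qed
    have "norm (min (f k x) R) \<le> R" for k x using R by (auto simp: f_def min_def)
    then show "\<And>k. AE x in M. norm (min (f k x) R) \<le> R" by simp
  qed auto
  show ?thesis
    unfolding f_def[symmetric]
  proof (rule LIMSEQ_I)
    fix r :: real assume r: "r > 0"
    have "((\<lambda>R. R powr (1 - q) * E') \<longlongrightarrow> 0 * E') at_top"
      by (intro tendsto_mult tendsto_const tendsto_neg_powr filterlim_ident) (use q in auto)
    then have "\<forall>\<^sub>F R in at_top. R powr (1 - q) * E' < r / 2"
      using r by (intro order_tendstoD(2)[of _ "0 * E'"]) auto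
    with eventually_ge_at_top[of 1] have "\<forall>\<^sub>F R in at_top. R \<ge> 1 \<and> R powr (1 - q) * E' < r / 2"
      by eventually_elim auto
    then obtain R where R: "R \<ge> 1" "R powr (1 - q) * E' < r / 2"
      using eventually_happens[of _ "at_top :: real filter"] by auto
    have "\<forall>\<^sub>F k in sequentially. (LINT x|M. min (f k x) R) < r / 2"
      using dct[OF R(1)] r by (intro order_tendstoD(2)[of _ 0]) auto
    then obtain N where N: "\<And>k. k \<ge> N \<Longrightarrow> (LINT x|M. min (f k x) R) < r / 2"
      by (auto simp: eventually_sequentially)
    have "norm ((LINT x|M. indicator K x * f k x) - 0) < r" if k: "k \<ge> N" for k
    proof -
      have Ki: "integrable M (\<lambda>x. indicator K x * f k x)"
      proof (rule Bochner_Integration.integrable_bound[OF fi[of k]])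
        show "AE x in M. norm (indicator K x * f k x) \<le> norm (f k x)" by (auto simp: indicator_def)
      qed measurable
      have mi: "integrable M (\<lambda>x. min (f k x) R)"
      proof (rule Bochner_Integration.integrable_bound[OF fi[of k]])
        show "AE x in M. norm (min (f k x) R) \<le> norm (f k x)" using R by (auto simp: f_def min_def)
      qed measurable
      have "(LINT x|M. indicator K x * f k x) \<le> (LINT x|M. min (f k x) R + R powr (1 - q) * f k x powr p x)"
        using Ki mi fpi ptw[OF R(1)] by (intro integral_mono) auto
      also have "\<dots> = (LINT x|M. min (f k x) R) + R powr (1 - q) * (LINT x|M. f k x powr p x)"
        using mi fpi by simp
      also have "\<dots> \<le> (LINT x|M. min (f k x) R) + R powr (1 - q) * E'"
        using fpe by (intro add_left_mono mult_left_mono) auto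
      also have "\<dots> < r" using N[OF k] R by linarith
      finally have "(LINT x|M. indicator K x * f k x) < r" .
      moreover have "(LINT x|M. indicator K x * f k x) \<ge> 0"
        by (rule Bochner_Integration.integral_nonneg) (simp add: f_def)
      ultimately show ?thesis by simp
    qed
    then show "\<exists>N. \<forall>k\<ge>N. norm ((LINT x|M. indicator K x * f k x) - 0) < r" by blast
  qed
qed

theorem BV_tilde_imp_BV:
  assumes u: "u \<in> BV_tilde \<Omega> p"
  shows "u \<in> BV \<Omega> p"
proof -
  have uL: "u \<in> space_Lp \<Omega> p" using u by (simp add: BV_tilde_def)
  have ui: "integrable M u" using uL by (rule space_Lp_integrable)
  show ?thesis
  proof (rule BV_tilde_limit[OF u])
    fix E Gs G v
    assume E: "E \<ge> 0" and Gi: "\<And>k. integrable M (Gs k)" and vi: "\<And>k. integrable M (v k)"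
      and Ge: "\<And>k. (\<integral>\<^sup>+x. ennreal (norm (Gs k x) powr p x) \<partial>M) \<le> ennreal E" and wi: "\<And>k. weak_identity (v k) (Gs k)"
      and vl: "(\<lambda>k. LINT x|M. \<bar>v k x - u x\<bar>) \<longlonglongrightarrow> 0" and Gl: "AE x in M. (\<lambda>k. Gs k x) \<longlonglongrightarrow> G x"
      and Gm[measurable]: "G \<in> borel_measurable M" and en: "(\<integral>\<^sup>+x. ennreal (norm (G x) powr p x) \<partial>M) \<le> ennreal E"
    have Gint: "integrable M G" using Gm en E by (rule L1_le_powr(1))
    have um: "u \<in> borel_measurable M" using ui by auto
    have Vb: "V \<in> sets borel" using V_open by simp
    have lhs: "(\<lambda>k. LINT x|M. v k x * partial_deriv b \<phi> x) \<longlonglongrightarrow> (LINT x|M. u x * partial_deriv b \<phi> x)"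
      if \<phi>: "\<phi> \<in> C1_compact \<Omega>" and b: "b \<in> Basis" for \<phi> b
    proof (rule C1_compact_partial[OF \<phi>, of b])
      fix B assume B: "\<And>x. \<bar>partial_deriv b \<phi> x\<bar> \<le> B" and c: "continuous_on UNIV (partial_deriv b \<phi>)"
      show ?thesis
      proof (rule integral_mult_tendsto_L1[OF vi ui _ B vl])
        have "partial_deriv b \<phi> \<in> borel_measurable lebesgue"
          by (rule measurable_completion) (simp add: borel_measurable_continuous_onI[OF c])
        then show "partial_deriv b \<phi> \<in> borel_measurable M" by (rule measurable_restrict_space1)
      qed
    qed (use b in simp)
    have "has_weak_gradient V (\<lambda>x. u x / l) (\<lambda>x. G x /\<^sub>R l)" if l: "l > 0" for l
      unfolding has_weak_gradient_def
    proof (intro conjI ballI)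
      have "integrable M (\<lambda>x. u x / l)" "integrable M (\<lambda>x. G x /\<^sub>R l)" using ui Gint by auto
      then show "locally_integrable V (\<lambda>x. u x / l)" "locally_integrable V (\<lambda>x. G x /\<^sub>R l)"
        using locally_integrable_M V_sub by auto
      fix \<phi> :: "'a \<Rightarrow> real" and b :: 'a assume \<phi>: "\<phi> \<in> C1_compact V" and b: "b \<in> Basis"
      have \<phi>': "\<phi> \<in> C1_compact \<Omega>" using \<phi> C1_compact_mono[OF V_sub] by blast
      have "(LINT x|M. u x * partial_deriv b \<phi> x) = - (LINT x|M. (G x \<bullet> b) * \<phi> x)
          \<and> (\<forall>x. x \<notin> V \<longrightarrow> \<phi> x = 0 \<and> partial_deriv b \<phi> x = 0)"
      proof (rule C1_compact_partial[OF \<phi>, of b])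
        fix B
        define K where "K = closure {x. \<phi> x \<noteq> 0}"
        assume B: "\<And>x. \<bar>\<phi> x\<bar> \<le> B" and c: "continuous_on UNIV \<phi>"
          and z: "\<And>x. x \<notin> closure {x. \<phi> x \<noteq> 0} \<Longrightarrow> \<phi> x = 0" "\<And>x. x \<notin> closure {x. \<phi> x \<noteq> 0} \<Longrightarrow> partial_deriv b \<phi> x = 0"
          and K: "compact (closure {x. \<phi> x \<noteq> 0})" "closure {x. \<phi> x \<noteq> 0} \<subseteq> V"
        note z = z[folded K_def] and K = K[folded K_def]
        have Kl: "K \<in> sets lebesgue" using K(1) by (simp add: lmeasurable_compact fmeasurableD)
        have Km[measurable]: "(indicator K :: 'a \<Rightarrow> real) \<in> borel_measurable M"
          by (rule measurable_restrict_space1) (use Kl in simp)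
        have \<phi>m: "\<phi> \<in> borel_measurable M"
        proof (rule measurable_restrict_space1)
          show "\<phi> \<in> borel_measurable lebesgue"
            by (rule measurable_completion) (simp add: borel_measurable_continuous_onI[OF c])
        qed
        \<comment> \<open>The cutoff to the support K of the test function changes none of the
          products with \<phi> and confines the gradients to where they converge in L1.\<close>
        have ki: "integrable M (\<lambda>x. indicator K x * (H x \<bullet> b))" if "integrable M H" for H :: "'a \<Rightarrow> 'a"
        proof (rule Bochner_Integration.integrable_bound[OF integrable_inner_left[of b, OF that]])
          show "(\<lambda>x. indicator K x * (H x \<bullet> b)) \<in> borel_measurable M" using that by measurable
        qed (auto simp: indicator_def)
        have "(\<lambda>k. LINT x|M. (indicator K x * (Gs k x \<bullet> b)) * \<phi> x) \<longlonglongrightarrow> (LINT x|M. (indicator K x * (G x \<bullet> b)) * \<phi> x)"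
        proof (rule integral_mult_tendsto_L1[OF ki[OF Gi] ki[OF Gint] \<phi>m B])
          show "(\<lambda>k. LINT x|M. \<bar>indicator K x * (Gs k x \<bullet> b) - indicator K x * (G x \<bullet> b)\<bar>) \<longlonglongrightarrow> 0"
          proof (rule tendsto_sandwich[OF _ _ tendsto_const equiintegrable_L1_limit[OF Gi Ge Gl Gm en E K]])
            show "\<forall>\<^sub>F k in sequentially. 0 \<le> (LINT x|M. \<bar>indicator K x * (Gs k x \<bullet> b) - indicator K x * (G x \<bullet> b)\<bar>)"
              by simp
            have "(LINT x|M. \<bar>indicator K x * (Gs k x \<bullet> b) - indicator K x * (G x \<bullet> b)\<bar>) \<le> (LINT x|M. indicator K x * norm (Gs k x - G x))" for k
            proof (rule integral_mono)
              show "integrable M (\<lambda>x. \<bar>indicator K x * (Gs k x \<bullet> b) - indicator K x * (G x \<bullet> b)\<bar>)"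
                using ki[OF Gi] ki[OF Gint] by auto
              show "integrable M (\<lambda>x. indicator K x * norm (Gs k x - G x))"
              proof (rule Bochner_Integration.integrable_bound[of M "\<lambda>x. Gs k x - G x"])
                show "(\<lambda>x. indicator K x * norm (Gs k x - G x)) \<in> borel_measurable M" using Gi[of k] by measurable
              qed (use Gi Gint in \<open>auto simp: indicator_def\<close>)
              have "\<bar>Gs k x \<bullet> b - G x \<bullet> b\<bar> \<le> norm (Gs k x - G x)" for x
                using Basis_le_norm[OF b, of "Gs k x - G x"] by (simp add: inner_diff_left)
              then show "\<bar>indicator K x * (Gs k x \<bullet> b) - indicator K x * (G x \<bullet> b)\<bar> \<le> indicator K x * norm (Gs k x - G x)" for x
                by (simp add: indicator_def)
            qed
            then show "\<forall>\<^sub>F k in sequentially. (LINT x|M. \<bar>indicator K x * (Gs k x \<bullet> b) - indicator K x * (G x \<bullet> b)\<bar>)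
              \<le> (LINT x|M. indicator K x * norm (Gs k x - G x))" by simp
          qed
        qed
        moreover have "(indicator K x * (H x \<bullet> b)) * \<phi> x = (H x \<bullet> b) * \<phi> x" for x and H :: "'a \<Rightarrow> 'a"
          using z(1)[of x] by (cases "x \<in> K") auto
        ultimately have "(\<lambda>k. LINT x|M. (Gs k x \<bullet> b) * \<phi> x) \<longlonglongrightarrow> (LINT x|M. (G x \<bullet> b) * \<phi> x)" by simp
        from tendsto_minus[OF this]
        have "(\<lambda>k. LINT x|M. v k x * partial_deriv b \<phi> x) \<longlonglongrightarrow> - (LINT x|M. (G x \<bullet> b) * \<phi> x)"
          using wi \<phi>' b by (simp add: weak_identity_def)
        with lhs[OF \<phi>' b] have "(LINT x|M. u x * partial_deriv b \<phi> x) = - (LINT x|M. (G x \<bullet> b) * \<phi> x)"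
          by (rule LIMSEQ_unique)
        then show ?thesis using z K(2) by blast
      qed (use b in simp)
      then have eq: "(LINT x|M. u x * partial_deriv b \<phi> x) = - (LINT x|M. (G x \<bullet> b) * \<phi> x)"
        and z: "\<And>x. x \<notin> V \<Longrightarrow> \<phi> x = 0" "\<And>x. x \<notin> V \<Longrightarrow> partial_deriv b \<phi> x = 0" by auto
      have "(LINT x|lebesgue_on V. u x / l * partial_deriv b \<phi> x) = (LINT x|M. u x / l * partial_deriv b \<phi> x)"
        by (rule lebesgue_on_integral_subset[OF V_sub Vb dom_borel]) (simp add: z)
      moreover have "(LINT x|lebesgue_on V. ((G x /\<^sub>R l) \<bullet> b) * \<phi> x) = (LINT x|M. ((G x /\<^sub>R l) \<bullet> b) * \<phi> x)"
        by (rule lebesgue_on_integral_subset[OF V_sub Vb dom_borel]) (simp add: z)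
      moreover have "(LINT x|M. u x / l * partial_deriv b \<phi> x) = (LINT x|M. u x * partial_deriv b \<phi> x) / l" by simp
      moreover have "(LINT x|M. ((G x /\<^sub>R l) \<bullet> b) * \<phi> x) = (LINT x|M. (G x \<bullet> b) * \<phi> x) / l"
        by (simp add: divide_inverse mult.commute mult.left_commute flip: integral_mult_right_zero)
      ultimately show "(LINT x|lebesgue_on V. u x / l * partial_deriv b \<phi> x) = - (LINT x|lebesgue_on V. ((G x /\<^sub>R l) \<bullet> b) * \<phi> x)"
        using eq by simp
    qed
    note wg = this
    have energy: "weak_gradient_energy V p (\<lambda>x. u x / l) \<le> ennreal (E / l)" if l: "l \<ge> 1" for l
    proof -
      have l0: "l > 0" using l by simp
      \<comment> \<open>The energy is defined through a chosen weak gradient of u / l; by uniqueness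
        it may be evaluated with the explicit one, G / l.\<close>
      have "has_weak_gradient V (\<lambda>x. u x / l) (weak_gradient V (\<lambda>x. u x / l))"
        using someI[of "has_weak_gradient V (\<lambda>x. u x / l)", OF wg[OF l0]] by (simp add: weak_gradient_def)
      from weak_gradient_unique[OF V_open this wg[OF l0]]
      have ae: "AE x in lebesgue. x \<in> V \<longrightarrow> weak_gradient V (\<lambda>x. u x / l) x = G x /\<^sub>R l" .
      have "weak_gradient_energy V p (\<lambda>x. u x / l)
          = (\<integral>\<^sup>+x. ennreal (norm (weak_gradient V (\<lambda>x. u x / l) x) powr p x) \<partial>lebesgue_on V)"
        using wg[OF l0] by (auto simp: weak_gradient_energy_def)
      also have "\<dots> = (\<integral>\<^sup>+x. ennreal (norm (weak_gradient V (\<lambda>x. u x / l) x) powr p x) * indicator V x \<partial>lebesgue)"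
        using Vb by (simp add: nn_integral_restrict_space)
      also have "\<dots> \<le> (\<integral>\<^sup>+x. ennreal (1 / l) * ennreal (norm (G x) powr p x) * indicator \<Omega> x \<partial>lebesgue)"
      proof (rule nn_integral_mono_AE)
        show "AE x in lebesgue. ennreal (norm (weak_gradient V (\<lambda>x. u x / l) x) powr p x) * indicator V x
            \<le> ennreal (1 / l) * ennreal (norm (G x) powr p x) * indicator \<Omega> x"
          using ae
        proof eventually_elim
          case (elim x)
          show ?case
          proof (cases "x \<in> V")
            case True
            then have x: "x \<in> \<Omega>" using V_sub by blast
            have "(norm (G x) / l) powr p x \<le> (1 / l) * norm (G x) powr p x"
              using l p_ge[OF x] by (intro powr_divide_le) auto
            then have "ennreal ((norm (G x) / l) powr p x) \<le> ennreal (1 / l) * ennreal (norm (G x) powr p x)"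
              using l by (simp add: ennreal_mult[symmetric] ennreal_leI)
            moreover have "norm (G x /\<^sub>R l) = norm (G x) / l" using l by (simp add: divide_inverse mult.commute)
            ultimately show ?thesis using elim True x by simp
          qed simp
        qed
      qed
      also have "\<dots> = (\<integral>\<^sup>+x. ennreal (1 / l) * ennreal (norm (G x) powr p x) \<partial>M)"
        by (simp add: nn_integral_restrict_space)
      also have "\<dots> = ennreal (1 / l) * (\<integral>\<^sup>+x. ennreal (norm (G x) powr p x) \<partial>M)"
        by (rule nn_integral_cmult) measurable
      also have "\<dots> \<le> ennreal (1 / l) * ennreal E" by (intro mult_left_mono en) simp
      also have "\<dots> = ennreal (E / l)" using l E by (simp add: ennreal_mult[symmetric])
      finally show ?thesis .
    qed
    have var: "variation \<Omega> (\<lambda>x. u x / l) Y \<le> ennreal ((vol + E) / l)" if l: "l \<ge> 1" for l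
    proof -
      \<comment> \<open>The whole of \<Omega> is an admissible neighbourhood of Y, and the bound on
        the L1 norms of the gradients controls the variation there.\<close>
      have "variation \<Omega> (\<lambda>x. u x / l) Y \<le> variation_open (\<lambda>x. u x / l) \<Omega>"
        unfolding variation_def by (rule INF_lower) (use open_dom in \<open>auto simp: Y_def\<close>)
      also have "\<dots> \<le> ennreal ((vol + E) / l)"
        unfolding variation_open_def
      proof (rule SUP_least)
        fix \<phi> :: "'a \<Rightarrow> 'a" assume "\<phi> \<in> {\<phi> \<in> C1_compact \<Omega>. \<forall>x\<in>\<Omega>. norm (\<phi> x) \<le> 1}"
        then have \<phi>: "\<phi> \<in> C1_compact \<Omega>" and n: "\<And>x. x \<in> \<Omega> \<Longrightarrow> norm (\<phi> x) \<le> 1" by auto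
        note \<phi>b = component_in_C1_compact[OF \<phi>]
        have D: "(LINT x|M. w x * divergence \<phi> x) = (\<Sum>b\<in>Basis. LINT x|M. w x * partial_deriv b (\<lambda>y. \<phi> y \<bullet> b) x)"
          if w: "integrable M w" for w
          unfolding divergence_def sum_distrib_left
          by (rule Bochner_Integration.integral_sum) (rule integrable_test(1)[OF \<phi>b _ w])
        have "(\<lambda>k. LINT x|M. v k x * divergence \<phi> x) \<longlonglongrightarrow> (LINT x|M. u x * divergence \<phi> x)"
          unfolding D[OF vi] D[OF ui] by (intro tendsto_sum lhs \<phi>b)
        moreover have "(LINT x|M. v k x * divergence \<phi> x) \<le> vol + E" for k
        proof -
          have "(LINT x|M. v k x * divergence \<phi> x) = (\<Sum>b\<in>Basis. - (LINT x|M. (Gs k x \<bullet> b) * (\<phi> x \<bullet> b)))"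
            unfolding D[OF vi] using wi[of k] \<phi>b by (intro sum.cong) (auto simp: weak_identity_def)
          also have "\<dots> = - (LINT x|M. (\<Sum>b\<in>Basis. (Gs k x \<bullet> b) * (\<phi> x \<bullet> b)))"
            by (subst Bochner_Integration.integral_sum) (auto intro: integrable_test(2)[OF \<phi>b _ Gi] simp: sum_negf)
          also have "\<dots> \<le> (LINT x|M. \<bar>\<Sum>b\<in>Basis. (Gs k x \<bullet> b) * (\<phi> x \<bullet> b)\<bar>)"
            using integral_abs_bound[of M "\<lambda>x. \<Sum>b\<in>Basis. (Gs k x \<bullet> b) * (\<phi> x \<bullet> b)"] by linarith
          also have "\<dots> \<le> (LINT x|M. norm (Gs k x))"
          proof (rule integral_mono)
            show "integrable M (\<lambda>x. \<bar>\<Sum>b\<in>Basis. (Gs k x \<bullet> b) * (\<phi> x \<bullet> b)\<bar>)"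
              by (intro integrable_abs Bochner_Integration.integrable_sum integrable_test(2)[OF \<phi>b _ Gi])
            show "integrable M (\<lambda>x. norm (Gs k x))" using Gi by auto
            fix x assume "x \<in> space M"
            then have "norm (\<phi> x) \<le> 1" using n by simp
            have "\<bar>Gs k x \<bullet> \<phi> x\<bar> \<le> norm (Gs k x) * norm (\<phi> x)" by (rule Cauchy_Schwarz_ineq2)
            also have "\<dots> \<le> norm (Gs k x) * 1" using \<open>norm (\<phi> x) \<le> 1\<close> by (intro mult_left_mono) auto
            finally show "\<bar>\<Sum>b\<in>Basis. (Gs k x \<bullet> b) * (\<phi> x \<bullet> b)\<bar> \<le> norm (Gs k x)"
              by (simp add: euclidean_inner[of "Gs k x" "\<phi> x"])
          qed
          also have "\<dots> \<le> vol + E" using Gi[of k] Ge[of k] E by (intro L1_le_powr(2)) auto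
          finally show ?thesis .
        qed
        ultimately have "(LINT x|M. u x * divergence \<phi> x) \<le> vol + E" by (intro LIMSEQ_le_const2) auto
        then have "(LINT x|M. u x / l * divergence \<phi> x) \<le> (vol + E) / l" using l by (simp add: divide_right_mono)
        then show "ennreal (LINT x|M. u x / l * divergence \<phi> x) \<le> ennreal ((vol + E) / l)" by (rule ennreal_leI)
      qed
      finally show ?thesis .
    qed
    \<comment> \<open>Variation and energy of u / l are at most (vol + E) / l and E / l, so this l
      brings their sum below 1.\<close>
    define l where "l = vol + 2 * E + 1"
    have l: "l \<ge> 1" "l > 0" using vol E by (auto simp: l_def)
    have "modular_BV \<Omega> p (\<lambda>x. u x / l) \<le> ennreal ((vol + E) / l) + ennreal (E / l)"
      unfolding modular_BV_def Let_def Y_def[symmetric] V_def[symmetric]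
      by (intro add_mono var energy l)
    also have "\<dots> = ennreal ((vol + 2 * E) / l)"
      using vol E l by (subst ennreal_plus[symmetric]) (auto simp: add_divide_distrib)
    also have "\<dots> \<le> ennreal 1" using l by (intro ennreal_leI) (simp add: l_def)
    finally have "luxemburg (modular_BV \<Omega> p) u < \<infinity>"
      unfolding luxemburg_finite_iff by (intro exI[of _ l] conjI l(2)) simp
    then show ?thesis
      using um uL by (auto simp: BV_def norm_BV_def space_Lp_iff)
  qed
qed

end

subsection \<open>Mollification of functions of bounded variation\<close>

text \<open>Let the centre move with velocity b and the scale grow at rate m. The motion carries a
  point at offset z with velocity b + (m/t) z; this field is the kernel times that velocity, its
  momentum.\<close>

definition kern_field :: "real \<Rightarrow> 'a::euclidean_space \<Rightarrow> real \<Rightarrow> 'a \<Rightarrow> 'a" where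
  "kern_field t z m b = kern t z *\<^sub>R (b + (m / t) *\<^sub>R z)"

lemma kern_deriv_field:
  fixes z :: "'a::euclidean_space"
  shows "kern_deriv t z m (- b) = - (kern_grad t z \<bullet> (b + (m / t) *\<^sub>R z) + DIM('a) * (m / t) * kern t z)"
proof -
  have "(norm z)\<^sup>2 = z \<bullet> z" by (simp add: power2_norm_eq_inner)
  then show ?thesis
    using bump_mass_pos[where 'a='a]
    by (cases "t = 0") (simp_all add: kern_deriv_def kern_grad_def kern_def inner_add_right field_simps power2_eq_square power3_eq_cube)
qed

lemma kern_field_component_derivative:
  assumes t: "t > 0"
  shows "((\<lambda>y. kern_field t (y - x) m b \<bullet> c) has_derivative
    (\<lambda>h. (((b + (m / t) *\<^sub>R (y - x)) \<bullet> c) *\<^sub>R kern_grad t (y - x) + (kern t (y - x) * (m / t)) *\<^sub>R c) \<bullet> h)) (at y)"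
proof -
  have "((\<lambda>y. kern t (y - x) * ((b + (m / t) *\<^sub>R (y - x)) \<bullet> c)) has_derivative
    (\<lambda>h. kern t (y - x) * ((m / t) *\<^sub>R h \<bullet> c) + (kern_grad t (y - x) \<bullet> h) * ((b + (m / t) *\<^sub>R (y - x)) \<bullet> c))) (at y)"
    by (rule has_derivative_mult[OF kern_has_grad[OF t]]) (auto intro!: derivative_eq_intros)
  then show ?thesis
    by (simp add: kern_field_def inner_add_left inner_commute[of c] mult_ac add.commute)
qed

lemma kern_field_norm:
  assumes t: "t > 0" and m: "\<bar>m\<bar> \<le> 1/2" and b: "norm b = 1"
  shows "norm (kern_field t z m b) \<le> 2 * kern t z"
proof (cases "norm z < t")
  case True
  have "norm (b + (m / t) *\<^sub>R z) \<le> norm b + \<bar>m\<bar> / t * norm z"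
    using norm_triangle_ineq[of b "(m / t) *\<^sub>R z"] t by simp
  also have "\<bar>m\<bar> / t * norm z \<le> (1/2) / t * t"
    using True m t by (intro mult_mono divide_right_mono) auto
  finally have "norm (b + (m / t) *\<^sub>R z) \<le> 2" using b t by simp
  then have "kern t z * norm (b + (m / t) *\<^sub>R z) \<le> kern t z * 2"
    using kern_nonneg[of t z] t by (intro mult_left_mono) auto
  then show ?thesis using kern_nonneg[of t z] t by (simp add: kern_field_def)
next
  case False
  then show ?thesis using kern_outside(1)[OF t, of z] by (simp add: kern_field_def)
qed

lemma kern_field_component_C1:
  assumes t: "t > 0" and sub: "cball x t \<subseteq> U"
  shows "(\<lambda>y. kern_field t (y - x) m b \<bullet> c) \<in> C1_compact U"
proof (rule C1_compactI[OF kern_field_component_derivative[OF t]])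
  have "continuous_on UNIV (\<lambda>y. kern t (y - x))"
    by (intro continuous_at_imp_continuous_on ballI has_derivative_continuous[OF kern_has_grad[OF t]])
  then show "continuous_on UNIV (\<lambda>y. ((b + (m / t) *\<^sub>R (y - x)) \<bullet> c) *\<^sub>R kern_grad t (y - x) + (kern t (y - x) * (m / t)) *\<^sub>R c)"
    by (intro continuous_intros continuous_on_kern_grad[OF t])
  show "kern_field t (y - x) m b \<bullet> c = 0" if "y \<notin> cball x t" for y
    using that kern_outside(1)[OF t, of "y - x"] by (simp add: kern_field_def dist_norm norm_minus_commute)
qed (use sub in auto)

text \<open>The continuity equation: the moving kernel keeps its mass, so its rate of change is
  minus the divergence of the momentum.\<close>

lemma kern_field_divergence:
  fixes x :: "'a::euclidean_space"
  assumes t: "t > 0"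
  shows "(\<Sum>c\<in>Basis. partial_deriv c (\<lambda>y. kern_field t (y - x) m b \<bullet> c) y) = - kern_deriv t (y - x) m (- b)"
proof -
  have "partial_deriv c (\<lambda>y. kern_field t (y - x) m b \<bullet> c) y
     = ((b + (m / t) *\<^sub>R (y - x)) \<bullet> c) * (kern_grad t (y - x) \<bullet> c) + kern t (y - x) * (m / t) * (c \<bullet> c)" for c
    by (subst partial_deriv_eqI[OF has_derivative_partial[OF kern_field_component_derivative[OF t]]])
      (simp add: inner_add_left)
  then have "(\<Sum>c\<in>Basis. partial_deriv c (\<lambda>y. kern_field t (y - x) m b \<bullet> c) y)
     = (\<Sum>c\<in>Basis. ((b + (m / t) *\<^sub>R (y - x)) \<bullet> c) * (kern_grad t (y - x) \<bullet> c)) + DIM('a) * (kern t (y - x) * (m / t))"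
    by (simp add: sum.distrib inner_same_Basis)
  also have "(\<Sum>c\<in>Basis. ((b + (m / t) *\<^sub>R (y - x)) \<bullet> c) * (kern_grad t (y - x) \<bullet> c)) = kern_grad t (y - x) \<bullet> (b + (m / t) *\<^sub>R (y - x))"
    by (subst euclidean_inner[of "kern_grad t (y - x)"]) (simp add: mult.commute)
  finally show ?thesis by (simp add: kern_deriv_field)
qed

lemma C1_compact_of_components:
  fixes \<phi> :: "'a::euclidean_space \<Rightarrow> 'b::euclidean_space"
  assumes c: "\<And>c. c \<in> Basis \<Longrightarrow> (\<lambda>x. \<phi> x \<bullet> c) \<in> C1_compact U"
  shows "\<phi> \<in> C1_compact U"
proof -
  have "\<forall>c\<in>Basis. \<exists>\<phi>'. (\<forall>x. ((\<lambda>x. \<phi> x \<bullet> c) has_derivative blinfun_apply (\<phi>' x)) (at x)) \<and> continuous_on UNIV \<phi>'"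
  proof
    fix c :: 'b assume "c \<in> Basis"
    from c[OF this] show "\<exists>\<phi>'. (\<forall>x. ((\<lambda>x. \<phi> x \<bullet> c) has_derivative blinfun_apply (\<phi>' x)) (at x)) \<and> continuous_on UNIV \<phi>'"
      unfolding C1_compact_def by (elim CollectE conjE)
  qed
  from bchoice[OF this] obtain D where D: "\<forall>c\<in>Basis. (\<forall>x. ((\<lambda>x. \<phi> x \<bullet> c) has_derivative blinfun_apply (D c x)) (at x)) \<and> continuous_on UNIV (D c)" ..
  define \<phi>' where "\<phi>' x = (\<Sum>c\<in>Basis. blinfun_scaleR_left c o\<^sub>L D c x)" for x
  have "(\<phi> has_derivative blinfun_apply (\<phi>' x)) (at x)" for x
  proof (rule has_derivative_componentwise_within[THEN iffD2], intro ballI)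
    fix i :: 'b assume i: "i \<in> Basis"
    have "blinfun_apply (\<phi>' x) h \<bullet> i = blinfun_apply (D i x) h" for h
    proof -
      have "blinfun_apply (\<phi>' x) h = (\<Sum>c\<in>Basis. blinfun_apply (D c x) h *\<^sub>R c)"
        by (simp add: \<phi>'_def blinfun.sum_left)
      then show ?thesis using i by (simp only: inner_sum_left_Basis)
    qed
    then show "((\<lambda>x. \<phi> x \<bullet> i) has_derivative (\<lambda>h. blinfun_apply (\<phi>' x) h \<bullet> i)) (at x)"
      using D i by simp
  qed
  note der = this
  have cont: "continuous_on UNIV \<phi>'"
    unfolding \<phi>'_def by (intro continuous_intros) (use D in auto)
  define C where "C = (\<Union>c\<in>Basis. closure {x. \<phi> x \<bullet> c \<noteq> 0})"
  have Cc: "compact (closure {x. \<phi> x \<bullet> c \<noteq> 0})" "closure {x. \<phi> x \<bullet> c \<noteq> 0} \<subseteq> U" if "c \<in> Basis" for c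
    using c[OF that] by (simp_all add: C1_compact_def)
  have C: "compact C" "C \<subseteq> U"
    unfolding C_def using Cc by (auto intro!: compact_UN simp del: closure_subset_eq)
  have "{x. \<phi> x \<noteq> 0} \<subseteq> C"
  proof
    fix x assume "x \<in> {x. \<phi> x \<noteq> 0}"
    then have "\<not> (\<forall>u\<in>Basis. \<phi> x \<bullet> u = 0)" unfolding euclidean_all_zero_iff by simp
    then obtain c where c: "c \<in> Basis" "\<phi> x \<bullet> c \<noteq> 0" by blast
    then have "x \<in> closure {x. \<phi> x \<bullet> c \<noteq> 0}" using closure_subset[of "{x. \<phi> x \<bullet> c \<noteq> 0}"] by blast
    then show "x \<in> C" using c(1) unfolding C_def by blast
  qed
  then have sub: "closure {x. \<phi> x \<noteq> 0} \<subseteq> C" using C(1) by (rule closure_minimal[OF _ compact_imp_closed])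
  then have comp: "compact (closure {x. \<phi> x \<noteq> 0})"
    using C(1) by (metis closed_closure compact_Int_closed inf.absorb_iff2)
  have sU: "closure {x. \<phi> x \<noteq> 0} \<subseteq> U" using sub C(2) by (rule order_trans)
  have "\<forall>x. (\<phi> has_derivative blinfun_apply (\<phi>' x)) (at x)" using der by (rule allI)
  note ders = this
  show ?thesis
    unfolding C1_compact_def
  proof (rule CollectI, rule conjI, rule exI[of _ \<phi>'], rule conjI)
    show "\<forall>x. (\<phi> has_derivative blinfun_apply (\<phi>' x)) (at x)" by (rule ders)
    show "continuous_on UNIV \<phi>'" by (rule cont)
    show "compact (closure {x. \<phi> x \<noteq> 0}) \<and> closure {x. \<phi> x \<noteq> 0} \<subseteq> U" using comp sU by (rule conjI)
  qed
qed

text \<open>With X = e + 1/d, \<open>a\<close> is at most (1 + K) X^n, and X^r \<le> e^c because r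
  \<le> c / ln X. A power law in the radius and a logarithmic modulus of the exponent thus
  compensate exactly.\<close>

lemma powr_log_Holder:
  fixes a K r q c d :: real
  assumes a: "0 \<le> a" "a \<le> K / d ^ n" and d: "d > 0" and K: "K \<ge> 0"
    and r: "0 \<le> r" "r \<le> c / ln (exp 1 + 1 / d)" and c: "c > 0"
  shows "a powr (q + r) \<le> exp (c * (ln (1 + K) + n)) * a powr q"
proof (cases "a = 0")
  case False
  define e where "e = exp 1 + 1 / d"
  have e1: "1 \<le> e" "1 / d \<le> e" "0 < e" using d by (auto simp: e_def add_increasing2 add_pos_pos)
  have le: "1 \<le> ln e" unfolding e_def
    by (subst ln_exp[of 1, symmetric], subst ln_le_cancel_iff) (use d in \<open>auto intro: add_pos_pos\<close>)
  have "a \<le> K * (1 / d) ^ n" using a by (simp add: power_divide)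
  also have "\<dots> \<le> K * e ^ n" using K e1 d by (intro mult_left_mono power_mono) auto
  \<comment> \<open>Replacing K by 1 + K makes the logarithm nonnegative, so that r may be estimated
    by c in front of it.\<close>
  also have "\<dots> \<le> (1 + K) * e ^ n" using e1 by (intro mult_right_mono) auto
  finally have a2: "a \<le> (1 + K) * e ^ n" .
  have X1: "1 \<le> (1 + K) * e ^ n" using K e1 mult_mono[of 1 "1 + K" 1 "e ^ n"] by simp
  have "a powr r \<le> ((1 + K) * e ^ n) powr r" using a a2 r by (intro powr_mono2) auto
  also have "\<dots> = exp (r * (ln (1 + K) + n * ln e))"
    using K e1 X1 by (simp add: powr_def ln_mult ln_realpow)
  also have "\<dots> \<le> exp (c * (ln (1 + K) + n))"
  proof -
    have "r * ln (1 + K) \<le> c * ln (1 + K)"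
    proof (rule mult_right_mono)
      have "r \<le> c / ln e" using r by (simp add: e_def)
      also have "\<dots> \<le> c / 1" using le c by (intro divide_left_mono) auto
      finally show "r \<le> c" by simp
    qed (use K in simp)
    moreover have "r * ln e \<le> c" using r(2) le by (simp add: e_def[symmetric] pos_le_divide_eq)
    then have "n * (r * ln e) \<le> n * c" by (intro mult_left_mono) auto
    ultimately show ?thesis by (simp add: algebra_simps)
  qed
  finally have "a powr r \<le> exp (c * (ln (1 + K) + n))" .
  then have "a powr r * a powr q \<le> exp (c * (ln (1 + K) + n)) * a powr q" by (intro mult_right_mono) auto
  then show ?thesis by (simp add: powr_add mult.commute)
qed simp

context variable_exponent
begin

text \<open>The factor of \<open>powr_log_Holder\<close> for an average bounded by H /
  (\<open>bump_mass\<close> times t^n), where n is the dimension.\<close>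

definition Jensen_const :: "real \<Rightarrow> real" where
  "Jensen_const H = exp (c * (ln (1 + H / bump_mass TYPE('a)) + DIM('a)))"

text \<open>Jensen's inequality holds for a constant exponent. It is applied with a lower bound q of
  p on the ball, where h^q \<le> 1 + h^p; the missing power p(x) - q of the mean is then absorbed by
  the log-Hoelder estimate. The summand 1 in F pays for the points where h \<le> 1.\<close>

lemma mollify_Jensen:
  fixes h :: "'a \<Rightarrow> real"
  assumes vs: "variable_scale \<Omega> \<delta>" and h: "integrable lborel h" "\<And>y. h y \<ge> 0" "(LINT y|lborel. h y) \<le> H"
    and F: "integrable lborel F" "\<And>y. y \<in> \<Omega> \<Longrightarrow> F y = 1 + h y powr p y" "\<And>y. F y \<ge> 0"
    and x: "x \<in> \<Omega>" and ball: "cball x (\<delta> x) \<subseteq> \<Omega>"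
  shows "(mollify \<delta> h x) powr p x \<le> Jensen_const H * mollify \<delta> F x"
proof -
  interpret variable_scale \<Omega> \<delta> by (rule vs)
  define t where "t = \<delta> x"
  have t: "t > 0" unfolding t_def by (rule \<delta>_pos[OF x])
  define a where "a = mollify \<delta> h x"
  \<comment> \<open>By log-Hoelder continuity q is at most p on the whole ball; the maximum with 1
    keeps the power convex.\<close>
  define q where "q = max 1 (p x - c / ln (exp 1 + 1 / t))"
  have lt: "1 \<le> ln (exp 1 + 1 / t)" using t by (rule ln_ge_1)
  have q: "q \<ge> 1" "q \<le> p x" "p x - q \<le> c / ln (exp 1 + 1 / t)"
    using p_ge[OF x] c_pos lt by (auto simp: q_def)
  have qp: "q \<le> p y" if y: "y \<in> cball x t" for y
  proof (cases "y = x")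
    case False
    have yO: "y \<in> \<Omega>" using y ball by (auto simp: t_def)
    have n: "0 < norm (x - y)" "norm (x - y) \<le> t" using False y by (auto simp: dist_norm)
    have "p x - p y \<le> c / ln (exp 1 + 1 / norm (x - y))"
      using p_log_Holder[OF x yO] False by (auto simp: abs_le_iff)
    also have "\<dots> \<le> c / ln (exp 1 + 1 / t)"
    proof (rule divide_left_mono)
      have "1 / t \<le> 1 / norm (x - y)" using n t by (intro divide_left_mono) auto
      then show "ln (exp 1 + 1 / t) \<le> ln (exp 1 + 1 / norm (x - y))"
        using add_pos_pos[OF exp_gt_zero, of "1 / t" 1] add_pos_pos[OF exp_gt_zero, of "1 / norm (x - y)" 1] t n
        by (subst ln_le_cancel_iff) simp_all
      show "0 < ln (exp 1 + 1 / norm (x - y)) * ln (exp 1 + 1 / t)"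
        using lt ln_ge_1[OF n(1)] by (intro mult_pos_pos) auto
    qed (use c_pos in simp)
    finally show ?thesis using p_ge[OF yO] by (simp add: q_def)
  qed (use q in simp)
  have k: "integrable lborel (\<lambda>y. kern t (y - x) * h y)" using h(1) t by (rule integrable_kern_mult)
  have kF: "integrable lborel (\<lambda>y. kern t (y - x) * F y)" using F(1) t by (rule integrable_kern_mult)
  have k1: "integrable lborel (\<lambda>y. kern t (y - x))" "(LINT y|lborel. kern t (y - x)) = 1"
    using kern_integral[OF t, of x] by auto
  have kn: "kern t z \<ge> 0" for z :: 'a using t by (intro kern_nonneg) simp
  have a0: "a \<ge> 0" unfolding a_def mollify_def
    by (rule Bochner_Integration.integral_nonneg) (use kn h(2) in \<open>auto simp: t_def\<close>)
  have I: "bump_mass TYPE('a) > 0" by (rule bump_mass_pos)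
  have "0 \<le> (LINT y|lborel. h y)" by (rule Bochner_Integration.integral_nonneg) (rule h(2))
  then have H0: "H \<ge> 0" using h(3) by linarith
  have aH: "a \<le> H / bump_mass TYPE('a) / t ^ DIM('a)"
  proof -
    have "a \<le> (LINT y|lborel. 1 / (bump_mass TYPE('a) * t ^ DIM('a)) * h y)"
      unfolding a_def mollify_def t_def[symmetric]
    proof (rule integral_mono[OF k])
      show "integrable lborel (\<lambda>y. 1 / (bump_mass TYPE('a) * t ^ DIM('a)) * h y)" using h(1) by (rule integrable_mult_right)
      show "kern t (y - x) * h y \<le> 1 / (bump_mass TYPE('a) * t ^ DIM('a)) * h y" for y
        by (intro mult_right_mono kern_le t h)
    qed
    also have "\<dots> = 1 / (bump_mass TYPE('a) * t ^ DIM('a)) * (LINT y|lborel. h y)" by simp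
    also have "\<dots> \<le> 1 / (bump_mass TYPE('a) * t ^ DIM('a)) * H" using I t h(3) by (intro mult_left_mono) auto
    finally show ?thesis by simp
  qed
  have aq: "a powr q \<le> mollify \<delta> F x"
  proof (cases "a = 0")
    case True
    have "mollify \<delta> F x \<ge> 0" unfolding mollify_def
      by (rule Bochner_Integration.integral_nonneg) (use kn F(3) in \<open>auto simp: t_def\<close>)
    then show ?thesis using True by simp
  next
    case False
    then have ap: "a > 0" using a0 by simp
    define s where "s = q * a powr (q - 1)"
    \<comment> \<open>Integrate the tangent of s^q at the mean a against the kernel. The kernel has
      mass 1 and a is the mean of h, so the linear term vanishes.\<close>
    have "a powr q = (LINT y|lborel. (a powr q - s * a) * kern t (y - x) + s * (kern t (y - x) * h y))"
      using k k1 by (simp add: a_def mollify_def t_def[symmetric])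
    also have "\<dots> \<le> (LINT y|lborel. kern t (y - x) * F y)"
    proof (rule integral_mono)
      show "integrable lborel (\<lambda>y. (a powr q - s * a) * kern t (y - x) + s * (kern t (y - x) * h y))" using k k1 by auto
      show "integrable lborel (\<lambda>y. kern t (y - x) * F y)" by (rule kF)
      fix y
      show "(a powr q - s * a) * kern t (y - x) + s * (kern t (y - x) * h y) \<le> kern t (y - x) * F y"
      proof (cases "norm (y - x) < t")
        case True
        then have yb: "y \<in> cball x t" by (simp add: dist_norm norm_minus_commute)
        then have yO: "y \<in> \<Omega>" using ball by (auto simp: t_def)
        have "a powr q + s * (h y - a) \<le> h y powr q" unfolding s_def by (rule powr_ge_tangent[OF h(2) ap q(1)])
        also have "\<dots> \<le> 1 + h y powr p y"
        proof (cases "h y \<le> 1")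
          case True
          then have "h y powr q \<le> 1" using h(2)[of y] q(1) powr_mono2[of q "h y" 1] by simp
          then show ?thesis by (simp add: add_increasing2)
        next
          case False
          then have "h y powr q \<le> h y powr p y" using qp[OF yb] by (intro powr_mono) auto
          then show ?thesis by simp
        qed
        also have "\<dots> = F y" using F(2)[OF yO] by simp
        finally have "kern t (y - x) * (a powr q + s * (h y - a)) \<le> kern t (y - x) * F y"
          using kn by (rule mult_left_mono)
        then show ?thesis by (simp add: algebra_simps)
      next
        case False
        then show ?thesis using kern_outside(1)[OF t, of "y - x"] by simp
      qed
    qed
    finally show ?thesis by (simp add: mollify_def t_def)
  qed
  have "a powr p x = a powr (q + (p x - q))" by simp
  also have "\<dots> \<le> Jensen_const H * a powr q"
    unfolding Jensen_const_def
    by (rule powr_log_Holder[OF a0 aH t]) (use q H0 I c_pos in auto)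
  also have "\<dots> \<le> Jensen_const H * mollify \<delta> F x"
    using aq by (intro mult_left_mono) (auto simp: Jensen_const_def)
  finally show ?thesis by (simp add: a_def)
qed

end

section \<open>Differentiation of superposed kernel fields\<close>

lemma integrable_bounded_mult:
  fixes f h :: "'b \<Rightarrow> real"
  assumes f: "integrable M f" and h: "h \<in> borel_measurable M" and B: "\<And>x. \<bar>h x\<bar> \<le> B"
  shows "integrable M (\<lambda>x. f x * h x)"
proof (rule Bochner_Integration.integrable_bound[OF integrable_mult_right[OF f, of B]])
  have "norm (f x * h x) \<le> norm (B * f x)" for x
    using mult_left_mono[OF B[of x], of "\<bar>f x\<bar>"] mult_right_mono[OF abs_ge_self[of B], of "\<bar>f x\<bar>"]
    by (simp add: abs_mult mult.commute)
  then show "AE x in M. norm (f x * h x) \<le> norm (B * f x)" by simp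
  show "(\<lambda>x. f x * h x) \<in> borel_measurable M" using f h by measurable
qed

lemma C1_compact_scale:
  fixes \<phi> :: "'a::euclidean_space \<Rightarrow> 'a"
  assumes \<phi>: "\<phi> \<in> C1_compact U"
  shows "(\<lambda>x. \<sigma> *\<^sub>R \<phi> x) \<in> C1_compact U" "divergence (\<lambda>x. \<sigma> *\<^sub>R \<phi> x) x = \<sigma> * divergence \<phi> x"
proof -
  obtain \<phi>' where 1: "\<forall>x. (\<phi> has_derivative blinfun_apply (\<phi>' x)) (at x)" "continuous_on UNIV \<phi>'"
    and K: "compact (closure {x. \<phi> x \<noteq> 0})" "closure {x. \<phi> x \<noteq> 0} \<subseteq> U"
    using \<phi> unfolding C1_compact_def by blast
  have sub: "closure {x. \<sigma> *\<^sub>R \<phi> x \<noteq> 0} \<subseteq> closure {x. \<phi> x \<noteq> 0}"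
    by (rule closure_mono) auto
  then have k: "compact (closure {x. \<sigma> *\<^sub>R \<phi> x \<noteq> 0})"
    using K(1) by (metis closed_closure compact_Int_closed inf.absorb_iff2)
  have d: "\<forall>x. ((\<lambda>x. \<sigma> *\<^sub>R \<phi> x) has_derivative blinfun_apply (\<sigma> *\<^sub>R \<phi>' x)) (at x)"
  proof
    fix x
    have "((\<lambda>x. \<sigma> *\<^sub>R \<phi> x) has_derivative (\<lambda>h. \<sigma> *\<^sub>R blinfun_apply (\<phi>' x) h)) (at x)"
      by (rule has_derivative_scaleR_right) (use 1(1) in blast)
    then show "((\<lambda>x. \<sigma> *\<^sub>R \<phi> x) has_derivative blinfun_apply (\<sigma> *\<^sub>R \<phi>' x)) (at x)"
      by (simp add: scaleR_blinfun.rep_eq)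
  qed
  have c: "continuous_on UNIV (\<lambda>x. \<sigma> *\<^sub>R \<phi>' x)" by (intro continuous_intros 1)
  have sU: "closure {x. \<sigma> *\<^sub>R \<phi> x \<noteq> 0} \<subseteq> U" using sub K(2) by (rule order_trans)
  show "(\<lambda>x. \<sigma> *\<^sub>R \<phi> x) \<in> C1_compact U"
    unfolding C1_compact_def
  proof (rule CollectI, rule conjI, rule exI[of _ "\<lambda>x. \<sigma> *\<^sub>R \<phi>' x"], rule conjI)
    show "\<forall>x. ((\<lambda>x. \<sigma> *\<^sub>R \<phi> x) has_derivative blinfun_apply (\<sigma> *\<^sub>R \<phi>' x)) (at x)" by (rule d)
    show "continuous_on UNIV (\<lambda>x. \<sigma> *\<^sub>R \<phi>' x)" by (rule c)
    show "compact (closure {x. \<sigma> *\<^sub>R \<phi> x \<noteq> 0}) \<and> closure {x. \<sigma> *\<^sub>R \<phi> x \<noteq> 0} \<subseteq> U" using k sU by (rule conjI)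
  qed
  have "partial_deriv b (\<lambda>y. (\<sigma> *\<^sub>R \<phi> y) \<bullet> b) x = \<sigma> * partial_deriv b (\<lambda>y. \<phi> y \<bullet> b) x" if b: "b \<in> Basis" for b
  proof (rule C1_compact_partial[OF component_in_C1_compact[OF \<phi>, of b], of b])
    assume "\<And>x. ((\<lambda>t. \<phi> (x + t *\<^sub>R b) \<bullet> b) has_real_derivative partial_deriv b (\<lambda>y. \<phi> y \<bullet> b) x) (at 0)"
    from DERIV_cmult[OF this[of x], of \<sigma>] show ?thesis
      by (intro partial_deriv_eqI) simp
  qed (use b in simp)
  then show "divergence (\<lambda>x. \<sigma> *\<^sub>R \<phi> x) x = \<sigma> * divergence \<phi> x"
    by (simp add: divergence_def sum_distrib_left)
qed

text \<open>By the mean value inequality a bound w on the gradients is also a Lipschitz bound for q,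
  so the normalised remainders are dominated by 2 w.\<close>

lemma has_derivative_integral_dominated:
  fixes q :: "'b \<Rightarrow> 'a::euclidean_space \<Rightarrow> real" and Q :: "'b \<Rightarrow> 'a \<Rightarrow> 'a"
  assumes der: "\<And>x y. ((\<lambda>y. q x y) has_derivative (\<lambda>h. Q x y \<bullet> h)) (at y)"
    and qi: "\<And>y. integrable M (\<lambda>x. q x y)" and Qm: "\<And>y. (\<lambda>x. Q x y) \<in> borel_measurable M"
    and w: "integrable M w" and Qw: "\<And>x y. norm (Q x y) \<le> w x"
  shows "((\<lambda>y. LINT x|M. q x y) has_derivative (\<lambda>h. (LINT x|M. Q x y) \<bullet> h)) (at y)"
    and "(\<And>x. continuous_on UNIV (Q x)) \<Longrightarrow> continuous_on UNIV (\<lambda>y. LINT x|M. Q x y)"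
proof -
  have Qi: "integrable M (\<lambda>x. Q x y)" for y
    by (rule Bochner_Integration.integrable_bound[OF w Qm])
      (use Qw in \<open>auto intro!: always_eventually intro: order_trans[OF _ abs_ge_self]\<close>)
  have w0: "w x \<ge> 0" for x using Qw[of x] norm_ge_zero order_trans by blast
  have lip: "\<bar>q x y - q x z\<bar> \<le> w x * norm (y - z)" for x y z
  proof -
    have "norm (q x y - q x z) \<le> w x * norm (y - z)"
    proof (rule differentiable_bound[where S = UNIV and f' = "\<lambda>y h. Q x y \<bullet> h"])
      fix y show "onorm (\<lambda>h. Q x y \<bullet> h) \<le> w x"
      proof (rule onorm_le)
        fix h
        have "norm (Q x y \<bullet> h) \<le> norm (Q x y) * norm h" by (simp add: Cauchy_Schwarz_ineq2)
        also have "\<dots> \<le> w x * norm h" by (intro mult_right_mono Qw) simp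
        finally show "norm (Q x y \<bullet> h) \<le> w x * norm h" .
      qed
    qed (use der in \<open>auto simp: has_derivative_at_withinI\<close>)
    then show ?thesis by simp
  qed
  show "((\<lambda>y. LINT x|M. q x y) has_derivative (\<lambda>h. (LINT x|M. Q x y) \<bullet> h)) (at y)"
    unfolding has_derivative_at_within
  proof (intro conjI)
    show "bounded_linear (\<lambda>h. (LINT x|M. Q x y) \<bullet> h)" by (rule bounded_linear_inner_right)
    show "((\<lambda>z. ((LINT x|M. q x z) - (LINT x|M. q x y) - (LINT x|M. Q x y) \<bullet> (z - y)) /\<^sub>R norm (z - y)) \<longlongrightarrow> 0) (at y)"
    proof (subst tendsto_at_iff_sequentially, intro allI impI)
      fix Z :: "nat \<Rightarrow> 'a" assume Z: "\<forall>i. Z i \<in> UNIV - {y}" "Z \<longlonglongrightarrow> y"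
      define r where "r i x = (q x (Z i) - q x y - Q x y \<bullet> (Z i - y)) /\<^sub>R norm (Z i - y)" for i x
      have nz: "norm (Z i - y) > 0" for i using Z(1) by auto
      have fl: "filterlim Z (at y) sequentially" using Z by (auto simp: filterlim_at)
      have ri: "integrable M (r i)" for i
        unfolding r_def by (intro integrable_scaleR_right Bochner_Integration.integrable_diff qi integrable_inner_left Qi)
      have "(\<lambda>i. LINT x|M. r i x) \<longlonglongrightarrow> (LINT x|M. 0)"
      proof (rule integral_dominated_convergence[where w = "\<lambda>x. 2 * w x"])
        show "integrable M (\<lambda>x. 2 * w x)" using w by simp
        have "(\<lambda>i. r i x) \<longlonglongrightarrow> 0" for x
        proof -
          have "((\<lambda>z. (q x z - q x y - Q x y \<bullet> (z - y)) /\<^sub>R norm (z - y)) \<longlongrightarrow> 0) (at y)"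
            using der[of x y] unfolding has_derivative_at_within by blast
          from filterlim_compose[OF this fl] show ?thesis by (simp add: r_def)
        qed
        then show "AE x in M. (\<lambda>i. r i x) \<longlonglongrightarrow> 0" by simp
        have "norm (r i x) \<le> 2 * w x" for i x
        proof -
          have "\<bar>Q x y \<bullet> (Z i - y)\<bar> \<le> norm (Q x y) * norm (Z i - y)" by (rule Cauchy_Schwarz_ineq2)
          also have "\<dots> \<le> w x * norm (Z i - y)" by (intro mult_right_mono Qw) simp
          finally have "\<bar>q x (Z i) - q x y - Q x y \<bullet> (Z i - y)\<bar> \<le> 2 * w x * norm (Z i - y)"
            using lip[of x "Z i" y] by linarith
          then have "\<bar>q x (Z i) - q x y - Q x y \<bullet> (Z i - y)\<bar> / norm (Z i - y) \<le> 2 * w x"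
            using nz[of i] by (simp add: pos_divide_le_eq)
          then show ?thesis by (simp add: r_def abs_mult divide_inverse mult.commute)
        qed
        then show "\<And>i. AE x in M. norm (r i x) \<le> 2 * w x" by simp
      qed (use ri in auto)
      moreover have "(LINT x|M. r i x) = ((LINT x|M. q x (Z i)) - (LINT x|M. q x y) - (LINT x|M. Q x y) \<bullet> (Z i - y)) /\<^sub>R norm (Z i - y)" for i
        unfolding r_def using qi Qi by (simp add: integrable_inner_left)
      ultimately show "((\<lambda>z. ((LINT x|M. q x z) - (LINT x|M. q x y) - (LINT x|M. Q x y) \<bullet> (z - y)) /\<^sub>R norm (z - y)) \<circ> Z) \<longlonglongrightarrow> 0"
        by (simp add: comp_def)
    qed
  qed
  show "continuous_on UNIV (\<lambda>y. LINT x|M. Q x y)" if c: "\<And>x. continuous_on UNIV (Q x)"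
  proof (rule continuous_at_imp_continuous_on, intro ballI)
    fix y
    show "isCont (\<lambda>y. LINT x|M. Q x y) y"
      unfolding isCont_def
    proof (subst tendsto_at_iff_sequentially, intro allI impI)
      fix Z :: "nat \<Rightarrow> 'a" assume Z: "\<forall>i. Z i \<in> UNIV - {y}" "Z \<longlonglongrightarrow> y"
      have "(\<lambda>i. LINT x|M. Q x (Z i)) \<longlonglongrightarrow> (LINT x|M. Q x y)"
      proof (rule integral_dominated_convergence[where w = w])
        have "(\<lambda>i. Q x (Z i)) \<longlonglongrightarrow> Q x y" for x
          using continuous_on_tendsto_compose[OF c Z(2), of x] by simp
        then show "AE x in M. (\<lambda>i. Q x (Z i)) \<longlonglongrightarrow> Q x y" by simp
        show "\<And>i. AE x in M. norm (Q x (Z i)) \<le> w x" using Qw by simp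
      qed (use Qm w in auto)
      then show "((\<lambda>y. LINT x|M. Q x y) \<circ> Z) \<longlonglongrightarrow> (LINT x|M. Q x y)" by (simp add: comp_def)
    qed
  qed
qed

text \<open>Take the bound for directional derivatives in the direction of the gradient itself and
  cancel one factor of its norm.\<close>

lemma kern_grad_norm:
  fixes z :: "'a::euclidean_space"
  assumes t: "t > 0"
  shows "norm (kern_grad t z) \<le> (4 + DIM('a)) / (bump_mass TYPE('a) * t ^ Suc DIM('a))"
proof (cases "kern_grad t z = 0")
  case False
  have "norm (kern_grad t z) * norm (kern_grad t z) = \<bar>kern_deriv t z 0 (kern_grad t z)\<bar>"
    by (simp add: kern_deriv_grad dot_square_norm power2_eq_square)
  also have "\<dots> \<le> (4 + DIM('a)) * (norm (kern_grad t z) + \<bar>0\<bar>) / (bump_mass TYPE('a) * t ^ Suc DIM('a))"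
    by (rule kern_deriv_le[OF t])
  finally have "norm (kern_grad t z) * norm (kern_grad t z) \<le> (4 + DIM('a)) / (bump_mass TYPE('a) * t ^ Suc DIM('a)) * norm (kern_grad t z)"
    by simp
  then show ?thesis by (rule mult_right_le_imp_le) (use False in simp)
next
  case True
  then show ?thesis using t bump_mass_pos[where 'a='a] by simp
qed

text \<open>The gradient in z of the component of \<open>kern_field\<close> along
  \<open>c\<close>.\<close>

definition field_grad :: "real \<Rightarrow> 'a::euclidean_space \<Rightarrow> real \<Rightarrow> 'a \<Rightarrow> 'a \<Rightarrow> 'a" where
  "field_grad t z m b c = ((b + (m / t) *\<^sub>R z) \<bullet> c) *\<^sub>R kern_grad t z + (kern t z * (m / t)) *\<^sub>R c"

lemma field_grad_norm:
  fixes z :: "'a::euclidean_space"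
  assumes t: "t0 > 0" "t \<ge> t0" and m: "\<bar>m\<bar> \<le> 1/2" and b: "norm b = 1" and c: "norm c = 1"
  shows "norm (field_grad t z m b c) \<le> 2 * (5 + DIM('a)) / (bump_mass TYPE('a) * t0 ^ Suc DIM('a))"
proof (cases "norm z < t")
  case True
  have I: "bump_mass TYPE('a) > 0" by (rule bump_mass_pos)
  have t1: "t > 0" using t by simp
  have "norm (b + (m / t) *\<^sub>R z) \<le> norm b + \<bar>m\<bar> / t * norm z"
    using norm_triangle_ineq[of b "(m / t) *\<^sub>R z"] t1 by simp
  also have "\<bar>m\<bar> / t * norm z \<le> (1/2) / t * t"
    using True m t1 by (intro mult_mono divide_right_mono) auto
  finally have "norm (b + (m / t) *\<^sub>R z) \<le> 2" using b t1 by simp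
  then have 1: "\<bar>(b + (m / t) *\<^sub>R z) \<bullet> c\<bar> \<le> 2"
    using Cauchy_Schwarz_ineq2[of "b + (m / t) *\<^sub>R z" c] c by simp
  have 2: "norm (kern_grad t z) \<le> (4 + DIM('a)) / (bump_mass TYPE('a) * t ^ Suc DIM('a))"
    by (rule kern_grad_norm[OF t1])
  have 3: "\<bar>kern t z * (m / t)\<bar> \<le> 1 / (bump_mass TYPE('a) * t ^ DIM('a)) * (1 / t)"
    unfolding abs_mult using kern_le[OF t1, of z] kern_nonneg[of t z] m t1 I
    by (intro mult_mono) (auto simp: abs_divide divide_right_mono)
  have "norm (field_grad t z m b c) \<le> \<bar>(b + (m / t) *\<^sub>R z) \<bullet> c\<bar> * norm (kern_grad t z) + \<bar>kern t z * (m / t)\<bar> * norm c"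
    unfolding field_grad_def by (rule order_trans[OF norm_triangle_ineq]) simp
  also have "\<dots> \<le> 2 * ((4 + DIM('a)) / (bump_mass TYPE('a) * t ^ Suc DIM('a))) + 1 / (bump_mass TYPE('a) * t ^ DIM('a)) * (1 / t)"
  proof (rule add_mono)
    show "\<bar>(b + (m / t) *\<^sub>R z) \<bullet> c\<bar> * norm (kern_grad t z) \<le> 2 * ((4 + DIM('a)) / (bump_mass TYPE('a) * t ^ Suc DIM('a)))"
      by (rule mult_mono[OF 1 2]) auto
    show "\<bar>kern t z * (m / t)\<bar> * norm c \<le> 1 / (bump_mass TYPE('a) * t ^ DIM('a)) * (1 / t)"
      using 3 unfolding c by (simp only: mult_1_right)
  qed
  also have "\<dots> = (9 + 2 * DIM('a)) / (bump_mass TYPE('a) * t ^ Suc DIM('a))"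
    using I t1 by (simp add: field_simps)
  also have "\<dots> \<le> 2 * (5 + DIM('a)) / (bump_mass TYPE('a) * t0 ^ Suc DIM('a))"
    using I t by (intro frac_le mult_left_mono power_mono mult_pos_pos zero_less_power) auto
  finally show ?thesis .
next
  case False
  have I: "bump_mass TYPE('a) > 0" by (rule bump_mass_pos)
  have z: "norm z \<ge> t" "t > 0" using False t by auto
  have "kern_grad t z = 0"
  proof -
    have "kern_grad t z \<bullet> kern_grad t z = 0"
      using kern_outside(2)[OF z(2,1), of 0 "kern_grad t z"] by (simp add: kern_deriv_grad)
    then show ?thesis by simp
  qed
  then show ?thesis using kern_outside(1)[OF z(2,1)] I t by (simp add: field_grad_def)
qed

section \<open>The variable radius and the derivatives of the mollification\<close>

lemma cball_subset_of_infdist: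
  fixes S :: "'a::euclidean_space set"
  assumes "r < infdist x (- S)"
  shows "cball x r \<subseteq> S"
proof
  fix y assume y: "y \<in> cball x r"
  show "y \<in> S"
  proof (rule ccontr)
    assume "y \<notin> S"
    then have "infdist x (- S) \<le> dist x y" by (intro infdist_le) simp
    then show False using y assms by simp
  qed
qed

text \<open>A function of bounded variation in a form fit for Fubini: \<open>f\<close> and
  \<open>g\<close> are defined on the whole space, vanish off \<Omega> and V respectively and are
  integrable for \<open>lborel\<close>; \<open>A\<close> bounds the variation on
  \<open>U\<close>.\<close>

locale BV_data = variable_exponent \<Omega> p c for \<Omega> :: "'a::euclidean_space set" and p c +
  fixes U :: "'a set" and f :: "'a \<Rightarrow> real" and g :: "'a \<Rightarrow> 'a" and A :: real
  assumes U: "open U" "Y \<subseteq> U" "U \<subseteq> \<Omega>"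
    and f: "integrable lborel f" "x \<notin> \<Omega> \<Longrightarrow> f x = 0"
    and g: "integrable lborel g" "x \<notin> V \<Longrightarrow> g x = 0"
    and var: "\<phi> \<in> C1_compact U \<Longrightarrow> (\<And>x. norm (\<phi> x) \<le> 1) \<Longrightarrow> (LINT x|lborel. f x * divergence \<phi> x) \<le> A"
    and wg: "\<psi> \<in> C1_compact V \<Longrightarrow> b \<in> Basis \<Longrightarrow>
      (LINT x|lborel. f x * partial_deriv b \<psi> x) = - (LINT x|lborel. (g x \<bullet> b) * \<psi> x)"
begin

lemma f_borel [measurable]: "f \<in> borel_measurable borel" using f(1) by auto
text \<open>The variation bound applied to the field divided by B, with both signs.\<close>

lemma var_abs:
  assumes \<phi>: "\<phi> \<in> C1_compact U" and B: "\<And>x. norm (\<phi> x) \<le> B" "B > 0"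
  shows "\<bar>LINT x|lborel. f x * divergence \<phi> x\<bar> \<le> A * B"
proof -
  have "\<sigma> * (LINT x|lborel. f x * divergence \<phi> x) \<le> A" if s: "\<bar>\<sigma>\<bar> = 1 / B" for \<sigma>
  proof -
    have "norm (\<sigma> *\<^sub>R \<phi> x) \<le> 1" for x
    proof -
      have "norm (\<sigma> *\<^sub>R \<phi> x) = norm (\<phi> x) / B" by (simp add: s)
      then show ?thesis using B(1)[of x] B(2) by simp
    qed
    from var[OF C1_compact_scale(1)[OF \<phi>] this]
    have "(LINT x|lborel. f x * (\<sigma> * divergence \<phi> x)) \<le> A" by (simp add: C1_compact_scale(2)[OF \<phi>])
    moreover have "(LINT x|lborel. f x * (\<sigma> * divergence \<phi> x)) = \<sigma> * (LINT x|lborel. f x * divergence \<phi> x)"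
      by (simp add: mult.left_commute)
    ultimately show ?thesis by simp
  qed
  note s = this
  define X where "X = (LINT x|lborel. f x * divergence \<phi> x)"
  have "X / B \<le> A" "- (X / B) \<le> A" using s[of "1 / B"] s[of "- (1 / B)"] B(2) by (simp_all add: X_def)
  then have "\<bar>X / B\<bar> \<le> A" by (simp add: abs_le_iff)
  then have "\<bar>X\<bar> / B \<le> A" using B(2) by (simp add: abs_divide)
  then show ?thesis unfolding X_def[symmetric] pos_divide_le_eq[OF B(2)] .
qed

definition margin :: "'a \<Rightarrow> real" where "margin x = max (infdist x (- U)) (infdist x (- V))"

lemma margin_lip: "\<bar>margin x - margin y\<bar> \<le> norm (x - y)"
  using infdist_triangle_abs[of x "- U" y] infdist_triangle_abs[of x "- V" y]
  by (simp add: margin_def dist_norm max_def abs_le_iff)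

lemma margin_pos: assumes x: "x \<in> \<Omega>" shows "margin x > 0"
proof -
  \<comment> \<open>The complements are nonempty because \<Omega> is bounded; the distance to an
    empty set would be 0 and tell nothing.\<close>
  have ne: "- U \<noteq> {}" "- V \<noteq> {}"
  proof -
    have "\<Omega> \<noteq> UNIV" using bounded_dom not_bounded_UNIV by auto
    then show "- U \<noteq> {}" "- V \<noteq> {}" using U(3) V_sub by auto
  qed
  have cl: "closed (- U)" "closed (- V)" using U(1) V_open by auto
  show ?thesis
  proof (cases "x \<in> Y")
    case True
    then have "infdist x (- U) > 0" using U(2) ne cl by (intro infdist_pos_not_in_closed) auto
    then show ?thesis by (simp add: margin_def)
  next
    case False
    then have "infdist x (- V) > 0" using x ne cl by (intro infdist_pos_not_in_closed) (auto simp: V_def)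
    then show ?thesis by (simp add: margin_def)
  qed
qed

lemma margin_bounded: obtains D where "D > 0" "\<And>x. x \<in> \<Omega> \<Longrightarrow> margin x \<le> D"
proof -
  have "\<Omega> \<noteq> UNIV" using bounded_dom not_bounded_UNIV by auto
  then obtain a where a: "a \<notin> \<Omega>" by auto
  obtain R where R: "R > 0" "\<Omega> \<subseteq> ball a R" using bounded_subset_ballD[OF bounded_dom, of a] by blast
  show thesis
  proof (rule that[OF R(1)])
    fix x assume x: "x \<in> \<Omega>"
    have d: "dist x a \<le> R" using R(2) x by (force simp: dist_commute)
    have "infdist x (- U) \<le> dist x a" "infdist x (- V) \<le> dist x a"
      using a U(3) V_sub by (auto intro!: infdist_le)
    then show "margin x \<le> R" using d by (simp add: margin_def)
  qed
qed

end

text \<open>The bound 1/2 on \<epsilon> acts twice: it gives the radius the Lipschitz constant 1/2,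
  and it makes twice the radius at most the margin.\<close>

locale mollified_BV = BV_data +
  fixes \<epsilon> :: real
  assumes eps: "0 < \<epsilon>" "\<epsilon> \<le> 1/2"
begin

definition \<delta> :: "'a \<Rightarrow> real" where "\<delta> x = \<epsilon> * margin x"

sublocale variable_scale \<Omega> \<delta>
proof
  show "(1/2)-lipschitz_on UNIV \<delta>"
  proof (rule lipschitz_onI)
    fix x y
    have "\<bar>\<delta> x - \<delta> y\<bar> = \<epsilon> * \<bar>margin x - margin y\<bar>" using eps by (simp add: \<delta>_def abs_mult flip: right_diff_distrib)
    also have "\<dots> \<le> (1/2) * norm (x - y)" using eps margin_lip by (intro mult_mono) auto
    finally show "dist (\<delta> x) (\<delta> y) \<le> 1 / 2 * dist x y" by (simp add: dist_real_def dist_norm)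
  qed simp
  show "0 < \<delta> x" if "x \<in> \<Omega>" for x using margin_pos[OF that] eps by (simp add: \<delta>_def)
qed (use open_dom bounded_dom in auto)

text \<open>The factor 2 places the closed kernel ball strictly inside \<open>U\<close>, and the
  non-strict inequality keeps the truncations used for duality closed.\<close>

definition inner_U :: "'a set" where "inner_U = {x \<in> \<Omega>. 2 * \<delta> x \<le> infdist x (- U)}"

lemma ball_U: assumes "x \<in> inner_U" shows "cball x (\<delta> x) \<subseteq> U"
proof (rule cball_subset_of_infdist)
  have "\<delta> x > 0" using assms \<delta>_pos by (simp add: inner_U_def)
  then show "\<delta> x < infdist x (- U)" using assms by (simp add: inner_U_def)
qed

lemma ball_cases:
  assumes x: "x \<in> \<Omega>"
  shows "cball x (\<delta> x) \<subseteq> V \<or> x \<in> inner_U"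
proof -
  have d: "\<delta> x > 0" by (rule \<delta>_pos[OF x])
  have "2 * \<delta> x \<le> margin x" using eps margin_pos[OF x] by (simp add: \<delta>_def)
  then consider "2 * \<delta> x \<le> infdist x (- U)" | "2 * \<delta> x \<le> infdist x (- V)"
    by (auto simp: margin_def max_def split: if_splits)
  then show ?thesis
  proof cases
    case 1 then show ?thesis using x by (simp add: inner_U_def)
  next
    case 2 then have "cball x (\<delta> x) \<subseteq> V" by (intro cball_subset_of_infdist) (use d in linarith)
    then show ?thesis ..
  qed
qed

lemma ball_\<Omega>: "x \<in> \<Omega> \<Longrightarrow> cball x (\<delta> x) \<subseteq> \<Omega>"
  using ball_cases[of x] ball_U[of x] U(3) V_sub by blast

text \<open>A version of the derivative of \<delta> along \<open>b\<close> that is Borel and bounded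
  by 1/2 everywhere; the truncation acts only on a null set.\<close>

definition slope :: "'a \<Rightarrow> 'a \<Rightarrow> real" where
  "slope b x = max (- (1/2)) (min (1/2) (lim (\<lambda>i. (\<delta> (x + (1 / real (Suc i)) *\<^sub>R b) - \<delta> x) / (1 / real (Suc i)))))"

lemma slope_borel [measurable]: "slope b \<in> borel_measurable borel"
  unfolding slope_def[abs_def] by measurable

lemma slope_le: "\<bar>slope b x\<bar> \<le> 1/2"
  by (auto simp: slope_def)

lemma slope_deriv:
  assumes b: "norm b = 1"
  shows "AE x in lborel. ((\<lambda>s. \<delta> (x + s *\<^sub>R b)) has_real_derivative slope b x) (at 0)"
  using lipschitz_partial_AE[OF \<delta>_lip, of b]
proof eventually_elim
  case (elim x)
  then obtain D where D: "((\<lambda>t. \<delta> (x + t *\<^sub>R b)) has_real_derivative D) (at 0)" by blast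
  have l: "(\<lambda>i. (\<delta> (x + (1 / real (Suc i)) *\<^sub>R b) - \<delta> x) / (1 / real (Suc i))) \<longlonglongrightarrow> D"
    using difference_quotient_sequence[OF open_UNIV UNIV_I D, of "\<lambda>i. 1 / real (Suc i)"] LIMSEQ_inverse_real_of_nat
    by (simp add: inverse_eq_divide)
  have "\<bar>(\<delta> (x + (1 / real (Suc i)) *\<^sub>R b) - \<delta> x) / (1 / real (Suc i))\<bar> \<le> 1/2" for i
  proof -
    have "\<bar>\<delta> (x + (1 / real (Suc i)) *\<^sub>R b) - \<delta> x\<bar> \<le> (1/2) * (1 / real (Suc i))"
      using \<delta>_dist[of "x + (1 / real (Suc i)) *\<^sub>R b" x] b by (simp add: mult.commute del: of_nat_Suc)
    then have "\<bar>\<delta> (x + (1 / real (Suc i)) *\<^sub>R b) - \<delta> x\<bar> / (1 / real (Suc i)) \<le> 1/2"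
      by (subst pos_divide_le_eq) auto
    then show ?thesis by (simp only: abs_divide)
  qed
  then have "\<bar>D\<bar> \<le> 1/2" using tendsto_rabs[OF l] by (intro LIMSEQ_le_const2[OF tendsto_rabs[OF l]]) auto
  then have "slope b x = D" using limI[OF l] by (auto simp: slope_def abs_le_iff)
  then show ?case using D by simp
qed

definition dmol :: "'a \<Rightarrow> 'a \<Rightarrow> real" where
  "dmol b x = (LINT y|lborel. kern_deriv (\<delta> x) (y - x) (slope b x) (- b) * f y)"

lemma dmol_borel [measurable]: "dmol b \<in> borel_measurable borel"
  unfolding dmol_def[abs_def] by measurable

lemma partial_mollify:
  assumes b: "b \<in> Basis"
  shows "AE x in lborel. x \<in> \<Omega> \<longrightarrow> partial_deriv b (mollify \<delta> f) x = dmol b x"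
proof -
  have n: "norm b = 1" using b by simp
  from slope_deriv[OF n] show ?thesis
  proof eventually_elim
    case (elim x)
    show ?case
    proof
      assume x: "x \<in> \<Omega>"
      show "partial_deriv b (mollify \<delta> f) x = dmol b x"
        unfolding dmol_def by (rule partial_deriv_eqI[OF mollify_has_partial[OF f(1) x n elim]])
    qed
  qed
qed

lemma dmol_divergence:
  assumes x: "x \<in> \<Omega>"
  shows "dmol b x = - (LINT y|lborel. f y * divergence (\<lambda>y. kern_field (\<delta> x) (y - x) (slope b x) b) y)"
proof -
  have "divergence (\<lambda>y. kern_field (\<delta> x) (y - x) (slope b x) b) y = - kern_deriv (\<delta> x) (y - x) (slope b x) (- b)" for y
    unfolding divergence_def by (rule kern_field_divergence[OF \<delta>_pos[OF x]])
  then show ?thesis by (simp add: dmol_def mult.commute)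
qed

lemma kern_field_C1:
  assumes "x \<in> \<Omega>" "cball x (\<delta> x) \<subseteq> S"
  shows "(\<lambda>y. kern_field (\<delta> x) (y - x) m b) \<in> C1_compact S"
  by (rule C1_compact_of_components[OF kern_field_component_C1[OF \<delta>_pos]]) (use assms in auto)

text \<open>The kernel field is supported in the ball, hence its components are test functions in V
  and the weak gradient may be inserted. The factor 2 bounds the velocity of the moving
  kernel.\<close>

lemma dmol_le_grad:
  assumes x: "x \<in> \<Omega>" and ball: "cball x (\<delta> x) \<subseteq> V" and b: "b \<in> Basis"
  shows "\<bar>dmol b x\<bar> \<le> 2 * mollify \<delta> (\<lambda>y. norm (g y)) x"
proof -
  define \<Phi> where "\<Phi> y = kern_field (\<delta> x) (y - x) (slope b x) b" for y
  note t = \<delta>_pos[OF x]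
  have C: "(\<lambda>y. \<Phi> y \<bullet> c) \<in> C1_compact V" for c
    unfolding \<Phi>_def by (rule kern_field_component_C1[OF t ball])
  have i1: "integrable lborel (\<lambda>y. f y * partial_deriv c (\<lambda>y. \<Phi> y \<bullet> c) y)"
    and i2: "integrable lborel (\<lambda>y. (g y \<bullet> c) * (\<Phi> y \<bullet> c))" if c: "c \<in> Basis" for c
  proof -
    have "integrable lborel (\<lambda>y. f y * partial_deriv c (\<lambda>y. \<Phi> y \<bullet> c) y) \<and> integrable lborel (\<lambda>y. (g y \<bullet> c) * (\<Phi> y \<bullet> c))"
    proof (rule C1_compact_partial[OF C, of c c])
      fix B assume B: "\<And>y. \<bar>\<Phi> y \<bullet> c\<bar> \<le> B" "\<And>y. \<bar>partial_deriv c (\<lambda>y. \<Phi> y \<bullet> c) y\<bar> \<le> B"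
        and co: "continuous_on UNIV (\<lambda>y. \<Phi> y \<bullet> c)" "continuous_on UNIV (partial_deriv c (\<lambda>y. \<Phi> y \<bullet> c))"
      have "integrable lborel (\<lambda>y. f y * partial_deriv c (\<lambda>y. \<Phi> y \<bullet> c) y)"
        by (rule integrable_bounded_mult[OF f(1) _ B(2)]) (use co in \<open>simp add: borel_measurable_continuous_onI\<close>)
      moreover have "integrable lborel (\<lambda>y. (g y \<bullet> c) * (\<Phi> y \<bullet> c))"
        by (rule integrable_bounded_mult[OF integrable_inner_left[of c, OF g(1)] _ B(1)]) (use co in \<open>simp add: borel_measurable_continuous_onI\<close>)
      ultimately show ?thesis ..
    qed (use c in simp)
    then show "integrable lborel (\<lambda>y. f y * partial_deriv c (\<lambda>y. \<Phi> y \<bullet> c) y)"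
      "integrable lborel (\<lambda>y. (g y \<bullet> c) * (\<Phi> y \<bullet> c))" by auto
  qed
  have "dmol b x = - (LINT y|lborel. (\<Sum>c\<in>Basis. f y * partial_deriv c (\<lambda>y. \<Phi> y \<bullet> c) y))"
    using dmol_divergence[OF x, of b] by (simp add: divergence_def \<Phi>_def sum_distrib_left)
  also have "\<dots> = (\<Sum>c\<in>Basis. - (LINT y|lborel. f y * partial_deriv c (\<lambda>y. \<Phi> y \<bullet> c) y))"
    using i1 by (subst Bochner_Integration.integral_sum) (auto simp: sum_negf)
  also have "\<dots> = (\<Sum>c\<in>Basis. (LINT y|lborel. (g y \<bullet> c) * (\<Phi> y \<bullet> c)))"
    by (intro sum.cong refl) (simp add: wg[OF C])
  also have "\<dots> = (LINT y|lborel. (\<Sum>c\<in>Basis. (g y \<bullet> c) * (\<Phi> y \<bullet> c)))"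
    using i2 by (subst Bochner_Integration.integral_sum) auto
  finally have eq: "dmol b x = (LINT y|lborel. (\<Sum>c\<in>Basis. (g y \<bullet> c) * (\<Phi> y \<bullet> c)))" .
  have "\<bar>dmol b x\<bar> \<le> (LINT y|lborel. \<bar>\<Sum>c\<in>Basis. (g y \<bullet> c) * (\<Phi> y \<bullet> c)\<bar>)"
    unfolding eq by (rule integral_abs_bound)
  also have "\<dots> \<le> (LINT y|lborel. 2 * (kern (\<delta> x) (y - x) * norm (g y)))"
  proof (rule integral_mono)
    show "integrable lborel (\<lambda>y. \<bar>\<Sum>c\<in>Basis. (g y \<bullet> c) * (\<Phi> y \<bullet> c)\<bar>)"
      by (intro integrable_abs Bochner_Integration.integrable_sum i2)
    show "integrable lborel (\<lambda>y. 2 * (kern (\<delta> x) (y - x) * norm (g y)))"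
      using integrable_kern_mult[OF integrable_norm[OF g(1)] t, of x] by simp
    fix y
    have "\<bar>\<Sum>c\<in>Basis. (g y \<bullet> c) * (\<Phi> y \<bullet> c)\<bar> = \<bar>g y \<bullet> \<Phi> y\<bar>" by (simp add: euclidean_inner[of "g y" "\<Phi> y"])
    also have "\<dots> \<le> norm (g y) * norm (\<Phi> y)" by (rule Cauchy_Schwarz_ineq2)
    also have "\<dots> \<le> norm (g y) * (2 * kern (\<delta> x) (y - x))"
      unfolding \<Phi>_def using b by (intro mult_left_mono kern_field_norm t slope_le) auto
    finally show "\<bar>\<Sum>c\<in>Basis. (g y \<bullet> c) * (\<Phi> y \<bullet> c)\<bar> \<le> 2 * (kern (\<delta> x) (y - x) * norm (g y))"
      by (simp add: mult_ac)
  qed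
  also have "\<dots> = 2 * mollify \<delta> (\<lambda>y. norm (g y)) x" by (simp add: mollify_def)
  finally show ?thesis .
qed

text \<open>A crude pointwise bound from the sup norm of a single kernel field. It serves only as
  the power law in the radius that \<open>powr_log_Holder\<close> requires.\<close>

lemma dmol_le_var:
  assumes x: "x \<in> inner_U" and b: "b \<in> Basis"
  shows "\<bar>dmol b x\<bar> \<le> A * 2 / bump_mass TYPE('a) / \<delta> x ^ DIM('a)"
proof -
  have xO: "x \<in> \<Omega>" using x by (simp add: inner_U_def)
  note t = \<delta>_pos[OF xO]
  have I: "bump_mass TYPE('a) > 0" by (rule bump_mass_pos)
  have n: "norm (kern_field (\<delta> x) (y - x) (slope b x) b) \<le> 2 / (bump_mass TYPE('a) * \<delta> x ^ DIM('a))" for y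
  proof -
    have "norm (kern_field (\<delta> x) (y - x) (slope b x) b) \<le> 2 * kern (\<delta> x) (y - x)"
      using b by (intro kern_field_norm t slope_le) auto
    also have "\<dots> \<le> 2 * (1 / (bump_mass TYPE('a) * \<delta> x ^ DIM('a)))" by (intro mult_left_mono kern_le t) simp
    finally show ?thesis by simp
  qed
  have "\<bar>LINT y|lborel. f y * divergence (\<lambda>y. kern_field (\<delta> x) (y - x) (slope b x) b) y\<bar>
     \<le> A * (2 / (bump_mass TYPE('a) * \<delta> x ^ DIM('a)))"
    by (rule var_abs[OF kern_field_C1[OF xO ball_U[OF x]] n]) (use I t in auto)
  then show ?thesis unfolding dmol_divergence[OF xO] by simp
qed

text \<open>Duality: testing the variation with the mollification of the sign of \<open>dmol b\<close>.\<close>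

lemma dmol_L1_level:
  fixes N :: nat
  assumes b: "b \<in> Basis" and N: "N > 0"
  defines "S \<equiv> {x \<in> inner_U. 1 / real N \<le> \<delta> x}"
  shows "(\<integral>\<^sup>+x. ennreal \<bar>dmol b x\<bar> * indicator S x \<partial>lborel) \<le> ennreal (A * (2 * kern_mass TYPE('a) + 1))"
proof -
  define t0 where "t0 = 1 / real N"
  have t0: "t0 > 0" using N by (simp add: t0_def)
  have nb: "norm b = 1" using b by simp
  have I: "bump_mass TYPE('a) > 0" by (rule bump_mass_pos)
  have St: "\<delta> x \<ge> t0" "x \<in> \<Omega>" "x \<in> inner_U" if "x \<in> S" for x
    using that by (auto simp: S_def inner_U_def t0_def)
  \<comment> \<open>Stated without the open set \<Omega>, the conditions are closed, so
    \<open>S\<close> is compact. On it the radius stays above \<open>t0\<close>, which provides the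
    uniform bounds below.\<close>
  have Seq: "S = {x. 2 * \<delta> x \<le> infdist x (- U)} \<inter> {x. t0 \<le> \<delta> x}"
  proof (intro subset_antisym subsetI)
    fix x assume x: "x \<in> {x. 2 * \<delta> x \<le> infdist x (- U)} \<inter> {x. t0 \<le> \<delta> x}"
    then have "\<delta> x < infdist x (- U)" using t0 by auto
    then have "cball x (\<delta> x) \<subseteq> U" by (rule cball_subset_of_infdist)
    moreover have "x \<in> cball x (\<delta> x)" using x t0 by simp
    ultimately have "x \<in> \<Omega>" using U(3) by blast
    then show "x \<in> S" using x by (simp add: S_def inner_U_def t0_def)
  qed (auto simp: S_def inner_U_def t0_def)
  have \<delta>c: "continuous_on UNIV \<delta>" by (rule lipschitz_on_continuous_on[OF \<delta>_lip])
  have "closed S" unfolding Seq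
    by (intro closed_Int closed_Collect_le continuous_intros \<delta>c)
  moreover have "bounded S" by (rule bounded_subset[OF bounded_dom]) (use St in blast)
  ultimately have Sc: "compact S" by (simp add: compact_eq_bounded_closed)
  have Sb[measurable]: "S \<in> sets borel" using \<open>closed S\<close> by simp
  have Sf: "emeasure lborel S < \<infinity>" using Sc by (rule emeasure_compact_finite)
  define \<psi> where "\<psi> x = indicator S x * sgn (dmol b x)" for x
  have \<psi>m[measurable]: "\<psi> \<in> borel_measurable borel" unfolding \<psi>_def by measurable
  have \<psi>1: "\<bar>\<psi> x\<bar> \<le> indicator S x" for x by (auto simp: \<psi>_def indicator_def abs_sgn_eq)
  have \<psi>0: "\<psi> x = 0" if "x \<notin> S" for x using that by (simp add: \<psi>_def)
  \<comment> \<open>A superposition of kernel fields weighted by signs. The divergence of each field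
    gives back \<open>dmol b\<close> at its centre when paired with \<open>f\<close>, so pairing
    \<open>f\<close> with the divergence of \<Psi> collects the absolute values.\<close>
  define \<Psi> where "\<Psi> y = (LINT x|lborel. \<psi> x *\<^sub>R kern_field (\<delta> x) (y - x) (slope b x) b)" for y
  have kfm: "(\<lambda>x. kern_field (\<delta> x) (y - x) (slope b x) b) \<in> borel_measurable borel" for y
    unfolding kern_field_def by measurable
  have fgm: "(\<lambda>x. field_grad (\<delta> x) (y - x) (slope b x) b c) \<in> borel_measurable borel" for y c
    unfolding field_grad_def kern_grad_def by measurable
  define BK where "BK = 1 / (bump_mass TYPE('a) * t0 ^ DIM('a))"
  have kb: "norm (\<psi> x *\<^sub>R kern_field (\<delta> x) (y - x) (slope b x) b) \<le> 2 * (kern (\<delta> x) (y - x) * indicator S x)" for x y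
  proof (cases "x \<in> S")
    case True
    have "\<bar>\<psi> x\<bar> * norm (kern_field (\<delta> x) (y - x) (slope b x) b) \<le> 1 * (2 * kern (\<delta> x) (y - x))"
      using True \<psi>1[of x] \<delta>_pos[OF St(2)[OF True]]
      by (intro mult_mono kern_field_norm slope_le nb) auto
    then show ?thesis using True by simp
  qed (simp add: \<psi>0)
  have kBK: "kern (\<delta> x) (y - x) \<le> BK" if "x \<in> S" for x y
  proof -
    have "kern (\<delta> x) (y - x) \<le> 1 / (bump_mass TYPE('a) * \<delta> x ^ DIM('a))"
      by (rule kern_le[OF \<delta>_pos[OF St(2)[OF that]]])
    also have "\<dots> \<le> BK" unfolding BK_def
      using I t0 St(1)[OF that] by (intro divide_left_mono mult_left_mono power_mono mult_pos_pos zero_less_power) auto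
    finally show ?thesis .
  qed
  have ind: "integrable lborel (\<lambda>x. C * indicator S x)" for C :: real
    using Sf by (simp add: integrable_indicator_iff)
  have \<Psi>i: "integrable lborel (\<lambda>x. \<psi> x *\<^sub>R kern_field (\<delta> x) (y - x) (slope b x) b)" for y
  proof (rule Bochner_Integration.integrable_bound[OF ind[of "2 * BK"]])
    have "norm (\<psi> x *\<^sub>R kern_field (\<delta> x) (y - x) (slope b x) b) \<le> norm (2 * BK * indicator S x)" for x
      using kb[of x y] kBK[of x y] by (cases "x \<in> S") (auto simp: \<psi>0)
    then show "AE x in lborel. norm (\<psi> x *\<^sub>R kern_field (\<delta> x) (y - x) (slope b x) b) \<le> norm (2 * BK * indicator S x)" by simp
  qed (use kfm in measurable)
  define w where "w x = 2 * (5 + DIM('a)) / (bump_mass TYPE('a) * t0 ^ Suc DIM('a)) * indicator S x" for x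
  have w: "integrable lborel w" unfolding w_def by (rule ind)
  define q where "q c x y = (\<psi> x *\<^sub>R kern_field (\<delta> x) (y - x) (slope b x) b) \<bullet> c" for c x y
  define Q where "Q c x y = \<psi> x *\<^sub>R field_grad (\<delta> x) (y - x) (slope b x) b c" for c x y
  have qQ: "((\<lambda>y. q c x y) has_derivative (\<lambda>h. Q c x y \<bullet> h)) (at y)" for c x y
  proof (cases "x \<in> S")
    case True
    have "((\<lambda>y. \<psi> x * (kern_field (\<delta> x) (y - x) (slope b x) b \<bullet> c)) has_derivative
        (\<lambda>h. \<psi> x * (field_grad (\<delta> x) (y - x) (slope b x) b c \<bullet> h))) (at y)"
      unfolding field_grad_def
      by (intro has_derivative_mult_right kern_field_component_derivative \<delta>_pos St(2) True)
    then show ?thesis by (simp add: q_def Q_def)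
  qed (simp add: q_def Q_def \<psi>0)
  have Qw: "norm (Q c x y) \<le> w x" if c: "c \<in> Basis" for c x y
  proof (cases "x \<in> S")
    case True
    have "\<bar>\<psi> x\<bar> * norm (field_grad (\<delta> x) (y - x) (slope b x) b c) \<le> 1 * (2 * (5 + DIM('a)) / (bump_mass TYPE('a) * t0 ^ Suc DIM('a)))"
      using True \<psi>1[of x] c by (intro mult_mono field_grad_norm t0 St(1) slope_le nb) auto
    then show ?thesis using True by (simp add: Q_def w_def)
  qed (simp add: Q_def w_def \<psi>0)
  have Qm: "(\<lambda>x. Q c x y) \<in> borel_measurable lborel" for c y unfolding Q_def using fgm by measurable
  have Qc: "continuous_on UNIV (Q c x)" for c x
  proof (cases "x \<in> S")
    case True
    note t = \<delta>_pos[OF St(2)[OF True]]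
    have "continuous_on UNIV (\<lambda>y. kern (\<delta> x) (y - x))"
      by (intro continuous_at_imp_continuous_on ballI has_derivative_continuous[OF kern_has_grad[OF t]])
    then show ?thesis unfolding Q_def field_grad_def
      by (intro continuous_intros continuous_on_kern_grad[OF t])
  next
    case False
    then have "Q c x = (\<lambda>_. 0)" by (simp add: Q_def \<psi>0 fun_eq_iff)
    then show ?thesis by simp
  qed
  have qi: "integrable lborel (\<lambda>x. q c x y)" for c y
    unfolding q_def by (rule integrable_inner_left[OF \<Psi>i])
  have \<Psi>c: "\<Psi> y \<bullet> c = (LINT x|lborel. q c x y)" for y c
    unfolding q_def \<Psi>_def by (rule integral_inner_left[symmetric]) (rule \<Psi>i)
  have der: "((\<lambda>y. \<Psi> y \<bullet> c) has_derivative (\<lambda>h. (LINT x|lborel. Q c x y) \<bullet> h)) (at y)" if c: "c \<in> Basis" for c y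
    unfolding \<Psi>c by (rule has_derivative_integral_dominated(1)[OF qQ qi Qm w Qw[OF c]])
  \<comment> \<open>The union of all closed kernel balls with centres in \<open>S\<close>, written
    as a continuous image of a compact product; it contains the support of \<Psi> and lies in
    \<open>U\<close>.\<close>
  define K where "K = (\<lambda>(x, z). x + \<delta> x *\<^sub>R z) ` (S \<times> cball 0 1)"
  have Kc: "compact K" unfolding K_def
    by (intro compact_continuous_image compact_Times Sc compact_cball)
      (auto simp: case_prod_unfold intro!: continuous_intros continuous_on_compose2[OF \<delta>c])
  have KU: "K \<subseteq> U"
  proof
    fix y assume "y \<in> K"
    then obtain x z where xz: "x \<in> S" "norm z \<le> 1" "y = x + \<delta> x *\<^sub>R z" by (auto simp: K_def)
    have "y \<in> cball x (\<delta> x)" using xz \<delta>_pos[OF St(2)[OF xz(1)]] by (simp add: dist_norm mult_left_le)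
    then show "y \<in> U" using ball_U[OF St(3)[OF xz(1)]] by blast
  qed
  have K0: "\<psi> x *\<^sub>R kern_field (\<delta> x) (y - x) (slope b x) b = 0" if y: "y \<notin> K" for x y
  proof (cases "x \<in> S")
    case True
    note t = \<delta>_pos[OF St(2)[OF True]]
    have "norm (y - x) \<ge> \<delta> x"
    proof (rule ccontr)
      assume "\<not> ?thesis"
      then have "norm ((1 / \<delta> x) *\<^sub>R (y - x)) \<le> 1" using t by (simp add: divide_le_eq)
      moreover have "y = x + \<delta> x *\<^sub>R ((1 / \<delta> x) *\<^sub>R (y - x))" using t by simp
      ultimately have "y \<in> K" unfolding K_def using True by (auto intro!: image_eqI[of _ _ "(x, (1 / \<delta> x) *\<^sub>R (y - x))"])
      then show False using y by simp
    qed
    then show ?thesis using kern_outside(1)[OF t, of "y - x"] by (simp add: kern_field_def)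
  qed (simp add: \<psi>0)
  have \<Psi>K: "\<Psi> y = 0" if "y \<notin> K" for y unfolding \<Psi>_def K0[OF that] by simp
  have \<Psi>C: "\<Psi> \<in> C1_compact U"
  proof (rule C1_compact_of_components)
    fix c :: 'a assume c: "c \<in> Basis"
    show "(\<lambda>y. \<Psi> y \<bullet> c) \<in> C1_compact U"
      by (rule C1_compactI[OF der[OF c] has_derivative_integral_dominated(2)[OF qQ qi Qm w Qw[OF c] Qc] Kc KU])
        (simp add: \<Psi>K)
  qed
  \<comment> \<open>The kernel is integrated over its centre here, which is where
    \<open>kern_mass\<close> enters; the 2 bounds the velocity. The added 1 makes the bound
    positive, as \<open>var_abs\<close> asks.\<close>
  have \<Psi>n: "norm (\<Psi> y) \<le> 2 * kern_mass TYPE('a) + 1" for y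
  proof -
    have "ennreal (norm (\<Psi> y)) \<le> (\<integral>\<^sup>+x. ennreal (norm (\<psi> x *\<^sub>R kern_field (\<delta> x) (y - x) (slope b x) b)) \<partial>lborel)"
      unfolding \<Psi>_def by (rule integral_norm_bound_ennreal[OF \<Psi>i])
    also have "\<dots> \<le> (\<integral>\<^sup>+x. ennreal 2 * (ennreal (kern (\<delta> x) (y - x)) * indicator \<Omega> x) \<partial>lborel)"
    proof (rule nn_integral_mono)
      fix x
      show "ennreal (norm (\<psi> x *\<^sub>R kern_field (\<delta> x) (y - x) (slope b x) b)) \<le> ennreal 2 * (ennreal (kern (\<delta> x) (y - x)) * indicator \<Omega> x)"
      proof (cases "x \<in> S")
        case True
        have "ennreal (norm (\<psi> x *\<^sub>R kern_field (\<delta> x) (y - x) (slope b x) b)) \<le> ennreal (2 * kern (\<delta> x) (y - x))"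
          using kb[of x y] True by (intro ennreal_leI) simp
        also have "\<dots> = ennreal 2 * ennreal (kern (\<delta> x) (y - x))"
          using kern_nonneg[of "\<delta> x" "y - x"] \<delta>_pos[OF St(2)[OF True]] by (intro ennreal_mult) auto
        finally show ?thesis using St(2)[OF True] by simp
      qed (simp add: \<psi>0)
    qed
    also have "\<dots> = ennreal 2 * (\<integral>\<^sup>+x. ennreal (kern (\<delta> x) (y - x)) * indicator \<Omega> x \<partial>lborel)"
      by (rule nn_integral_cmult) measurable
    also have "\<dots> \<le> ennreal 2 * ennreal (kern_mass TYPE('a))" by (intro mult_left_mono kern_mass_le) simp
    also have "\<dots> = ennreal (2 * kern_mass TYPE('a))" using kern_mass_nonneg[where 'a='a] by (simp add: ennreal_mult)
    finally have "norm (\<Psi> y) \<le> 2 * kern_mass TYPE('a)"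
      using kern_mass_nonneg[where 'a='a] by (subst (asm) ennreal_le_iff) auto
    then show ?thesis by simp
  qed
  define \<kappa> where "\<kappa> x y = kern_deriv (\<delta> x) (y - x) (slope b x) (- b)" for x y
  have \<kappa>m[measurable]: "(\<lambda>(x, y). \<kappa> x y) \<in> borel_measurable (lborel \<Otimes>\<^sub>M lborel)"
    unfolding \<kappa>_def by measurable
  have div\<Psi>: "divergence \<Psi> y = - (LINT x|lborel. \<psi> x * \<kappa> x y)" for y
  proof -
    have "partial_deriv c (\<lambda>y. \<Psi> y \<bullet> c) y = (LINT x|lborel. Q c x y \<bullet> c)" if c: "c \<in> Basis" for c
    proof -
      have "integrable lborel (\<lambda>x. Q c x y)"
        by (rule Bochner_Integration.integrable_bound[OF w Qm]) (use Qw[OF c] in \<open>auto intro!: always_eventually intro: order_trans[OF _ abs_ge_self]\<close>)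
      then show ?thesis using partial_deriv_eqI[OF has_derivative_partial[OF der[OF c]], of c y] by simp
    qed
    then have "divergence \<Psi> y = (\<Sum>c\<in>Basis. LINT x|lborel. Q c x y \<bullet> c)" by (simp add: divergence_def)
    also have "\<dots> = (LINT x|lborel. (\<Sum>c\<in>Basis. Q c x y \<bullet> c))"
    proof (rule Bochner_Integration.integral_sum[symmetric])
      fix c :: 'a assume c: "c \<in> Basis"
      show "integrable lborel (\<lambda>x. Q c x y \<bullet> c)"
        by (rule integrable_inner_left, rule Bochner_Integration.integrable_bound[OF w Qm])
          (use Qw[OF c] in \<open>auto intro!: always_eventually intro: order_trans[OF _ abs_ge_self]\<close>)
    qed
    also have "\<dots> = (LINT x|lborel. - (\<psi> x * \<kappa> x y))"
    proof (rule Bochner_Integration.integral_cong[OF refl])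
      fix x
      show "(\<Sum>c\<in>Basis. Q c x y \<bullet> c) = - (\<psi> x * \<kappa> x y)"
      proof (cases "x \<in> S")
        case True
        note t = \<delta>_pos[OF St(2)[OF True]]
        have "partial_deriv c (\<lambda>y. kern_field (\<delta> x) (y - x) (slope b x) b \<bullet> c) y = field_grad (\<delta> x) (y - x) (slope b x) b c \<bullet> c" for c
          unfolding field_grad_def
          by (rule partial_deriv_eqI[OF has_derivative_partial[OF kern_field_component_derivative[OF t]]])
        then have "(\<Sum>c\<in>Basis. field_grad (\<delta> x) (y - x) (slope b x) b c \<bullet> c) = - \<kappa> x y"
          using kern_field_divergence[OF t, of x "slope b x" b y] by (simp add: \<kappa>_def)
        then show ?thesis by (simp add: Q_def flip: sum_distrib_left)
      qed (simp add: Q_def \<psi>0)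
    qed
    finally show ?thesis by simp
  qed
  define BD where "BD = (4 + DIM('a)) * (1 + 1/2) / (bump_mass TYPE('a) * t0 ^ Suc DIM('a))"
  have \<kappa>b: "\<bar>\<psi> x * \<kappa> x y\<bar> \<le> BD * indicator S x" for x y
  proof (cases "x \<in> S")
    case True
    note t = \<delta>_pos[OF St(2)[OF True]]
    have "\<bar>\<kappa> x y\<bar> \<le> (4 + DIM('a)) * (norm (- b) + \<bar>slope b x\<bar>) / (bump_mass TYPE('a) * \<delta> x ^ Suc DIM('a))"
      unfolding \<kappa>_def by (rule kern_deriv_le[OF t])
    also have "\<dots> \<le> BD" unfolding BD_def using nb slope_le[of b x] I t0 St(1)[OF True]
      by (intro frac_le mult_left_mono power_mono mult_pos_pos zero_less_power add_mono) auto
    finally have "\<bar>\<psi> x\<bar> * \<bar>\<kappa> x y\<bar> \<le> 1 * BD" using True \<psi>1[of x] by (intro mult_mono) auto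
    then show ?thesis using True by (simp add: abs_mult)
  qed (simp add: \<psi>0)
  \<comment> \<open>On \<open>S\<close> the kernel derivatives are bounded by \<open>BD\<close>, so
    the double integrand is dominated by an integrable product.\<close>
  have fub: "integrable (lborel \<Otimes>\<^sub>M lborel) (\<lambda>(x, y). \<psi> x * \<kappa> x y * f y)"
  proof (rule lborel_pair.Fubini_integrable)
    show "(\<lambda>(x, y). \<psi> x * \<kappa> x y * f y) \<in> borel_measurable (lborel \<Otimes>\<^sub>M lborel)" by measurable
    have i: "integrable lborel (\<lambda>y. \<psi> x * \<kappa> x y * f y)" for x
    proof (rule Bochner_Integration.integrable_bound[OF integrable_mult_right[OF f(1), of "BD * indicator S x"]])
      have "norm (\<psi> x * \<kappa> x y * f y) \<le> norm (BD * indicator S x * f y)" for y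
        unfolding norm_mult[of "\<psi> x * \<kappa> x y"] norm_mult[of "BD * indicator S x"]
        using \<kappa>b[of x y] by (intro mult_right_mono) auto
      then show "AE y in lborel. norm (\<psi> x * \<kappa> x y * f y) \<le> norm (BD * indicator S x * f y)" by simp
    qed measurable
    then show "AE x in lborel. integrable lborel (\<lambda>y. case (x, y) of (x, y) \<Rightarrow> \<psi> x * \<kappa> x y * f y)" by simp
    show "integrable lborel (\<lambda>x. LINT y|lborel. norm (case (x, y) of (x, y) \<Rightarrow> \<psi> x * \<kappa> x y * f y))"
    proof (rule Bochner_Integration.integrable_bound[OF ind[of "BD * (LINT y|lborel. \<bar>f y\<bar>)"]])
      show "(\<lambda>x. LINT y|lborel. norm (case (x, y) of (x, y) \<Rightarrow> \<psi> x * \<kappa> x y * f y)) \<in> borel_measurable lborel" by measurable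
      have "(LINT y|lborel. norm (\<psi> x * \<kappa> x y * f y)) \<le> BD * (LINT y|lborel. \<bar>f y\<bar>) * indicator S x" for x
      proof -
        have "(LINT y|lborel. norm (\<psi> x * \<kappa> x y * f y)) \<le> (LINT y|lborel. BD * indicator S x * \<bar>f y\<bar>)"
        proof (rule integral_mono)
          show "integrable lborel (\<lambda>y. norm (\<psi> x * \<kappa> x y * f y))" by (rule integrable_norm[OF i])
          show "integrable lborel (\<lambda>y. BD * indicator S x * \<bar>f y\<bar>)" by (intro integrable_mult_right integrable_abs f)
          show "norm (\<psi> x * \<kappa> x y * f y) \<le> BD * indicator S x * \<bar>f y\<bar>" for y
            unfolding norm_mult[of "\<psi> x * \<kappa> x y"] using \<kappa>b[of x y] by (intro mult_mono) auto
        qed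
        then show ?thesis by (simp add: mult_ac)
      qed
      moreover have "0 \<le> (LINT y|lborel. norm (\<psi> x * \<kappa> x y * f y))" for x
        by (rule Bochner_Integration.integral_nonneg) simp
      ultimately show "AE x in lborel. norm (LINT y|lborel. norm (case (x, y) of (x, y) \<Rightarrow> \<psi> x * \<kappa> x y * f y)) \<le> norm (BD * (LINT y|lborel. \<bar>f y\<bar>) * indicator S x)"
        by (intro always_eventually allI) (force intro: order_trans[OF _ abs_ge_self])
    qed
  qed
  have pe: "(LINT y|lborel. \<psi> x * \<kappa> x y * f y) = \<bar>dmol b x\<bar> * indicator S x" for x
  proof -
    have "(LINT y|lborel. \<psi> x * \<kappa> x y * f y) = \<psi> x * dmol b x" by (simp add: dmol_def \<kappa>_def mult.assoc)
    also have "\<dots> = \<bar>dmol b x\<bar> * indicator S x" by (simp add: \<psi>_def abs_sgn mult_ac)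
    finally show ?thesis .
  qed
  have "(LINT y|lborel. f y * divergence \<Psi> y) = - (LINT y|lborel. (LINT x|lborel. \<psi> x * \<kappa> x y * f y))"
    by (simp add: div\<Psi> mult.commute)
  also have "(LINT y|lborel. (LINT x|lborel. \<psi> x * \<kappa> x y * f y)) = (LINT x|lborel. (LINT y|lborel. \<psi> x * \<kappa> x y * f y))"
    by (rule lborel_pair.Fubini_integral[OF fub])
  also have "\<dots> = (LINT x|lborel. \<bar>dmol b x\<bar> * indicator S x)"
    by (simp only: pe)
  finally have dual: "(LINT y|lborel. f y * divergence \<Psi> y) = - (LINT x|lborel. \<bar>dmol b x\<bar> * indicator S x)" .
  have "\<bar>LINT y|lborel. f y * divergence \<Psi> y\<bar> \<le> A * (2 * kern_mass TYPE('a) + 1)"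
    by (rule var_abs[OF \<Psi>C \<Psi>n]) (use kern_mass_nonneg[where 'a='a] in simp)
  then have le: "(LINT x|lborel. \<bar>dmol b x\<bar> * indicator S x) \<le> A * (2 * kern_mass TYPE('a) + 1)" unfolding dual by linarith
  have di: "integrable lborel (\<lambda>x. \<bar>dmol b x\<bar> * indicator S x)"
  proof -
    have "integrable lborel (\<lambda>x. LINT y|lborel. \<psi> x * \<kappa> x y * f y)"
      using lborel_pair.integrable_fst'[OF fub] by simp
    then show ?thesis by (simp only: pe)
  qed
  have "(\<integral>\<^sup>+x. ennreal \<bar>dmol b x\<bar> * indicator S x \<partial>lborel) = (\<integral>\<^sup>+x. ennreal (\<bar>dmol b x\<bar> * indicator S x) \<partial>lborel)"
    by (intro nn_integral_cong) (simp add: indicator_def)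
  also have "\<dots> = ennreal (LINT x|lborel. \<bar>dmol b x\<bar> * indicator S x)"
    by (rule nn_integral_eq_integral[OF di]) simp
  also have "\<dots> \<le> ennreal (A * (2 * kern_mass TYPE('a) + 1))" by (rule ennreal_leI[OF le])
  finally show ?thesis .
qed

end

text \<open>The sum is at most \<open>card I\<close> times its largest term, whose power is one of
  the summands on the right.\<close>

lemma powr_sum_le:
  fixes a :: "'i \<Rightarrow> real"
  assumes I: "finite I" "I \<noteq> {}" and a: "\<And>i. i \<in> I \<Longrightarrow> a i \<ge> 0" and q: "1 \<le> q" "q \<le> P"
  shows "(\<Sum>i\<in>I. a i) powr q \<le> real (card I) powr P * (\<Sum>i\<in>I. a i powr q)"
proof -
  define m where "m = Max (a ` I)"
  have "m \<in> a ` I" unfolding m_def using I by (intro Max_in) auto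
  then obtain j where j: "j \<in> I" "a j = m" by auto
  have m: "a i \<le> m" if "i \<in> I" for i unfolding m_def using I that by (intro Max_ge) auto
  have m0: "m \<ge> 0" using a[OF j(1)] j(2) by simp
  have c: "real (card I) \<ge> 1" using I by (simp add: Suc_le_eq card_gt_0_iff)
  have "(\<Sum>i\<in>I. a i) \<le> real (card I) * m" using sum_bounded_above[of I a m] m by simp
  then have "(\<Sum>i\<in>I. a i) powr q \<le> (real (card I) * m) powr q"
    using a q by (intro powr_mono2 sum_nonneg) auto
  also have "\<dots> = real (card I) powr q * m powr q" using m0 c by (simp add: powr_mult)
  also have "\<dots> \<le> real (card I) powr P * m powr q"
    using c q by (intro mult_right_mono powr_mono) auto
  also have "\<dots> \<le> real (card I) powr P * (\<Sum>i\<in>I. a i powr q)"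
    using member_le_sum[OF j(1), of "\<lambda>i. a i powr q"] I j(2) by (intro mult_left_mono) auto
  finally show ?thesis .
qed

section \<open>Scaling of the modular for a bounded exponent\<close>

context variable_exponent
begin

lemma powr_scale_le:
  assumes x: "x \<in> \<Omega>" and k: "k \<ge> 0" "a \<ge> 0"
  shows "(k * a) powr p x \<le> max 1 k powr P * a powr p x"
proof -
  have "(k * a) powr p x = k powr p x * a powr p x" using k by (simp add: powr_mult)
  also have "k powr p x \<le> max 1 k powr P"
  proof -
    have "k powr p x \<le> max 1 k powr p x" using k p_ge[OF x] by (intro powr_mono2) auto
    also have "\<dots> \<le> max 1 k powr P" using p_le[OF x] by (intro powr_mono) auto
    finally show ?thesis .
  qed
  finally show ?thesis by (simp add: mult_right_mono)
qed

lemma modular_scale_up: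
  assumes k: "k \<ge> 0" and [measurable]: "w \<in> borel_measurable M"
  shows "modular_Lp \<Omega> p (\<lambda>x. k * w x) \<le> ennreal (max 1 k powr P) * modular_Lp \<Omega> p w"
proof -
  have "modular_Lp \<Omega> p (\<lambda>x. k * w x) \<le> (\<integral>\<^sup>+x. ennreal (max 1 k powr P) * ennreal (\<bar>w x\<bar> powr p x) \<partial>M)"
    unfolding modular_Lp_def
  proof (rule nn_integral_mono)
    fix x assume "x \<in> space M"
    then have "(k * \<bar>w x\<bar>) powr p x \<le> max 1 k powr P * \<bar>w x\<bar> powr p x" using k by (intro powr_scale_le) auto
    then have "ennreal ((k * \<bar>w x\<bar>) powr p x) \<le> ennreal (max 1 k powr P * \<bar>w x\<bar> powr p x)" by (rule ennreal_leI)
    also have "\<dots> = ennreal (max 1 k powr P) * ennreal (\<bar>w x\<bar> powr p x)" by (rule ennreal_mult) auto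
    finally show "ennreal (\<bar>k * w x\<bar> powr p x) \<le> ennreal (max 1 k powr P) * ennreal (\<bar>w x\<bar> powr p x)"
      using k by (simp add: abs_mult)
  qed
  also have "\<dots> = ennreal (max 1 k powr P) * modular_Lp \<Omega> p w"
    unfolding modular_Lp_def by (rule nn_integral_cmult) measurable
  finally show ?thesis .
qed

lemma space_Lp_modular_finite:
  assumes "u \<in> space_Lp \<Omega> p" shows "modular_Lp \<Omega> p u < \<infinity>"
proof -
  have um: "u \<in> borel_measurable M" using assms by (simp add: space_Lp_def)
  obtain l where l: "l > 0" "modular_Lp \<Omega> p (\<lambda>x. u x / l) < \<infinity>" using assms by (auto simp: space_Lp_def)
  have "modular_Lp \<Omega> p (\<lambda>x. l * (u x / l)) \<le> ennreal (max 1 l powr P) * modular_Lp \<Omega> p (\<lambda>x. u x / l)"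
    using l(1) um by (intro modular_scale_up) auto
  also have "\<dots> < \<infinity>" using l(2) by (simp add: ennreal_mult_less_top)
  finally show ?thesis using l(1) by simp
qed

text \<open>Because p \<le> P, dividing by \<eta> multiplies the modular by at most a constant
  depending on \<eta>; convergence of modulars therefore implies convergence of norms.\<close>

lemma norm_Lp_tendsto_0:
  assumes w: "\<And>i. w i \<in> borel_measurable M" and lim: "(\<lambda>i. modular_Lp \<Omega> p (w i)) \<longlonglongrightarrow> 0"
  shows "(\<lambda>i. norm_Lp \<Omega> p (w i)) \<longlonglongrightarrow> 0"
proof (rule order_tendstoI)
  fix a :: ennreal assume "0 < a"
  then obtain \<eta> where \<eta>: "0 < \<eta>" "ennreal \<eta> < a"
  proof -
    obtain b where b: "0 < b" "b < a" using dense[OF \<open>0 < a\<close>] by blast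
    then obtain r where "b = ennreal r" "r \<ge> 0" by (cases b) auto
    then show thesis using that[of r] b by auto
  qed
  define k where "k = 1 / \<eta>"
  have k: "k \<ge> 0" using \<eta> by (simp add: k_def)
  define B where "B = max 1 k powr P"
  have B: "B > 0" by (simp add: B_def)
  have "\<forall>\<^sub>F i in sequentially. modular_Lp \<Omega> p (w i) < ennreal (1 / B)"
    using lim by (rule order_tendstoD(2)) (use B in simp)
  then show "\<forall>\<^sub>F i in sequentially. norm_Lp \<Omega> p (w i) < a"
  proof eventually_elim
    case (elim i)
    have "modular_Lp \<Omega> p (\<lambda>x. k * w i x) \<le> ennreal B * modular_Lp \<Omega> p (w i)"
      unfolding B_def by (rule modular_scale_up[OF k w])
    also have "\<dots> \<le> ennreal B * ennreal (1 / B)" using elim by (intro mult_left_mono) auto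
    also have "\<dots> = 1" using B by (simp add: ennreal_mult[symmetric])
    finally have "modular_Lp \<Omega> p (\<lambda>x. w i x / \<eta>) \<le> 1" by (simp add: k_def)
    then have "norm_Lp \<Omega> p (w i) \<le> ennreal \<eta>" unfolding norm_Lp_def by (rule luxemburg_le[OF \<eta>(1)])
    then show ?case using \<eta>(2) by (rule le_less_trans)
  qed
qed simp

lemma norm_Lp_cong_AE:
  assumes "AE x in M. w x = w' x"
  shows "norm_Lp \<Omega> p w = norm_Lp \<Omega> p w'"
proof -
  have "modular_Lp \<Omega> p (\<lambda>x. w x / l) = modular_Lp \<Omega> p (\<lambda>x. w' x / l)" for l
    unfolding modular_Lp_def using assms by (intro nn_integral_cong_AE) auto
  then show ?thesis unfolding norm_Lp_def luxemburg_def by simp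
qed

end

section \<open>Energy of the mollification\<close>

context mollified_BV
begin

lemma A_nonneg: "A \<ge> 0"
proof -
  have z: "(\<lambda>_. 0 :: 'a) \<in> C1_compact U"
    unfolding C1_compact_def by (auto intro!: exI[of _ "\<lambda>_. 0"] simp: zero_blinfun.rep_eq)
  have "divergence (\<lambda>_. 0 :: 'a) x = 0" for x :: 'a
    by (simp add: divergence_def partial_deriv_def)
  then show ?thesis using var[OF z] by simp
qed

lemma inner_U_borel [measurable]: "inner_U \<in> sets borel"
proof -
  have "inner_U = \<Omega> \<inter> {x. 2 * \<delta> x \<le> infdist x (- U)}" by (auto simp: inner_U_def)
  also have "\<dots> \<in> sets borel"
    by (intro sets.Int \<Omega>_borel borel_closed closed_Collect_le continuous_intros lipschitz_on_continuous_on[OF \<delta>_lip])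
  finally show ?thesis .
qed

text \<open>The bound of \<open>dmol_L1_level\<close> does not depend on the level, so Fatou's lemma
  extends it to the union of the levels.\<close>

lemma dmol_L1:
  assumes b: "b \<in> Basis"
  shows "(\<integral>\<^sup>+x. ennreal \<bar>dmol b x\<bar> * indicator inner_U x \<partial>lborel) \<le> ennreal (A * (2 * kern_mass TYPE('a) + 1))"
proof -
  define S where "S N = {x \<in> inner_U. 1 / real (Suc N) \<le> \<delta> x}" for N
  have Sb[measurable]: "S N \<in> sets borel" for N
  proof -
    have "S N = inner_U \<inter> {x. 1 / real (Suc N) \<le> \<delta> x}" by (auto simp: S_def)
    also have "\<dots> \<in> sets borel" by (intro sets.Int inner_U_borel borel_closed closed_Collect_le continuous_intros lipschitz_on_continuous_on[OF \<delta>_lip])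
    finally show ?thesis .
  qed
  have "(\<integral>\<^sup>+x. ennreal \<bar>dmol b x\<bar> * indicator inner_U x \<partial>lborel)
     \<le> (\<integral>\<^sup>+x. liminf (\<lambda>N. ennreal \<bar>dmol b x\<bar> * indicator (S N) x) \<partial>lborel)"
  proof (rule nn_integral_mono)
    fix x
    show "ennreal \<bar>dmol b x\<bar> * indicator inner_U x \<le> liminf (\<lambda>N. ennreal \<bar>dmol b x\<bar> * indicator (S N) x)"
    proof (cases "x \<in> inner_U")
      case True
      then have "\<delta> x > 0" using \<delta>_pos by (simp add: inner_U_def)
      then obtain N0 where N0: "1 / real (Suc N0) < \<delta> x" using reals_Archimedean by (auto simp: inverse_eq_divide)
      show ?thesis
      proof (rule Liminf_bounded)
        show "\<forall>\<^sub>F N in sequentially. ennreal \<bar>dmol b x\<bar> * indicator inner_U x \<le> ennreal \<bar>dmol b x\<bar> * indicator (S N) x"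
          using eventually_ge_at_top[of N0]
        proof eventually_elim
          case (elim N)
          have "1 / real (Suc N) \<le> 1 / real (Suc N0)" using elim by (intro divide_left_mono) auto
          then have "x \<in> S N" using True N0 by (simp add: S_def)
          then show ?case using True by simp
        qed
      qed
    qed simp
  qed
  also have "\<dots> \<le> liminf (\<lambda>N. \<integral>\<^sup>+x. ennreal \<bar>dmol b x\<bar> * indicator (S N) x \<partial>lborel)"
    by (rule nn_integral_liminf) measurable
  also have "\<dots> \<le> ennreal (A * (2 * kern_mass TYPE('a) + 1))"
    by (rule Liminf_le) (use dmol_L1_level[OF b, of "Suc _"] in \<open>auto simp: S_def\<close>)
  finally show ?thesis .
qed

text \<open>The factor of \<open>powr_log_Holder\<close> for the power law of
  \<open>dmol_le_var\<close>.\<close>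

definition sing_const :: real where
  "sing_const = exp (c * (ln (1 + A * 2 / bump_mass TYPE('a)) + DIM('a)))"

lemma sing_const_ge_1: "sing_const \<ge> 1"
  unfolding sing_const_def using A_nonneg c_pos bump_mass_pos[where 'a='a] by (simp add: add_increasing)

text \<open>One term is enough in each case: the first when the kernel ball lies in V, the second
  otherwise. Both are nonnegative, and their sum can be integrated over \<Omega> without splitting
  the domain.\<close>

lemma dmol_powr_le:
  assumes F: "integrable lborel F" "\<And>y. y \<in> \<Omega> \<Longrightarrow> F y = 1 + norm (g y) powr p y" "\<And>y. F y \<ge> 0"
    and x: "x \<in> \<Omega>" and b: "b \<in> Basis"
  shows "\<bar>dmol b x\<bar> powr p x \<le> 2 powr P * Jensen_const (LINT y|lborel. norm (g y)) * mollify \<delta> F x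
     + sing_const * (\<bar>dmol b x\<bar> * indicator inner_U x)"
proof -
  have mF: "mollify \<delta> F x \<ge> 0" unfolding mollify_def
    by (intro Bochner_Integration.integral_nonneg mult_nonneg_nonneg kern_nonneg F(3)) (use \<delta>_pos[OF x] in simp)
  have J0: "Jensen_const H \<ge> 0" for H by (simp add: Jensen_const_def)
  show ?thesis
  proof (cases "cball x (\<delta> x) \<subseteq> V")
    case True
    define a where "a = mollify \<delta> (\<lambda>y. norm (g y)) x"
    have a0: "a \<ge> 0" unfolding a_def mollify_def
      by (intro Bochner_Integration.integral_nonneg mult_nonneg_nonneg kern_nonneg) (use \<delta>_pos[OF x] in auto)
    have "\<bar>dmol b x\<bar> powr p x \<le> (2 * a) powr p x"
      unfolding a_def using p_ge[OF x] by (intro powr_mono2 dmol_le_grad x True b) auto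
    also have "\<dots> \<le> max 1 2 powr P * a powr p x" using a0 by (intro powr_scale_le[OF x]) auto
    also have "\<dots> = 2 powr P * a powr p x" by simp
    also have "\<dots> \<le> 2 powr P * (Jensen_const (LINT y|lborel. norm (g y)) * mollify \<delta> F x)"
      unfolding a_def
      by (intro mult_left_mono mollify_Jensen[OF variable_scale_axioms integrable_norm[OF g(1)] _ order_refl F x ball_\<Omega>[OF x]]) auto
    finally show ?thesis using sing_const_ge_1 by (simp add: mult.assoc add_increasing2)
  next
    case False
    then have iU: "x \<in> inner_U" using ball_cases[OF x] by blast
    \<comment> \<open>The ball lies in \<Omega> but not in V, so it contains a point where p = 1;
      this bounds p(x) - 1 by the log-Hoelder modulus at the radius.\<close>
    obtain y where y: "y \<in> cball x (\<delta> x)" "y \<notin> V" using False by blast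
    have yO: "y \<in> \<Omega>" using y(1) ball_\<Omega>[OF x] by blast
    then have py: "p y = 1" using y(2) by (simp add: V_def Y_def)
    note t = \<delta>_pos[OF x]
    have r: "p x - 1 \<le> c / ln (exp 1 + 1 / \<delta> x)"
    proof (cases "y = x")
      case True
      then show ?thesis using py c_pos ln_ge_1[OF t] by simp
    next
      case False
      have n: "0 < norm (x - y)" "norm (x - y) \<le> \<delta> x" using False y(1) by (auto simp: dist_norm)
      have "p x - p y \<le> c / ln (exp 1 + 1 / norm (x - y))"
        using p_log_Holder[OF x yO] False by (auto simp: abs_le_iff)
      also have "\<dots> \<le> c / ln (exp 1 + 1 / \<delta> x)"
      proof (rule divide_left_mono)
        have "1 / \<delta> x \<le> 1 / norm (x - y)" using n t by (intro divide_left_mono) auto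
        then show "ln (exp 1 + 1 / \<delta> x) \<le> ln (exp 1 + 1 / norm (x - y))"
          using add_pos_pos[OF exp_gt_zero, of "1 / \<delta> x" 1] add_pos_pos[OF exp_gt_zero, of "1 / norm (x - y)" 1] t n
          by (subst ln_le_cancel_iff) simp_all
        show "0 < ln (exp 1 + 1 / norm (x - y)) * ln (exp 1 + 1 / \<delta> x)"
          using ln_ge_1[OF t] ln_ge_1[OF n(1)] by (intro mult_pos_pos) auto
      qed (use c_pos in simp)
      finally show ?thesis by (simp add: py)
    qed
    have "\<bar>dmol b x\<bar> powr (1 + (p x - 1)) \<le> sing_const * \<bar>dmol b x\<bar> powr 1"
      unfolding sing_const_def
    proof (rule powr_log_Holder[OF abs_ge_zero dmol_le_var[OF iU b] t _ _ r c_pos])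
      show "0 \<le> A * 2 / bump_mass TYPE('a)" using A_nonneg bump_mass_pos[where 'a='a] by simp
      show "0 \<le> p x - 1" using p_ge[OF x] by simp
    qed
    then have "\<bar>dmol b x\<bar> powr p x \<le> sing_const * (\<bar>dmol b x\<bar> * indicator inner_U x)" using iU by simp
    then show ?thesis using mF J0 by (simp add: add_increasing)
  qed
qed

text \<open>The right side is free of \<epsilon>, which is what a recovery sequence for the
  relaxation needs.\<close>

lemma mollify_energy:
  assumes F: "integrable lborel F" "\<And>y. y \<in> \<Omega> \<Longrightarrow> F y = 1 + norm (g y) powr p y" "\<And>y. F y \<ge> 0"
  shows "(\<integral>\<^sup>+x. ennreal (norm (grad (mollify \<delta> f) x) powr p x) \<partial>M)
    \<le> ennreal (real DIM('a) powr P * (real DIM('a) *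
        (2 powr P * Jensen_const (LINT y|lborel. norm (g y)) * (kern_mass TYPE('a) * (LINT y|lborel. F y))
          + sing_const * (A * (2 * kern_mass TYPE('a) + 1)))))"
proof -
  define C1 where "C1 = 2 powr P * Jensen_const (LINT y|lborel. norm (g y))"
  have C1: "C1 \<ge> 0" by (simp add: C1_def Jensen_const_def)
  have s0: "sing_const \<ge> 0" using sing_const_ge_1 by simp
  have Fm[measurable]: "F \<in> borel_measurable borel" using F(1) by auto
  have [measurable]: "mollify \<delta> F \<in> borel_measurable borel" by (rule mollify_borel) measurable
  have mF: "mollify \<delta> F x \<ge> 0" if x: "x \<in> \<Omega>" for x unfolding mollify_def
    by (intro Bochner_Integration.integral_nonneg mult_nonneg_nonneg kern_nonneg F(3)) (use \<delta>_pos[OF x] in simp)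
  have "AE x in lborel. \<forall>b\<in>Basis. x \<in> \<Omega> \<longrightarrow> partial_deriv b (mollify \<delta> f) x = dmol b x"
    by (rule AE_finite_allI[OF finite_Basis partial_mollify])
  then have "(\<integral>\<^sup>+x. ennreal (norm (grad (mollify \<delta> f) x) powr p x) * indicator \<Omega> x \<partial>lborel)
    \<le> (\<integral>\<^sup>+x. ennreal (real DIM('a) powr P) * (\<Sum>b\<in>(Basis::'a set).
         ennreal C1 * (ennreal \<bar>mollify \<delta> F x\<bar> * indicator \<Omega> x) + ennreal sing_const * (ennreal \<bar>dmol b x\<bar> * indicator inner_U x)) \<partial>lborel)"
  proof (intro nn_integral_mono_AE, eventually_elim)
    fix x assume pd: "\<forall>b\<in>Basis. x \<in> \<Omega> \<longrightarrow> partial_deriv b (mollify \<delta> f) x = dmol b x"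
    show "ennreal (norm (grad (mollify \<delta> f) x) powr p x) * indicator \<Omega> x \<le> ennreal (real DIM('a) powr P) * (\<Sum>b\<in>(Basis::'a set).
         ennreal C1 * (ennreal \<bar>mollify \<delta> F x\<bar> * indicator \<Omega> x) + ennreal sing_const * (ennreal \<bar>dmol b x\<bar> * indicator inner_U x))"
    proof (cases "x \<in> \<Omega>")
      case x: True
      have "norm (grad (mollify \<delta> f) x) \<le> (\<Sum>b\<in>Basis. \<bar>grad (mollify \<delta> f) x \<bullet> b\<bar>)" by (rule norm_le_l1)
      also have "\<dots> = (\<Sum>b\<in>Basis. \<bar>dmol b x\<bar>)"
        using pd x by (intro sum.cong refl) (simp add: grad_def)
      finally have "norm (grad (mollify \<delta> f) x) powr p x \<le> (\<Sum>b\<in>(Basis::'a set). \<bar>dmol b x\<bar>) powr p x"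
        using p_ge[OF x] by (intro powr_mono2) auto
      also have "\<dots> \<le> real DIM('a) powr P * (\<Sum>b\<in>(Basis::'a set). \<bar>dmol b x\<bar> powr p x)"
        using p_ge[OF x] p_le[OF x] by (intro powr_sum_le) auto
      also have "\<dots> \<le> real DIM('a) powr P * (\<Sum>b\<in>(Basis::'a set). C1 * mollify \<delta> F x + sing_const * (\<bar>dmol b x\<bar> * indicator inner_U x))"
        unfolding C1_def by (intro mult_left_mono sum_mono dmol_powr_le F x) auto
      finally have "ennreal (norm (grad (mollify \<delta> f) x) powr p x)
         \<le> ennreal (real DIM('a) powr P * (\<Sum>b\<in>(Basis::'a set). C1 * mollify \<delta> F x + sing_const * (\<bar>dmol b x\<bar> * indicator inner_U x)))"
        by (rule ennreal_leI)
      also have "\<dots> = ennreal (real DIM('a) powr P) * ennreal (\<Sum>b\<in>(Basis::'a set). C1 * mollify \<delta> F x + sing_const * (\<bar>dmol b x\<bar> * indicator inner_U x))"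
        using C1 s0 mF[OF x] by (intro ennreal_mult sum_nonneg) auto
      also have "ennreal (\<Sum>b\<in>(Basis::'a set). C1 * mollify \<delta> F x + sing_const * (\<bar>dmol b x\<bar> * indicator inner_U x))
         = (\<Sum>b\<in>(Basis::'a set). ennreal (C1 * mollify \<delta> F x + sing_const * (\<bar>dmol b x\<bar> * indicator inner_U x)))"
        using C1 s0 mF[OF x] by (intro sum_ennreal[symmetric]) auto
      also have "\<dots> = (\<Sum>b\<in>(Basis::'a set). ennreal C1 * (ennreal \<bar>mollify \<delta> F x\<bar> * indicator \<Omega> x) + ennreal sing_const * (ennreal \<bar>dmol b x\<bar> * indicator inner_U x))"
        using C1 s0 mF[OF x] x by (intro sum.cong refl) (simp add: ennreal_plus ennreal_mult indicator_def)
      finally show ?thesis using x by simp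
    qed simp
  qed
  also have "\<dots> = ennreal (real DIM('a) powr P) * (\<Sum>b\<in>(Basis::'a set).
      ennreal C1 * (\<integral>\<^sup>+x. ennreal \<bar>mollify \<delta> F x\<bar> * indicator \<Omega> x \<partial>lborel)
      + ennreal sing_const * (\<integral>\<^sup>+x. ennreal \<bar>dmol b x\<bar> * indicator inner_U x \<partial>lborel))"
    by (simp add: nn_integral_cmult nn_integral_sum nn_integral_add)
  also have "\<dots> \<le> ennreal (real DIM('a) powr P) * (\<Sum>b\<in>(Basis::'a set).
      ennreal C1 * (ennreal (kern_mass TYPE('a)) * ennreal (LINT y|lborel. \<bar>F y\<bar>))
      + ennreal sing_const * ennreal (A * (2 * kern_mass TYPE('a) + 1)))"
    by (intro mult_left_mono sum_mono add_mono mollify_L1 F dmol_L1) auto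
  also have "\<dots> = ennreal (real DIM('a) powr P * (real DIM('a) *
        (C1 * (kern_mass TYPE('a) * (LINT y|lborel. F y)) + sing_const * (A * (2 * kern_mass TYPE('a) + 1)))))"
  proof -
    have km: "kern_mass TYPE('a) \<ge> 0" by (rule kern_mass_nonneg)
    have F0: "(LINT y|lborel. F y) \<ge> 0" by (rule Bochner_Integration.integral_nonneg) (rule F(3))
    have Fa: "(LINT y|lborel. \<bar>F y\<bar>) = (LINT y|lborel. F y)" using F(3) by simp
    define X where "X = C1 * (kern_mass TYPE('a) * (LINT y|lborel. F y)) + sing_const * (A * (2 * kern_mass TYPE('a) + 1))"
    have X0: "X \<ge> 0" unfolding X_def using km F0 C1 s0 A_nonneg by (intro add_nonneg_nonneg mult_nonneg_nonneg) auto
    have "ennreal C1 * (ennreal (kern_mass TYPE('a)) * ennreal (LINT y|lborel. \<bar>F y\<bar>))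
      + ennreal sing_const * ennreal (A * (2 * kern_mass TYPE('a) + 1)) = ennreal X"
      unfolding X_def Fa using km F0 C1 s0 A_nonneg by (simp add: ennreal_plus ennreal_mult)
    moreover have "(\<Sum>b\<in>(Basis::'a set). ennreal X) = ennreal (real DIM('a) * X)"
      using X0 by (simp add: sum_ennreal flip: sum_constant)
    ultimately show ?thesis using X0 by (simp add: X_def[symmetric] ennreal_mult)
  qed
  finally show ?thesis by (simp add: nn_integral_M C1_def)
qed

end

section \<open>Convergence of the mollifications as the scale shrinks\<close>

context BV_data
begin

text \<open>The radius as a function of \<epsilon>, outside the locale that fixes \<epsilon>, so
  that a sequence of scales can be considered.\<close>

definition scaled :: "real \<Rightarrow> 'a \<Rightarrow> real" where "scaled \<epsilon> x = \<epsilon> * margin x"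

lemma scaled_eq:
  assumes "0 < \<epsilon>" "\<epsilon> \<le> 1/2"
  shows "mollified_BV \<Omega> p c U f g A \<epsilon>" "mollified_BV.\<delta> \<Omega> p U \<epsilon> = scaled \<epsilon>"
proof -
  show m: "mollified_BV \<Omega> p c U f g A \<epsilon>" by unfold_locales (use assms in auto)
  show "mollified_BV.\<delta> \<Omega> p U \<epsilon> = scaled \<epsilon>"
    by (simp add: fun_eq_iff scaled_def mollified_BV.\<delta>_def[OF m])
qed

lemma mollify_L1_tendsto:
  assumes h: "integrable lborel h" "\<And>x. x \<notin> \<Omega> \<Longrightarrow> h x = 0" and e: "\<And>i. 0 < e i" "\<And>i. e i \<le> 1/2" "e \<longlonglongrightarrow> 0"
  shows "\<And>i. integrable lborel (\<lambda>x. indicator \<Omega> x * (mollify (scaled (e i)) h x - h x))"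
    and "(\<lambda>i. LINT x|lborel. \<bar>indicator \<Omega> x * (mollify (scaled (e i)) h x - h x)\<bar>) \<longlonglongrightarrow> 0"
proof -
  have hm[measurable]: "h \<in> borel_measurable borel" using h(1) by auto
  have vs: "variable_scale \<Omega> (scaled (e i))" for i
  proof -
    interpret m: mollified_BV \<Omega> p c U f g A "e i" by (rule scaled_eq(1)[OF e(1,2)])
    show ?thesis using m.variable_scale_axioms unfolding scaled_eq(2)[OF e(1,2)] .
  qed
  have mm[measurable]: "mollify (scaled (e i)) h \<in> borel_measurable borel" for i
    by (rule variable_scale.mollify_borel[OF vs hm])
  have int: "integrable lborel (\<lambda>x. indicator \<Omega> x * (mollify (scaled (e i)) h x - h x))" for i
  proof -
    have "integrable lborel (\<lambda>x. indicator \<Omega> x * mollify (scaled (e i)) h x)"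
    proof (rule integrableI_bounded)
      have "(\<integral>\<^sup>+x. ennreal (norm (indicator \<Omega> x * mollify (scaled (e i)) h x)) \<partial>lborel)
        = (\<integral>\<^sup>+x. ennreal \<bar>mollify (scaled (e i)) h x\<bar> * indicator \<Omega> x \<partial>lborel)"
        by (intro nn_integral_cong) (simp add: indicator_def)
      also have "\<dots> \<le> ennreal (kern_mass TYPE('a)) * ennreal (LINT x|lborel. \<bar>h x\<bar>)"
        by (rule variable_scale.mollify_L1[OF vs h(1)])
      also have "\<dots> < \<infinity>" by (simp add: ennreal_mult_less_top)
      finally show "(\<integral>\<^sup>+x. ennreal (norm (indicator \<Omega> x * mollify (scaled (e i)) h x)) \<partial>lborel) < \<infinity>" .
    qed measurable
    then have "integrable lborel (\<lambda>x. indicator \<Omega> x * mollify (scaled (e i)) h x - h x)"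
      using h(1) by (rule Bochner_Integration.integrable_diff)
    moreover have "indicator \<Omega> x * mollify (scaled (e i)) h x - h x = indicator \<Omega> x * (mollify (scaled (e i)) h x - h x)" for x
      using h(2)[of x] by (cases "x \<in> \<Omega>") auto
    ultimately show ?thesis by simp
  qed
  then show "\<And>i. integrable lborel (\<lambda>x. indicator \<Omega> x * (mollify (scaled (e i)) h x - h x))" .
  show "(\<lambda>i. LINT x|lborel. \<bar>indicator \<Omega> x * (mollify (scaled (e i)) h x - h x)\<bar>) \<longlonglongrightarrow> 0"
  proof (rule LIMSEQ_I)
    fix r :: real assume r: "r > 0"
    then have r2: "r / 2 > 0" by simp
    show "\<exists>N. \<forall>i\<ge>N. norm ((LINT x|lborel. \<bar>indicator \<Omega> x * (mollify (scaled (e i)) h x - h x)\<bar>) - 0) < r"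
    proof (rule mollify_L1_convergence[OF h(1) r2 open_dom bounded_dom], rule margin_bounded)
      fix s D :: real
      assume s: "0 < s" and conv: "\<And>\<delta>. variable_scale \<Omega> \<delta> \<Longrightarrow> (\<And>x. x \<in> \<Omega> \<Longrightarrow> \<delta> x \<le> s) \<Longrightarrow>
         (\<integral>\<^sup>+x. ennreal \<bar>mollify \<delta> h x - h x\<bar> * indicator \<Omega> x \<partial>lborel) \<le> ennreal (r / 2)"
        and D: "0 < D" "\<And>x. x \<in> \<Omega> \<Longrightarrow> margin x \<le> D"
      have "\<forall>\<^sub>F i in sequentially. e i < s / D" using e(3) by (rule order_tendstoD(2)) (use s D in simp)
      then obtain N where N: "\<And>i. i \<ge> N \<Longrightarrow> e i < s / D" by (auto simp: eventually_sequentially)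
      have "norm ((LINT x|lborel. \<bar>indicator \<Omega> x * (mollify (scaled (e i)) h x - h x)\<bar>) - 0) < r" if i: "i \<ge> N" for i
      proof -
        have "scaled (e i) x \<le> s" if x: "x \<in> \<Omega>" for x
        proof -
          have "e i * margin x \<le> e i * D" using D(2)[OF x] e(1)[of i] by (intro mult_left_mono) auto
          also have "\<dots> \<le> s" using N[OF i] D(1) by (simp add: pos_less_divide_eq)
          finally show ?thesis by (simp add: scaled_def)
        qed
        from conv[OF vs this]
        have "(\<integral>\<^sup>+x. ennreal \<bar>mollify (scaled (e i)) h x - h x\<bar> * indicator \<Omega> x \<partial>lborel) \<le> ennreal (r / 2)" .
        also have "(\<integral>\<^sup>+x. ennreal \<bar>mollify (scaled (e i)) h x - h x\<bar> * indicator \<Omega> x \<partial>lborel)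
          = (\<integral>\<^sup>+x. ennreal \<bar>indicator \<Omega> x * (mollify (scaled (e i)) h x - h x)\<bar> \<partial>lborel)"
          by (intro nn_integral_cong) (simp add: indicator_def)
        also have "\<dots> = ennreal (LINT x|lborel. \<bar>indicator \<Omega> x * (mollify (scaled (e i)) h x - h x)\<bar>)"
          by (rule nn_integral_eq_integral[OF integrable_abs[OF int]]) simp
        finally have "(LINT x|lborel. \<bar>indicator \<Omega> x * (mollify (scaled (e i)) h x - h x)\<bar>) \<le> r / 2"
          using r by (subst (asm) ennreal_le_iff) auto
        moreover have "0 \<le> (LINT x|lborel. \<bar>indicator \<Omega> x * (mollify (scaled (e i)) h x - h x)\<bar>)"
          by (rule Bochner_Integration.integral_nonneg) simp
        ultimately show ?thesis using r by simp
      qed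
      then show ?thesis by blast
    qed
  qed
qed

text \<open>Jensen's inequality dominates the power p of the mollification by J times the
  mollification T of H, and T converges to H in L1. Together with almost everywhere convergence
  along a subsequence, dominated convergence with varying majorants gives convergence of the
  modular. Passing to a subsequence is harmless, because the energy bound is uniform.\<close>

lemma smooth_approximation:
  assumes F: "integrable lborel F" "\<And>y. y \<in> \<Omega> \<Longrightarrow> F y = 1 + norm (g y) powr p y" "\<And>y. F y \<ge> 0"
    and H: "integrable lborel H" "\<And>y. y \<in> \<Omega> \<Longrightarrow> H y = 1 + \<bar>f y\<bar> powr p y" "\<And>y. H y \<ge> 0" "\<And>y. y \<notin> \<Omega> \<Longrightarrow> H y = 0"
  obtains v C where "\<And>i. v i \<in> Lip_loc \<Omega> \<inter> space_Lp \<Omega> p" "(\<lambda>i. norm_Lp \<Omega> p (\<lambda>x. v i x - f x)) \<longlonglongrightarrow> 0"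
    "\<And>i::nat. (\<integral>\<^sup>+x. ennreal (norm (grad (v i) x) powr p x) \<partial>M) \<le> ennreal C"
proof -
  define e where "e i = 1 / (real i + 2)" for i :: nat
  have e: "0 < e i" "e i \<le> 1/2" for i by (auto simp: e_def field_simps)
  have e0: "e \<longlonglongrightarrow> 0"
  proof (rule Lim_null_comparison[OF _ LIMSEQ_inverse_real_of_nat])
    show "\<forall>\<^sub>F i in sequentially. norm (e i) \<le> inverse (real (Suc i))"
      by (intro always_eventually allI) (simp add: e_def inverse_eq_divide frac_le)
  qed
  define v where "v i = mollify (scaled (e i)) f" for i
  define T where "T i = mollify (scaled (e i)) H" for i
  have Hm[measurable]: "H \<in> borel_measurable borel" using H(1) by auto
  define J where "J = Jensen_const (LINT y|lborel. \<bar>f y\<bar>)"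
  have J0: "J \<ge> 0" by (simp add: J_def Jensen_const_def)
  have vs: "variable_scale \<Omega> (scaled (e i))" for i
  proof -
    interpret m: mollified_BV \<Omega> p c U f g A "e i" by (rule scaled_eq(1)[OF e])
    show ?thesis using m.variable_scale_axioms unfolding scaled_eq(2)[OF e] .
  qed
  have vm[measurable]: "v i \<in> borel_measurable borel" for i
    unfolding v_def by (rule variable_scale.mollify_borel[OF vs f_borel])
  have Tm[measurable]: "T i \<in> borel_measurable borel" for i
    unfolding T_def by (rule variable_scale.mollify_borel[OF vs Hm])
  have vL: "v i \<in> Lip_loc \<Omega>" for i
    unfolding v_def by (rule variable_scale.mollify_Lip_loc[OF vs f(1)])
  have T0: "T i x \<ge> 0" if x: "x \<in> \<Omega>" for i x unfolding T_def mollify_def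
    by (intro Bochner_Integration.integral_nonneg mult_nonneg_nonneg kern_nonneg H(3) less_imp_le variable_scale.\<delta>_pos[OF vs x])
  have vT: "\<bar>v i x\<bar> powr p x \<le> J * T i x" if x: "x \<in> \<Omega>" for i x
  proof -
    interpret m: mollified_BV \<Omega> p c U f g A "e i" by (rule scaled_eq(1)[OF e])
    have ball: "cball x (scaled (e i) x) \<subseteq> \<Omega>" using m.ball_\<Omega>[OF x] unfolding scaled_eq(2)[OF e] .
    note t = variable_scale.\<delta>_pos[OF vs[of i] x]
    have "\<bar>v i x\<bar> \<le> (LINT y|lborel. \<bar>kern (scaled (e i) x) (y - x) * f y\<bar>)"
      unfolding v_def mollify_def by (rule integral_abs_bound)
    also have "\<dots> = mollify (scaled (e i)) (\<lambda>y. \<bar>f y\<bar>) x"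
      unfolding mollify_def abs_mult abs_of_nonneg[OF kern_nonneg[OF less_imp_le[OF t]]] ..
    finally have "\<bar>v i x\<bar> powr p x \<le> (mollify (scaled (e i)) (\<lambda>y. \<bar>f y\<bar>) x) powr p x"
      using p_ge[OF x] by (intro powr_mono2) auto
    also have "\<dots> \<le> J * T i x"
      unfolding J_def T_def
      by (rule mollify_Jensen[OF vs integrable_abs[OF f(1)] _ order_refl H(1,2,3) x ball]) auto
    finally show ?thesis .
  qed
  have pb[measurable]: "(\<lambda>x. indicator \<Omega> x * p x) \<in> borel_measurable borel"
    using borel_measurable_continuous_on_indicator[OF dom_borel p_continuous] by simp
  have TM: "(\<integral>\<^sup>+x. ennreal (T i x) * indicator \<Omega> x \<partial>lborel) < \<infinity>" for i
  proof -
    have "(\<integral>\<^sup>+x. ennreal (T i x) * indicator \<Omega> x \<partial>lborel) \<le> (\<integral>\<^sup>+x. ennreal \<bar>T i x\<bar> * indicator \<Omega> x \<partial>lborel)"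
      by (intro nn_integral_mono mult_right_mono ennreal_leI) auto
    also have "\<dots> \<le> ennreal (kern_mass TYPE('a)) * ennreal (LINT x|lborel. \<bar>H x\<bar>)"
      unfolding T_def by (rule variable_scale.mollify_L1[OF vs H(1)])
    also have "\<dots> < \<infinity>" by (simp add: ennreal_mult_less_top)
    finally show ?thesis .
  qed
  have M_meas: "h \<in> borel_measurable M" if "h \<in> borel_measurable borel" for h :: "'a \<Rightarrow> real"
    by (rule measurable_restrict_space1, rule measurable_completion) (use that in simp)
  have vLp: "v i \<in> space_Lp \<Omega> p" for i
  proof -
    have "modular_Lp \<Omega> p (v i) \<le> (\<integral>\<^sup>+x. ennreal J * (ennreal (T i x) * indicator \<Omega> x) \<partial>lborel)"
      unfolding modular_Lp_def nn_integral_M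
    proof (rule nn_integral_mono)
      fix x
      show "ennreal (\<bar>v i x\<bar> powr p x) * indicator \<Omega> x \<le> ennreal J * (ennreal (T i x) * indicator \<Omega> x)"
        using vT[of x i] J0 T0[of x i] by (cases "x \<in> \<Omega>") (auto simp: ennreal_mult[symmetric] ennreal_leI)
    qed
    also have "\<dots> = ennreal J * (\<integral>\<^sup>+x. ennreal (T i x) * indicator \<Omega> x \<partial>lborel)" by (rule nn_integral_cmult) measurable
    also have "\<dots> < \<infinity>" using TM[of i] by (simp add: ennreal_mult_less_top)
    finally have "modular_Lp \<Omega> p (\<lambda>x. v i x / 1) < \<infinity>" by simp
    then show ?thesis unfolding space_Lp_def using M_meas[OF vm[of i]] by (auto intro!: exI[of _ 1])
  qed
  define C where "C = real DIM('a) powr P * (real DIM('a) *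
        (2 powr P * Jensen_const (LINT y|lborel. norm (g y)) * (kern_mass TYPE('a) * (LINT y|lborel. F y))
          + exp (c * (ln (1 + A * 2 / bump_mass TYPE('a)) + DIM('a))) * (A * (2 * kern_mass TYPE('a) + 1))))"
  have en: "(\<integral>\<^sup>+x. ennreal (norm (grad (v i) x) powr p x) \<partial>M) \<le> ennreal C" for i
  proof -
    interpret m: mollified_BV \<Omega> p c U f g A "e i" by (rule scaled_eq(1)[OF e])
    show ?thesis using m.mollify_energy[OF F] unfolding v_def C_def scaled_eq(2)[OF e] m.sing_const_def .
  qed
  define d where "d i x = indicator \<Omega> x * (v i x - f x)" for i x
  define k where "k i x = indicator \<Omega> x * (T i x - H x)" for i x
  have d: "\<And>i. integrable lborel (d i)" "(\<lambda>i. LINT x|lborel. norm (d i x)) \<longlonglongrightarrow> 0"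
    unfolding d_def[abs_def] v_def real_norm_def
    by (rule mollify_L1_tendsto(1)[OF f(1,2) e e0], assumption?, rule mollify_L1_tendsto(2)[OF f(1,2) e e0], assumption?)
  have k: "\<And>i. integrable lborel (k i)"
    unfolding k_def[abs_def] T_def by (rule mollify_L1_tendsto(1)[OF H(1,4) e e0])
  have k': "(\<lambda>i. LINT x|lborel. \<bar>k i x\<bar>) \<longlonglongrightarrow> 0"
    unfolding k_def[abs_def] T_def by (rule mollify_L1_tendsto(2)[OF H(1,4) e e0])
  obtain r where r: "strict_mono r" "AE x in lborel. (\<lambda>n. d (r n) x) \<longlonglongrightarrow> 0"
    using tendsto_L1_AE_subseq[OF d] by blast
  define K where "K = 2 powr P * (J + 1)"
  have K0: "K \<ge> 0" using J0 by (simp add: K_def)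
  define a where "a n x = indicator \<Omega> x * \<bar>v (r n) x - f x\<bar> powr p x" for n x
  \<comment> \<open>Outside \<Omega> the function p is arbitrary; the indicator in the exponent
    makes the expression Borel.\<close>
  have aeq: "a n x = indicator \<Omega> x * \<bar>v (r n) x - f x\<bar> powr (indicator \<Omega> x * p x)" for n x
    by (cases "x \<in> \<Omega>") (auto simp: a_def)
  have am[measurable]: "a n \<in> borel_measurable borel" for n
    unfolding aeq[abs_def] by measurable
  have a0: "a n x \<ge> 0" for n x by (simp add: a_def)
  \<comment> \<open>The bound 2^P (J T + H) is at most K (T + H) = K (T - H) + 2 K H: an L1-small
    error plus a fixed majorant.\<close>
  have akH: "a n x \<le> K * \<bar>k (r n) x\<bar> + 2 * K * H x" for n x
  proof (cases "x \<in> \<Omega>")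
    case x: True
    have "\<bar>v (r n) x - f x\<bar> powr p x \<le> (\<bar>v (r n) x\<bar> + \<bar>f x\<bar>) powr p x" using p_ge[OF x] by (intro powr_mono2) auto
    also have "\<dots> \<le> 2 powr P * (\<bar>v (r n) x\<bar> powr p x + \<bar>f x\<bar> powr p x)"
      using p_ge[OF x] p_le[OF x] by (intro powr_add_le) auto
    also have "\<dots> \<le> 2 powr P * (J * T (r n) x + H x)"
      using vT[OF x] H(2)[OF x] by (intro mult_left_mono add_mono) auto
    also have "\<dots> \<le> 2 powr P * ((J + 1) * T (r n) x + (J + 1) * H x)"
      using T0[OF x] H(3)[of x] J0 by (intro mult_left_mono add_mono mult_right_mono) (auto simp: algebra_simps)
    also have "\<dots> = K * (T (r n) x - H x) + 2 * K * H x" by (simp add: K_def algebra_simps)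
    also have "\<dots> \<le> K * \<bar>k (r n) x\<bar> + 2 * K * H x" using K0 x by (intro add_right_mono mult_left_mono) (auto simp: k_def)
    finally show ?thesis using x by (simp add: a_def)
  qed (use K0 H(4) in \<open>simp add: a_def\<close>)
  have KHi: "integrable lborel (\<lambda>x. 2 * K * H x)" by (rule integrable_mult_right[OF H(1)])
  have ai: "integrable lborel (a n)" for n
  proof (rule Bochner_Integration.integrable_bound)
    show "integrable lborel (\<lambda>x. K * \<bar>k (r n) x\<bar> + 2 * K * H x)"
      by (intro Bochner_Integration.integrable_add integrable_mult_right integrable_abs k H)
    show "AE x in lborel. norm (a n x) \<le> norm (K * \<bar>k (r n) x\<bar> + 2 * K * H x)"
      by (intro always_eventually allI) (use akH a0 in \<open>auto intro: order_trans[OF _ abs_ge_self]\<close>)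
  qed measurable
  \<comment> \<open>Truncating at the fixed majorant permits ordinary dominated convergence; the
    excess is at most K times \<bar>k\<bar>, whose integral tends to 0.\<close>
  have mini: "integrable lborel (\<lambda>x. min (a n x) (2 * K * H x))" for n
    by (rule integrable_min[OF ai KHi])
  have "(\<lambda>n. LINT x|lborel. min (a n x) (2 * K * H x)) \<longlonglongrightarrow> (LINT x::'a|lborel. 0)"
  proof (rule integral_dominated_convergence[where w = "\<lambda>x. 2 * K * H x"])
    show "AE x in lborel. (\<lambda>n. min (a n x) (2 * K * H x)) \<longlonglongrightarrow> 0"
      using r(2)
    proof eventually_elim
      case (elim x)
      have "(\<lambda>n. a n x) \<longlonglongrightarrow> 0"
      proof (cases "x \<in> \<Omega>")
        case True
        then have "(\<lambda>n. \<bar>d (r n) x\<bar> powr p x) \<longlonglongrightarrow> \<bar>0\<bar> powr p x"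
          using p_ge[OF True] by (intro tendsto_powr2 tendsto_rabs elim tendsto_const) auto
        then show ?thesis using True by (simp add: a_def d_def)
      qed (simp add: a_def)
      then have "(\<lambda>n. min (a n x) (2 * K * H x)) \<longlonglongrightarrow> min 0 (2 * K * H x)"
        by (intro tendsto_intros)
      then show ?case using K0 H(3)[of x] by simp
    qed
    have "norm (min (a n x) (2 * K * H x)) \<le> 2 * K * H x" for n x
      using a0[of n x] K0 H(3)[of x] by (auto simp: min_def)
    then show "\<And>n. AE x in lborel. norm (min (a n x) (2 * K * H x)) \<le> 2 * K * H x" by simp
  qed (use KHi mini in auto)
  then have l1: "(\<lambda>n. LINT x|lborel. min (a n x) (2 * K * H x)) \<longlonglongrightarrow> 0" by simp
  have l2: "(\<lambda>n. K * (LINT x|lborel. \<bar>k (r n) x\<bar>)) \<longlonglongrightarrow> 0"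
    using tendsto_mult_right_zero[OF LIMSEQ_subseq_LIMSEQ[OF k' r(1)], of K] by (simp add: comp_def)
  have al: "(\<lambda>n. LINT x|lborel. a n x) \<longlonglongrightarrow> 0"
  proof (rule tendsto_sandwich[OF _ _ tendsto_const])
    show "\<forall>\<^sub>F n in sequentially. 0 \<le> (LINT x|lborel. a n x)"
      by (intro always_eventually allI Bochner_Integration.integral_nonneg a0)
    show "(\<lambda>n. (LINT x|lborel. min (a n x) (2 * K * H x)) + K * (LINT x|lborel. \<bar>k (r n) x\<bar>)) \<longlonglongrightarrow> 0"
      using tendsto_add[OF l1 l2] by simp
    have "(LINT x|lborel. a n x) \<le> (LINT x|lborel. min (a n x) (2 * K * H x)) + K * (LINT x|lborel. \<bar>k (r n) x\<bar>)" for n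
    proof -
      have "(LINT x|lborel. a n x) \<le> (LINT x|lborel. min (a n x) (2 * K * H x) + K * \<bar>k (r n) x\<bar>)"
      proof (rule integral_mono[OF ai])
        show "integrable lborel (\<lambda>x. min (a n x) (2 * K * H x) + K * \<bar>k (r n) x\<bar>)"
          by (intro Bochner_Integration.integrable_add mini integrable_mult_right integrable_abs k)
        fix x
        have "0 \<le> K * \<bar>k (r n) x\<bar>" using K0 by simp
        then show "a n x \<le> min (a n x) (2 * K * H x) + K * \<bar>k (r n) x\<bar>" using akH[of n x] by (simp add: min_def)
      qed
      also have "\<dots> = (LINT x|lborel. min (a n x) (2 * K * H x)) + K * (LINT x|lborel. \<bar>k (r n) x\<bar>)"
        using mini k by (simp add: integrable_abs)
      finally show ?thesis .
    qed
    then show "\<forall>\<^sub>F n in sequentially. (LINT x|lborel. a n x) \<le> (LINT x|lborel. min (a n x) (2 * K * H x)) + K * (LINT x|lborel. \<bar>k (r n) x\<bar>)"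
      by simp
  qed
  have mod: "modular_Lp \<Omega> p (\<lambda>x. v (r n) x - f x) = ennreal (LINT x|lborel. a n x)" for n
  proof -
    have "modular_Lp \<Omega> p (\<lambda>x. v (r n) x - f x) = (\<integral>\<^sup>+x. ennreal (a n x) \<partial>lborel)"
      unfolding modular_Lp_def nn_integral_M by (intro nn_integral_cong) (simp add: a_def indicator_def)
    also have "\<dots> = ennreal (LINT x|lborel. a n x)"
      by (rule nn_integral_eq_integral[OF ai]) (simp add: a0)
    finally show ?thesis .
  qed
  have lim: "(\<lambda>n. norm_Lp \<Omega> p (\<lambda>x. v (r n) x - f x)) \<longlonglongrightarrow> 0"
  proof (rule norm_Lp_tendsto_0)
    show "(\<lambda>x. v (r n) x - f x) \<in> borel_measurable M" for n by (rule M_meas) measurable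
    show "(\<lambda>n. modular_Lp \<Omega> p (\<lambda>x. v (r n) x - f x)) \<longlonglongrightarrow> 0"
      unfolding mod using tendsto_ennrealI[OF al] by simp
  qed
  show thesis by (rule that[of "\<lambda>n. v (r n)" C, OF IntI[OF vL vLp] lim en])
qed

end

section \<open>From a BV function to Borel data\<close>

context variable_exponent
begin

text \<open>Local integrability yields measurability on compact sets only; an exhaustion of V by
  compact sets extends it to V.\<close>

lemma weak_gradient_measurable:
  fixes G :: "'a \<Rightarrow> 'a"
  assumes "locally_integrable V G"
  shows "(\<lambda>x. indicator V x *\<^sub>R G x) \<in> borel_measurable lebesgue"
proof -
  obtain Cn where Cn: "\<And>n. compact (Cn n)" "\<And>n. Cn n \<subseteq> V" "\<Union>(range Cn) = V" "\<And>n. Cn n \<subseteq> interior (Cn (Suc n))"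
    by (rule open_Union_compact_subsets[OF V_open]) blast
  have mono: "Cn m \<subseteq> Cn n" if "m \<le> n" for m n
    by (rule lift_Suc_mono_le[OF _ that]) (rule subset_trans[OF Cn(4) interior_subset])
  have m: "(\<lambda>x. indicator (Cn n) x *\<^sub>R G x) \<in> borel_measurable lebesgue" for n
  proof -
    have "integrable lebesgue (\<lambda>x. indicator (Cn n) x *\<^sub>R G x)"
      using assms Cn(1,2)[of n] by (simp add: locally_integrable_def set_integrable_def)
    then show ?thesis by (rule borel_measurable_integrable)
  qed
  show ?thesis
  proof (rule borel_measurable_LIMSEQ_metric[OF m])
    fix x
    show "(\<lambda>n. indicator (Cn n) x *\<^sub>R G x) \<longlonglongrightarrow> indicator V x *\<^sub>R G x"
    proof (cases "x \<in> V")
      case True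
      then obtain n0 where n0: "x \<in> Cn n0" using Cn(3) by blast
      have "\<forall>\<^sub>F n in sequentially. indicator V x *\<^sub>R G x = indicator (Cn n) x *\<^sub>R G x"
        using eventually_ge_at_top[of n0] by eventually_elim (use True n0 mono in \<open>auto simp: indicator_def\<close>)
      then show ?thesis by (rule Lim_transform_eventually[OF tendsto_const])
    next
      case False
      then have "x \<notin> Cn n" for n using Cn(2) by blast
      then show ?thesis using False by simp
    qed
  qed
qed

theorem BV_imp_BV_tilde:
  assumes u: "u \<in> BV \<Omega> p"
  shows "u \<in> BV_tilde \<Omega> p"
proof -
  have um: "u \<in> borel_measurable M" and nf: "norm_Lp \<Omega> p u < \<infinity>" "luxemburg (modular_BV \<Omega> p) u < \<infinity>"
    using u by (auto simp: BV_def norm_BV_def)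
  have uL: "u \<in> space_Lp \<Omega> p" using um nf(1) by (simp add: space_Lp_iff)
  have ui: "integrable M u" by (rule space_Lp_integrable[OF uL])
  obtain l where l: "l > 0" and mod: "modular_BV \<Omega> p (\<lambda>x. u x / l) \<le> 1"
    using nf(2) unfolding luxemburg_finite_iff by blast
  have mod': "variation \<Omega> (\<lambda>x. u x / l) Y + weak_gradient_energy V p (\<lambda>x. u x / l) \<le> 1"
    using mod unfolding modular_BV_def Let_def Y_def[symmetric] V_def[symmetric] .
  have v1: "variation \<Omega> (\<lambda>x. u x / l) Y \<le> 1"
    by (rule order_trans[OF _ mod']) simp
  have e1: "weak_gradient_energy V p (\<lambda>x. u x / l) \<le> 1"
    by (rule order_trans[OF _ mod']) simp
  \<comment> \<open>The variation of Y is an infimum over open neighbourhoods. Being at most 1 it is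
    below 2, so some neighbourhood \<open>U\<close> has variation below 2.\<close>
  have "variation \<Omega> (\<lambda>x. u x / l) Y < 2" using v1 by (rule le_less_trans) simp
  then obtain U where U: "open U" "Y \<subseteq> U" "U \<subseteq> \<Omega>" and Uv: "variation_open (\<lambda>x. u x / l) U < 2"
    unfolding variation_def INF_less_iff by blast
  have ex: "\<exists>G. has_weak_gradient V (\<lambda>x. u x / l) G"
    by (rule ccontr) (use e1 in \<open>simp add: weak_gradient_energy_def top_unique\<close>)
  define G where "G = weak_gradient V (\<lambda>x. u x / l)"
  have G: "has_weak_gradient V (\<lambda>x. u x / l) G"
    using someI_ex[OF ex] by (simp add: G_def weak_gradient_def)
  have Ge: "(\<integral>\<^sup>+x. ennreal (norm (G x) powr p x) \<partial>lebesgue_on V) \<le> 1"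
    using e1 ex by (simp add: weak_gradient_energy_def G_def)
  have Vb[measurable]: "V \<in> sets borel" and Ub: "U \<in> sets borel" using V_open U(1) by auto
  define Gv where "Gv x = indicator V x *\<^sub>R G x" for x
  have Gvm: "Gv \<in> borel_measurable lebesgue"
    unfolding Gv_def[abs_def] by (rule weak_gradient_measurable) (use G in \<open>simp add: has_weak_gradient_def\<close>)
  have Gvm': "Gv \<in> borel_measurable M" by (rule measurable_restrict_space1[OF Gvm])
  have Gve: "(\<integral>\<^sup>+x. ennreal (norm (Gv x) powr p x) \<partial>M) \<le> ennreal 1"
  proof -
    have "(\<integral>\<^sup>+x. ennreal (norm (Gv x) powr p x) \<partial>M) = (\<integral>\<^sup>+x. ennreal (norm (Gv x) powr p x) * indicator \<Omega> x \<partial>lebesgue)"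
      by (simp add: nn_integral_restrict_space)
    also have "\<dots> = (\<integral>\<^sup>+x. ennreal (norm (G x) powr p x) * indicator V x \<partial>lebesgue)"
      using V_sub by (intro nn_integral_cong) (auto simp: Gv_def indicator_def)
    also have "\<dots> = (\<integral>\<^sup>+x. ennreal (norm (G x) powr p x) \<partial>lebesgue_on V)"
      by (simp add: nn_integral_restrict_space)
    finally show ?thesis using Ge by simp
  qed
  have GvM: "integrable M Gv" by (rule L1_le_powr(1)[OF Gvm' Gve]) simp
  have Gvi: "integrable lebesgue Gv"
  proof -
    have "integrable lebesgue (\<lambda>x. indicator \<Omega> x *\<^sub>R Gv x)" using GvM by (simp add: integrable_restrict_space)
    moreover have "(\<lambda>x. indicator \<Omega> x *\<^sub>R Gv x) = Gv" using V_sub by (auto simp: Gv_def indicator_def fun_eq_iff)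
    ultimately show ?thesis by simp
  qed
  have "integrable lebesgue (\<lambda>x. indicator \<Omega> x *\<^sub>R u x)" using ui by (simp add: integrable_restrict_space)
  then obtain f0 where f0[measurable]: "f0 \<in> borel_measurable borel" and f0e: "AE x in lborel. f0 x = indicator \<Omega> x *\<^sub>R u x"
    and f0i: "integrable lborel f0" by (rule ex_borel_version)
  define f where "f x = indicator \<Omega> x * f0 x" for x
  have fm[measurable]: "f \<in> borel_measurable borel" unfolding f_def by measurable
  have fi: "integrable lborel f"
    unfolding f_def using integrable_mult_indicator[OF _ f0i, of \<Omega>] by simp
  have fz: "f x = 0" if "x \<notin> \<Omega>" for x using that by (simp add: f_def)
  have fe: "AE x in lborel. x \<in> \<Omega> \<longrightarrow> u x = f x"
    using f0e by eventually_elim (simp add: f_def)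
  have "\<forall>b. \<exists>h. h \<in> borel_measurable borel \<and> (AE x in lborel. h x = Gv x \<bullet> b) \<and> integrable lborel h"
  proof
    fix b
    have "integrable lebesgue (\<lambda>x. Gv x \<bullet> b)" by (rule integrable_inner_left) (rule Gvi)
    then obtain h0 where "h0 \<in> borel_measurable borel" "AE x in lborel. h0 x = Gv x \<bullet> b" "integrable lborel h0"
      by (rule ex_borel_version)
    then show "\<exists>h. h \<in> borel_measurable borel \<and> (AE x in lborel. h x = Gv x \<bullet> b) \<and> integrable lborel h"
      by (intro exI[of _ h0] conjI)
  qed
  from choice[OF this] obtain h where h: "\<forall>b. h b \<in> borel_measurable borel \<and> (AE x in lborel. h b x = Gv x \<bullet> b) \<and> integrable lborel (h b)" ..
  have hm[measurable]: "h b \<in> borel_measurable borel" for b using h by blast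
  \<comment> \<open>A Borel representative of l times the weak gradient of u / l, assembled from its
    components and set to zero off V.\<close>
  define g where "g x = indicator V x *\<^sub>R (\<Sum>b\<in>Basis. (l * h b x) *\<^sub>R b)" for x
  have gm[measurable]: "g \<in> borel_measurable borel" unfolding g_def by measurable
  have gi: "integrable lborel g"
  proof -
    have "integrable lborel (\<lambda>x. (\<Sum>b\<in>Basis. (l * h b x) *\<^sub>R b))"
      using h by (intro Bochner_Integration.integrable_sum integrable_scaleR_left integrable_mult_right) auto
    then show ?thesis unfolding g_def by (rule integrable_mult_indicator[rotated]) simp
  qed
  have gz: "g x = 0" if "x \<notin> V" for x using that by (simp add: g_def)
  have "AE x in lborel. \<forall>b\<in>Basis. h b x = Gv x \<bullet> b"
    by (rule AE_finite_allI[OF finite_Basis]) (use h in blast)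
  then have ge: "AE x in lborel. g x = l *\<^sub>R Gv x"
  proof eventually_elim
    case (elim x)
    have "(\<Sum>b\<in>Basis. (l * h b x) *\<^sub>R b) = l *\<^sub>R (\<Sum>b\<in>Basis. (Gv x \<bullet> b) *\<^sub>R b)"
      using elim by (simp add: scaleR_sum_right)
    then have "g x = indicator V x *\<^sub>R (l *\<^sub>R Gv x)" by (simp add: g_def euclidean_representation)
    then show ?case by (simp add: Gv_def indicator_def)
  qed
  \<comment> \<open>Undoing the division by l turns the variation bound 2 for u / l into 2
    l.\<close>
  have var: "(LINT x|lborel. f x * divergence \<phi> x) \<le> l * 2" if \<phi>: "\<phi> \<in> C1_compact U" and n: "\<And>x. norm (\<phi> x) \<le> 1" for \<phi> :: "'a \<Rightarrow> 'a"
  proof -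
    have co: "continuous_on UNIV (partial_deriv b (\<lambda>y. \<phi> y \<bullet> b)) \<and> (\<forall>x. x \<notin> U \<longrightarrow> partial_deriv b (\<lambda>y. \<phi> y \<bullet> b) x = 0)" if b: "b \<in> Basis" for b
    proof (rule C1_compact_partial[OF component_in_C1_compact[OF \<phi>, of b], of b])
      assume "continuous_on UNIV (partial_deriv b (\<lambda>y. \<phi> y \<bullet> b))"
        "\<And>x. x \<notin> closure {x. \<phi> x \<bullet> b \<noteq> 0} \<Longrightarrow> partial_deriv b (\<lambda>y. \<phi> y \<bullet> b) x = 0"
        "closure {x. \<phi> x \<bullet> b \<noteq> 0} \<subseteq> U"
      then show ?thesis by blast
    qed (use b in simp)
    have dm[measurable]: "divergence \<phi> \<in> borel_measurable borel"
      unfolding divergence_def[abs_def] using co by (intro borel_measurable_sum borel_measurable_continuous_onI) auto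
    have dz: "divergence \<phi> x = 0" if "x \<notin> U" for x unfolding divergence_def using co that by simp
    have "(LINT x|lborel. f x * divergence \<phi> x) = (LINT x|lebesgue_on U. u x * divergence \<phi> x)"
    proof (rule lebesgue_on_integral_eq(1)[OF Ub, symmetric])
      show "AE x in lborel. x \<in> U \<longrightarrow> u x * divergence \<phi> x = f x * divergence \<phi> x"
        using fe by eventually_elim (use U(3) in auto)
    qed (auto simp: dz)
    also have "\<dots> = (LINT x|lebesgue_on U. l * (u x / l * divergence \<phi> x))" using l by simp
    also have "\<dots> = l * (LINT x|lebesgue_on U. u x / l * divergence \<phi> x)" by (rule integral_mult_right_zero)
    also have "\<dots> \<le> l * 2"
    proof (rule mult_left_mono)
      have "ennreal (LINT x|lebesgue_on U. u x / l * divergence \<phi> x) \<le> variation_open (\<lambda>x. u x / l) U"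
        unfolding variation_open_def by (rule SUP_upper) (use \<phi> n in auto)
      also have "\<dots> \<le> ennreal 2" using Uv by simp
      finally show "(LINT x|lebesgue_on U. u x / l * divergence \<phi> x) \<le> 2" by (subst (asm) ennreal_le_iff) auto
    qed (use l in simp)
    finally show ?thesis .
  qed
  have wg: "(LINT x|lborel. f x * partial_deriv b \<psi> x) = - (LINT x|lborel. (g x \<bullet> b) * \<psi> x)"
    if \<psi>: "\<psi> \<in> C1_compact V" and b: "b \<in> Basis" for \<psi> :: "'a \<Rightarrow> real" and b
  proof -
    have co: "continuous_on UNIV \<psi> \<and> continuous_on UNIV (partial_deriv b \<psi>) \<and> (\<forall>x. x \<notin> V \<longrightarrow> \<psi> x = 0 \<and> partial_deriv b \<psi> x = 0)"
    proof (rule C1_compact_partial[OF \<psi>, of b])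
      assume "continuous_on UNIV \<psi>" "continuous_on UNIV (partial_deriv b \<psi>)"
        "\<And>x. x \<notin> closure {x. \<psi> x \<noteq> 0} \<Longrightarrow> \<psi> x = 0"
        "\<And>x. x \<notin> closure {x. \<psi> x \<noteq> 0} \<Longrightarrow> partial_deriv b \<psi> x = 0"
        "closure {x. \<psi> x \<noteq> 0} \<subseteq> V"
      then show ?thesis by blast
    qed (use b in simp)
    have [measurable]: "\<psi> \<in> borel_measurable borel" "partial_deriv b \<psi> \<in> borel_measurable borel"
      using co by (auto intro: borel_measurable_continuous_onI)
    have "(LINT x|lborel. f x * partial_deriv b \<psi> x) = (LINT x|lebesgue_on V. u x * partial_deriv b \<psi> x)"
    proof (rule lebesgue_on_integral_eq(1)[OF Vb, symmetric])
      show "AE x in lborel. x \<in> V \<longrightarrow> u x * partial_deriv b \<psi> x = f x * partial_deriv b \<psi> x"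
        using fe by eventually_elim (use V_sub in auto)
    qed (use co in auto)
    also have "\<dots> = (LINT x|lebesgue_on V. l * (u x / l * partial_deriv b \<psi> x))" using l by simp
    also have "\<dots> = l * (LINT x|lebesgue_on V. u x / l * partial_deriv b \<psi> x)" by (rule integral_mult_right_zero)
    also have "\<dots> = - (l * (LINT x|lebesgue_on V. (G x \<bullet> b) * \<psi> x))"
      using G \<psi> b by (simp add: has_weak_gradient_def)
    also have "l * (LINT x|lebesgue_on V. (G x \<bullet> b) * \<psi> x) = (LINT x|lebesgue_on V. l * ((G x \<bullet> b) * \<psi> x))" by simp
    also have "\<dots> = (LINT x|lborel. (g x \<bullet> b) * \<psi> x)"
    proof (rule lebesgue_on_integral_eq(1)[OF Vb])
      show "AE x in lborel. x \<in> V \<longrightarrow> l * ((G x \<bullet> b) * \<psi> x) = (g x \<bullet> b) * \<psi> x"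
        using ge by eventually_elim (simp add: Gv_def)
    qed (use co in auto)
    finally show ?thesis .
  qed
  interpret BV_data \<Omega> p c U f g "l * 2"
    by unfold_locales (use U fi fz gi gz var wg in auto)
  have pb[measurable]: "(\<lambda>x. indicator \<Omega> x * p x) \<in> borel_measurable borel"
    using borel_measurable_continuous_on_indicator[OF dom_borel p_continuous] by simp
  \<comment> \<open>Supplies both majorants of \<open>smooth_approximation\<close>: with w = g for
    the energy, and with w = f for the convergence.\<close>
  have aux: "integrable lborel (\<lambda>y. indicator \<Omega> y * (1 + norm (w y) powr p y))"
    if w[measurable]: "w \<in> borel_measurable borel" and fin: "(\<integral>\<^sup>+x. ennreal (norm (w x) powr p x) \<partial>M) < \<infinity>"
    for w :: "'a \<Rightarrow> 'b::euclidean_space"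
  proof (rule integrableI_bounded)
    have "(\<lambda>y. indicator \<Omega> y * (1 + norm (w y) powr p y)) = (\<lambda>y. indicator \<Omega> y * (1 + norm (w y) powr (indicator \<Omega> y * p y)) :: real)"
      by (auto simp: indicator_def)
    then show "(\<lambda>y. indicator \<Omega> y * (1 + norm (w y) powr p y)) \<in> borel_measurable lborel" by simp
    have "(\<integral>\<^sup>+y. ennreal (norm (indicator \<Omega> y * (1 + norm (w y) powr p y))) \<partial>lborel)
      = (\<integral>\<^sup>+y. ennreal (1 + norm (w y) powr p y) * indicator \<Omega> y \<partial>lborel)"
      by (intro nn_integral_cong) (simp add: indicator_def)
    also have "\<dots> = (\<integral>\<^sup>+y. 1 + ennreal (norm (w y) powr p y) \<partial>M)"
      unfolding nn_integral_M by (intro nn_integral_cong) (simp add: ennreal_plus indicator_def)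
    also have "\<dots> = ennreal vol + (\<integral>\<^sup>+y. ennreal (norm (w y) powr p y) \<partial>M)"
    proof (subst nn_integral_add)
      have "w \<in> borel_measurable M"
        by (rule measurable_restrict_space1, rule measurable_completion) (use w in simp)
      then show "(\<lambda>x. ennreal (norm (w x) powr p x)) \<in> borel_measurable M" by measurable
    qed (use emeasure_M in auto)
    also have "\<dots> < \<infinity>" using fin by simp
    finally show "(\<integral>\<^sup>+y. ennreal (norm (indicator \<Omega> y * (1 + norm (w y) powr p y))) \<partial>lborel) < \<infinity>" .
  qed
  have aeM: "AE x in M. u x = f x"
    using AE_completion[OF fe] by (simp add: AE_restrict_space_iff)
  have ffin: "(\<integral>\<^sup>+x. ennreal (norm (f x) powr p x) \<partial>M) < \<infinity>"
  proof -
    have "(\<integral>\<^sup>+x. ennreal (norm (f x) powr p x) \<partial>M) = modular_Lp \<Omega> p u"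
      unfolding modular_Lp_def using aeM by (intro nn_integral_cong_AE) auto
    then show ?thesis using space_Lp_modular_finite[OF uL] by simp
  qed
  have gfin: "(\<integral>\<^sup>+x. ennreal (norm (g x) powr p x) \<partial>M) < \<infinity>"
  proof -
    have "AE x in M. g x = l *\<^sub>R Gv x"
      using AE_completion[OF ge] by (subst AE_restrict_space_iff) (auto elim: eventually_mono)
    then have "(\<integral>\<^sup>+x. ennreal (norm (g x) powr p x) \<partial>M) = (\<integral>\<^sup>+x. ennreal (\<bar>l * norm (Gv x)\<bar> powr p x) \<partial>M)"
      by (intro nn_integral_cong_AE) (use l in \<open>auto elim!: eventually_mono\<close>)
    also have "\<dots> \<le> ennreal (max 1 l powr P) * modular_Lp \<Omega> p (\<lambda>x. norm (Gv x))"
      using modular_scale_up[of l "\<lambda>x. norm (Gv x)"] l Gvm' by (simp add: modular_Lp_def)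
    also have "\<dots> \<le> ennreal (max 1 l powr P) * ennreal 1"
      using Gve by (intro mult_left_mono) (auto simp: modular_Lp_def)
    also have "\<dots> < \<infinity>" by (simp add: ennreal_mult_less_top)
    finally show ?thesis .
  qed
  show ?thesis
  proof (rule smooth_approximation[OF aux[OF gm gfin] _ _ aux[OF fm ffin]])
    fix v :: "nat \<Rightarrow> 'a \<Rightarrow> real" and C
    assume v: "\<And>i. v i \<in> Lip_loc \<Omega> \<inter> space_Lp \<Omega> p" and lim: "(\<lambda>i. norm_Lp \<Omega> p (\<lambda>x. v i x - f x)) \<longlonglongrightarrow> 0"
      and en: "\<And>i. (\<integral>\<^sup>+x. ennreal (norm (grad (v i) x) powr p x) \<partial>M) \<le> ennreal C"
    have "norm_Lp \<Omega> p (\<lambda>x. v i x - u x) = norm_Lp \<Omega> p (\<lambda>x. v i x - f x)" for i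
      by (rule norm_Lp_cong_AE) (use aeM in \<open>auto elim: eventually_mono\<close>)
    then have lim': "(\<lambda>i. norm_Lp \<Omega> p (\<lambda>x. v i x - u x)) \<longlonglongrightarrow> 0" using lim by simp
    have "modular_BV_tilde \<Omega> p u \<le> liminf (\<lambda>i. \<integral>\<^sup>+x. ennreal (norm (grad (v i) x) powr p x) \<partial>M)"
      unfolding modular_BV_tilde_def by (rule Inf_lower) (use v lim' in blast)
    also have "\<dots> \<le> ennreal C" by (rule Liminf_le) (use en in auto)
    also have "\<dots> < \<infinity>" by simp
    finally show ?thesis using uL by (simp add: BV_tilde_def)
  qed auto
qed

end

theorem theorem4p7:
  fixes \<Omega> :: "'a::euclidean_space set" and p :: "'a \<Rightarrow> real"
  assumes "open \<Omega>" and "bounded \<Omega>"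
    and "\<And>x. x \<in> \<Omega> \<Longrightarrow> 1 \<le> p x"
    and "log_Holder \<Omega> p"
    and "esssup (lebesgue_on \<Omega>) (\<lambda>x. ereal (p x)) < \<infinity>"
  shows "BV_tilde \<Omega> p = BV \<Omega> p"
proof -
  obtain c where "c > 0" "\<forall>x\<in>\<Omega>. \<forall>y\<in>\<Omega>. x \<noteq> y \<longrightarrow> \<bar>p x - p y\<bar> \<le> c / ln (exp 1 + 1 / norm (x - y))"
    using assms(4) unfolding log_Holder_def by blast
  then interpret variable_exponent \<Omega> p c
    by unfold_locales (use assms(1,2,3) in auto)
  show ?thesis using BV_tilde_imp_BV BV_imp_BV_tilde by blast
qed

end
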